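(* Let $d\ge 1$ be an integer, $s>0$ and $T>0$. Let $a,b,u_0,u_1$ be (possibly irregular) functions or distributions on $\mathbb{R}^d$, with $a,b\ge 0$ in the sense that their approximating nets are non-negative. Assume that there exist $L^{\infty}(\mathbb{R}^d)$-, $L^{\infty}(\mathbb{R}^d)$-, $H^s(\mathbb{R}^d)$- and $L^2(\mathbb{R}^d)$-moderate approximations of $a$, $b$, $u_0$ and $u_1$, respectively, those of $a$ and $b$ being non-negative. Then the very weak solution to the Cauchy problem $$u_{tt}(t,x)+(-\Delta)^s u(t,x)+a(x)u(t,x)+b(x)u_t(t,x)=0,\ (t,x)\in[0,T]\times\mathbb{R}^d,\qquad u(0,x)=u_0(x),\ u_t(0,x)=u_1(x),\ x\in\mathbb{R}^d,$$ is unique, in the following sense. For all non-negative $L^\infty(\mathbb{R}^d)$-moderate approximations $(a_\varepsilon)_\varepsilon,(\tilde a_\varepsilon)_\varepsilon$ of $a$ and $(b_\varepsilon)_\varepsilon,(\tilde b_\varepsilon)_\varepsilon$ of $b$, all $H^s(\mathbb{R}^d)$-moderate approximations $(u_{0,\varepsilon})_\varepsilon,(\tilde u_{0,\varepsilon})_\varepsilon$ of $u_0$ and all $L^2(\mathbb{R}^d)$-moderate approximations $(u_{1,\varepsilon})_\varepsilon,(\tilde u_{1,\varepsilon})_\varepsilon$ of $u_1$ such that the nets $(a_\varepsilon-\tilde a_\varepsilon)_\varepsilon$, $(b_\varepsilon-\tilde b_\varepsilon)_\varepsilon$, $(u_{0,\varepsilon}-\tilde u_{0,\varepsilon})_\varepsilon$,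 $(u_{1,\varepsilon}-\tilde u_{1,\varepsilon})_\varepsilon$ are $L^\infty(\mathbb{R}^d)$-, $L^\infty(\mathbb{R}^d)$-, $H^s(\mathbb{R}^d)$-, $L^2(\mathbb{R}^d)$-negligible, respectively, the net $(u_\varepsilon(t,\cdot)-\tilde u_\varepsilon(t,\cdot))_\varepsilon$ is $L^2(\mathbb{R}^d)$-negligible for all $t\in[0,T]$, where, for each $\varepsilon\in(0,1]$, $u_\varepsilon$ and $\tilde u_\varepsilon$ are the solutions in $C([0,T];H^s(\mathbb{R}^d))\cap C^1([0,T];L^2(\mathbb{R}^d))$ of $$\partial_t^2u_\varepsilon+(-\Delta)^su_\varepsilon+a_\varepsilon u_\varepsilon+b_\varepsilon\partial_tu_\varepsilon=0,\quad u_\varepsilon(0,\cdot)=u_{0,\varepsilon},\ \partial_tu_\varepsilon(0,\cdot)=u_{1,\varepsilon},$$ $$\partial_t^2\tilde u_\varepsilon+(-\Delta)^s\tilde u_\varepsilon+\tilde a_\varepsilon \tilde u_\varepsilon+\tilde b_\varepsilon\partial_t\tilde u_\varepsilon=0,\quad \tilde u_\varepsilon(0,\cdot)=\tilde u_{0,\varepsilon},\ \partial_t\tilde u_\varepsilon(0,\cdot)=\tilde u_{1,\varepsilon},$$ on $[0,T]\times\mathbb{R}^d$.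
   Context: The fractional Laplacian is $(-\Delta)^s f=\mathcal{F}^{-1}(|\xi|^{2s}\widehat f)$, and $H^s(\mathbb{R}^d)=\{f\in L^2(\mathbb{R}^d): (-\Delta)^{s/2}f\in L^2(\mathbb{R}^d)\}$ with norm $\|f\|_{H^s}=\|f\|_{L^2}+\|(-\Delta)^{s/2}f\|_{L^2}$. An approximation of a function or distribution $f$ on $\mathbb{R}^d$ is a net $(f_\varepsilon)_{\varepsilon\in(0,1]}$ of smooth functions approximating $f$, not necessarily obtained by convolution with a mollifier (no particular mode of convergence is prescribed). For a normed space $X$ of functions on $\mathbb{R}^d$, a net $(f_\varepsilon)_{\varepsilon\in(0,1]}$ of elements of $X$ is $X$-moderate if there exist $N\in\mathbb{N}_0$ and $C>0$ with $\|f_\varepsilon\|_X\le C\varepsilon^{-N}$ for all $\varepsilon\in(0,1]$; it is $X$-negligible if for every $k>0$ there exists $C_k>0$ with $\|f_\varepsilon\|_X\le C_k\varepsilon^{k}$ for all $\varepsilon\in(0,1]$. A very weak solution is a net $(u_\varepsilon)_\varepsilon$ in $C([0,T];H^s(\mathbb{R}^d))\cap C^1([0,T];L^2(\mathbb{R}^d))$ solving, for each $\varepsilon\in(0,1]$, the approximating Cauchy problem built from such moderate approximations of the coefficients (non-negative) and data, and such that $\sup_{t\in[0,T]}\big(\|u_\varepsilon(t,\cdot)\|_{L^2}+\|(-\Delta)^{s/2}u_\varepsilon(t,\cdot)\|_{L^2}+\|\partial_tu_\varepsilon(t,\cdot)\|_{L^2}\big)\le C\varepsilon^{-N}$ for some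 $N\in\mathbb{N}_0$, $C>0$ and all $\varepsilon\in(0,1]$. The approximating equations are understood in the sense of distributions on $(0,T)\times\mathbb{R}^d$. *)

theory Defs
  imports "HOL-Analysis.Analysis" "HOL-Probability.Essential_Supremum"
begin

text \<open>Iterated directional derivative along the vectors of the list, the last one applied first.\<close>

fun iter_deriv :: "'a::real_normed_vector list \<Rightarrow> ('a \<Rightarrow> 'b::real_normed_vector) \<Rightarrow> 'a \<Rightarrow> 'b" where
  "iter_deriv [] f = f"
| "iter_deriv (v # vs) f = (\<lambda>x. frechet_derivative (iter_deriv vs f) (at x) v)"

text \<open>Existence and differentiability of all iterated directional derivatives makes all of them
  continuous, so this is \<open>C\<^sup>\<infinity>\<close>.\<close>

definition smooth :: "('a::euclidean_space \<Rightarrow> 'b::real_normed_vector) \<Rightarrow> bool" where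
  "smooth f \<longleftrightarrow> (\<forall>vs x. iter_deriv vs f differentiable (at x))"

definition supported_in :: "('a \<Rightarrow> 'b::zero) \<Rightarrow> 'a set \<Rightarrow> bool" where
  "supported_in \<phi> K \<longleftrightarrow> (\<forall>x. x \<notin> K \<longrightarrow> \<phi> x = 0)"

definition test_function_on :: "'a::euclidean_space set \<Rightarrow> ('a \<Rightarrow> complex) \<Rightarrow> bool" where
  "test_function_on U \<phi> \<longleftrightarrow> smooth \<phi> \<and> (\<exists>K. compact K \<and> K \<subseteq> U \<and> supported_in \<phi> K)"

definition schwartz :: "('a::euclidean_space \<Rightarrow> complex) \<Rightarrow> bool" where
  "schwartz \<phi> \<longleftrightarrow> smooth \<phi> \<and>
     (\<forall>vs k. bounded (range (\<lambda>x. norm x ^ k *\<^sub>R iter_deriv vs \<phi> x)))"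

definition distribution :: "(('a::euclidean_space \<Rightarrow> complex) \<Rightarrow> complex) \<Rightarrow> bool" where
  "distribution \<Lambda> \<longleftrightarrow>
     (\<forall>\<phi> \<psi> c. test_function_on UNIV \<phi> \<and> test_function_on UNIV \<psi> \<longrightarrow>
        \<Lambda> (\<lambda>x. \<phi> x + c * \<psi> x) = \<Lambda> \<phi> + c * \<Lambda> \<psi>) \<and>
     (\<forall>K. compact K \<longrightarrow> (\<exists>N C. \<forall>\<phi> B. smooth \<phi> \<and> supported_in \<phi> K \<and>
        (\<forall>vs x. set vs \<subseteq> Basis \<and> length vs \<le> N \<longrightarrow> norm (iter_deriv vs \<phi> x) \<le> B) \<longrightarrow>
        norm (\<Lambda> \<phi>) \<le> C * B))"

text \<open>The irregular coefficients and data are functions or distributions.  The function case is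
  kept separate since no local integrability is imposed.\<close>

datatype 'a function_or_distribution =
    Function "'a \<Rightarrow> complex"
  | Distribution "('a \<Rightarrow> complex) \<Rightarrow> complex"

fun is_function_or_distribution :: "'a::euclidean_space function_or_distribution \<Rightarrow> bool" where
  "is_function_or_distribution (Function f) = True"
| "is_function_or_distribution (Distribution \<Lambda>) = distribution \<Lambda>"

text \<open>Elements of Lebesgue spaces are represented by Borel measurable functions (every class has
  such a representative); equality in these spaces is equality almost everywhere.\<close>

definition Linf_space :: "('a::euclidean_space \<Rightarrow> complex) set" where
  "Linf_space = {f \<in> borel_measurable lborel. esssup lborel (\<lambda>x. ereal (norm (f x))) < \<infinity>}"

definition Linf_norm :: "('a::euclidean_space \<Rightarrow> complex) \<Rightarrow> real" where
  "Linf_norm f = real_of_ereal (esssup lborel (\<lambda>x. ereal (norm (f x))))"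

definition L2_space :: "('a::euclidean_space \<Rightarrow> complex) set" where
  "L2_space = {f \<in> borel_measurable lborel. integrable lborel (\<lambda>x. (norm (f x))\<^sup>2)}"

definition L2_norm :: "('a::euclidean_space \<Rightarrow> complex) \<Rightarrow> real" where
  "L2_norm f = sqrt (\<integral>x. (norm (f x))\<^sup>2 \<partial>lborel)"

text \<open>The Fourier transform is normalised without a factor \<open>2 \<pi>\<close> in the exponent, so that
  the symbol of \<open>- \<Delta>\<close> is the square of \<open>norm \<xi>\<close>.\<close>

definition fourier :: "('a::euclidean_space \<Rightarrow> complex) \<Rightarrow> 'a \<Rightarrow> complex" where
  "fourier f \<xi> = (\<integral>x. cis (- (x \<bullet> \<xi>)) * f x \<partial>lborel)"

definition inv_fourier :: "('a::euclidean_space \<Rightarrow> complex) \<Rightarrow> 'a \<Rightarrow> complex" where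
  "inv_fourier f x = (\<integral>\<xi>. cis (x \<bullet> \<xi>) * f \<xi> \<partial>lborel) / (2 * pi) ^ DIM('a)"

text \<open>The tempered distribution \<open>\<Lambda>\<close> (a functional on Schwartz functions) is the
  \<open>L\<^sup>2\<close> function \<open>g\<close>; there is at most one such \<open>g\<close> up to null sets.\<close>

definition is_L2_function :: "(('a::euclidean_space \<Rightarrow> complex) \<Rightarrow> complex) \<Rightarrow> ('a \<Rightarrow> complex) \<Rightarrow> bool" where
  "is_L2_function \<Lambda> g \<longleftrightarrow>
     g \<in> L2_space \<and> (\<forall>\<phi>. schwartz \<phi> \<longrightarrow> \<Lambda> \<phi> = (\<integral>x. g x * \<phi> x \<partial>lborel))"

definition L2_function :: "(('a::euclidean_space \<Rightarrow> complex) \<Rightarrow> complex) \<Rightarrow> 'a \<Rightarrow> complex" where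
  "L2_function \<Lambda> = (SOME g. is_L2_function \<Lambda> g)"

text \<open>Fourier transform on \<open>L\<^sup>2\<close>: the transform of \<open>f\<close> as a tempered distribution, which
  by Plancherel is again an \<open>L\<^sup>2\<close> function.\<close>

definition fourier_L2 :: "('a::euclidean_space \<Rightarrow> complex) \<Rightarrow> 'a \<Rightarrow> complex" where
  "fourier_L2 f = L2_function (\<lambda>\<phi>. \<integral>x. f x * fourier \<phi> x \<partial>lborel)"

text \<open>For \<open>f\<close> in \<open>L\<^sup>2\<close>, the inverse Fourier transform of
  \<open>norm \<xi> powr (2 * \<sigma>) * fourier_L2 f \<xi>\<close>, taken in the sense of tempered distributions,
  that is, with the inverse transform moved to the Schwartz function \<open>\<phi>\<close>.\<close>

definition frac_laplacian ::
    "real \<Rightarrow> ('a::euclidean_space \<Rightarrow> complex) \<Rightarrow> ('a \<Rightarrow> complex) \<Rightarrow> complex" where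
  "frac_laplacian \<sigma> f \<phi> =
     (\<integral>\<xi>. (of_real (norm \<xi> powr (2 * \<sigma>)) * fourier_L2 f \<xi>) * inv_fourier \<phi> \<xi> \<partial>lborel)"

definition Hs_space :: "real \<Rightarrow> ('a::euclidean_space \<Rightarrow> complex) set" where
  "Hs_space s = {f \<in> L2_space. \<exists>g. is_L2_function (frac_laplacian (s / 2) f) g}"

definition Hs_norm :: "real \<Rightarrow> ('a::euclidean_space \<Rightarrow> complex) \<Rightarrow> real" where
  "Hs_norm s f = L2_norm f + L2_norm (L2_function (frac_laplacian (s / 2) f))"

definition moderate_net ::
    "('a \<Rightarrow> complex) set \<Rightarrow> (('a \<Rightarrow> complex) \<Rightarrow> real) \<Rightarrow> (real \<Rightarrow> 'a \<Rightarrow> complex) \<Rightarrow> bool" where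
  "moderate_net X nrm f \<longleftrightarrow> (\<forall>\<epsilon>\<in>{0<..1}. f \<epsilon> \<in> X) \<and>
     (\<exists>(N::nat) C. C > 0 \<and> (\<forall>\<epsilon>\<in>{0<..1}. nrm (f \<epsilon>) \<le> C * \<epsilon> powr (- real N)))"

definition negligible_net ::
    "('a \<Rightarrow> complex) set \<Rightarrow> (('a \<Rightarrow> complex) \<Rightarrow> real) \<Rightarrow> (real \<Rightarrow> 'a \<Rightarrow> complex) \<Rightarrow> bool" where
  "negligible_net X nrm f \<longleftrightarrow> (\<forall>\<epsilon>\<in>{0<..1}. f \<epsilon> \<in> X) \<and>
     (\<forall>k::real. k > 0 \<longrightarrow> (\<exists>C. C > 0 \<and> (\<forall>\<epsilon>\<in>{0<..1}. nrm (f \<epsilon>) \<le> C * \<epsilon> powr k)))"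

definition nonneg_net :: "(real \<Rightarrow> 'a \<Rightarrow> complex) \<Rightarrow> bool" where
  "nonneg_net f \<longleftrightarrow> (\<forall>\<epsilon>\<in>{0<..1}. \<forall>x. f \<epsilon> x \<in> \<real>\<^sub>\<ge>\<^sub>0)"

text \<open>No mode of convergence is prescribed: the parameter \<open>approximates\<close> is an arbitrary relation
  expressing in which sense a net approximates an irregular object.\<close>

definition moderate_approximation ::
    "((real \<Rightarrow> 'a::euclidean_space \<Rightarrow> complex) \<Rightarrow> 'a function_or_distribution \<Rightarrow> bool) \<Rightarrow>
     ('a \<Rightarrow> complex) set \<Rightarrow> (('a \<Rightarrow> complex) \<Rightarrow> real) \<Rightarrow>
     'a function_or_distribution \<Rightarrow> (real \<Rightarrow> 'a \<Rightarrow> complex) \<Rightarrow> bool" where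
  "moderate_approximation approximates X nrm F f \<longleftrightarrow>
     (\<forall>\<epsilon>\<in>{0<..1}. smooth (f \<epsilon>)) \<and> approximates f F \<and> moderate_net X nrm f"

definition continuous_into ::
    "real \<Rightarrow> ('a \<Rightarrow> complex) set \<Rightarrow> (('a \<Rightarrow> complex) \<Rightarrow> real) \<Rightarrow> (real \<Rightarrow> 'a \<Rightarrow> complex) \<Rightarrow> bool" where
  "continuous_into T X nrm u \<longleftrightarrow> (\<forall>t\<in>{0..T}. u t \<in> X \<and>
     ((\<lambda>\<tau>. nrm (\<lambda>x. u \<tau> x - u t x)) \<longlongrightarrow> 0) (at t within {0..T}))"

definition has_L2_time_derivative ::
    "real \<Rightarrow> (real \<Rightarrow> 'a::euclidean_space \<Rightarrow> complex) \<Rightarrow> (real \<Rightarrow> 'a \<Rightarrow> complex) \<Rightarrow> bool" where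
  "has_L2_time_derivative T u v \<longleftrightarrow> (\<forall>t\<in>{0..T}.
     ((\<lambda>\<tau>. L2_norm (\<lambda>x. (u \<tau> x - u t x) / of_real (\<tau> - t) - v t x)) \<longlongrightarrow> 0)
       (at t within {0..T}))"

text \<open>The equation in the sense of distributions on the open time slab, with \<open>v\<close> the time
  derivative of \<open>u\<close>.  The second time derivative is moved to the test function; the direction
  \<open>(1, 0)\<close> is the time direction.\<close>

definition damped_wave_equation ::
    "real \<Rightarrow> real \<Rightarrow> ('a::euclidean_space \<Rightarrow> complex) \<Rightarrow> ('a \<Rightarrow> complex) \<Rightarrow>
     (real \<Rightarrow> 'a \<Rightarrow> complex) \<Rightarrow> (real \<Rightarrow> 'a \<Rightarrow> complex) \<Rightarrow> bool" where
  "damped_wave_equation s T a b u v \<longleftrightarrow>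
     (\<forall>\<phi>. test_function_on ({0<..<T} \<times> UNIV) \<phi> \<longrightarrow>
        (LINT t:{0<..<T}|lborel.
            (\<integral>x. u t x * iter_deriv [(1, 0), (1, 0)] \<phi> (t, x) \<partial>lborel)
          + frac_laplacian s (u t) (\<lambda>x. \<phi> (t, x))
          + (\<integral>x. a x * u t x * \<phi> (t, x) \<partial>lborel)
          + (\<integral>x. b x * v t x * \<phi> (t, x) \<partial>lborel)) = 0)"

definition solves_cauchy_problem ::
    "real \<Rightarrow> real \<Rightarrow> ('a::euclidean_space \<Rightarrow> complex) \<Rightarrow> ('a \<Rightarrow> complex) \<Rightarrow>
     ('a \<Rightarrow> complex) \<Rightarrow> ('a \<Rightarrow> complex) \<Rightarrow> (real \<Rightarrow> 'a \<Rightarrow> complex) \<Rightarrow> bool" where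
  "solves_cauchy_problem s T a b u0 u1 u \<longleftrightarrow>
     continuous_into T (Hs_space s) (Hs_norm s) u \<and>
     (\<exists>v. has_L2_time_derivative T u v \<and> continuous_into T L2_space L2_norm v \<and>
        damped_wave_equation s T a b u v \<and>
        (AE x in lborel. u 0 x = u0 x) \<and> (AE x in lborel. v 0 x = u1 x))"

end

theory Submission
  imports Defs "HOL-Probability.Probability"
begin

text \<open>
  Fix \<open>\<epsilon>\<close> and write \<open>w = u - u'\<close>, \<open>\<alpha> = a - a'\<close>, \<open>\<beta> = b - b'\<close> for two solutions \<open>u\<close>, \<open>u'\<close> of the approximating
  problems with coefficients \<open>a\<close>, \<open>b\<close> and \<open>a'\<close>, \<open>b'\<close>.  The task is to bound the \<open>L\<^sup>2\<close> norm of \<open>w t\<close>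
  polynomially in the norms of the coefficients and data and linearly in the differences of the
  coefficients and data.  A Gronwall argument would produce the exponential of a negative power of
  \<open>\<epsilon>\<close>, so the non-negativity of \<open>a\<close> and \<open>b\<close> has to be used.

  The equation is integrated once in time.  Since \<open>b\<close> does not depend on time, it becomes
  \<open>w\<^sub>t(t) + b w(t) + \<integral>\<^sub>0\<^sup>t ((-\<Delta>)\<^sup>s w + a w) = w\<^sub>t(0) + b w(0) + \<beta> u'(0) - \<beta> u'(t) - \<integral>\<^sub>0\<^sup>t \<alpha> u'\<close>.
  Now pair with \<open>w t\<close>, which lies in \<open>H\<^sup>s\<close>; testing with the time derivative, which is only
  square integrable, would need a regularisation.  The real part of the pairing of \<open>w\<^sub>t\<close> with \<open>w\<close>
  is half the derivative of the squared norm of \<open>w\<close>, the damping term has a sign, and the term with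
  the time integral is the integral over \<open>r\<close> in \<open>[0, t]\<close> of
  \<open>k r t = \<langle>(-\<Delta>)\<^sup>s\<^sup>/\<^sup>2 w(r), (-\<Delta>)\<^sup>s\<^sup>/\<^sup>2 w(t)\<rangle> + \<langle>a w(r), w(t)\<rangle>\<close>.  Integrated over \<open>t\<close> as well it
  gives half the integral of \<open>k\<close> over a square, and this is non-negative because \<open>k\<close> is a positive
  semidefinite kernel.  Hence \<open>\<parallel>w(t)\<parallel> \<le> \<parallel>w(0)\<parallel> + 2 T K\<close> with
  \<open>K = \<parallel>w\<^sub>t(0)\<parallel> + \<parallel>b\<parallel> \<parallel>w(0)\<parallel> + (2 \<parallel>\<beta>\<parallel> + T \<parallel>\<alpha>\<parallel>) sup \<parallel>u'\<parallel>\<close>.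
  The same estimate for \<open>u'\<close> alone bounds the supremum by a moderate quantity, and a
  negligible quantity times a moderate one is negligible.  The steps are \<open>integrated_equation\<close>,
  \<open>scalar_energy_bound\<close>, \<open>solution_L2_bound\<close> and \<open>solution_difference_L2_bound\<close>.

  A solution is a family of functions of \<open>x\<close>, one for each time, without joint measurability.
  Everything is therefore said about scalar functions of time such as \<open>\<langle>u(t), \<eta>\<rangle>\<close>, and no integral of
  a function with values in \<open>L\<^sup>2\<close> is formed.  The weak equation is tested with products of a function
  of time and a function of space, which gives a scalar second order equation in the distributional
  sense (\<open>weak_second_derivative\<close>).  It holds first for test functions of \<open>x\<close> and extends
  to all of \<open>H\<^sup>s\<close> by density (\<open>test_functions_dense_in_Hs\<close>).

  On the Fourier side two facts suffice: the transform is bounded on \<open>L\<^sup>2\<close>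
  (\<open>fourier_L2_bound\<close>), and it is bounded from below (\<open>L2_norm_le_fourier_L2\<close>).
  The first is proved by inserting a Gaussian under the integral, the second follows from inversion
  for test functions and duality.  In the same way the transform of \<open>(-\<Delta>)\<^sup>s\<^sup>/\<^sup>2 f\<close>, for \<open>f\<close> in \<open>H\<^sup>s\<close>, is
  identified with \<open>\<bar>\<xi>\<bar>\<^sup>s\<close> times the transform of \<open>f\<close> (\<open>Hs_freq_deriv\<close>).
\<close>

section \<open>Smooth functions and a smooth step\<close>

lemma iter_deriv_append: "iter_deriv (vs @ ws) f = iter_deriv vs (iter_deriv ws f)"
  by (induction vs) auto

text \<open>Smoothness is coinductive: a class of differentiable functions that is closed under directional
  derivatives consists of smooth functions. The closure properties below exhibit such classes.\<close>
lemma smooth_coinduct: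
  assumes "f \<in> C"
    and "\<And>g. g \<in> C \<Longrightarrow> \<exists>g'. (\<forall>x. (g has_derivative g' x) (at x)) \<and> (\<forall>v. (\<lambda>x. g' x v) \<in> C)"
  shows "smooth f"
proof -
  have "iter_deriv vs f \<in> C" for vs
  proof (induction vs)
    case (Cons v vs)
    obtain g' where g': "\<And>x. (iter_deriv vs f has_derivative g' x) (at x)" "\<And>v. (\<lambda>x. g' x v) \<in> C"
      using assms(2)[OF Cons] by blast
    have "frechet_derivative (iter_deriv vs f) (at x) = g' x" for x
      using frechet_derivative_at[OF g'(1)] by simp
    with g'(2)[of v] show ?case by simp
  qed (use assms(1) in simp)
  then show ?thesis
    unfolding smooth_def using assms(2) differentiableI by blast
qed

lemma smooth_iter_deriv: "smooth f \<Longrightarrow> smooth (iter_deriv vs f)"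
  unfolding smooth_def by (simp add: iter_deriv_append[symmetric])

lemma smooth_differentiable_on: "smooth f \<Longrightarrow> f differentiable (at x)"
  unfolding smooth_def by (metis iter_deriv.simps(1))

lemma smooth_has_derivative:
  "smooth f \<Longrightarrow> (f has_derivative (\<lambda>v. iter_deriv [v] f x)) (at x)"
  using frechet_derivative_works[of f "at x"] smooth_differentiable_on[of f x] by simp

lemma iter_deriv_eqI: "(\<And>x. (f has_derivative f' x) (at x)) \<Longrightarrow> iter_deriv [v] f = (\<lambda>x. f' x v)"
  unfolding iter_deriv.simps by (rule ext) (metis frechet_derivative_at)

lemma smooth_continuous_on: "smooth f \<Longrightarrow> continuous_on S f"
  by (auto intro!: continuous_at_imp_continuous_on differentiable_imp_continuous_within smooth_differentiable_on)

lemma smooth_antiderivative: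
  assumes "\<And>x. (f has_derivative f' x) (at x)" "\<And>v. smooth (\<lambda>x. f' x v)"
  shows "smooth f"
proof (rule smooth_coinduct[of _ "insert f {g. smooth g}"])
  fix g assume "g \<in> insert f {g. smooth g}"
  then consider "g = f" | "smooth g" by blast
  then show "\<exists>g'. (\<forall>x. (g has_derivative g' x) (at x)) \<and> (\<forall>v. (\<lambda>x. g' x v) \<in> insert f {g. smooth g})"
  proof cases
    case 1
    then show ?thesis using assms by (intro exI[of _ f']) simp
  next
    case 2
    then show ?thesis using smooth_has_derivative[OF 2] smooth_iter_deriv[OF 2, of "[_]"]
      by (intro exI[of _ "\<lambda>x v. iter_deriv [v] g x"]) simp
  qed
qed simp

lemma smooth_const: "smooth (\<lambda>x. c)"
  by (rule smooth_coinduct[of _ "range (\<lambda>c x. c)"]) (auto intro!: exI[of _ "\<lambda>x v. 0"])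

lemma smooth_linear: "bounded_linear L \<Longrightarrow> smooth L"
  by (rule smooth_antiderivative[of L "\<lambda>x. L"]) (auto intro: bounded_linear_imp_has_derivative smooth_const)

lemma smooth_compose_linear:
  fixes f :: "'b::euclidean_space \<Rightarrow> 'c::real_normed_vector" and L :: "'a::euclidean_space \<Rightarrow> 'b"
  assumes L: "bounded_linear L" and f: "smooth f"
  shows "iter_deriv vs (\<lambda>x. f (L x)) = (\<lambda>x. iter_deriv (map L vs) f (L x))" "smooth (\<lambda>x. f (L x))"
proof -
  have d: "((\<lambda>x. g (L x)) has_derivative (\<lambda>v. iter_deriv [L v] g (L x))) (at x)" if "smooth g" for g :: "'b \<Rightarrow> 'c" and x
    using has_derivative_compose[OF bounded_linear_imp_has_derivative[OF L] smooth_has_derivative[OF that]] .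
  show e: "iter_deriv vs (\<lambda>x. f (L x)) = (\<lambda>x. iter_deriv (map L vs) f (L x))" for vs
  proof (induction vs)
    case (Cons v vs)
    have "iter_deriv [v] (iter_deriv vs (\<lambda>x. f (L x))) = (\<lambda>x. iter_deriv [L v] (iter_deriv (map L vs) f) (L x))"
      unfolding Cons by (rule iter_deriv_eqI, rule d, rule smooth_iter_deriv, rule f)
    then show ?case by simp
  qed simp
  show "smooth (\<lambda>x. f (L x))"
    unfolding smooth_def e by (intro allI differentiableI[OF d] smooth_iter_deriv f)
qed

lemma smooth_linear_compose:
  fixes f :: "'a::euclidean_space \<Rightarrow> 'b::real_normed_vector" and L :: "'b \<Rightarrow> 'c::real_normed_vector"
  assumes L: "bounded_linear L" and f: "smooth f"
  shows "smooth (\<lambda>x. L (f x))"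
proof -
  have d: "((\<lambda>x. L (g x)) has_derivative (\<lambda>v. L (iter_deriv [v] g x))) (at x)" if "smooth g" for g :: "'a \<Rightarrow> 'b" and x
    using bounded_linear.has_derivative[OF L smooth_has_derivative[OF that]] .
  have e: "iter_deriv vs (\<lambda>x. L (f x)) = (\<lambda>x. L (iter_deriv vs f x))" for vs
  proof (induction vs)
    case (Cons v vs)
    have "iter_deriv [v] (iter_deriv vs (\<lambda>x. L (f x))) = (\<lambda>x. L (iter_deriv [v] (iter_deriv vs f) x))"
      unfolding Cons by (rule iter_deriv_eqI, rule d, rule smooth_iter_deriv, rule f)
    then show ?case by simp
  qed simp
  show ?thesis
    unfolding smooth_def e by (intro allI differentiableI[OF d] smooth_iter_deriv f)
qed

text \<open>Translation is affine and not linear, so this is not an instance of composition with a bounded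
  linear map.\<close>
lemma smooth_translate:
  fixes f :: "'a::euclidean_space \<Rightarrow> 'b::real_normed_vector"
  assumes f: "smooth f"
  shows "iter_deriv vs (\<lambda>x. f (x + c)) = (\<lambda>x. iter_deriv vs f (x + c))" "smooth (\<lambda>x. f (x + c))"
proof -
  have d: "((\<lambda>x. g (x + c)) has_derivative (\<lambda>v. iter_deriv [v] g (x + c))) (at x)" if "smooth g" for g :: "'a \<Rightarrow> 'b" and x
    by (rule has_derivative_compose[of "\<lambda>x. x + c" "\<lambda>x. x", OF _ smooth_has_derivative[OF that]]) (auto intro!: derivative_eq_intros)
  show e: "iter_deriv vs (\<lambda>x. f (x + c)) = (\<lambda>x. iter_deriv vs f (x + c))" for vs
  proof (induction vs)
    case (Cons v vs)
    have "iter_deriv [v] (iter_deriv vs (\<lambda>x. f (x + c))) = (\<lambda>x. iter_deriv [v] (iter_deriv vs f) (x + c))"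
      unfolding Cons by (rule iter_deriv_eqI, rule d, rule smooth_iter_deriv, rule f)
    then show ?case by simp
  qed simp
  show "smooth (\<lambda>x. f (x + c))"
    unfolding smooth_def e by (intro allI differentiableI[OF d] smooth_iter_deriv f)
qed

text \<open>The derivative of a product is a sum of products, so the coinduction needs a class closed under both
  operations.\<close>
inductive_set smooth_algebra :: "('a::euclidean_space \<Rightarrow> 'b::real_normed_algebra) set" where
  base: "smooth f \<Longrightarrow> f \<in> smooth_algebra"
| add: "f \<in> smooth_algebra \<Longrightarrow> g \<in> smooth_algebra \<Longrightarrow> (\<lambda>x. f x + g x) \<in> smooth_algebra"
| mult: "f \<in> smooth_algebra \<Longrightarrow> g \<in> smooth_algebra \<Longrightarrow> (\<lambda>x. f x * g x) \<in> smooth_algebra"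

lemma smooth_algebra_smooth: "f \<in> smooth_algebra \<Longrightarrow> smooth f"
proof (rule smooth_coinduct[of _ smooth_algebra])
  fix g :: "'a \<Rightarrow> 'b" assume "g \<in> smooth_algebra"
  then show "\<exists>g'. (\<forall>x. (g has_derivative g' x) (at x)) \<and> (\<forall>v. (\<lambda>x. g' x v) \<in> smooth_algebra)"
  proof induction
    case (base f)
    then show ?case
      using smooth_has_derivative[OF base] smooth_iter_deriv[OF base, of "[_]"]
      by (intro exI[of _ "\<lambda>x v. iter_deriv [v] f x"]) (auto intro: smooth_algebra.base)
  next
    case (add f g)
    then obtain f' g' where "\<forall>x. (f has_derivative f' x) (at x)" "\<forall>v. (\<lambda>x. f' x v) \<in> smooth_algebra"
      "\<forall>x. (g has_derivative g' x) (at x)" "\<forall>v. (\<lambda>x. g' x v) \<in> smooth_algebra" by blast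
    then show ?case
      by (intro exI[of _ "\<lambda>x v. f' x v + g' x v"]) (auto intro!: derivative_intros smooth_algebra.add)
  next
    case (mult f g)
    then obtain f' g' where "\<forall>x. (f has_derivative f' x) (at x)" "\<forall>v. (\<lambda>x. f' x v) \<in> smooth_algebra"
      "\<forall>x. (g has_derivative g' x) (at x)" "\<forall>v. (\<lambda>x. g' x v) \<in> smooth_algebra" by blast
    then show ?case using mult
      by (intro exI[of _ "\<lambda>x v. f x * g' x v + f' x v * g x"]) (auto intro!: derivative_intros smooth_algebra.add smooth_algebra.mult)
  qed
qed

lemma smooth_add: "smooth f \<Longrightarrow> smooth g \<Longrightarrow> smooth (\<lambda>x. f x + g x :: 'b::real_normed_algebra)"
  and smooth_mult: "smooth f \<Longrightarrow> smooth g \<Longrightarrow> smooth (\<lambda>x. f x * g x :: 'b::real_normed_algebra)"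
  by (rule smooth_algebra_smooth, rule smooth_algebra.add smooth_algebra.mult; erule smooth_algebra.base)+

lemma smooth_prod: "(\<And>i. i \<in> I \<Longrightarrow> smooth (f i)) \<Longrightarrow> smooth (\<lambda>x. \<Prod>i\<in>I. f i x :: 'b::{real_normed_algebra,comm_ring_1})"
  by (induction I rule: infinite_finite_induct) (auto intro: smooth_const smooth_mult)

text \<open>A function on the line is smooth once its successive derivatives are listed.\<close>
lemma smooth_ladder:
  fixes h :: "nat \<Rightarrow> real \<Rightarrow> 'b::real_normed_vector"
  assumes "\<And>n x. (h n has_vector_derivative h (Suc n) x) (at x)"
  shows "smooth (h n)"
proof (rule smooth_coinduct[of _ "{\<lambda>x. c *\<^sub>R h n x | c n. True}"], goal_cases)
  case 1
  then show ?case by (auto intro!: exI[of _ 1] exI[of _ n])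
next
  case (2 g)
  then obtain c m where g: "g = (\<lambda>x. c *\<^sub>R h m x)" by auto
  have "((\<lambda>x. c *\<^sub>R h m x) has_derivative (\<lambda>v. c *\<^sub>R (v *\<^sub>R h (Suc m) x))) (at x)" for x
    using has_derivative_scaleR_right[OF assms[of m x, unfolded has_vector_derivative_def], of c] .
  moreover have "\<exists>d n. (\<lambda>x. c *\<^sub>R (v *\<^sub>R h (Suc m) x)) = (\<lambda>x. d *\<^sub>R h n x)" for v
    by (intro exI[of _ "c * v"] exI[of _ "Suc m"]) auto
  ultimately show ?case unfolding g by (intro exI[of _ "\<lambda>x v. c *\<^sub>R (v *\<^sub>R h (Suc m) x)"]) auto
qed

text \<open>The case \<open>p = 1\<close> is the standard smooth function that is flat at the origin; general \<open>p\<close> covers its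
  derivatives.\<close>
definition flat_exp :: "real poly \<Rightarrow> real \<Rightarrow> real" where
  "flat_exp p x = (if x > 0 then poly p (1 / x) * exp (- (1 / x)) else 0)"

text \<open>Exponential decay beats polynomial growth; this makes all derivatives of the flat function below
  vanish at the origin.\<close>
lemma poly_exp_neg_tendsto_0: "((\<lambda>y. poly p y * exp (- y)) \<longlongrightarrow> (0::real)) at_top"
proof -
  have "((\<lambda>y. \<Sum>i\<le>degree p. coeff p i * (y ^ i / exp y)) \<longlongrightarrow> (\<Sum>i\<le>degree p. coeff p i * 0)) at_top"
    by (intro tendsto_sum tendsto_mult_left tendsto_power_div_exp_0)
  then show ?thesis by (simp add: poly_altdef exp_minus sum_distrib_right divide_inverse mult.assoc)
qed

lemma flat_exp_tendsto_0: "(flat_exp p \<longlongrightarrow> 0) (at 0)"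
proof -
  have "((\<lambda>x. poly p (inverse x) * exp (- inverse x)) \<longlongrightarrow> 0) (at_right 0)"
    using filterlim_compose[OF poly_exp_neg_tendsto_0 filterlim_inverse_at_top_right] by simp
  then have "(flat_exp p \<longlongrightarrow> 0) (at_right 0)"
    by (rule Lim_transform_eventually)
      (auto simp: flat_exp_def eventually_at_filter inverse_eq_divide)
  moreover have "(flat_exp p \<longlongrightarrow> 0) (at_left 0)"
    by (rule Lim_transform_eventually[OF tendsto_const])
      (auto simp: flat_exp_def eventually_at_filter)
  ultimately show ?thesis by (simp add: filterlim_split_at)
qed

text \<open>The functions \<open>p (1 / x) exp (- 1 / x)\<close>, extended by zero, are closed under
  differentiation, including at the origin. The new polynomial is \<open>t\<^sup>2 (p -
  p')\<close>.\<close>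
lemma flat_exp_has_derivative:
  "(flat_exp p has_real_derivative flat_exp ([:0,0,1:] * (p - pderiv p)) x) (at x)"
proof -
  consider "x > 0" | "x < 0" | "x = 0" by linarith
  then show ?thesis
  proof cases
    case 1
    have "((\<lambda>x. poly p (1 / x) * exp (- (1 / x))) has_real_derivative
       flat_exp ([:0,0,1:] * (p - pderiv p)) x) (at x)"
      using 1 by (auto intro!: derivative_eq_intros simp: flat_exp_def field_simps power2_eq_square)
    then show ?thesis
      by (rule has_field_derivative_transform_within_open[of _ _ _ "{0<..}"]) (use 1 in \<open>auto simp: flat_exp_def\<close>)
  next
    case 2
    have "((\<lambda>x. 0) has_real_derivative flat_exp ([:0,0,1:] * (p - pderiv p)) x) (at x)"
      using 2 by (auto simp: flat_exp_def)
    then show ?thesis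
      by (rule has_field_derivative_transform_within_open[of _ _ _ "{..<0}"]) (use 2 in \<open>auto simp: flat_exp_def\<close>)
  next
    case 3
    have "((\<lambda>h. (flat_exp p (0 + h) - flat_exp p 0) / h) \<longlongrightarrow> 0) (at 0)"
      by (rule Lim_transform_eventually[OF flat_exp_tendsto_0[of "[:0,1:] * p"]])
        (auto simp: flat_exp_def eventually_at_filter)
    then show ?thesis using 3 by (simp add: DERIV_def flat_exp_def)
  qed
qed

lemma smooth_flat_exp: "smooth (flat_exp p)"
  using smooth_ladder[of "\<lambda>n. flat_exp (((\<lambda>p. [:0,0,1:] * (p - pderiv p)) ^^ n) p)" 0]
    flat_exp_has_derivative by (simp add: has_real_derivative_iff_has_vector_derivative)

text \<open>The derivative \<open>\<beta>\<close> of the step is a bump of integral one supported in the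
  unit interval: up to normalisation it is the product of the flat function with its reflection.
  The step is its primitive.\<close>
lemma smooth_step_exists:
  obtains S \<beta> :: "real \<Rightarrow> real" where "smooth S" "smooth \<beta>"
    "\<And>t. (S has_real_derivative \<beta> t) (at t)" "\<And>t. \<beta> t \<ge> 0" "\<And>t. t \<notin> {0..1} \<Longrightarrow> \<beta> t = 0"
    "\<And>t. t \<le> 0 \<Longrightarrow> S t = 0" "\<And>t. t \<ge> 1 \<Longrightarrow> S t = 1" "\<And>t. 0 \<le> S t" "\<And>t. S t \<le> 1"
proof -
  define b where "b = (\<lambda>t. flat_exp 1 t * flat_exp 1 (1 - t))"
  have sm: "smooth b" unfolding b_def
    using smooth_compose_linear(2)[OF bounded_linear_minus[OF bounded_linear_ident] smooth_translate(2)[OF smooth_flat_exp, of 1 1]]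
    by (intro smooth_mult smooth_flat_exp) (simp add: add.commute)
  have nn: "b t \<ge> 0" and z: "t \<notin> {0..1} \<Longrightarrow> b t = 0" and p: "0 < t \<Longrightarrow> t < 1 \<Longrightarrow> b t > 0" for t
    by (auto simp: b_def flat_exp_def)
  define B where "B = (\<lambda>t. integral {-1..t} b - 0)"
  have cont: "continuous_on S b" for S by (rule smooth_continuous_on[OF sm])
  have int: "b integrable_on {x..y}" for x y by (intro integrable_continuous_interval cont)
  have z0: "B t = 0" if "t \<le> 0" for t
  proof -
    have "integral {-1..t} b = integral {-1..t} (\<lambda>_. 0)"
      by (rule integral_cong) (use z that in \<open>auto simp: b_def flat_exp_def\<close>)
    then show ?thesis by (simp add: B_def)
  qed
  have d1: "(B has_real_derivative b t) (at t)" if "t > -1" for t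
  proof -
    have "((\<lambda>u. integral {-1..u} b) has_real_derivative b t) (at t within {-1..t+1})"
      by (rule integral_has_real_derivative) (use that cont in auto)
    moreover have "at t within {-1..t+1} = at t" using that by (intro at_within_interior) auto
    ultimately show ?thesis by (simp add: B_def)
  qed
  have d: "(B has_real_derivative b t) (at t)" for t
  proof (cases "t > -1")
    case False
    have "((\<lambda>_. 0) has_real_derivative b t) (at t)" using z[of t] False by auto
    then show ?thesis
      by (rule has_field_derivative_transform_within_open[of _ _ _ "{..<0}"]) (use False z0 in auto)
  qed (use d1 in auto)
  have mono: "B x \<le> B y" if "x \<le> y" for x y
    using DERIV_nonneg_imp_nondecreasing[OF that] d nn by blast
  have one: "B t = B 1" if "t \<ge> 1" for t
  proof (rule antisym)
    show "B t \<le> B 1"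
    proof (cases "t = 1")
      case False
      then have that': "t > 1" using that by simp
      obtain \<xi> where "\<xi> > 1" "B t - B 1 = (t - 1) * b \<xi>"
        using MVT2[of 1 t B b, OF _ d] that that' by blast
      then show ?thesis using z[of \<xi>] by simp
    qed simp
  qed (use mono that in auto)
  have pos: "B 1 > 0"
  proof -
    obtain \<xi> where "\<xi> > 0" "\<xi> < 1" "B 1 - B 0 = (1 - 0) * b \<xi>" 
      using MVT2[of 0 1 B b] d by auto
    then show ?thesis using p[of \<xi>] z0[of 0] by auto
  qed
  have s: "((\<lambda>t. B t / B 1) has_real_derivative b t / B 1) (at t)" for t
    by (intro DERIV_cdivide d)
  have sb: "smooth (\<lambda>t. b t / B 1)"
    using smooth_mult[OF sm smooth_const[of "1 / B 1"]] by simp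
  show thesis
  proof (rule that[OF _ sb s])
    show "smooth (\<lambda>t. B t / B 1)"
      by (rule smooth_antiderivative[OF s[unfolded has_field_derivative_def]])
        (rule smooth_mult[OF sb smooth_const])
    show "B t / B 1 \<le> 1" for t
      using pos mono[of t 1] one[of t] by (cases "t \<le> 1") auto
    show "0 \<le> B t / B 1" for t
      using pos mono[of 0 t] z0[of t] z0[of 0] by (cases "t \<le> 0") auto
    show "0 \<le> b t / B 1" for t using nn pos by simp
    show "b t / B 1 = 0" if "t \<notin> {0..1}" for t using z[OF that] by simp
    show "B t / B 1 = 0" if "t \<le> 0" for t using z0[OF that] by simp
    show "B t / B 1 = 1" if "t \<ge> 1" for t using one[OF that] pos by simp
  qed
qed

section \<open>Test functions, differentiation under the integral, and the space of square integrable functions\<close>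

text \<open>The complement of a closed set is open, so a function vanishing there has vanishing derivatives
  there.\<close>
lemma iter_deriv_supported_in:
  assumes K: "closed K" and f: "supported_in f K"
  shows "supported_in (iter_deriv vs f) K"
proof (induction vs)
  case (Cons v vs)
  show ?case unfolding supported_in_def
  proof (intro allI impI)
    fix x assume x: "x \<notin> K"
    have "((\<lambda>_. 0) has_derivative (\<lambda>_. 0)) (at x)" by simp
    then have "(iter_deriv vs f has_derivative (\<lambda>_. 0)) (at x)"
      by (rule has_derivative_transform_within_open[where s = "- K"])
        (use K x Cons in \<open>auto simp: supported_in_def\<close>)
    then show "iter_deriv (v # vs) f x = 0"
      by (simp add: frechet_derivative_at[symmetric])
  qed
qed (use f in simp)

lemma test_function_smooth: "test_function_on U f \<Longrightarrow> smooth f"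
  by (simp add: test_function_on_def)

lemma test_function_iter_deriv: "test_function_on U f \<Longrightarrow> test_function_on U (iter_deriv vs f)"
  unfolding test_function_on_def by (auto intro: smooth_iter_deriv iter_deriv_supported_in compact_imp_closed)

lemma test_function_mult: "test_function_on U f \<Longrightarrow> smooth g \<Longrightarrow> test_function_on U (\<lambda>x. f x * g x)"
  unfolding test_function_on_def supported_in_def by (auto intro!: smooth_mult)

lemma test_function_linear:
  "test_function_on U f \<Longrightarrow> bounded_linear L \<Longrightarrow> test_function_on U (\<lambda>x. L (f x))"
  using smooth_linear_compose[of L f] linear_0[OF bounded_linear.linear, of L]
  unfolding test_function_on_def supported_in_def by auto

lemma test_function_cnj: "test_function_on U f \<Longrightarrow> test_function_on U (\<lambda>x. cnj (f x))"
  by (rule test_function_linear[OF _ bounded_linear_cnj])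

lemma test_function_continuous: "test_function_on U f \<Longrightarrow> continuous_on S f"
  by (rule smooth_continuous_on, rule test_function_smooth)

lemma test_function_borel: "test_function_on U f \<Longrightarrow> f \<in> borel_measurable borel"
  by (rule borel_measurable_continuous_onI, rule test_function_continuous)

lemma test_function_bounded_support:
  assumes "test_function_on U f"
  obtains C R where "C > 0" "R > 0" "\<And>x. norm (f x) \<le> C" "\<And>x. norm x > R \<Longrightarrow> f x = 0"
proof -
  obtain K where K: "compact K" "supported_in f K" using assms by (auto simp: test_function_on_def)
  obtain R where R: "R > 0" "\<And>x. x \<in> K \<Longrightarrow> norm x \<le> R"
    using compact_imp_bounded[OF K(1)] bounded_pos by blast
  have "compact (f ` K)" using compact_continuous_image K(1) test_function_continuous[OF assms] by blast
  then obtain C where C: "C > 0" "\<And>x. x \<in> K \<Longrightarrow> norm (f x) \<le> C"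
    using compact_imp_bounded[of "f ` K"] bounded_pos by (metis imageI)
  show thesis
  proof
    show "norm (f x) \<le> C" for x using C K(2) by (cases "x \<in> K") (auto simp: supported_in_def)
    show "norm x > R \<Longrightarrow> f x = 0" for x using R(2)[of x] K(2) by (auto simp: supported_in_def)
  qed fact+
qed

lemma integrable_bounded_support:
  fixes f :: "'a::euclidean_space \<Rightarrow> 'b::{banach,second_countable_topology}"
  assumes [measurable]: "f \<in> borel_measurable borel" and "\<And>x. norm (f x) \<le> C" "\<And>x. norm x > R \<Longrightarrow> f x = 0"
  shows "integrable lborel f"
proof (rule Bochner_Integration.integrable_bound)
  show "integrable lborel (\<lambda>x. C * indicator (cball 0 R) x)"
    by (intro integrable_mult_right integrable_real_indicator emeasure_lborel_cball_finite) auto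
  show "AE x in lborel. norm (f x) \<le> norm (C * indicator (cball 0 R) x)"
  proof (rule AE_I2)
    fix x
    have "0 \<le> C" using assms(2)[of x] norm_ge_zero order_trans by blast
    then show "norm (f x) \<le> norm (C * indicator (cball 0 R) x)"
      using assms(2)[of x] assms(3)[of x] by (auto simp: indicator_def)
  qed
qed simp

lemma test_function_integrable: "test_function_on U f \<Longrightarrow> integrable lborel f"
  by (frule test_function_borel, erule test_function_bounded_support, rule integrable_bounded_support) auto

text \<open>Dominated convergence of difference quotients. The mean value theorem turns the bound on
  \<open>K'\<close> into one on the quotients; measurability of \<open>K'\<close> in
  \<open>y\<close> is automatic because it is a limit of quotients.\<close>
lemma has_derivative_integral:
  fixes K :: "'a::euclidean_space \<Rightarrow> 'c \<Rightarrow> 'b::{banach,second_countable_topology}"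
  assumes der: "\<And>x y. y \<in> space M \<Longrightarrow> ((\<lambda>x. K x y) has_derivative K' x y) (at x)"
    and bnd: "\<And>x y h. y \<in> space M \<Longrightarrow> norm (K' x y h) \<le> G y * norm h"
    and G: "integrable M G" and K: "\<And>x. integrable M (K x)"
  shows "integrable M (\<lambda>y. K' x y h)"
    and "((\<lambda>x. \<integral>y. K x y \<partial>M) has_derivative (\<lambda>h. \<integral>y. K' x y h \<partial>M)) (at x)"
proof -
  have lim: "(\<lambda>n. real (Suc n) *\<^sub>R (K (x + (1 / real (Suc n)) *\<^sub>R h) y - K x y)) \<longlonglongrightarrow> K' x y h"
    if "y \<in> space M" for x h y
  proof -
    have "((\<lambda>t. K (x + t *\<^sub>R h) y) has_derivative (\<lambda>t. K' x y (t *\<^sub>R h))) (at 0)"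
      by (rule has_derivative_compose[of "\<lambda>t. x + t *\<^sub>R h" "\<lambda>t. t *\<^sub>R h", OF _ der[OF that, THEN has_derivative_eq_rhs]])
        (auto intro!: derivative_eq_intros)
    moreover have "K' x y (t *\<^sub>R h) = t *\<^sub>R K' x y h" for t
      using der[OF that] has_derivative_bounded_linear bounded_linear.linear linear_scale by blast
    ultimately have l: "((\<lambda>t. (K (x + t *\<^sub>R h) y - K x y - t *\<^sub>R K' x y h) /\<^sub>R \<bar>t\<bar>) \<longlongrightarrow> 0) (at 0)"
      by (simp add: has_derivative_at_within)
    have at: "filterlim (\<lambda>n. 1 / real (Suc n)) (at 0) sequentially"
      using LIMSEQ_Suc[OF lim_1_over_n] by (auto simp: filterlim_at)
    have "(\<lambda>n. real (Suc n) *\<^sub>R (K (x + (1 / real (Suc n)) *\<^sub>R h) y - K x y) - K' x y h) \<longlonglongrightarrow> 0"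
      using filterlim_compose[OF l at] by (simp add: scaleR_diff_right)
    then show ?thesis by (rule LIM_zero_cancel)
  qed
  have meas [measurable]: "(\<lambda>y. K' x y h) \<in> borel_measurable M" for x h
    by (rule borel_measurable_LIMSEQ_metric[OF _ lim]) (use K in measurable)
  show int: "integrable M (\<lambda>y. K' x y h)" for x h
    by (rule Bochner_Integration.integrable_bound[of _ "\<lambda>y. G y * norm h"])
      (use G bnd in \<open>auto intro!: AE_I2 intro: order_trans[OF bnd]\<close>)
  have lin: "linear (K' x y)" if "y \<in> space M" for x y
    using der[OF that] has_derivative_bounded_linear bounded_linear.linear by blast
  have "bounded_linear (\<lambda>h. \<integral>y. K' x y h \<partial>M)"
  proof (rule linear_conv_bounded_linear[THEN iffD1], rule linearI)
    show "(\<integral>y. K' x y (a + b) \<partial>M) = (\<integral>y. K' x y a \<partial>M) + (\<integral>y. K' x y b \<partial>M)" for a b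
      unfolding Bochner_Integration.integral_add[OF int int, symmetric]
      by (rule Bochner_Integration.integral_cong) (simp_all add: linear_add[OF lin])
    show "(\<integral>y. K' x y (r *\<^sub>R b) \<partial>M) = r *\<^sub>R (\<integral>y. K' x y b \<partial>M)" for r b
      unfolding integral_scaleR_right[symmetric]
      by (rule Bochner_Integration.integral_cong) (simp_all add: linear_scale[OF lin])
  qed
  moreover have "((\<lambda>z. ((\<integral>y. K z y \<partial>M) - (\<integral>y. K x y \<partial>M) - (\<integral>y. K' x y (z - x) \<partial>M)) /\<^sub>R norm (z - x)) \<longlongrightarrow> 0) (at x)"
    unfolding tendsto_at_iff_sequentially comp_def
  proof (intro allI impI)
    fix X :: "nat \<Rightarrow> 'a" assume X: "\<forall>i. X i \<in> UNIV - {x}" and Xl: "X \<longlonglongrightarrow> x"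
    have at: "filterlim X (at x) sequentially" using X Xl by (auto simp: filterlim_at)
    let ?D = "\<lambda>i y. (K (X i) y - K x y - K' x y (X i - x)) /\<^sub>R norm (X i - x)"
    have eq: "((\<integral>y. K (X i) y \<partial>M) - (\<integral>y. K x y \<partial>M) - (\<integral>y. K' x y (X i - x) \<partial>M)) /\<^sub>R norm (X i - x) = (\<integral>y. ?D i y \<partial>M)" for i
      using K int by (simp add: Bochner_Integration.integral_diff)
    have bd: "norm (?D i y) \<le> 2 * G y" if y: "y \<in> space M" for i y
    proof -
      have "norm (K (X i) y - K x y) \<le> G y * norm (X i - x)"
        by (rule differentiable_bound[of UNIV "\<lambda>x. K x y" "\<lambda>x. K' x y"])
          (use der[OF y] bnd[OF y] in \<open>auto intro!: onorm_le\<close>)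
      then have "norm (K (X i) y - K x y - K' x y (X i - x)) \<le> 2 * G y * norm (X i - x)"
        using bnd[OF y, of x "X i - x"] norm_triangle_ineq4[of "K (X i) y - K x y" "K' x y (X i - x)"] by linarith
      then show ?thesis using X by (simp add: divide_simps)
    qed
    have "(\<lambda>i. \<integral>y. ?D i y \<partial>M) \<longlonglongrightarrow> (\<integral>y. 0 \<partial>M)"
    proof (rule integral_dominated_convergence[where w = "\<lambda>y. 2 * G y"])
      show "AE y in M. (\<lambda>i. ?D i y) \<longlonglongrightarrow> 0"
      proof (rule AE_I2)
        fix y assume "y \<in> space M"
        then have "((\<lambda>z. (K z y - K x y - K' x y (z - x)) /\<^sub>R norm (z - x)) \<longlongrightarrow> 0) (at x)"
          using der[of y x] by (simp add: has_derivative_at_within)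
        from filterlim_compose[OF this at] show "(\<lambda>i. ?D i y) \<longlonglongrightarrow> 0" .
      qed
      show "AE y in M. norm (?D i y) \<le> 2 * G y" for i using bd by auto
      show "integrable M (\<lambda>y. 2 * G y)" using G by simp
    qed (use K in measurable)
    then show "(\<lambda>i. ((\<integral>y. K (X i) y \<partial>M) - (\<integral>y. K x y \<partial>M) - (\<integral>y. K' x y (X i - x) \<partial>M)) /\<^sub>R norm (X i - x)) \<longlonglongrightarrow> 0"
      unfolding eq by simp
  qed
  ultimately show "((\<lambda>x. \<integral>y. K x y \<partial>M) has_derivative (\<lambda>h. \<integral>y. K' x y h \<partial>M)) (at x)"
    unfolding has_derivative_at_within by simp
qed

lemma L2_measurable [measurable_dest]: "f \<in> L2_space \<Longrightarrow> f \<in> borel_measurable borel"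
  by (simp add: L2_space_def)

lemma L2_integrable_sq: "f \<in> L2_space \<Longrightarrow> integrable lborel (\<lambda>x. (norm (f x))\<^sup>2)"
  by (simp add: L2_space_def)

lemma L2_norm_nonneg [simp]: "L2_norm f \<ge> 0"
  by (simp add: L2_norm_def)

lemma L2_norm_sq: "(L2_norm f)\<^sup>2 = (\<integral>x. (norm (f x))\<^sup>2 \<partial>lborel)"
  by (simp add: L2_norm_def)

lemma L2_nn_integral: "f \<in> L2_space \<Longrightarrow> (\<integral>\<^sup>+x. ennreal ((norm (f x))\<^sup>2) \<partial>lborel) = ennreal ((L2_norm f)\<^sup>2)"
  unfolding L2_norm_sq by (rule nn_integral_eq_integral) (auto simp: L2_integrable_sq)

text \<open>Membership in \<open>L\<^sup>2\<close> and norm bounds are usually obtained together, from an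
  estimate of a non-negative integral.\<close>
lemma L2_nn_bound:
  assumes [measurable]: "f \<in> borel_measurable borel"
    and le: "(\<integral>\<^sup>+x. ennreal ((norm (f x))\<^sup>2) \<partial>lborel) \<le> ennreal (c\<^sup>2)" and "c \<ge> 0"
  shows "f \<in> L2_space" "L2_norm f \<le> c"
proof -
  show L2: "f \<in> L2_space"
    unfolding L2_space_def using le by (auto intro!: integrableI_bounded simp: le_less_trans)
  have "(L2_norm f)\<^sup>2 \<le> c\<^sup>2" using le L2_nn_integral[OF L2] by simp
  then show "L2_norm f \<le> c" using \<open>c \<ge> 0\<close> by (rule power2_le_imp_le)
qed

lemma L2_cong_AE:
  assumes "AE x in lborel. f x = g x" "g \<in> borel_measurable borel" "f \<in> L2_space"
  shows "g \<in> L2_space" "L2_norm g = L2_norm f"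
proof -
  have [measurable]: "f \<in> borel_measurable borel" "g \<in> borel_measurable borel" using assms L2_measurable by auto
  have ae: "AE x in lborel. (norm (f x))\<^sup>2 = (norm (g x))\<^sup>2" using assms(1) by eventually_elim simp
  show "g \<in> L2_space" 
    using integrable_cong_AE[OF _ _ ae] assms(3) by (simp add: L2_space_def)
  show "L2_norm g = L2_norm f" 
    unfolding L2_norm_def using integral_cong_AE[OF _ _ ae] by simp
qed

lemma L2_mult_integrable:
  assumes "f \<in> L2_space" "g \<in> L2_space" shows "integrable lborel (\<lambda>x. f x * g x)"
proof (rule Bochner_Integration.integrable_bound)
  have [measurable]: "f \<in> borel_measurable borel" "g \<in> borel_measurable borel" using assms by (auto dest: L2_measurable)
  show "integrable lborel (\<lambda>x. (norm (f x))\<^sup>2 + (norm (g x))\<^sup>2)" using assms by (simp add: L2_integrable_sq)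
  show "AE x in lborel. norm (f x * g x) \<le> norm ((norm (f x))\<^sup>2 + (norm (g x))\<^sup>2)"
  proof (rule AE_I2)
    fix x
    have "2 * (norm (f x) * norm (g x)) \<le> (norm (f x))\<^sup>2 + (norm (g x))\<^sup>2"
      using sum_squares_bound[of "norm (f x)" "norm (g x)"] by simp
    moreover have "0 \<le> norm (f x) * norm (g x)" by simp
    ultimately show "norm (f x * g x) \<le> norm ((norm (f x))\<^sup>2 + (norm (g x))\<^sup>2)"
      unfolding norm_mult real_norm_def by linarith
  qed
  show "(\<lambda>x. f x * g x) \<in> borel_measurable lborel" by measurable
qed

lemma L2_Cauchy_Schwarz:
  assumes "f \<in> L2_space" "g \<in> L2_space"
  shows "(\<integral>x. norm (f x * g x) \<partial>lborel) \<le> L2_norm f * L2_norm g"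
    and "norm (\<integral>x. f x * g x \<partial>lborel) \<le> L2_norm f * L2_norm g"
proof -
  have [measurable]: "f \<in> borel_measurable borel" "g \<in> borel_measurable borel" using assms by (auto dest: L2_measurable)
  have "ennreal ((\<integral>x. norm (f x * g x) \<partial>lborel)\<^sup>2) = (\<integral>\<^sup>+x. ennreal (norm (f x)) * ennreal (norm (g x)) \<partial>lborel)\<^sup>2"
    using nn_integral_eq_integral[OF integrable_norm[OF L2_mult_integrable[OF assms]]]
    by (simp add: norm_mult ennreal_mult ennreal_power[symmetric])
  also have "\<dots> \<le> (\<integral>\<^sup>+x. (ennreal (norm (f x)))\<^sup>2 \<partial>lborel) * (\<integral>\<^sup>+x. (ennreal (norm (g x)))\<^sup>2 \<partial>lborel)"
    by (rule Cauchy_Schwarz_nn_integral) auto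
  also have "\<dots> = ennreal ((L2_norm f * L2_norm g)\<^sup>2)"
    using L2_nn_integral[OF assms(1)] L2_nn_integral[OF assms(2)]
    by (simp add: ennreal_power power_mult_distrib ennreal_mult)
  finally have "(\<integral>x. norm (f x * g x) \<partial>lborel)\<^sup>2 \<le> (L2_norm f * L2_norm g)\<^sup>2" by simp
  then show *: "(\<integral>x. norm (f x * g x) \<partial>lborel) \<le> L2_norm f * L2_norm g"
    by (rule power2_le_imp_le) simp
  show "norm (\<integral>x. f x * g x \<partial>lborel) \<le> L2_norm f * L2_norm g"
    by (rule order_trans[OF integral_norm_bound *])
qed

text \<open>Multiplication by the coefficients, which are bounded only almost everywhere.\<close>
lemma L2_multiplier:
  assumes "f \<in> L2_space" and [measurable]: "m \<in> borel_measurable borel"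
    and bnd: "AE x in lborel. norm (m x) \<le> C" and C: "C \<ge> 0"
  shows "(\<lambda>x. m x * f x) \<in> L2_space" "L2_norm (\<lambda>x. m x * f x) \<le> C * L2_norm f"
proof -
  have [measurable]: "f \<in> borel_measurable borel" using assms by (auto dest: L2_measurable)
  have "(\<integral>\<^sup>+x. ennreal ((norm (m x * f x))\<^sup>2) \<partial>lborel) \<le> (\<integral>\<^sup>+x. ennreal (C\<^sup>2) * ennreal ((norm (f x))\<^sup>2) \<partial>lborel)"
  proof (rule nn_integral_mono_AE)
    show "AE x in lborel. ennreal ((norm (m x * f x))\<^sup>2) \<le> ennreal (C\<^sup>2) * ennreal ((norm (f x))\<^sup>2)"
      using bnd
    proof eventually_elim
      case (elim x)
      then show ?case using C
        by (simp add: norm_mult power_mult_distrib ennreal_mult[symmetric] ennreal_leI mult_right_mono power_mono)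
    qed
  qed
  also have "\<dots> = ennreal ((C * L2_norm f)\<^sup>2)"
    using L2_nn_integral[OF assms(1)] by (simp add: nn_integral_cmult ennreal_mult power_mult_distrib)
  finally have *: "(\<integral>\<^sup>+x. ennreal ((norm (m x * f x))\<^sup>2) \<partial>lborel) \<le> ennreal ((C * L2_norm f)\<^sup>2)" .
  show "(\<lambda>x. m x * f x) \<in> L2_space" "L2_norm (\<lambda>x. m x * f x) \<le> C * L2_norm f"
    using L2_nn_bound[OF _ *] C by auto
qed

lemma L2_cmult: "f \<in> L2_space \<Longrightarrow> (\<lambda>x. c * f x) \<in> L2_space"
  using L2_multiplier(1)[of f "\<lambda>_. c" "norm c"] by simp

lemma L2_norm_cmult: "L2_norm (\<lambda>x. c * f x) = norm c * L2_norm f"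
  by (simp add: L2_norm_def norm_mult power_mult_distrib real_sqrt_mult)

lemma L2_cnj [simp]: "(\<lambda>x. cnj (f x)) \<in> L2_space \<longleftrightarrow> f \<in> L2_space" "L2_norm (\<lambda>x. cnj (f x)) = L2_norm f"
proof -
  have "(\<lambda>x. cnj (f x)) \<in> borel_measurable borel \<longleftrightarrow> f \<in> borel_measurable borel"
  proof
    have m: "cnj \<in> borel_measurable borel" by (intro borel_measurable_continuous_onI continuous_on_cnj continuous_on_id)
    show "(\<lambda>x. cnj (f x)) \<in> borel_measurable borel" if "f \<in> borel_measurable borel"
      using measurable_compose[OF that m] .
    show "f \<in> borel_measurable borel" if "(\<lambda>x. cnj (f x)) \<in> borel_measurable borel"
      using measurable_compose[OF that m] by simp
  qed
  then show "(\<lambda>x. cnj (f x)) \<in> L2_space \<longleftrightarrow> f \<in> L2_space" by (simp add: L2_space_def)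
  show "L2_norm (\<lambda>x. cnj (f x)) = L2_norm f" by (simp add: L2_norm_def)
qed

lemma L2_add:
  assumes "f \<in> L2_space" "g \<in> L2_space"
  shows "(\<lambda>x. f x + g x) \<in> L2_space" "L2_norm (\<lambda>x. f x + g x) \<le> L2_norm f + L2_norm g"
proof -
  have [measurable]: "f \<in> borel_measurable borel" "g \<in> borel_measurable borel" using assms by (auto dest: L2_measurable)
  let ?h = "\<lambda>x. (norm (f x))\<^sup>2 + (norm (g x))\<^sup>2 + 2 * norm (f x * g x)"
  have int: "integrable lborel ?h"
    using assms L2_mult_integrable[OF assms] by (simp add: L2_integrable_sq)
  have le: "(norm (f x + g x))\<^sup>2 \<le> ?h x" for x
    using power_mono[OF norm_triangle_ineq[of "f x" "g x"], of 2]
    by (simp add: power2_sum norm_mult mult.assoc)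
  have "(\<integral>\<^sup>+x. ennreal ((norm (f x + g x))\<^sup>2) \<partial>lborel) \<le> (\<integral>\<^sup>+x. ennreal (?h x) \<partial>lborel)"
    by (intro nn_integral_mono ennreal_leI le)
  also have "\<dots> = ennreal (\<integral>x. ?h x \<partial>lborel)"
    by (rule nn_integral_eq_integral[OF int]) simp
  also have "(\<integral>x. ?h x \<partial>lborel) = (L2_norm f)\<^sup>2 + (L2_norm g)\<^sup>2 + 2 * (\<integral>x. norm (f x * g x) \<partial>lborel)"
    using assms L2_mult_integrable[OF assms] by (simp add: L2_integrable_sq L2_norm_sq)
  also have "ennreal \<dots> \<le> ennreal ((L2_norm f + L2_norm g)\<^sup>2)"
    using L2_Cauchy_Schwarz(1)[OF assms] by (intro ennreal_leI) (simp add: power2_sum)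
  finally have *: "(\<integral>\<^sup>+x. ennreal ((norm (f x + g x))\<^sup>2) \<partial>lborel) \<le> ennreal ((L2_norm f + L2_norm g)\<^sup>2)" .
  show "(\<lambda>x. f x + g x) \<in> L2_space" "L2_norm (\<lambda>x. f x + g x) \<le> L2_norm f + L2_norm g"
    using L2_nn_bound[OF _ *] by auto
qed

lemma L2_diff:
  assumes "f \<in> L2_space" "g \<in> L2_space"
  shows "(\<lambda>x. f x - g x) \<in> L2_space" "L2_norm (\<lambda>x. f x - g x) \<le> L2_norm f + L2_norm g"
  using L2_add[OF assms(1) L2_cmult[OF assms(2), of "-1"]] L2_norm_cmult[of "-1" g] by auto

lemma L2_norm_minus_commute: "L2_norm (\<lambda>x. f x - g x) = L2_norm (\<lambda>x. g x - f x)"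
  by (simp add: L2_norm_def norm_minus_commute)

lemma L2_norm_triangle_diff:
  assumes "f \<in> L2_space" "g \<in> L2_space"
  shows "L2_norm f \<le> L2_norm g + L2_norm (\<lambda>x. f x - g x)"
  using L2_add(2)[OF assms(2) L2_diff(1)[OF assms]] by simp

lemma L2_norm_diff_triangle:
  assumes "f \<in> L2_space" "g \<in> L2_space" "h \<in> L2_space"
  shows "L2_norm (\<lambda>x. f x - h x) \<le> L2_norm (\<lambda>x. f x - g x) + L2_norm (\<lambda>x. g x - h x)"
  using L2_add(2)[OF L2_diff(1)[OF assms(1,2)] L2_diff(1)[OF assms(2,3)]] by simp

lemma L2_zero [simp]: "(\<lambda>x. 0) \<in> L2_space" "L2_norm (\<lambda>x. 0) = 0"
  by (simp_all add: L2_space_def L2_norm_def)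

lemma L2_sum:
  assumes "finite I" "\<And>i. i \<in> I \<Longrightarrow> f i \<in> L2_space"
  shows "(\<lambda>x. \<Sum>i\<in>I. f i x) \<in> L2_space"
  using assms by (induction I) (auto intro!: L2_add)

lemma test_function_L2:
  assumes "test_function_on U f" shows "f \<in> L2_space"
proof -
  have [measurable]: "f \<in> borel_measurable borel" by (rule test_function_borel[OF assms])
  obtain C R where CR: "C > 0" "R > 0" "\<And>x. norm (f x) \<le> C" "\<And>x. norm x > R \<Longrightarrow> f x = 0"
    using test_function_bounded_support[OF assms] by metis
  have "integrable lborel (\<lambda>x. (norm (f x))\<^sup>2)"
    by (rule integrable_bounded_support[of _ "C\<^sup>2" R]) (use CR in \<open>auto intro!: power_mono\<close>)
  then show ?thesis by (simp add: L2_space_def)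
qed

definition L2_inner :: "('a::euclidean_space \<Rightarrow> complex) \<Rightarrow> ('a \<Rightarrow> complex) \<Rightarrow> complex" where
  "L2_inner f g = (\<integral>x. f x * cnj (g x) \<partial>lborel)"

lemma L2_inner_integrable: "f \<in> L2_space \<Longrightarrow> g \<in> L2_space \<Longrightarrow> integrable lborel (\<lambda>x. f x * cnj (g x))"
  using L2_mult_integrable[of f "\<lambda>x. cnj (g x)"] by simp

lemma L2_inner_bound: "f \<in> L2_space \<Longrightarrow> g \<in> L2_space \<Longrightarrow> norm (L2_inner f g) \<le> L2_norm f * L2_norm g"
  unfolding L2_inner_def using L2_Cauchy_Schwarz(2)[of f "\<lambda>x. cnj (g x)"] by simp

lemma L2_inner_add_left: "f \<in> L2_space \<Longrightarrow> g \<in> L2_space \<Longrightarrow> h \<in> L2_space \<Longrightarrow> L2_inner (\<lambda>x. f x + g x) h = L2_inner f h + L2_inner g h"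
  and L2_inner_diff_left: "f \<in> L2_space \<Longrightarrow> g \<in> L2_space \<Longrightarrow> h \<in> L2_space \<Longrightarrow> L2_inner (\<lambda>x. f x - g x) h = L2_inner f h - L2_inner g h"
  and L2_inner_diff_right: "f \<in> L2_space \<Longrightarrow> g \<in> L2_space \<Longrightarrow> h \<in> L2_space \<Longrightarrow> L2_inner h (\<lambda>x. f x - g x) = L2_inner h f - L2_inner h g"
  unfolding L2_inner_def by (simp_all add: ring_distribs L2_inner_integrable)

lemma L2_inner_cmult: "L2_inner (\<lambda>x. c * f x) g = c * L2_inner f g" "L2_inner f (\<lambda>x. c * g x) = cnj c * L2_inner f g"
  unfolding L2_inner_def integral_mult_right_zero[symmetric] by (simp_all add: mult_ac)

lemma L2_inner_self: "L2_inner f f = of_real ((L2_norm f)\<^sup>2)"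
  unfolding L2_inner_def L2_norm_sq integral_complex_of_real[symmetric] complex_norm_square ..

lemma L2_inner_cnj: "cnj (L2_inner f g) = L2_inner g f"
  unfolding L2_inner_def using Bochner_Integration.integral_cnj[of lborel "\<lambda>x. f x * cnj (g x)"] by (simp add: mult.commute)

text \<open>Riesz and Fischer. Weighting with a fixed positive function of \<open>L\<^sup>2\<close> makes
  the sequence Cauchy in \<open>L\<^sup>1\<close>, where a subsequence converges almost
  everywhere; the limit is the limit in \<open>L\<^sup>2\<close> by Fatou.\<close>
lemma L2_complete:
  fixes f :: "nat \<Rightarrow> 'a::euclidean_space \<Rightarrow> complex"
  assumes f: "\<And>n. f n \<in> L2_space"
    and Cauchy: "\<And>e. e > 0 \<Longrightarrow> \<exists>N. \<forall>i\<ge>N. \<forall>j\<ge>N. L2_norm (\<lambda>x. f i x - f j x) < e"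
  obtains g where "g \<in> L2_space" "(\<lambda>n. L2_norm (\<lambda>x. f n x - g x)) \<longlonglongrightarrow> 0"
proof -
  have [measurable]: "f n \<in> borel_measurable borel" for n using f by (auto dest: L2_measurable)
  obtain h :: "'a \<Rightarrow> ennreal" where h [measurable]: "h \<in> borel_measurable borel" and hfin: "(\<integral>\<^sup>+x. h x \<partial>lborel) \<noteq> \<infinity>"
    and hpos: "\<And>x. 0 < h x" "\<And>x. h x < \<infinity>"
    using sigma_finite_measure.Ex_finite_integrable_function[OF sigma_finite_lborel] by auto
  \<comment> \<open>A strictly positive weight in \<open>L\<^sup>2\<close>, from a strictly positive integrable function.\<close>
  define w where "w = (\<lambda>x. complex_of_real (sqrt (enn2real (h x))))"
  have wpos: "w x \<noteq> 0" for x using hpos[of x] by (simp add: w_def enn2real_eq_0_iff less_top)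
  have w: "w \<in> L2_space"
  proof -
    have "(\<integral>\<^sup>+x. ennreal (enn2real (h x)) \<partial>lborel) < \<infinity>"
      using hfin hpos by (simp add: less_top)
    then show ?thesis unfolding L2_space_def w_def by (auto intro!: integrableI_bounded)
  qed
  obtain r where r: "strict_mono r" and ae: "AE x in lborel. Cauchy (\<lambda>i. f (r i) x * w x)"
  proof (rule cauchy_L1_AE_cauchy_subseq[of lborel "\<lambda>n x. f n x * w x"])
    show "integrable lborel (\<lambda>x. f n x * w x)" for n by (rule L2_mult_integrable[OF f w])
    fix e :: real assume e: "e > 0"
    obtain N where N: "\<And>i j. i \<ge> N \<Longrightarrow> j \<ge> N \<Longrightarrow> L2_norm (\<lambda>x. f i x - f j x) < e / (L2_norm w + 1)"
      using Cauchy[of "e / (L2_norm w + 1)"] e by (auto simp: add_nonneg_pos)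
    have "(\<integral>x. norm (f i x * w x - f j x * w x) \<partial>lborel) < e" if "i \<ge> N" "j \<ge> N" for i j
    proof -
      have "(\<integral>x. norm (f i x * w x - f j x * w x) \<partial>lborel) = (\<integral>x. norm ((f i x - f j x) * w x) \<partial>lborel)"
        by (simp add: left_diff_distrib)
      also have "\<dots> \<le> L2_norm (\<lambda>x. f i x - f j x) * L2_norm w"
        by (rule L2_Cauchy_Schwarz(1)[OF L2_diff(1)[OF f f] w])
      also have "\<dots> \<le> L2_norm (\<lambda>x. f i x - f j x) * (L2_norm w + 1)"
        by (intro mult_left_mono) auto
      also have "\<dots> < e" using N[OF that] by (simp add: pos_less_divide_eq add_nonneg_pos)
      finally show ?thesis .
    qed
    then show "\<exists>N. \<forall>i\<ge>N. \<forall>j\<ge>N. (\<integral>x. norm (f i x * w x - f j x * w x) \<partial>lborel) < e" by blast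
  qed (use that in blast)
  define g where "g = (\<lambda>x. lim (\<lambda>i. f (r i) x))"
  have [measurable]: "g \<in> borel_measurable borel" unfolding g_def by measurable
  have lim: "AE x in lborel. (\<lambda>i. f (r i) x) \<longlonglongrightarrow> g x" using ae
  proof eventually_elim
    case (elim x)
    have "convergent (\<lambda>i. f (r i) x * w x)" using elim by (simp add: Cauchy_convergent_iff)
    then obtain l where "(\<lambda>i. f (r i) x * w x) \<longlonglongrightarrow> l" by (auto simp: convergent_def)
    then have "(\<lambda>i. f (r i) x * w x / w x) \<longlonglongrightarrow> l / w x" using wpos by (intro tendsto_intros)
    then have "convergent (\<lambda>i. f (r i) x)" using wpos by (auto simp: convergent_def)
    then show ?case by (simp add: g_def convergent_LIMSEQ_iff)
  qed
  have close: "\<exists>N. \<forall>n\<ge>N. (\<lambda>x. f n x - g x) \<in> L2_space \<and> L2_norm (\<lambda>x. f n x - g x) \<le> e" if e: "e > 0" for e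
  proof -
    obtain N where N: "\<And>i j. i \<ge> N \<Longrightarrow> j \<ge> N \<Longrightarrow> L2_norm (\<lambda>x. f i x - f j x) < e" using Cauchy[OF e] by blast
    have "(\<lambda>x. f n x - g x) \<in> L2_space \<and> L2_norm (\<lambda>x. f n x - g x) \<le> e" if n: "n \<ge> N" for n
    proof -
      have "(\<integral>\<^sup>+x. ennreal ((norm (f n x - g x))\<^sup>2) \<partial>lborel) 
        = (\<integral>\<^sup>+x. liminf (\<lambda>i. ennreal ((norm (f n x - f (r i) x))\<^sup>2)) \<partial>lborel)"
      proof (rule nn_integral_cong_AE)
        show "AE x in lborel. ennreal ((norm (f n x - g x))\<^sup>2) = liminf (\<lambda>i. ennreal ((norm (f n x - f (r i) x))\<^sup>2))"
          using lim
        proof eventually_elim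
          case (elim x)
          have "(\<lambda>i. ennreal ((norm (f n x - f (r i) x))\<^sup>2)) \<longlonglongrightarrow> ennreal ((norm (f n x - g x))\<^sup>2)"
            by (intro tendsto_ennrealI tendsto_intros elim)
          then show ?case using lim_imp_Liminf[OF sequentially_bot] by metis
        qed
      qed
      also have "\<dots> \<le> liminf (\<lambda>i. \<integral>\<^sup>+x. ennreal ((norm (f n x - f (r i) x))\<^sup>2) \<partial>lborel)"
        by (rule nn_integral_liminf) measurable
      also have "\<dots> \<le> ennreal (e\<^sup>2)"
      proof (rule Liminf_le)
        show "\<forall>\<^sub>F i in sequentially. (\<integral>\<^sup>+x. ennreal ((norm (f n x - f (r i) x))\<^sup>2) \<partial>lborel) \<le> ennreal (e\<^sup>2)"
          using eventually_ge_at_top[of N]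
        proof eventually_elim
          case (elim i)
          then have "r i \<ge> N" using seq_suble[OF r, of i] by linarith
          then show ?case using N[OF n, of "r i"] L2_nn_integral[OF L2_diff(1)[OF f f], of n "r i"]
            by (auto intro!: ennreal_leI power_mono)
        qed
      qed simp
      finally show ?thesis using L2_nn_bound[of "\<lambda>x. f n x - g x" e] e by simp
    qed
    then show ?thesis by blast
  qed
  obtain N where "(\<lambda>x. f N x - g x) \<in> L2_space" using close[of 1] by auto
  from L2_diff(1)[OF f[of N] this] have "g \<in> L2_space" by simp
  moreover have "(\<lambda>n. L2_norm (\<lambda>x. f n x - g x)) \<longlonglongrightarrow> 0"
  proof (rule LIMSEQ_I)
    fix e :: real assume "e > 0"
    then obtain N where "\<And>n. n \<ge> N \<Longrightarrow> L2_norm (\<lambda>x. f n x - g x) \<le> e / 2" using close[of "e/2"] by auto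
    then show "\<exists>N. \<forall>n\<ge>N. norm (L2_norm (\<lambda>x. f n x - g x) - 0) < e" using \<open>e > 0\<close> by (intro exI[of _ N]) fastforce
  qed
  ultimately show thesis by (rule that)
qed

section \<open>The fundamental lemma of the calculus of variations and Gaussians\<close>

abbreviation test_fn :: "('a::euclidean_space \<Rightarrow> complex) \<Rightarrow> bool" where
  "test_fn \<equiv> test_function_on UNIV"

text \<open>The indicator of an open box is a bounded pointwise limit of products of smooth steps of slope
  proportional to \<open>n\<close>.\<close>
lemma smooth_box_cutoff:
  fixes a b :: "'a::euclidean_space"
  obtains \<psi> :: "nat \<Rightarrow> 'a \<Rightarrow> complex" where "\<And>n. test_fn (\<psi> n)"
    "\<And>n x. norm (\<psi> n x) \<le> indicator (box a b) x" "\<And>x. (\<lambda>n. \<psi> n x) \<longlonglongrightarrow> indicator (box a b) x"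
proof -
  obtain S \<beta> :: "real \<Rightarrow> real" where S: "smooth S" "\<And>t. t \<le> 0 \<Longrightarrow> S t = 0" "\<And>t. t \<ge> 1 \<Longrightarrow> S t = 1"
    "\<And>t. 0 \<le> S t" "\<And>t. S t \<le> 1"
    using smooth_step_exists by metis
  define r where "r = (\<lambda>n x. \<Prod>i\<in>Basis. S (real n * (x \<bullet> i - a \<bullet> i)) * S (real n * (b \<bullet> i - x \<bullet> i)))"
  have "smooth (\<lambda>x. S (real n * (x \<bullet> i - a \<bullet> i)))" for i n
  proof -
    have "bounded_linear (\<lambda>x. real n * (x \<bullet> i))"
      by (intro bounded_linear_const_mult bounded_linear_inner_left)
    from smooth_compose_linear(2)[OF this smooth_translate(2)[OF S(1), of "- (real n * (a \<bullet> i))"]]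
    show ?thesis by (simp add: algebra_simps)
  qed
  moreover have "smooth (\<lambda>x. S (real n * (b \<bullet> i - x \<bullet> i)))" for i n
  proof -
    have "bounded_linear (\<lambda>x. - real n * (x \<bullet> i))"
      by (intro bounded_linear_const_mult bounded_linear_inner_left)
    from smooth_compose_linear(2)[OF this smooth_translate(2)[OF S(1), of "real n * (b \<bullet> i)"]]
    show ?thesis by (simp add: algebra_simps)
  qed
  ultimately have sm: "smooth (r n)" for n unfolding r_def by (intro smooth_prod smooth_mult)
  have zero: "r n x = 0" if x: "x \<notin> box a b" for n x
  proof -
    obtain i where i: "i \<in> Basis" "x \<bullet> i \<le> a \<bullet> i \<or> b \<bullet> i \<le> x \<bullet> i" using x by (auto simp: mem_box not_less)
    then have "S (real n * (x \<bullet> i - a \<bullet> i)) = 0 \<or> S (real n * (b \<bullet> i - x \<bullet> i)) = 0"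
      using S(2)[of "real n * (x \<bullet> i - a \<bullet> i)"] S(2)[of "real n * (b \<bullet> i - x \<bullet> i)"]
      by (auto simp: mult_le_0_iff)
    then show ?thesis unfolding r_def using i(1) by (intro prod_zero) auto
  qed
  have bd: "0 \<le> r n x" "r n x \<le> 1" for n x
    unfolding r_def by (auto intro!: prod_nonneg prod_le_1 mult_nonneg_nonneg mult_le_one S)
  have one: "(\<lambda>n. r n x) \<longlonglongrightarrow> 1" if x: "x \<in> box a b" for x
  proof -
    have ev: "\<forall>\<^sub>F n in sequentially. S (real n * c) = 1" if "c > 0" for c
    proof -
      have "filterlim (\<lambda>n. real n * c) at_top sequentially"
        using that by (intro filterlim_tendsto_pos_mult_at_top[OF tendsto_const] filterlim_at_top_mult_tendsto_pos[OF tendsto_const] filterlim_real_sequentially)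
      then have "\<forall>\<^sub>F n in sequentially. real n * c \<ge> 1" by (simp add: filterlim_at_top)
      then show ?thesis by eventually_elim (rule S(3))
    qed
    have "\<forall>\<^sub>F n in sequentially. \<forall>i\<in>Basis. S (real n * (x \<bullet> i - a \<bullet> i)) = 1 \<and> S (real n * (b \<bullet> i - x \<bullet> i)) = 1"
      unfolding eventually_ball_finite_distrib[OF finite_Basis] eventually_conj_iff
      using x by (auto simp: mem_box intro!: ev)
    then have "\<forall>\<^sub>F n in sequentially. r n x = 1"
      by eventually_elim (simp add: r_def)
    then show ?thesis by (rule tendsto_eventually)
  qed
  show thesis
  proof (rule that[of "\<lambda>n x. complex_of_real (r n x)"])
    show "test_fn (\<lambda>x. complex_of_real (r n x))" for n
    proof -
      have "smooth (\<lambda>x. complex_of_real (r n x))"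
        by (rule smooth_linear_compose[OF bounded_linear_of_real sm])
      moreover have "supported_in (\<lambda>x. complex_of_real (r n x)) (cbox a b)"
        using zero box_subset_cbox[of a b] by (auto simp: supported_in_def)
      ultimately show ?thesis unfolding test_function_on_def using compact_cbox by blast
    qed
    show "norm (complex_of_real (r n x)) \<le> indicator (box a b) x" for n x
      using zero[of x n] bd[of n x] by (auto simp: indicator_def)
    show "(\<lambda>n. complex_of_real (r n x)) \<longlonglongrightarrow> indicator (box a b) x" for x
    proof (cases "x \<in> box a b")
      case True
      then show ?thesis using tendsto_of_real[OF one[OF True], where 'a = complex] by simp
    qed (use zero[of x] in simp)
  qed
qed

text \<open>Approximating indicators of boxes by test functions shows that \<open>h\<close> has integral
  zero over every box. Boxes generate the Borel sets, so on each bounded box \<open>h\<close> has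
  integral zero over every Borel subset and vanishes almost everywhere.\<close>
lemma fundamental_lemma_calculus_of_variations:
  fixes h :: "'a::euclidean_space \<Rightarrow> complex"
  assumes loc: "\<And>a b. integrable lborel (\<lambda>x. indicator (box a b) x * h x)"
    and zero: "\<And>\<phi>. test_fn \<phi> \<Longrightarrow> (\<integral>x. h x * \<phi> x \<partial>lborel) = 0"
  shows "AE x in lborel. h x = 0"
proof -
  have box: "(\<integral>x. indicator (box a b) x * h x \<partial>lborel) = 0" for a b :: 'a
  proof -
    obtain \<psi> :: "nat \<Rightarrow> 'a \<Rightarrow> complex" where \<psi>: "\<And>n. test_fn (\<psi> n)"
      "\<And>n x. norm (\<psi> n x) \<le> indicator (box a b) x" "\<And>x. (\<lambda>n. \<psi> n x) \<longlonglongrightarrow> indicator (box a b) x"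
      using smooth_box_cutoff by metis
    have [measurable]: "\<psi> n \<in> borel_measurable borel" for n using test_function_borel[OF \<psi>(1)] .
    have eq: "\<psi> n x * (indicator (box a b) x * h x) = h x * \<psi> n x" for n x
      using \<psi>(2)[of n x] by (auto simp: indicator_def)
    have m: "(\<lambda>x. indicator (box a b) x * h x) \<in> borel_measurable lborel"
      using loc by (rule borel_measurable_integrable)
    have "(\<lambda>n. \<integral>x. \<psi> n x * (indicator (box a b) x * h x) \<partial>lborel) \<longlonglongrightarrow> (\<integral>x. indicator (box a b) x * h x \<partial>lborel)"
    proof (rule integral_dominated_convergence[where w = "\<lambda>x. norm (indicator (box a b) x * h x)"])
      show "AE x in lborel. (\<lambda>n. \<psi> n x * (indicator (box a b) x * h x)) \<longlonglongrightarrow> indicator (box a b) x * h x"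
      proof (rule AE_I2)
        fix x
        have "(\<lambda>n. \<psi> n x * (indicator (box a b) x * h x)) \<longlonglongrightarrow> indicator (box a b) x * (indicator (box a b) x * h x)"
          by (intro tendsto_intros \<psi>(3))
        then show "(\<lambda>n. \<psi> n x * (indicator (box a b) x * h x)) \<longlonglongrightarrow> indicator (box a b) x * h x"
          by (auto simp: indicator_def)
      qed
      show "AE x in lborel. norm (\<psi> n x * (indicator (box a b) x * h x)) \<le> norm (indicator (box a b) x * h x)" for n
      proof (rule AE_I2)
        fix x
        have "norm (\<psi> n x) \<le> 1" using \<psi>(2)[of n x] by (cases "x \<in> box a b") auto
        then show "norm (\<psi> n x * (indicator (box a b) x * h x)) \<le> norm (indicator (box a b) x * h x)"
          by (simp add: norm_mult mult_left_le_one_le)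
      qed
    qed (use m loc in \<open>auto intro!: borel_measurable_times integrable_norm\<close>)
    then show ?thesis unfolding eq using zero[OF \<psi>(1)] by (simp add: LIMSEQ_const_iff)
  qed
  let ?B = "\<lambda>n::nat. box (- (real n *\<^sub>R One)) (real n *\<^sub>R One) :: 'a set"
  have "AE x in lborel. indicator (?B n) x * h x = 0" for n
  proof (rule sigma_finite_measure.density_zero[OF sigma_finite_lborel loc])
    fix A :: "'a set" assume "A \<in> sets lborel"
    then have A: "A \<in> sigma_sets UNIV (range (\<lambda>(a, b). box a b))" by (simp add: borel_eq_box)
    have int: "set_integrable lborel A (\<lambda>x. indicator (?B n) x * h x)" if "A \<in> sets lborel" for A
      unfolding set_integrable_def by (rule integrable_mult_indicator[OF that loc])
    show "set_lebesgue_integral lborel A (\<lambda>x. indicator (?B n) x * h x) = 0"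
    proof (rule sigma_sets_induct_disjoint[OF _ _ A])
      show "Int_stable (range (\<lambda>(a, b). box a b :: 'a set))" by (auto simp: Int_stable_def box_Int_box)
    next
      fix A assume "A \<in> range (\<lambda>(a, b). box a b :: 'a set)"
      then obtain a b where ab: "A = box a b" by auto
      obtain c d where cd: "box a b \<inter> ?B n = box c d" unfolding box_Int_box by blast
      have eq: "indicator (box c d) x * h x = indicator A x *\<^sub>R (indicator (?B n) x * h x)" for x
        unfolding cd[symmetric] ab by (auto simp: indicator_def)
      show "set_lebesgue_integral lborel A (\<lambda>x. indicator (?B n) x * h x) = 0"
        using box[of c d] unfolding set_lebesgue_integral_def eq .
    next
      show "set_lebesgue_integral lborel {} (\<lambda>x. indicator (?B n) x * h x) = 0" by (simp add: set_lebesgue_integral_def)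
    next
      fix A assume "A \<in> sigma_sets UNIV (range (\<lambda>(a, b). box a b :: 'a set))"
        and 0: "set_lebesgue_integral lborel A (\<lambda>x. indicator (?B n) x * h x) = 0"
      then have A': "A \<in> sets lborel" by (simp add: borel_eq_box)
      then have A'': "UNIV - A \<in> sets lborel" using sets.compl_sets[of A lborel] by simp
      have "set_lebesgue_integral lborel (A \<union> (UNIV - A)) (\<lambda>x. indicator (?B n) x * h x)
         = 0 + set_lebesgue_integral lborel (UNIV - A) (\<lambda>x. indicator (?B n) x * h x)"
        unfolding 0[symmetric] by (rule set_integral_Un) (use A' A'' int in auto)
      moreover have "A \<union> (UNIV - A) = UNIV" by auto
      ultimately show "set_lebesgue_integral lborel (UNIV - A) (\<lambda>x. indicator (?B n) x * h x) = 0"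
        using box by (simp add: set_lebesgue_integral_def)
    next
      fix A :: "nat \<Rightarrow> 'a set" assume dis: "disjoint_family A"
        and "range A \<subseteq> sigma_sets UNIV (range (\<lambda>(a, b). box a b :: 'a set))"
        and 0: "\<And>i. set_lebesgue_integral lborel (A i) (\<lambda>x. indicator (?B n) x * h x) = 0"
      then have A': "A i \<in> sets borel" for i by (auto simp: borel_eq_box)
      have U: "(\<Union>i. A i) \<in> sets borel" using A' by (intro sets.countable_UN) auto
      have "set_lebesgue_integral lborel (\<Union>i. A i) (\<lambda>x. indicator (?B n) x * h x) = (\<Sum>i. set_lebesgue_integral lborel (A i) (\<lambda>x. indicator (?B n) x * h x))"
        by (rule lebesgue_integral_countable_add) (use dis A' U int in \<open>auto simp: disjoint_family_on_def\<close>)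
      then show "set_lebesgue_integral lborel (\<Union>i. A i) (\<lambda>x. indicator (?B n) x * h x) = 0" using 0 by simp
    qed auto
  qed
  then have "AE x in lborel. \<forall>n. indicator (?B n) x * h x = 0" unfolding AE_all_countable by blast
  then show ?thesis
  proof eventually_elim
    case (elim x)
    have "x \<in> (\<Union>n. ?B n)" unfolding UN_box_eq_UNIV by simp
    then obtain n where "x \<in> ?B n" by blast
    then show ?case using spec[OF elim, of n] by simp
  qed
qed

lemma L2_box_integrable:
  assumes "f \<in> L2_space" shows "integrable lborel (\<lambda>x. indicator (box a b) x * f x)"
proof (rule L2_mult_integrable[OF _ assms])
  have "integrable lborel (indicat_real (box a b))"
    by (intro integrable_real_indicator emeasure_lborel_box_finite) auto
  moreover have "(norm (indicator (box a b) x :: complex))\<^sup>2 = indicat_real (box a b) x" for x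
    by (auto simp: indicator_def)
  ultimately show "indicator (box a b) \<in> L2_space" by (simp add: L2_space_def)
qed

lemma L2_eq_AE_of_test_functions:
  assumes "f \<in> L2_space" "g \<in> L2_space"
    and "\<And>\<phi>. test_fn \<phi> \<Longrightarrow> (\<integral>x. f x * \<phi> x \<partial>lborel) = (\<integral>x. g x * \<phi> x \<partial>lborel)"
  shows "AE x in lborel. f x = g x"
proof -
  have "AE x in lborel. f x - g x = 0"
  proof (rule fundamental_lemma_calculus_of_variations)
    show "integrable lborel (\<lambda>x. indicator (box a b) x * (f x - g x))" for a b
      by (rule L2_box_integrable[OF L2_diff(1)[OF assms(1,2)]])
    show "(\<integral>x. (f x - g x) * \<phi> x \<partial>lborel) = 0" if "test_fn \<phi>" for \<phi>
      using assms(3)[OF that] L2_mult_integrable[OF assms(1) test_function_L2[OF that]]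
        L2_mult_integrable[OF assms(2) test_function_L2[OF that]]
      by (simp add: left_diff_distrib)
  qed
  then show ?thesis by eventually_elim simp
qed

text \<open>Lebesgue measure on a Euclidean space is a product over the coordinates; this reduces Gaussian
  integrals and decay estimates to one dimension.\<close>
lemma integral_lborel_prod:
  fixes f :: "'a::euclidean_space \<Rightarrow> real \<Rightarrow> complex"
  assumes "\<And>b. b \<in> Basis \<Longrightarrow> integrable lborel (f b)"
  shows "integrable lborel (\<lambda>x::'a. \<Prod>b\<in>Basis. f b (x \<bullet> b))"
    and "(\<integral>x. (\<Prod>b\<in>Basis. f b (x \<bullet> b)) \<partial>lborel) = (\<Prod>b\<in>Basis. \<integral>x. f b x \<partial>lborel)"
proof -
  interpret product_sigma_finite "\<lambda>_::'a. lborel :: real measure" by standard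
  have [measurable]: "f b \<in> borel_measurable borel" if "b \<in> Basis" for b
    using borel_measurable_integrable[OF assms[OF that]] by simp
  have m [measurable]: "(\<lambda>x::'a. \<Prod>b\<in>Basis. f b (x \<bullet> b)) \<in> borel_measurable borel"
    by measurable
  have m2 [measurable]: "(\<lambda>f. \<Sum>b\<in>Basis. f b *\<^sub>R b) \<in> (\<Pi>\<^sub>M b\<in>Basis. lborel) \<rightarrow>\<^sub>M (borel :: 'a measure)"
    by measurable
  have eq: "(\<Prod>b\<in>Basis. f b ((\<Sum>b\<in>Basis. g b *\<^sub>R b) \<bullet> b)) = (\<Prod>b\<in>Basis. f b (g b))" for g :: "'a \<Rightarrow> real"
    by (intro prod.cong refl) simp
  have "integrable (\<Pi>\<^sub>M b\<in>Basis. lborel) (\<lambda>x. \<Prod>b\<in>Basis. f b (x b))"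
    by (rule product_integrable_prod[OF finite_Basis assms])
  then show "integrable lborel (\<lambda>x::'a. \<Prod>b\<in>Basis. f b (x \<bullet> b))"
    unfolding lborel_eq[where 'a = 'a] by (subst integrable_distr_eq[OF m2]) (auto simp: eq)
  have "(\<integral>x. (\<Prod>b\<in>Basis. f b (x \<bullet> b)) \<partial>lborel) = (\<integral>x. (\<Prod>b\<in>Basis. f b (x b)) \<partial>(\<Pi>\<^sub>M b\<in>Basis. lborel))"
    unfolding lborel_eq[where 'a = 'a] by (subst integral_distr[OF m2]) (auto simp: eq)
  also have "\<dots> = (\<Prod>b\<in>Basis. \<integral>x. f b x \<partial>lborel)"
    by (rule product_integral_prod[OF finite_Basis assms])
  finally show "(\<integral>x. (\<Prod>b\<in>Basis. f b (x \<bullet> b)) \<partial>lborel) = (\<Prod>b\<in>Basis. \<integral>x. f b x \<partial>lborel)" .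
qed

definition gauss :: "real \<Rightarrow> 'a::euclidean_space \<Rightarrow> real" where
  "gauss \<delta> x = exp (- (\<delta>\<^sup>2 * (norm x)\<^sup>2) / 2)"

text \<open>The characteristic function of the normal distribution, after rescaling.\<close>
lemma gauss_real_fourier:
  assumes \<delta>: "\<delta> > 0"
  shows "integrable lborel (\<lambda>x::real. cis (- (t * x)) * of_real (gauss \<delta> x))"
    and "(\<integral>x. cis (- (t * x)) * of_real (gauss \<delta> x) \<partial>lborel) = of_real (sqrt (2 * pi) / \<delta> * gauss (1 / \<delta>) t)"
proof -
  let ?F = "\<lambda>x::real. cis (- (t * x)) * of_real (gauss \<delta> x)"
  have sc: "integrable lborel (\<lambda>x. ?F (0 + (1 / \<delta>) * x)) \<and>
     (\<integral>x. ?F (0 + (1 / \<delta>) * x) \<partial>lborel) = of_real (sqrt (2 * pi) * gauss (1 / \<delta>) t)"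
  proof -
    have g: "gauss \<delta> ((1 / \<delta>) * x) = sqrt (2 * pi) * std_normal_density x" for x :: real
      using \<delta> by (simp add: gauss_def std_normal_density_def power_mult_distrib power_divide)
    have i: "integrable lborel (\<lambda>x. complex_of_real (std_normal_density x))"
      using integrable_normal_density[of 1 0] by simp
    have j: "integrable lborel (\<lambda>x. cis (- (t / \<delta> * x)) * complex_of_real (std_normal_density x))"
      by (rule Bochner_Integration.integrable_bound[OF i]) (auto simp: norm_mult cis_conv_exp)
    have "char std_normal_distribution (- (t / \<delta>)) = (\<integral>x. std_normal_density x *\<^sub>R iexp (- (t / \<delta>) * x) \<partial>lborel)"
      unfolding char_def by (rule integral_density) (auto simp: normal_density_nonneg)
    also have "\<dots> = (\<integral>x. cis (- (t / \<delta> * x)) * complex_of_real (std_normal_density x) \<partial>lborel)"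
      by (simp add: scaleR_conv_of_real cis_conv_exp mult.commute)
    finally have "(\<integral>x. cis (- (t / \<delta> * x)) * complex_of_real (std_normal_density x) \<partial>lborel) = of_real (gauss (1 / \<delta>) t)"
      by (simp add: char_std_normal_distribution gauss_def power_divide power2_eq_square)
    then have "(\<integral>x. complex_of_real (sqrt (2 * pi)) * (cis (- (t / \<delta> * x)) * complex_of_real (std_normal_density x)) \<partial>lborel)
        = of_real (sqrt (2 * pi)) * of_real (gauss (1 / \<delta>) t)" by (simp only: integral_mult_right_zero)
    moreover have F: "(\<lambda>x. ?F (0 + (1 / \<delta>) * x)) = (\<lambda>x. complex_of_real (sqrt (2 * pi)) * (cis (- (t / \<delta> * x)) * complex_of_real (std_normal_density x)))"
      unfolding add_0 g by (rule ext) (simp add: mult.left_commute)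
    moreover have "integrable lborel (\<lambda>x. complex_of_real (sqrt (2 * pi)) * (cis (- (t / \<delta> * x)) * complex_of_real (std_normal_density x)))"
      using j by (rule integrable_mult_right)
    ultimately show ?thesis unfolding F of_real_mult by blast
  qed
  show "integrable lborel ?F"
    using sc lborel_integrable_real_affine_iff[of "1 / \<delta>" ?F 0] \<delta> by auto
  show "(\<integral>x. ?F x \<partial>lborel) = of_real (sqrt (2 * pi) / \<delta> * gauss (1 / \<delta>) t)"
    using sc lborel_integral_real_affine[of "1 / \<delta>" ?F 0] \<delta> by (simp add: scaleR_conv_of_real)
qed

lemma gauss_prod: "gauss \<delta> x = (\<Prod>b\<in>Basis. gauss \<delta> (x \<bullet> b))" for x :: "'a::euclidean_space"
proof -
  have "(norm x)\<^sup>2 = (\<Sum>b\<in>Basis. (x \<bullet> b)\<^sup>2)"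
    unfolding power2_norm_eq_inner by (subst euclidean_inner) (simp add: power2_eq_square)
  then show ?thesis
    by (simp add: gauss_def exp_sum[symmetric] sum_divide_distrib sum_negf sum_distrib_left)
qed

lemma cis_prod: "finite I \<Longrightarrow> cis (\<Sum>i\<in>I. f i) = (\<Prod>i\<in>I. cis (f i))"
  by (induction I rule: finite_induct) (auto simp: cis_mult[symmetric])

lemma gauss_fourier:
  fixes x :: "'a::euclidean_space"
  assumes \<delta>: "\<delta> > 0"
  shows "integrable lborel (\<lambda>\<xi>. cis (- (\<xi> \<bullet> x)) * of_real (gauss \<delta> \<xi>))"
    and "(\<integral>\<xi>. cis (- (\<xi> \<bullet> x)) * of_real (gauss \<delta> \<xi>) \<partial>lborel) = of_real ((sqrt (2 * pi) / \<delta>) ^ DIM('a) * gauss (1 / \<delta>) x)"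
proof -
  have eq: "cis (- (\<xi> \<bullet> x)) * of_real (gauss \<delta> \<xi>) = (\<Prod>b\<in>Basis. cis (- ((x \<bullet> b) * (\<xi> \<bullet> b))) * of_real (gauss \<delta> (\<xi> \<bullet> b)))" for \<xi> :: 'a
    by (subst euclidean_inner) (simp add: gauss_prod[of \<delta> \<xi>] prod.distrib cis_prod[symmetric] sum_negf mult.commute)
  show "integrable lborel (\<lambda>\<xi>. cis (- (\<xi> \<bullet> x)) * of_real (gauss \<delta> \<xi>))"
    unfolding eq by (rule integral_lborel_prod(1)) (rule gauss_real_fourier(1)[OF \<delta>])
  show "(\<integral>\<xi>. cis (- (\<xi> \<bullet> x)) * of_real (gauss \<delta> \<xi>) \<partial>lborel) = of_real ((sqrt (2 * pi) / \<delta>) ^ DIM('a) * gauss (1 / \<delta>) x)"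
    unfolding eq integral_lborel_prod(2)[OF gauss_real_fourier(1)[OF \<delta>]] gauss_real_fourier(2)[OF \<delta>]
    unfolding gauss_prod[of "1/\<delta>" x] of_real_mult of_real_prod prod.distrib by simp
qed

lemma gauss_pos: "gauss \<delta> x > 0" and gauss_le_1: "gauss \<delta> x \<le> 1"
  by (auto simp: gauss_def)

lemma gauss_measurable [measurable]: "gauss \<delta> \<in> borel_measurable borel"
  unfolding gauss_def by measurable

text \<open>The density of the normal distribution with standard deviation \<open>\<delta>\<close> in every direction.\<close>
definition heat :: "real \<Rightarrow> 'a::euclidean_space \<Rightarrow> real" where
  "heat \<delta> x = (1 / (sqrt (2 * pi) * \<delta>)) ^ DIM('a) * gauss (1 / \<delta>) x"

lemma heat_nonneg: "\<delta> > 0 \<Longrightarrow> heat \<delta> x \<ge> 0"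
  by (simp add: heat_def gauss_pos[THEN less_imp_le])

lemma heat_measurable [measurable]: "heat \<delta> \<in> borel_measurable borel"
  unfolding heat_def by measurable

lemma gauss_integrable: "\<delta> > 0 \<Longrightarrow> integrable lborel (gauss \<delta> :: 'a::euclidean_space \<Rightarrow> real)"
  using gauss_fourier(1)[of \<delta> "0::'a"] by (simp add: complex_of_real_integrable_eq)

text \<open>The Gaussian transform at frequency zero, with the reciprocal width.\<close>
lemma heat_integral:
  assumes \<delta>: "\<delta> > 0"
  shows "integrable lborel (heat \<delta> :: 'a::euclidean_space \<Rightarrow> real)" "(\<integral>x. heat \<delta> (x::'a) \<partial>lborel) = 1"
proof -
  show "integrable lborel (heat \<delta> :: 'a \<Rightarrow> real)"
    unfolding heat_def using gauss_integrable[of "1 / \<delta>"] \<delta> by auto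
  have "complex_of_real (\<integral>x. gauss (1 / \<delta>) (x::'a) \<partial>lborel) = of_real ((sqrt (2 * pi) * \<delta>) ^ DIM('a))"
    using gauss_fourier(2)[of "1 / \<delta>" "0::'a"] \<delta> by (simp add: gauss_def)
  then have "(\<integral>x. gauss (1 / \<delta>) (x::'a) \<partial>lborel) = (sqrt (2 * pi) * \<delta>) ^ DIM('a)" by (simp only: of_real_eq_iff)
  then show "(\<integral>x. heat \<delta> (x::'a) \<partial>lborel) = 1" 
    using \<delta> by (simp add: heat_def power_mult_distrib power_divide)
qed

text \<open>The transform of a modulated Gaussian is a translated heat kernel. Inserting \<open>gauss
  \<delta>\<close> into an integral over frequencies therefore amounts to convolving with
  \<open>heat \<delta>\<close>.\<close>
lemma fourier_modulated_gauss:
  fixes x y :: "'a::euclidean_space"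
  assumes \<delta>: "\<delta> > 0"
  shows "fourier (\<lambda>\<xi>. cis (x \<bullet> \<xi>) * of_real (gauss \<delta> \<xi>)) y = of_real ((2 * pi) ^ DIM('a) * heat \<delta> (y - x))"
proof -
  have "fourier (\<lambda>\<xi>. cis (x \<bullet> \<xi>) * of_real (gauss \<delta> \<xi>)) y = (\<integral>\<xi>. cis (- (\<xi> \<bullet> (y - x))) * of_real (gauss \<delta> \<xi>) \<partial>lborel)"
    unfolding fourier_def mult.assoc[symmetric] cis_mult by (simp add: inner_diff_right inner_commute)
  also have "\<dots> = of_real ((sqrt (2 * pi) / \<delta>) ^ DIM('a) * gauss (1 / \<delta>) (y - x))"
    by (rule gauss_fourier(2)[OF \<delta>])
  also have "(sqrt (2 * pi) / \<delta>) ^ DIM('a) = (2 * pi) ^ DIM('a) * (1 / (sqrt (2 * pi) * \<delta>)) ^ DIM('a)"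
    unfolding power_mult_distrib[symmetric] using \<delta> by (intro arg_cong[of _ _ "\<lambda>x. x ^ _"]) (simp add: field_simps)
  finally show ?thesis by (simp add: heat_def mult.assoc)
qed

section \<open>Plancherel bound and Fourier inversion by Gaussian regularisation\<close>

lemma lborel_affine_integral:
  fixes f :: "'a::euclidean_space \<Rightarrow> 'b::{banach,second_countable_topology}"
  assumes c: "c \<noteq> 0" and [measurable]: "f \<in> borel_measurable borel"
  shows "(\<integral>x. f x \<partial>lborel) = \<bar>c\<bar> ^ DIM('a) *\<^sub>R (\<integral>x. f (t + c *\<^sub>R x) \<partial>lborel)"
    and "integrable lborel f \<longleftrightarrow> integrable lborel (\<lambda>x. f (t + c *\<^sub>R x))"
proof -
  have eq: "(\<integral>x. f x \<partial>lborel) = (\<integral>x. f x \<partial>(density (distr lborel borel (\<lambda>x. t + c *\<^sub>R x)) (\<lambda>_. ennreal (\<bar>c\<bar> ^ DIM('a)))))"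
    "integrable lborel f \<longleftrightarrow> integrable (density (distr lborel borel (\<lambda>x. t + c *\<^sub>R x)) (\<lambda>_. ennreal (\<bar>c\<bar> ^ DIM('a)))) f"
    using lborel_affine[OF c, of t] by (simp_all add: ennreal_power)
  show "(\<integral>x. f x \<partial>lborel) = \<bar>c\<bar> ^ DIM('a) *\<^sub>R (\<integral>x. f (t + c *\<^sub>R x) \<partial>lborel)"
    unfolding eq by (subst integral_density, simp, simp, simp, subst integral_distr) simp_all
  show "integrable lborel f \<longleftrightarrow> integrable lborel (\<lambda>x. f (t + c *\<^sub>R x))"
  proof -
    have "integrable lborel f \<longleftrightarrow> integrable lborel (\<lambda>x. (\<bar>c\<bar> ^ DIM('a)) *\<^sub>R f (t + c *\<^sub>R x))"
      unfolding eq by (subst integrable_density, simp, simp, simp, subst integrable_distr_eq) simp_all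
    moreover have "integrable lborel (\<lambda>x. f (t + c *\<^sub>R x))" if "integrable lborel (\<lambda>x. (\<bar>c\<bar> ^ DIM('a)) *\<^sub>R f (t + c *\<^sub>R x))"
      using integrable_scaleR_right[OF that, of "1 / \<bar>c\<bar> ^ DIM('a)"] c by simp
    ultimately show ?thesis by auto
  qed
qed

lemma lborel_nn_translate:
  fixes f :: "'a::euclidean_space \<Rightarrow> ennreal"
  assumes [measurable]: "f \<in> borel_measurable borel"
  shows "(\<integral>\<^sup>+x. f (x - c) \<partial>lborel) = (\<integral>\<^sup>+x. f x \<partial>lborel)"
proof -
  have "(\<integral>\<^sup>+x. f x \<partial>lborel) = (\<integral>\<^sup>+x. f x \<partial>(distr lborel borel ((+) (- c))))"
    unfolding lborel_distr_plus ..
  also have "\<dots> = (\<integral>\<^sup>+x. f (x - c) \<partial>lborel)" by (subst nn_integral_distr) (auto simp: algebra_simps)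
  finally show ?thesis ..
qed

text \<open>The hypothesis of Fubini in the form in which it occurs for Fourier transforms, where
  \<open>m\<close> is an exponential factor.\<close>
lemma lborel_product_integrable:
  fixes f :: "'a::euclidean_space \<Rightarrow> complex" and g :: "'b::euclidean_space \<Rightarrow> complex"
  assumes f: "integrable lborel f" and g: "integrable lborel g"
    and [measurable]: "m \<in> borel_measurable (borel \<Otimes>\<^sub>M borel)" and bnd: "\<And>z. norm (m z) \<le> C"
  shows "integrable (lborel \<Otimes>\<^sub>M lborel) (\<lambda>(x, y). m (x, y) * (f x * g y))"
proof -
  have [measurable]: "f \<in> borel_measurable borel" "g \<in> borel_measurable borel"
    using f g by (auto dest: borel_measurable_integrable)
  have C: "C \<ge> 0" using bnd[of undefined] norm_ge_zero order_trans by blast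
  have fg: "integrable (lborel \<Otimes>\<^sub>M lborel) (\<lambda>(x, y). f x * g y)"
  proof (rule lborel_pair.Fubini_integrable)
    show "integrable lborel (\<lambda>x. \<integral>y. norm (case (x, y) of (x, y) \<Rightarrow> f x * g y) \<partial>lborel)"
      using f by (simp add: norm_mult)
  qed (use g in auto)
  have "integrable (lborel \<Otimes>\<^sub>M lborel) (\<lambda>z. of_real C * (case z of (x, y) \<Rightarrow> f x * g y))"
    using fg by (rule integrable_mult_right)
  then show ?thesis
    by (rule Bochner_Integration.integrable_bound) (use bnd C in \<open>auto simp: norm_mult intro!: mult_right_mono AE_I2\<close>)
qed

lemma fourier_measurable [measurable]:
  assumes [measurable]: "f \<in> borel_measurable borel" shows "fourier f \<in> borel_measurable borel"
proof -
  have "(\<lambda>\<xi>. \<integral>x. cis (- (x \<bullet> \<xi>)) * f x \<partial>lborel) \<in> borel_measurable lborel"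
    unfolding cis_conv_exp by measurable
  then show ?thesis by (simp add: fourier_def[abs_def])
qed

lemma cis_integrable: 
  assumes "integrable lborel f" "g \<in> borel_measurable borel" shows "integrable lborel (\<lambda>x. cis (g x) * f x)"
proof -
  have [measurable]: "f \<in> borel_measurable borel" using assms(1) by (auto dest: borel_measurable_integrable)
  show ?thesis
    by (rule Bochner_Integration.integrable_bound[OF assms(1)]) (use assms(2) in \<open>auto simp: norm_mult cis_conv_exp\<close>)
qed

lemma fourier_bound: "norm (fourier f \<xi>) \<le> (\<integral>x. norm (f x) \<partial>lborel)"
  unfolding fourier_def using integral_norm_bound[of lborel "\<lambda>x. cis (- (x \<bullet> \<xi>)) * f x"] by (simp add: norm_mult)

text \<open>Fubini. This identity is the definition of the transform of tempered distributions and the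
  source of every identity below.\<close>
lemma fourier_multiplication_formula:
  fixes f g :: "'a::euclidean_space \<Rightarrow> complex"
  assumes "integrable lborel f" "integrable lborel g"
  shows "(\<integral>\<xi>. fourier f \<xi> * g \<xi> \<partial>lborel) = (\<integral>x. f x * fourier g x \<partial>lborel)"
proof -
  let ?h = "\<lambda>x \<xi>. cis (- (x \<bullet> \<xi>)) * (f x * g \<xi>)"
  have "(\<lambda>z. cis (- (fst z \<bullet> snd z))) \<in> borel_measurable (borel \<Otimes>\<^sub>M (borel :: 'a measure))"
    unfolding cis_conv_exp by measurable
  then have "integrable (lborel \<Otimes>\<^sub>M lborel) (case_prod ?h)"
    using lborel_product_integrable[OF assms, of "\<lambda>z. cis (- (fst z \<bullet> snd z))" 1] by simp
  from lborel_pair.Fubini_integral[OF this]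
  have "(\<integral>\<xi>. \<integral>x. ?h x \<xi> \<partial>lborel \<partial>lborel) = (\<integral>x. \<integral>\<xi>. ?h x \<xi> \<partial>lborel \<partial>lborel)" .
  moreover have "(\<integral>x. ?h x \<xi> \<partial>lborel) = fourier f \<xi> * g \<xi>" for \<xi>
    unfolding fourier_def integral_mult_left_zero[symmetric] by (simp add: mult.assoc)
  moreover have "(\<integral>\<xi>. ?h x \<xi> \<partial>lborel) = f x * fourier g x" for x
    unfolding fourier_def integral_mult_right_zero[symmetric] by (simp add: mult.left_commute inner_commute)
  ultimately show ?thesis by simp
qed

lemma modulated_gauss_integrable: 
  "\<delta> > 0 \<Longrightarrow> integrable lborel (\<lambda>\<xi>. cis (x \<bullet> \<xi>) * of_real (gauss \<delta> (\<xi>::'a::euclidean_space)))"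
  by (rule cis_integrable) (simp_all add: complex_of_real_integrable_eq gauss_integrable)

lemma heat_bound: "\<delta> > 0 \<Longrightarrow> heat \<delta> (x::'a::euclidean_space) \<le> (1 / (sqrt (2 * pi) * \<delta>)) ^ DIM('a)"
  unfolding heat_def using gauss_le_1[of "1/\<delta>" x] by (simp add: mult_left_le)

lemma heat_nn_integral:
  fixes x :: "'a::euclidean_space"
  assumes \<delta>: "\<delta> > 0" shows "(\<integral>\<^sup>+y. ennreal (heat \<delta> (y - x)) \<partial>lborel) = 1"
proof -
  have "(\<integral>\<^sup>+y. ennreal (heat \<delta> (y - x)) \<partial>lborel) = (\<integral>\<^sup>+y. ennreal (heat \<delta> (y :: 'a)) \<partial>lborel)"
    by (rule lborel_nn_translate) simp
  also have "\<dots> = ennreal (\<integral>y. heat \<delta> (y :: 'a) \<partial>lborel)"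
    by (rule nn_integral_eq_integral[OF heat_integral(1)[OF \<delta>]]) (simp add: heat_nonneg[OF \<delta>])
  finally show ?thesis by (simp add: heat_integral(2)[OF \<delta>])
qed

text \<open>From \<open>2 p q \<le> p\<^sup>2 + q\<^sup>2\<close>, since the heat kernel is even and has
  integral one in each variable.\<close>
lemma heat_convolution_form_bound:
  fixes f :: "'a::euclidean_space \<Rightarrow> complex"
  assumes f: "f \<in> L2_space" and \<delta>: "\<delta> > 0"
  shows "(\<integral>\<^sup>+x. \<integral>\<^sup>+y. ennreal (norm (f x) * (norm (f y) * heat \<delta> (y - x))) \<partial>lborel \<partial>lborel) \<le> ennreal ((L2_norm f)\<^sup>2)"
proof -
  have [measurable]: "f \<in> borel_measurable borel" using L2_measurable[OF f] .
  let ?q = "\<lambda>x. ennreal ((norm (f x))\<^sup>2 / 2)" and ?h = "\<lambda>x y. ennreal (heat \<delta> (y - x))"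
  have le: "ennreal (norm (f x) * (norm (f y) * heat \<delta> (y - x))) \<le> ?q x * ?h x y + ?q y * ?h x y" for x y
  proof -
    have "norm (f x) * norm (f y) \<le> (norm (f x))\<^sup>2 / 2 + (norm (f y))\<^sup>2 / 2"
      using sum_squares_bound[of "norm (f x)" "norm (f y)"] by simp
    from mult_right_mono[OF this heat_nonneg[OF \<delta>, of "y - x"]]
    show ?thesis using heat_nonneg[OF \<delta>, of "y - x"]
      by (simp add: ennreal_mult[symmetric] ennreal_plus[symmetric] ennreal_leI distrib_right mult.assoc del: ennreal_plus)
  qed
  have q: "(\<integral>\<^sup>+x. ?q x \<partial>lborel) = ennreal ((L2_norm f)\<^sup>2 / 2)"
  proof -
    have "(\<integral>\<^sup>+x. ?q x \<partial>lborel) = (\<integral>\<^sup>+x. ennreal (1/2) * ennreal ((norm (f x))\<^sup>2) \<partial>lborel)"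
      by (intro nn_integral_cong) (simp add: ennreal_mult[symmetric] del: ennreal_half)
    also have "\<dots> = ennreal (1/2) * ennreal ((L2_norm f)\<^sup>2)"
      by (simp add: nn_integral_cmult L2_nn_integral[OF f])
    finally show ?thesis by (simp add: ennreal_mult[symmetric] del: ennreal_half)
  qed
  have sym: "?h x y = ?h y x" for x y by (simp add: heat_def gauss_def norm_minus_commute)
  have "(\<integral>\<^sup>+x. \<integral>\<^sup>+y. ennreal (norm (f x) * (norm (f y) * heat \<delta> (y - x))) \<partial>lborel \<partial>lborel)
    \<le> (\<integral>\<^sup>+x. \<integral>\<^sup>+y. (?q x * ?h x y + ?q y * ?h x y) \<partial>lborel \<partial>lborel)"
    by (intro nn_integral_mono le)
  also have "\<dots> = (\<integral>\<^sup>+x. \<integral>\<^sup>+y. ?q x * ?h x y \<partial>lborel \<partial>lborel) + (\<integral>\<^sup>+x. \<integral>\<^sup>+y. ?q y * ?h x y \<partial>lborel \<partial>lborel)"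
    by (simp add: nn_integral_add)
  also have "(\<integral>\<^sup>+x. \<integral>\<^sup>+y. ?q x * ?h x y \<partial>lborel \<partial>lborel) = ennreal ((L2_norm f)\<^sup>2 / 2)"
    by (simp add: nn_integral_cmult heat_nn_integral[OF \<delta>] q)
  also have "(\<integral>\<^sup>+x. \<integral>\<^sup>+y. ?q y * ?h x y \<partial>lborel \<partial>lborel) = (\<integral>\<^sup>+y. \<integral>\<^sup>+x. ?q y * ?h x y \<partial>lborel \<partial>lborel)"
    by (rule lborel_pair.Fubini') measurable
  also have "\<dots> = (\<integral>\<^sup>+y. \<integral>\<^sup>+x. ?q y * ?h y x \<partial>lborel \<partial>lborel)"
    by (subst sym) (rule refl)
  also have "\<dots> = ennreal ((L2_norm f)\<^sup>2 / 2)"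
    by (simp add: nn_integral_cmult heat_nn_integral[OF \<delta>] q)
  also have "ennreal ((L2_norm f)\<^sup>2 / 2) + ennreal ((L2_norm f)\<^sup>2 / 2) = ennreal ((L2_norm f)\<^sup>2)"
    by (simp add: ennreal_plus[symmetric] del: ennreal_plus)
  finally show ?thesis .
qed

text \<open>The Gaussian weight makes all integrals converge absolutely. The multiplication formula, applied
  to \<open>f\<close> and to \<open>G\<close>, the conjugate of the transform of \<open>f\<close>
  times the weight, gives a quadratic form with the heat kernel, which is bounded uniformly in the
  width.\<close>
lemma fourier_gauss_weighted_bound:
  fixes f :: "'a::euclidean_space \<Rightarrow> complex"
  assumes f1: "integrable lborel f" and f2: "f \<in> L2_space" and \<delta>: "\<delta> > 0"
  shows "(\<integral>\<^sup>+\<xi>. ennreal ((norm (fourier f \<xi>))\<^sup>2 * gauss \<delta> \<xi>) \<partial>lborel) \<le> ennreal ((2 * pi) ^ DIM('a) * (L2_norm f)\<^sup>2)"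
proof -
  have [measurable]: "f \<in> borel_measurable borel" using L2_measurable[OF f2] .
  define K where "K = (\<integral>x. norm (f x) \<partial>lborel)"
  have K: "norm (fourier f \<xi>) \<le> K" for \<xi> unfolding K_def by (rule fourier_bound)
  let ?P = "(2 * pi) ^ DIM('a)"
  define G where "G = (\<lambda>\<xi>. cnj (fourier f \<xi>) * of_real (gauss \<delta> \<xi>))"
  have cnjm: "cnj \<in> borel_measurable borel" by (intro borel_measurable_continuous_onI continuous_on_cnj continuous_on_id)
  have Gm [measurable]: "G \<in> borel_measurable borel"
    unfolding G_def using measurable_compose[OF fourier_measurable[of f] cnjm] by measurable
  have Gi: "integrable lborel G"
  proof (rule Bochner_Integration.integrable_bound)
    show "integrable lborel (\<lambda>\<xi>. K * gauss \<delta> (\<xi>::'a))" using gauss_integrable[OF \<delta>, where 'a = 'a] by simp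
    show "AE \<xi> in lborel. norm (G \<xi>) \<le> norm (K * gauss \<delta> \<xi>)"
      unfolding G_def using K gauss_pos by (intro AE_I2) (auto simp: norm_mult abs_mult intro!: mult_mono order_trans[OF K])
  qed simp
  have fG: "fourier f \<xi> * G \<xi> = of_real ((norm (fourier f \<xi>))\<^sup>2 * gauss \<delta> \<xi>)" for \<xi>
    unfolding G_def mult.assoc[symmetric] of_real_mult complex_norm_square ..
  have int: "integrable lborel (\<lambda>\<xi>. fourier f \<xi> * G \<xi>)"
  proof (rule Bochner_Integration.integrable_bound[of _ "\<lambda>\<xi>. of_real K * G \<xi>"])
    show "AE \<xi> in lborel. norm (fourier f \<xi> * G \<xi>) \<le> norm (complex_of_real K * G \<xi>)"
      using K by (intro AE_I2) (auto simp: norm_mult intro!: mult_right_mono order_trans[OF K])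
  qed (use Gi in auto)
  have FG: "cnj (fourier G x) = (\<integral>y. f y * of_real (?P * heat \<delta> (y - x)) \<partial>lborel)" for x
  proof -
    have "cnj (fourier G x) = (\<integral>\<xi>. cnj (cis (- (\<xi> \<bullet> x)) * G \<xi>) \<partial>lborel)"
      unfolding fourier_def by (rule Bochner_Integration.integral_cnj[symmetric])
    also have "\<dots> = (\<integral>\<xi>. fourier f \<xi> * (cis (x \<bullet> \<xi>) * of_real (gauss \<delta> \<xi>)) \<partial>lborel)"
      by (simp add: G_def cis_cnj inner_commute mult_ac)
    also have "\<dots> = (\<integral>y. f y * fourier (\<lambda>\<xi>. cis (x \<bullet> \<xi>) * of_real (gauss \<delta> \<xi>)) y \<partial>lborel)"
      by (rule fourier_multiplication_formula[OF f1 modulated_gauss_integrable[OF \<delta>]])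
    finally show ?thesis unfolding fourier_modulated_gauss[OF \<delta>] .
  qed
  have FGb: "ennreal (norm (fourier G x)) \<le> (\<integral>\<^sup>+y. ennreal (?P * (norm (f y) * heat \<delta> (y - x))) \<partial>lborel)" for x
  proof -
    have "integrable lborel (\<lambda>y. f y * of_real (?P * heat \<delta> (y - x)))"
    proof (rule Bochner_Integration.integrable_bound)
      show "integrable lborel (\<lambda>y. f y * of_real (?P * (1 / (sqrt (2 * pi) * \<delta>)) ^ DIM('a)))" using f1 by (rule integrable_mult_left)
      show "AE y in lborel. norm (f y * of_real (?P * heat \<delta> (y - x))) \<le> norm (f y * of_real (?P * (1 / (sqrt (2 * pi) * \<delta>)) ^ DIM('a)))"
      proof (rule AE_I2)
        fix y
        have "?P * heat \<delta> (y - x) \<le> ?P * (1 / (sqrt (2 * pi) * \<delta>)) ^ DIM('a)" "0 \<le> ?P * heat \<delta> (y - x)"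
          using heat_bound[OF \<delta>, of "y - x"] heat_nonneg[OF \<delta>, of "y - x"] by (auto intro!: mult_left_mono)
        then have "\<bar>?P * heat \<delta> (y - x)\<bar> \<le> \<bar>?P * (1 / (sqrt (2 * pi) * \<delta>)) ^ DIM('a)\<bar>" by linarith
        then show "norm (f y * of_real (?P * heat \<delta> (y - x))) \<le> norm (f y * of_real (?P * (1 / (sqrt (2 * pi) * \<delta>)) ^ DIM('a)))"
          unfolding norm_mult norm_of_real by (rule mult_left_mono) simp
      qed
    qed measurable
    from integral_norm_bound_ennreal[OF this]
    have "ennreal (norm (cnj (fourier G x))) \<le> (\<integral>\<^sup>+y. ennreal (norm (f y * of_real (?P * heat \<delta> (y - x)))) \<partial>lborel)" unfolding FG .
    moreover have "norm (f y * of_real (?P * heat \<delta> (y - x))) = ?P * (norm (f y) * heat \<delta> (y - x))" for y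
      unfolding norm_mult norm_of_real using heat_nonneg[OF \<delta>, of "y - x"] by (simp add: abs_mult)
    ultimately show ?thesis by simp
  qed
  have "(\<integral>\<^sup>+\<xi>. ennreal ((norm (fourier f \<xi>))\<^sup>2 * gauss \<delta> \<xi>) \<partial>lborel) = ennreal (\<integral>\<xi>. (norm (fourier f \<xi>))\<^sup>2 * gauss \<delta> \<xi> \<partial>lborel)"
  proof (rule nn_integral_eq_integral)
    show "integrable lborel (\<lambda>\<xi>. (norm (fourier f \<xi>))\<^sup>2 * gauss \<delta> \<xi>)"
      using int unfolding fG complex_of_real_integrable_eq .
  qed (auto intro!: mult_nonneg_nonneg gauss_pos[THEN less_imp_le])
  also have "\<dots> \<le> ennreal (norm (\<integral>\<xi>. fourier f \<xi> * G \<xi> \<partial>lborel))"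
    unfolding fG integral_complex_of_real by (intro ennreal_leI) simp
  also have "\<dots> = ennreal (norm (\<integral>x. f x * fourier G x \<partial>lborel))"
    unfolding fourier_multiplication_formula[OF f1 Gi] ..
  also have "\<dots> \<le> (\<integral>\<^sup>+x. ennreal (norm (f x * fourier G x)) \<partial>lborel)"
  proof (rule integral_norm_bound_ennreal)
    show "integrable lborel (\<lambda>x. f x * fourier G x)"
      by (rule Bochner_Integration.integrable_bound[OF integrable_mult_left[OF f1, of "of_real (\<integral>x. norm (G x) \<partial>lborel)"]])
        (auto simp: norm_mult intro!: AE_I2 mult_left_mono order_trans[OF fourier_bound])
  qed
  also have "\<dots> \<le> (\<integral>\<^sup>+x. ennreal ?P * (\<integral>\<^sup>+y. ennreal (norm (f x) * (norm (f y) * heat \<delta> (y - x))) \<partial>lborel) \<partial>lborel)"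
  proof (rule nn_integral_mono)
    fix x
    have "ennreal (norm (f x * fourier G x)) = ennreal (norm (f x)) * ennreal (norm (fourier G x))" by (simp add: norm_mult ennreal_mult)
    also have "\<dots> \<le> ennreal (norm (f x)) * (\<integral>\<^sup>+y. ennreal (?P * (norm (f y) * heat \<delta> (y - x))) \<partial>lborel)"
      by (intro mult_left_mono FGb) simp
    also have "\<dots> = (\<integral>\<^sup>+y. ennreal ?P * ennreal (norm (f x) * (norm (f y) * heat \<delta> (y - x))) \<partial>lborel)"
      by (subst nn_integral_cmult[symmetric]) (auto intro!: nn_integral_cong simp: ennreal_mult[symmetric] heat_nonneg[OF \<delta>] mult_ac)
    also have "\<dots> = ennreal ?P * (\<integral>\<^sup>+y. ennreal (norm (f x) * (norm (f y) * heat \<delta> (y - x))) \<partial>lborel)"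
      by (rule nn_integral_cmult) measurable
    finally show "ennreal (norm (f x * fourier G x)) \<le> ennreal ?P * (\<integral>\<^sup>+y. ennreal (norm (f x) * (norm (f y) * heat \<delta> (y - x))) \<partial>lborel)" .
  qed
  also have "\<dots> = ennreal ?P * (\<integral>\<^sup>+x. \<integral>\<^sup>+y. ennreal (norm (f x) * (norm (f y) * heat \<delta> (y - x))) \<partial>lborel \<partial>lborel)"
    by (rule nn_integral_cmult) measurable
  also have "\<dots> \<le> ennreal ?P * ennreal ((L2_norm f)\<^sup>2)"
    by (intro mult_left_mono heat_convolution_form_bound[OF f2 \<delta>]) simp
  finally show ?thesis by (simp add: ennreal_mult)
qed

lemma gauss_tendsto_1: "(\<lambda>n. gauss (1 / real (Suc n)) x) \<longlonglongrightarrow> 1"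
proof -
  have "(\<lambda>n. gauss (1 / real (Suc n)) x) \<longlonglongrightarrow> exp (- (0\<^sup>2 * (norm x)\<^sup>2) / 2)"
    unfolding gauss_def by (intro tendsto_intros LIMSEQ_Suc[OF lim_1_over_n]) simp
  then show ?thesis by simp
qed

text \<open>The norm of the Fourier transform on \<open>L\<^sup>2\<close> in the normalisation without \<open>2 pi\<close> in the exponent.\<close>
definition plancherel_const :: "'a::euclidean_space itself \<Rightarrow> real" where
  "plancherel_const _ = sqrt ((2 * pi) ^ DIM('a))"

lemma plancherel_const_nonneg [simp]: "plancherel_const t \<ge> 0"
  by (simp add: plancherel_const_def)

text \<open>One half of the Plancherel theorem: remove the Gaussian weight by Fatou.\<close>
lemma fourier_L2_bound_L1:
  fixes f :: "'a::euclidean_space \<Rightarrow> complex"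
  assumes f1: "integrable lborel f" and f2: "f \<in> L2_space"
  shows "fourier f \<in> L2_space" "L2_norm (fourier f) \<le> plancherel_const TYPE('a) * L2_norm f"
proof -
  have [measurable]: "f \<in> borel_measurable borel" using L2_measurable[OF f2] .
  have "(\<integral>\<^sup>+\<xi>. ennreal ((norm (fourier f \<xi>))\<^sup>2) \<partial>lborel) 
    = (\<integral>\<^sup>+\<xi>. liminf (\<lambda>n. ennreal ((norm (fourier f \<xi>))\<^sup>2 * gauss (1 / real (Suc n)) \<xi>)) \<partial>lborel)"
  proof (rule nn_integral_cong)
    fix \<xi> :: 'a
    have "(\<lambda>n. ennreal ((norm (fourier f \<xi>))\<^sup>2 * gauss (1 / real (Suc n)) \<xi>)) \<longlonglongrightarrow> ennreal ((norm (fourier f \<xi>))\<^sup>2 * 1)"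
      by (intro tendsto_ennrealI tendsto_mult_left gauss_tendsto_1)
    then show "ennreal ((norm (fourier f \<xi>))\<^sup>2) = liminf (\<lambda>n. ennreal ((norm (fourier f \<xi>))\<^sup>2 * gauss (1 / real (Suc n)) \<xi>))"
      using lim_imp_Liminf[OF sequentially_bot] by force
  qed
  also have "\<dots> \<le> liminf (\<lambda>n. \<integral>\<^sup>+\<xi>. ennreal ((norm (fourier f \<xi>))\<^sup>2 * gauss (1 / real (Suc n)) \<xi>) \<partial>lborel)"
    by (rule nn_integral_liminf) measurable
  also have "\<dots> \<le> ennreal ((2 * pi) ^ DIM('a) * (L2_norm f)\<^sup>2)"
    by (intro Liminf_le always_eventually allI fourier_gauss_weighted_bound[OF f1 f2]) auto
  also have "(2 * pi) ^ DIM('a) * (L2_norm f)\<^sup>2 = (plancherel_const TYPE('a) * L2_norm f)\<^sup>2"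
    by (simp add: plancherel_const_def power_mult_distrib)
  finally have *: "(\<integral>\<^sup>+\<xi>. ennreal ((norm (fourier f \<xi>))\<^sup>2) \<partial>lborel) \<le> ennreal ((plancherel_const TYPE('a) * L2_norm f)\<^sup>2)" .
  show "fourier f \<in> L2_space" "L2_norm (fourier f) \<le> plancherel_const TYPE('a) * L2_norm f"
    using L2_nn_bound[OF _ *] by auto
qed

text \<open>The multiplication formula for \<open>\<psi>\<close> and a modulated Gaussian, as the width
  tends to zero: on one side the weight tends to one, on the other the rescaled heat kernel
  concentrates at \<open>x\<close>.\<close>
lemma fourier_inversion:
  fixes \<psi> :: "'a::euclidean_space \<Rightarrow> complex"
  assumes int: "integrable lborel \<psi>" and cont: "continuous_on UNIV \<psi>" and bnd: "\<And>x. norm (\<psi> x) \<le> C"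
    and F: "integrable lborel (fourier \<psi>)"
  shows "fourier (fourier \<psi>) (- x) = of_real ((2 * pi) ^ DIM('a)) * \<psi> x"
proof -
  let ?P = "(2 * pi) ^ DIM('a)" and ?d = "\<lambda>n. 1 / real (Suc n)"
  have [measurable]: "\<psi> \<in> borel_measurable borel" using cont by (rule borel_measurable_continuous_onI)
  have Fm [measurable]: "fourier \<psi> \<in> borel_measurable borel" by measurable
  have cm [measurable]: "(\<lambda>\<xi>::'a. cis (x \<bullet> \<xi>)) \<in> borel_measurable borel" unfolding cis_conv_exp by measurable
  have eq: "(\<integral>\<xi>. fourier \<psi> \<xi> * (cis (x \<bullet> \<xi>) * of_real (gauss (?d n) \<xi>)) \<partial>lborel) = (\<integral>z. \<psi> (x + ?d n *\<^sub>R z) * of_real (?P * heat 1 z) \<partial>lborel)" for n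
  proof -
    have "(\<integral>\<xi>. fourier \<psi> \<xi> * (cis (x \<bullet> \<xi>) * of_real (gauss (?d n) \<xi>)) \<partial>lborel) = (\<integral>y. \<psi> y * of_real (?P * heat (?d n) (y - x)) \<partial>lborel)"
      by (subst fourier_multiplication_formula[OF int modulated_gauss_integrable]) (simp_all add: fourier_modulated_gauss)
    also have "\<dots> = \<bar>?d n\<bar> ^ DIM('a) *\<^sub>R (\<integral>z. \<psi> (x + ?d n *\<^sub>R z) * of_real (?P * heat (?d n) (x + ?d n *\<^sub>R z - x)) \<partial>lborel)"
      by (rule lborel_affine_integral(1)) auto
    also have "\<dots> = (\<integral>z. \<psi> (x + ?d n *\<^sub>R z) * of_real (?P * heat 1 z) \<partial>lborel)"
    proof -
      have "\<bar>?d n\<bar> ^ DIM('a) * heat (?d n) (?d n *\<^sub>R z) = heat 1 z" for z :: 'a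
        by (simp add: heat_def gauss_def power_mult_distrib power_divide)
      moreover have "r *\<^sub>R (p * of_real (?P * h)) = p * of_real (?P * (r * h))" for r h and p :: complex
        by (simp add: scaleR_conv_of_real mult_ac)
      ultimately have "\<bar>?d n\<bar> ^ DIM('a) *\<^sub>R (\<psi> (x + ?d n *\<^sub>R z) * of_real (?P * heat (?d n) (x + ?d n *\<^sub>R z - x))) = \<psi> (x + ?d n *\<^sub>R z) * of_real (?P * heat 1 z)" for z
        unfolding add_diff_cancel_left' by (simp only:)
      then show ?thesis unfolding integral_scaleR_right[symmetric] by (simp only:)
    qed
    finally show ?thesis .
  qed
  have "(\<lambda>n. \<integral>z. \<psi> (x + ?d n *\<^sub>R z) * of_real (?P * heat 1 z) \<partial>lborel) \<longlonglongrightarrow> (\<integral>z. \<psi> x * of_real (?P * heat 1 (z::'a)) \<partial>lborel)"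
  proof (rule integral_dominated_convergence[where w = "\<lambda>z. C * (?P * heat 1 z)"])
    show "integrable lborel (\<lambda>z. C * (?P * heat 1 (z::'a)))" using heat_integral(1)[of 1, where 'a = 'a] by simp
    show "AE z in lborel. (\<lambda>n. \<psi> (x + ?d n *\<^sub>R z) * of_real (?P * heat 1 z)) \<longlonglongrightarrow> \<psi> x * of_real (?P * heat 1 z)"
    proof (intro AE_I2 tendsto_mult_right)
      fix z
      have "(\<lambda>n. x + ?d n *\<^sub>R z) \<longlonglongrightarrow> x + 0 *\<^sub>R z" by (intro tendsto_intros LIMSEQ_Suc[OF lim_1_over_n])
      then show "(\<lambda>n. \<psi> (x + ?d n *\<^sub>R z)) \<longlonglongrightarrow> \<psi> x"
        using continuous_on_tendsto_compose[OF cont, of _ x sequentially] by simp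
    qed
    show "AE z in lborel. norm (\<psi> (x + ?d n *\<^sub>R z) * of_real (?P * heat 1 z)) \<le> C * (?P * heat 1 z)" for n
    proof (rule AE_I2)
      fix z :: 'a
      have nn: "0 \<le> ?P * heat 1 z" by (simp add: heat_nonneg)
      show "norm (\<psi> (x + ?d n *\<^sub>R z) * of_real (?P * heat 1 z)) \<le> C * (?P * heat 1 z)"
        unfolding norm_mult norm_of_real abs_of_nonneg[OF nn] by (rule mult_right_mono[OF bnd nn])
    qed
  qed measurable
  also have "(\<integral>z. \<psi> x * of_real (?P * heat 1 (z::'a)) \<partial>lborel) = \<psi> x * of_real ?P"
    using heat_integral(2)[of 1, where 'a='a] by simp
  finally have l1: "(\<lambda>n. \<integral>\<xi>. fourier \<psi> \<xi> * (cis (x \<bullet> \<xi>) * of_real (gauss (?d n) \<xi>)) \<partial>lborel) \<longlonglongrightarrow> \<psi> x * of_real ?P"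
    unfolding eq .
  have "(\<lambda>n. \<integral>\<xi>. fourier \<psi> \<xi> * (cis (x \<bullet> \<xi>) * of_real (gauss (?d n) \<xi>)) \<partial>lborel) \<longlonglongrightarrow> (\<integral>\<xi>. fourier \<psi> \<xi> * (cis (x \<bullet> \<xi>) * of_real 1) \<partial>lborel)"
  proof (rule integral_dominated_convergence[where w = "\<lambda>\<xi>. norm (fourier \<psi> \<xi>)"])
    show "AE \<xi> in lborel. (\<lambda>n. fourier \<psi> \<xi> * (cis (x \<bullet> \<xi>) * of_real (gauss (?d n) \<xi>))) \<longlonglongrightarrow> fourier \<psi> \<xi> * (cis (x \<bullet> \<xi>) * of_real 1)"
      by (intro AE_I2 tendsto_mult_left tendsto_of_real gauss_tendsto_1)
    show "AE \<xi> in lborel. norm (fourier \<psi> \<xi> * (cis (x \<bullet> \<xi>) * of_real (gauss (?d n) \<xi>))) \<le> norm (fourier \<psi> \<xi>)" for n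
      using gauss_le_1 by (intro AE_I2) (auto simp: norm_mult abs_of_pos[OF gauss_pos] intro!: mult_left_le)
  qed (use F in \<open>auto intro!: integrable_norm\<close>)
  from LIMSEQ_unique[OF l1 this] show ?thesis by (simp add: fourier_def inner_commute mult.commute)
qed

section \<open>Fourier transforms of test functions\<close>

lemma smooth_cis: "smooth (\<lambda>x. cis (x \<bullet> \<xi>))"
proof -
  have "(((\<lambda>t. \<i> ^ n * cis t)) has_vector_derivative \<i> ^ Suc n * cis t) (at t)" for n t
    unfolding has_vector_derivative_def by (auto intro!: derivative_eq_intros simp: algebra_simps)
  from smooth_ladder[of "\<lambda>n t. \<i> ^ n * cis t" 0, OF this] have "smooth cis" by simp
  from smooth_compose_linear(2)[OF bounded_linear_inner_left this] show ?thesis .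
qed

lemma smooth_inner: "smooth (\<lambda>x. complex_of_real (x \<bullet> v))"
  by (rule smooth_linear_compose[OF bounded_linear_of_real smooth_linear[OF bounded_linear_inner_left]])

lemma smooth_cmult: "smooth f \<Longrightarrow> smooth (\<lambda>x. c * f x :: complex)"
  by (rule smooth_mult[OF smooth_const])

lemma test_fn_cmult: "test_function_on U f \<Longrightarrow> test_function_on U (\<lambda>x. c * f x)"
  using test_function_mult[OF _ smooth_const[of c], of U f] by (simp add: mult.commute)

lemma test_fn_has_derivative: "test_fn \<eta> \<Longrightarrow> (\<eta> has_derivative (\<lambda>v. iter_deriv [v] \<eta> x)) (at x)"
  by (rule smooth_has_derivative[OF test_function_smooth])

lemma test_fn_deriv_scale: 
  assumes "test_fn \<eta>" shows "iter_deriv [r *\<^sub>R v] \<eta> x = r *\<^sub>R iter_deriv [v] \<eta> x"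
  using linear_scale[OF has_derivative_linear[OF test_fn_has_derivative[OF assms]]] .

text \<open>The integral of a translate does not depend on the translation, and differentiating under the
  integral gives the claim.\<close>
lemma integral_derivative_zero:
  fixes \<eta> :: "'a::euclidean_space \<Rightarrow> complex"
  assumes \<eta>: "test_fn \<eta>"
  shows "(\<integral>x. iter_deriv [v] \<eta> x \<partial>lborel) = 0"
proof -
  have \<eta>': "test_fn (iter_deriv [v] \<eta>)" by (rule test_function_iter_deriv[OF \<eta>])
  have [measurable]: "\<eta> \<in> borel_measurable borel" using test_function_borel[OF \<eta>] .
  obtain C R where CR: "C > 0" "\<And>x. norm (iter_deriv [v] \<eta> x) \<le> C" "\<And>x. norm x > R \<Longrightarrow> iter_deriv [v] \<eta> x = 0"
    using test_function_bounded_support[OF \<eta>'] by metis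
  \<comment> \<open>The translation vector is \<open>sin h v\<close> and not \<open>h v\<close>, so that one ball supports all translates.\<close>
  define K where "K = (\<lambda>h x. \<eta> (x + sin h *\<^sub>R v))"
  define K' where "K' = (\<lambda>h x k. (k * cos h) *\<^sub>R iter_deriv [v] \<eta> (x + sin h *\<^sub>R v))"
  have Kd: "((\<lambda>h. K h x) has_derivative K' h x) (at h)" for h x
  proof -
    have "((\<lambda>h. x + sin h *\<^sub>R v) has_derivative (\<lambda>k. (k * cos h) *\<^sub>R v)) (at h)"
      by (auto intro!: derivative_eq_intros)
    from has_derivative_compose[OF this test_fn_has_derivative[OF \<eta>]]
    show ?thesis unfolding K_def K'_def test_fn_deriv_scale[OF \<eta>] .
  qed
  have Kint: "(\<integral>x. K h x \<partial>lborel) = (\<integral>x. \<eta> x \<partial>lborel)" "integrable lborel (K h)" for h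
    using lborel_affine_integral[of 1 \<eta> "sin h *\<^sub>R v"] test_function_integrable[OF \<eta>]
    by (simp_all add: K_def add.commute)
  have "((\<lambda>h. \<integral>x. K h x \<partial>lborel) has_derivative (\<lambda>k. \<integral>x. K' 0 x k \<partial>lborel)) (at 0)"
  proof (rule has_derivative_integral(2)[OF Kd])
    show "norm (K' h x k) \<le> C * indicator (cball 0 (R + norm v)) x * norm k" for h x k
    proof (cases "norm x \<le> R + norm v")
      case True
      have "\<bar>k\<bar> * \<bar>cos h\<bar> * norm (iter_deriv [v] \<eta> (x + sin h *\<^sub>R v)) \<le> (\<bar>k\<bar> * 1) * C"
        by (intro mult_mono CR(2) mult_nonneg_nonneg) auto
      then show ?thesis using True by (simp add: K'_def abs_mult mult.commute)
    next
      case False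
      have "norm (sin h *\<^sub>R v) \<le> norm v" by (simp add: mult_left_le_one_le)
      then have "norm (x + sin h *\<^sub>R v) > R" using False norm_triangle_ineq2[of x "- (sin h *\<^sub>R v)"] by simp
      then show ?thesis using CR(3) False by (simp add: K'_def)
    qed
    show "integrable lborel (\<lambda>x. C * indicat_real (cball 0 (R + norm v)) x)"
      by (intro integrable_mult_right integrable_real_indicator emeasure_lborel_cball_finite) auto
  qed (rule Kint)
  then have "((\<lambda>h::real. \<integral>x. \<eta> x \<partial>lborel) has_derivative (\<lambda>k. \<integral>x. K' 0 x k \<partial>lborel)) (at 0)"
    unfolding Kint .
  then have "(\<lambda>k. \<integral>x. K' 0 x k \<partial>lborel) = (\<lambda>k. 0)" by (rule has_derivative_unique) simp
  from fun_cong[OF this, of 1] show ?thesis by (simp add: K'_def)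
qed

text \<open>Integration by parts: the integral of the derivative of \<open>\<eta>\<close> times the
  exponential vanishes.\<close>
lemma fourier_iter_deriv:
  fixes \<eta> :: "'a::euclidean_space \<Rightarrow> complex"
  assumes \<eta>: "test_fn \<eta>"
  shows "fourier (iter_deriv [v] \<eta>) \<xi> = \<i> * of_real (v \<bullet> \<xi>) * fourier \<eta> \<xi>"
proof -
  have e: "cis (- (x \<bullet> \<xi>)) = cis (x \<bullet> (- \<xi>))" for x :: 'a by simp
  define w where "w = (\<lambda>x. \<eta> x * cis (x \<bullet> (- \<xi>)))"
  have w: "test_fn w" unfolding w_def by (rule test_function_mult[OF \<eta> smooth_cis])
  have "iter_deriv [v] w = (\<lambda>x. cis (- (x \<bullet> \<xi>)) * iter_deriv [v] \<eta> x - \<i> * of_real (v \<bullet> \<xi>) * (cis (- (x \<bullet> \<xi>)) * \<eta> x))"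
    unfolding w_def
  proof (rule iter_deriv_eqI)
    show "((\<lambda>x. \<eta> x * cis (x \<bullet> - \<xi>)) has_derivative
      (\<lambda>v. cis (- (x \<bullet> \<xi>)) * iter_deriv [v] \<eta> x - \<i> * of_real (v \<bullet> \<xi>) * (cis (- (x \<bullet> \<xi>)) * \<eta> x))) (at x)" for x
      by (auto intro!: derivative_eq_intros test_fn_has_derivative[OF \<eta>] simp del: iter_deriv.simps simp: algebra_simps scaleR_conv_of_real)
  qed
  then have "0 = (\<integral>x. cis (- (x \<bullet> \<xi>)) * iter_deriv [v] \<eta> x - \<i> * of_real (v \<bullet> \<xi>) * (cis (- (x \<bullet> \<xi>)) * \<eta> x) \<partial>lborel)"
    using integral_derivative_zero[OF w, of v] by simp
  also have "\<dots> = fourier (iter_deriv [v] \<eta>) \<xi> - (\<integral>x. \<i> * of_real (v \<bullet> \<xi>) * (cis (- (x \<bullet> \<xi>)) * \<eta> x) \<partial>lborel)"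
    unfolding fourier_def
    by (rule Bochner_Integration.integral_diff)
      (auto intro!: integrable_mult_right cis_integrable test_function_integrable[OF \<eta>] test_function_integrable[OF test_function_iter_deriv[OF \<eta>]] simp del: iter_deriv.simps)
  also have "(\<integral>x. \<i> * of_real (v \<bullet> \<xi>) * (cis (- (x \<bullet> \<xi>)) * \<eta> x) \<partial>lborel) = \<i> * of_real (v \<bullet> \<xi>) * fourier \<eta> \<xi>"
    unfolding fourier_def by (rule integral_mult_right_zero)
  finally show ?thesis by simp
qed

text \<open>Each factor \<open>norm \<xi>\<close> is dominated by the sum of the coordinates, and a
  coordinate can be traded for a derivative of \<open>\<eta>\<close>.\<close>
lemma fourier_test_fn_decay:
  fixes \<eta> :: "'a::euclidean_space \<Rightarrow> complex"
  assumes "test_fn \<eta>"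
  shows "\<exists>M. \<forall>\<xi>. norm \<xi> ^ k * norm (fourier \<eta> \<xi>) \<le> M"
  using assms
proof (induction k arbitrary: \<eta>)
  case 0
  then show ?case using fourier_bound[of \<eta>] by auto
next
  case (Suc k)
  have "\<forall>i. \<exists>M. \<forall>\<xi>. norm \<xi> ^ k * norm (fourier (iter_deriv [i] \<eta>) \<xi>) \<le> M"
    using Suc.IH[OF test_function_iter_deriv[OF Suc.prems]] by blast
  then obtain M where M: "\<And>i \<xi>. norm \<xi> ^ k * norm (fourier (iter_deriv [i] \<eta>) \<xi>) \<le> M i" by metis
  have "norm \<xi> ^ Suc k * norm (fourier \<eta> \<xi>) \<le> (\<Sum>i\<in>Basis. M i)" for \<xi>
  proof -
    have "norm \<xi> ^ Suc k * norm (fourier \<eta> \<xi>) = norm \<xi> * (norm \<xi> ^ k * norm (fourier \<eta> \<xi>))" by simp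
    also have "\<dots> \<le> (\<Sum>i\<in>Basis. \<bar>\<xi> \<bullet> i\<bar>) * (norm \<xi> ^ k * norm (fourier \<eta> \<xi>))"
      by (intro mult_right_mono norm_le_l1) auto
    also have "\<dots> = (\<Sum>i\<in>Basis. norm \<xi> ^ k * norm (fourier (iter_deriv [i] \<eta>) \<xi>))"
      unfolding fourier_iter_deriv[OF Suc.prems] by (simp add: norm_mult sum_distrib_left sum_distrib_right inner_commute mult_ac)
    also have "\<dots> \<le> (\<Sum>i\<in>Basis. M i)" by (intro sum_mono M)
    finally show ?thesis .
  qed
  then show ?case by blast
qed

lemma fourier_derivative:
  fixes \<eta> :: "'a::euclidean_space \<Rightarrow> complex"
  assumes \<eta>: "test_fn \<eta>"
  shows "(fourier \<eta> has_derivative (\<lambda>v. fourier (\<lambda>x. \<eta> x * (- \<i> * of_real (x \<bullet> v))) \<xi>)) (at \<xi>)"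
proof -
  have [measurable]: "\<eta> \<in> borel_measurable borel" using test_function_borel[OF \<eta>] .
  obtain C R where CR: "C > 0" "R > 0" "\<And>x. norm (\<eta> x) \<le> C" "\<And>x. norm x > R \<Longrightarrow> \<eta> x = 0"
    using test_function_bounded_support[OF \<eta>] by metis
  have "((\<lambda>\<xi>. \<integral>x. cis (- (x \<bullet> \<xi>)) * \<eta> x \<partial>lborel) has_derivative
    (\<lambda>v. \<integral>x. cis (- (x \<bullet> \<xi>)) * (\<eta> x * (- \<i> * of_real (x \<bullet> v))) \<partial>lborel)) (at \<xi>)"
  proof (rule has_derivative_integral(2))
    show "((\<lambda>\<xi>. cis (- (x \<bullet> \<xi>)) * \<eta> x) has_derivative (\<lambda>v. cis (- (x \<bullet> \<xi>)) * (\<eta> x * (- \<i> * of_real (x \<bullet> v))))) (at \<xi>)" for \<xi> x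
      by (auto intro!: derivative_eq_intros simp: algebra_simps scaleR_conv_of_real)
    show "norm (cis (- (x \<bullet> \<xi>)) * (\<eta> x * (- \<i> * of_real (x \<bullet> v)))) \<le> (norm x * norm (\<eta> x)) * norm v" for x \<xi> v
    proof -
      have "norm (\<eta> x) * \<bar>x \<bullet> v\<bar> \<le> norm (\<eta> x) * (norm x * norm v)" by (intro mult_left_mono Cauchy_Schwarz_ineq2) simp
      then show ?thesis by (simp add: norm_mult mult_ac)
    qed
    show "integrable lborel (\<lambda>x. norm x * norm (\<eta> x))"
    proof (rule integrable_bounded_support)
      show "norm (norm x * norm (\<eta> x)) \<le> R * C" for x
        using CR(1,2) CR(3)[of x] CR(4)[of x] by (cases "norm x > R") (auto intro!: mult_mono)
      show "norm x * norm (\<eta> x) = 0" if "norm x > R" for x using CR(4)[OF that] by simp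
    qed measurable
    show "integrable lborel (\<lambda>x. cis (- (x \<bullet> \<xi>)) * \<eta> x)" for \<xi>
      by (rule cis_integrable[OF test_function_integrable[OF \<eta>]]) simp
  qed
  then show ?thesis by (simp add: fourier_def[abs_def])
qed

text \<open>Derivatives of the transform of a test function are again transforms of test functions, which
  decay.\<close>
lemma fourier_test_fn_schwartz:
  fixes \<eta> :: "'a::euclidean_space \<Rightarrow> complex"
  assumes "test_fn \<eta>"
  shows "schwartz (fourier \<eta>)"
proof -
  have mult: "test_fn (\<lambda>x. \<eta> x * (- \<i> * of_real (x \<bullet> v)))" if "test_fn \<eta>" for v :: 'a and \<eta>
    by (rule test_function_mult[OF that]) (rule smooth_cmult[OF smooth_inner])
  have it: "\<exists>\<psi>. test_fn \<psi> \<and> iter_deriv vs (fourier \<eta>) = fourier \<psi>" for vs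
  proof (induction vs)
    case (Cons v vs)
    then obtain \<psi> where \<psi>: "test_fn \<psi>" "iter_deriv vs (fourier \<eta>) = fourier \<psi>" by blast
    have "iter_deriv (v # vs) (fourier \<eta>) = iter_deriv [v] (fourier \<psi>)" using \<psi>(2) by simp
    also have "\<dots> = fourier (\<lambda>x. \<psi> x * (- \<i> * of_real (x \<bullet> v)))"
      using iter_deriv_eqI[OF fourier_derivative[OF \<psi>(1)]] by simp
    finally show ?case using mult[OF \<psi>(1)] by blast
  qed (use assms in auto)
  show ?thesis unfolding schwartz_def smooth_def
  proof (intro conjI allI)
    fix vs x and k :: nat
    obtain \<psi> where \<psi>: "test_fn \<psi>" "iter_deriv vs (fourier \<eta>) = fourier \<psi>" using it by blast
    show "iter_deriv vs (fourier \<eta>) differentiable (at x)"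
      unfolding \<psi>(2) using fourier_derivative[OF \<psi>(1)] by (rule differentiableI)
    show "bounded (range (\<lambda>x. norm x ^ k *\<^sub>R iter_deriv vs (fourier \<eta>) x))"
      unfolding \<psi>(2) using fourier_test_fn_decay[OF \<psi>(1), of k] by (auto simp: bounded_iff)
  qed
qed

lemma test_fn_schwartz:
  fixes \<eta> :: "'a::euclidean_space \<Rightarrow> complex"
  assumes \<eta>: "test_fn \<eta>" shows "schwartz \<eta>"
  unfolding schwartz_def
proof (intro conjI allI)
  show "smooth \<eta>" using \<eta> by (rule test_function_smooth)
  fix vs and k :: nat
  obtain C R where CR: "C > 0" "R > 0" "\<And>x. norm (iter_deriv vs \<eta> x) \<le> C" "\<And>x. norm x > R \<Longrightarrow> iter_deriv vs \<eta> x = 0"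
    using test_function_bounded_support[OF test_function_iter_deriv[OF \<eta>]] by metis
  have "norm (norm x ^ k *\<^sub>R iter_deriv vs \<eta> x) \<le> R ^ k * C" for x
    using CR(1,2) CR(3)[of x] CR(4)[of x] by (cases "norm x > R") (auto intro!: mult_mono power_mono)
  then show "bounded (range (\<lambda>x. norm x ^ k *\<^sub>R iter_deriv vs \<eta> x))" by (auto simp: bounded_iff)
qed

lemma schwartz_borel: "schwartz \<phi> \<Longrightarrow> \<phi> \<in> borel_measurable borel"
  unfolding schwartz_def using smooth_continuous_on[of \<phi> UNIV] by (auto intro: borel_measurable_continuous_onI)

lemma schwartz_bounds:
  assumes "schwartz \<phi>" obtains M where "M \<ge> 0" "\<And>x. norm x ^ k * norm (\<phi> x) \<le> M"
proof -
  have "bounded (range (\<lambda>x. norm x ^ k *\<^sub>R iter_deriv [] \<phi> x))" using assms unfolding schwartz_def by blast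
  then obtain M where M: "\<And>x. norm x ^ k * norm (\<phi> x) \<le> M" by (auto simp: bounded_iff)
  moreover have "0 \<le> norm (undefined :: 'a) ^ k * norm (\<phi> undefined)" by simp
  ultimately show thesis using that order_trans by blast
qed

text \<open>Comparison with the product of \<open>1 / (1 + t\<^sup>2)\<close> over the coordinates, whose
  reciprocal grows like the power \<open>2 DIM('a)\<close> of the norm.\<close>
lemma schwartz_integrable:
  fixes \<phi> :: "'a::euclidean_space \<Rightarrow> complex"
  assumes \<phi>: "schwartz \<phi>" shows "integrable lborel \<phi>"
proof -
  let ?d = "DIM('a)"
  obtain M0 where M0: "M0 \<ge> 0" "\<And>x. norm (\<phi> x) \<le> M0" using schwartz_bounds[OF \<phi>, of 0] by auto
  obtain M1 where M1: "M1 \<ge> 0" "\<And>x. norm x ^ (2 * ?d) * norm (\<phi> x) \<le> M1" using schwartz_bounds[OF \<phi>] by metis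
  have "integrable lborel (\<lambda>t::real. inverse (1 + t\<^sup>2))"
    using integrable_inverse_1_plus_square by (simp add: set_integrable_def einterval_def)
  then have "integrable lborel (\<lambda>t::real. complex_of_real (inverse (1 + t\<^sup>2)))" by (simp only: complex_of_real_integrable_eq)
  then have int: "integrable lborel (\<lambda>x::'a. \<Prod>b\<in>Basis. complex_of_real (inverse (1 + (x \<bullet> b)\<^sup>2)))"
    by (rule integral_lborel_prod(1))
  have le: "(\<Prod>b\<in>Basis. 1 + (x \<bullet> b)\<^sup>2) \<le> 2 ^ ?d * (1 + norm x ^ (2 * ?d))" for x :: 'a
  proof -
    have "(\<Prod>b\<in>Basis. 1 + (x \<bullet> b)\<^sup>2) \<le> (\<Prod>b\<in>(Basis::'a set). 1 + (norm x)\<^sup>2)"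
      by (intro prod_mono) (auto intro!: abs_le_square_iff[THEN iffD1] Basis_le_norm[THEN order_trans])
    also have "\<dots> = (1 + (norm x)\<^sup>2) ^ ?d" by simp
    also have "\<dots> \<le> 2 ^ ?d * (1 + norm x ^ (2 * ?d))"
    proof (cases "norm x \<le> 1")
      case True
      then have "(1 + (norm x)\<^sup>2) ^ ?d \<le> 2 ^ ?d" by (intro power_mono) (auto simp: power_le_one)
      also have "\<dots> \<le> 2 ^ ?d * (1 + norm x ^ (2 * ?d))" by simp
      finally show ?thesis .
    next
      case False
      then have "(1 + (norm x)\<^sup>2) ^ ?d \<le> (2 * (norm x)\<^sup>2) ^ ?d" by (intro power_mono) (auto simp: one_le_power)
      also have "\<dots> = 2 ^ ?d * norm x ^ (2 * ?d)" by (simp add: power_mult_distrib power_mult)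
      finally show ?thesis by (simp add: distrib_left add_increasing)
    qed
    finally show ?thesis .
  qed
  show ?thesis
  proof (rule Bochner_Integration.integrable_bound)
    show "integrable lborel (\<lambda>x::'a. of_real (2 ^ ?d * (M0 + M1)) * (\<Prod>b\<in>Basis. complex_of_real (inverse (1 + (x \<bullet> b)\<^sup>2))))"
      using int by (rule integrable_mult_right)
    show "\<phi> \<in> borel_measurable lborel" using schwartz_borel[OF \<phi>] by simp
    show "AE x in lborel. norm (\<phi> x) \<le> norm (of_real (2 ^ ?d * (M0 + M1)) * (\<Prod>b\<in>Basis. complex_of_real (inverse (1 + (x \<bullet> b)\<^sup>2))))"
    proof (rule AE_I2)
      fix x :: 'a
      have pos: "(\<Prod>b\<in>Basis. 1 + (x \<bullet> b)\<^sup>2) > 0" by (intro prod_pos) (simp add: add_pos_nonneg)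
      have "norm (\<phi> x) * (\<Prod>b\<in>Basis. 1 + (x \<bullet> b)\<^sup>2) \<le> norm (\<phi> x) * (2 ^ ?d * (1 + norm x ^ (2 * ?d)))"
        by (intro mult_left_mono le) simp
      also have "\<dots> = 2 ^ ?d * (norm (\<phi> x) + norm x ^ (2 * ?d) * norm (\<phi> x))" by (simp add: algebra_simps)
      also have "\<dots> \<le> 2 ^ ?d * (M0 + M1)" using M0(2)[of x] M1(2)[of x] by (intro mult_left_mono add_mono) auto
      finally have "norm (\<phi> x) \<le> 2 ^ ?d * (M0 + M1) / (\<Prod>b\<in>Basis. 1 + (x \<bullet> b)\<^sup>2)" using pos by (simp add: pos_le_divide_eq)
      also have "\<dots> = norm (of_real (2 ^ ?d * (M0 + M1) * (\<Prod>b\<in>Basis. inverse (1 + (x \<bullet> b)\<^sup>2)) ) :: complex)"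
      proof -
        have "(\<Prod>b\<in>Basis. inverse (1 + (x \<bullet> b)\<^sup>2)) = inverse (\<Prod>b\<in>Basis. 1 + (x \<bullet> b)\<^sup>2)"
          using prod_inversef[of "\<lambda>b. 1 + (x \<bullet> b)\<^sup>2" Basis] by (simp add: o_def)
        then show ?thesis unfolding norm_of_real using M0(1) M1(1) pos by (simp add: divide_inverse abs_mult)
      qed
      finally show "norm (\<phi> x) \<le> norm (of_real (2 ^ ?d * (M0 + M1)) * (\<Prod>b\<in>Basis. complex_of_real (inverse (1 + (x \<bullet> b)\<^sup>2))))"
        by (simp only: of_real_mult of_real_prod)
    qed
  qed
qed

lemma L2_of_integrable_bounded:
  assumes f: "integrable lborel f" and b: "\<And>x. norm (f x) \<le> M"
  shows "f \<in> L2_space"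
proof -
  have [measurable]: "f \<in> borel_measurable borel" using f by (auto dest: borel_measurable_integrable)
  have "integrable lborel (\<lambda>x. (norm (f x))\<^sup>2)"
  proof (rule Bochner_Integration.integrable_bound)
    show "integrable lborel (\<lambda>x. M * norm (f x))" using f by (intro integrable_mult_right integrable_norm)
    show "AE x in lborel. norm ((norm (f x))\<^sup>2) \<le> norm (M * norm (f x))"
    proof (rule AE_I2)
      fix x
      have "norm (f x) * norm (f x) \<le> M * norm (f x)" by (intro mult_right_mono b) simp
      then show "norm ((norm (f x))\<^sup>2) \<le> norm (M * norm (f x))" by (simp add: power2_eq_square)
    qed
  qed measurable
  then show ?thesis by (simp add: L2_space_def)
qed

lemma schwartz_L2:
  assumes "schwartz \<phi>" shows "\<phi> \<in> L2_space"
proof -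
  obtain M where "\<And>x. norm x ^ 0 * norm (\<phi> x) \<le> M" using schwartz_bounds[OF assms, of 0] by blast
  then have "\<And>x. norm (\<phi> x) \<le> M" by simp
  then show ?thesis by (rule L2_of_integrable_bounded[OF schwartz_integrable[OF assms]])
qed

lemma fourier_fourier_test_fn:
  fixes \<eta> :: "'a::euclidean_space \<Rightarrow> complex"
  assumes \<eta>: "test_fn \<eta>"
  shows "fourier (fourier \<eta>) (- x) = of_real ((2 * pi) ^ DIM('a)) * \<eta> x"
    and "inv_fourier (fourier \<eta>) x = \<eta> x"
proof -
  obtain C R where C: "\<And>x. norm (\<eta> x) \<le> C"
    using test_function_bounded_support[OF \<eta>] by metis
  show *: "fourier (fourier \<eta>) (- x) = of_real ((2 * pi) ^ DIM('a)) * \<eta> x"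
    by (rule fourier_inversion[OF test_function_integrable[OF \<eta>] test_function_continuous[OF \<eta>] C
          schwartz_integrable[OF fourier_test_fn_schwartz[OF \<eta>]]])
  then show "inv_fourier (fourier \<eta>) x = \<eta> x"
    by (simp add: inv_fourier_def fourier_def inner_commute)
qed

section \<open>The Fourier transform of square integrable functions\<close>

lemma L2_dominated:
  fixes f :: "'a::euclidean_space \<Rightarrow> complex"
  assumes [measurable]: "f \<in> borel_measurable borel" and g: "g \<in> L2_space"
    and le: "AE x in lborel. norm (f x) \<le> norm (g x)"
  shows "f \<in> L2_space" "L2_norm f \<le> L2_norm g"
proof -
  have "(\<integral>\<^sup>+x. ennreal ((norm (f x))\<^sup>2) \<partial>lborel) \<le> (\<integral>\<^sup>+x. ennreal ((norm (g x))\<^sup>2) \<partial>lborel)"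
    by (intro nn_integral_mono_AE) (use le in \<open>eventually_elim, auto intro!: ennreal_leI power_mono\<close>)
  also have "\<dots> = ennreal ((L2_norm g)\<^sup>2)" by (rule L2_nn_integral[OF g])
  finally have *: "(\<integral>\<^sup>+x. ennreal ((norm (f x))\<^sup>2) \<partial>lborel) \<le> ennreal ((L2_norm g)\<^sup>2)" .
  show "f \<in> L2_space" "L2_norm f \<le> L2_norm g" using L2_nn_bound[OF _ *] by auto
qed

lemma L2_dominated_convergence:
  fixes f :: "nat \<Rightarrow> 'a::euclidean_space \<Rightarrow> complex"
  assumes [measurable]: "\<And>n. f n \<in> borel_measurable borel" and g: "g \<in> L2_space"
    and le: "\<And>n. AE x in lborel. norm (f n x) \<le> norm (g x)"
    and lim: "AE x in lborel. (\<lambda>n. f n x) \<longlonglongrightarrow> 0"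
  shows "(\<lambda>n. L2_norm (f n)) \<longlonglongrightarrow> 0"
proof -
  have "(\<lambda>n. \<integral>x. (norm (f n x))\<^sup>2 \<partial>lborel) \<longlonglongrightarrow> (\<integral>x. 0 \<partial>(lborel :: 'a measure))"
  proof (rule integral_dominated_convergence[where w = "\<lambda>x. (norm (g x))\<^sup>2"])
    show "AE x in lborel. (\<lambda>n. (norm (f n x))\<^sup>2) \<longlonglongrightarrow> 0" using lim
    proof eventually_elim
      case (elim x)
      from tendsto_power[OF tendsto_norm[OF elim], of 2] show ?case by simp
    qed
    show "AE x in lborel. norm ((norm (f n x))\<^sup>2) \<le> (norm (g x))\<^sup>2" for n using le[of n]
      by eventually_elim (auto intro!: power_mono)
  qed (use L2_integrable_sq[OF g] in auto)
  then have "(\<lambda>n. sqrt (\<integral>x. (norm (f n x))\<^sup>2 \<partial>lborel)) \<longlonglongrightarrow> sqrt (\<integral>x. 0 \<partial>(lborel :: 'a measure))"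
    by (rule tendsto_real_sqrt)
  then show ?thesis by (simp add: L2_norm_def)
qed

lemma L2_truncation:
  fixes f :: "'a::euclidean_space \<Rightarrow> complex"
  assumes f: "f \<in> L2_space"
  defines "F \<equiv> \<lambda>n::nat. \<lambda>x. indicator (ball 0 (real n)) x * f x"
  shows "F n \<in> L2_space" "integrable lborel (F n)" "(\<lambda>n. L2_norm (\<lambda>x. F n x - f x)) \<longlonglongrightarrow> 0"
proof -
  have [measurable]: "f \<in> borel_measurable borel" using L2_measurable[OF f] .
  have m [measurable]: "F n \<in> borel_measurable borel" for n
    unfolding F_def using L2_measurable[OF f] by (intro borel_measurable_times borel_measurable_indicator) auto
  show F: "F n \<in> L2_space"
    by (rule L2_dominated(1)[OF m f]) (auto simp: F_def indicator_def)
  have "indicator (ball 0 (real n)) \<in> (L2_space :: ('a \<Rightarrow> complex) set)"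
  proof -
    have "integrable lborel (indicat_real (ball (0::'a) (real n)))"
      by (intro integrable_real_indicator emeasure_lborel_ball_finite) auto
    moreover have "(norm (indicator (ball 0 (real n)) x :: complex))\<^sup>2 = indicat_real (ball (0::'a) (real n)) x" for x
      by (auto simp: indicator_def)
    moreover have "(indicator (ball 0 (real n)) :: 'a \<Rightarrow> complex) \<in> borel_measurable borel"
      by (rule borel_measurable_indicator) simp
    ultimately show ?thesis by (simp add: L2_space_def)
  qed
  from L2_mult_integrable[OF this f] show "integrable lborel (F n)" unfolding F_def .
  show "(\<lambda>n. L2_norm (\<lambda>x. F n x - f x)) \<longlonglongrightarrow> 0"
  proof (rule L2_dominated_convergence[OF _ f])
    show "AE x in lborel. norm (F n x - f x) \<le> norm (f x)" for n by (auto simp: F_def indicator_def)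
    show "AE x in lborel. (\<lambda>n. F n x - f x) \<longlonglongrightarrow> 0"
    proof (rule AE_I2)
      fix x :: 'a
      obtain N :: nat where N: "norm x < real N" using reals_Archimedean2 by blast
      have "\<forall>\<^sub>F n in sequentially. F n x - f x = 0"
        using eventually_ge_at_top[of N] by eventually_elim (use N in \<open>auto simp: F_def\<close>)
      then show "(\<lambda>n. F n x - f x) \<longlonglongrightarrow> 0" by (rule tendsto_eventually)
    qed
  qed measurable
qed

lemma fourier_diff:
  assumes "integrable lborel f" "integrable lborel g"
  shows "fourier (\<lambda>x. f x - g x) = (\<lambda>\<xi>. fourier f \<xi> - fourier g \<xi>)"
  unfolding fourier_def using cis_integrable[OF assms(1)] cis_integrable[OF assms(2)]
  by (simp add: right_diff_distrib)

lemma L2_tendsto_pairing: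
  assumes F: "\<And>n. F n \<in> L2_space" and f: "f \<in> L2_space" and g: "g \<in> L2_space"
    and lim: "(\<lambda>n. L2_norm (\<lambda>x. F n x - f x)) \<longlonglongrightarrow> 0"
  shows "(\<lambda>n. \<integral>x. F n x * g x \<partial>lborel) \<longlonglongrightarrow> (\<integral>x. f x * g x \<partial>lborel)"
proof -
  have "(\<lambda>n. (\<integral>x. F n x * g x \<partial>lborel) - (\<integral>x. f x * g x \<partial>lborel)) \<longlonglongrightarrow> 0"
  proof (rule Lim_null_comparison)
    show "\<forall>\<^sub>F n in sequentially. norm ((\<integral>x. F n x * g x \<partial>lborel) - (\<integral>x. f x * g x \<partial>lborel)) \<le> L2_norm (\<lambda>x. F n x - f x) * L2_norm g"
    proof (rule always_eventually, rule allI)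
      fix n
      have "(\<integral>x. F n x * g x \<partial>lborel) - (\<integral>x. f x * g x \<partial>lborel) = (\<integral>x. (F n x - f x) * g x \<partial>lborel)"
        using L2_mult_integrable[OF F g] L2_mult_integrable[OF f g] by (simp add: left_diff_distrib)
      then show "norm ((\<integral>x. F n x * g x \<partial>lborel) - (\<integral>x. f x * g x \<partial>lborel)) \<le> L2_norm (\<lambda>x. F n x - f x) * L2_norm g"
        using L2_Cauchy_Schwarz(2)[OF L2_diff(1)[OF F f] g] by simp
    qed
    show "(\<lambda>n. L2_norm (\<lambda>x. F n x - f x) * L2_norm g) \<longlonglongrightarrow> 0" using tendsto_mult_left_zero[OF lim] .
  qed
  then show ?thesis by (rule LIM_zero_cancel)
qed

lemma L2_tendsto_norm:
  assumes F: "\<And>n. F n \<in> L2_space" and f: "f \<in> L2_space"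
    and lim: "(\<lambda>n. L2_norm (\<lambda>x. F n x - f x)) \<longlonglongrightarrow> 0"
  shows "(\<lambda>n. L2_norm (F n)) \<longlonglongrightarrow> L2_norm f"
proof -
  have "(\<lambda>n. L2_norm (F n) - L2_norm f) \<longlonglongrightarrow> 0"
  proof (rule Lim_null_comparison[OF _ lim], rule always_eventually, rule allI)
    fix n
    show "norm (L2_norm (F n) - L2_norm f) \<le> L2_norm (\<lambda>x. F n x - f x)"
      using L2_norm_triangle_diff[OF F[of n] f] L2_norm_triangle_diff[OF f F[of n]] L2_norm_minus_commute[of f "F n"] by simp
  qed
  then show ?thesis by (rule LIM_zero_cancel)
qed

text \<open>The transforms of truncations of \<open>f\<close> form a Cauchy sequence by the Plancherel
  bound, and the duality with Schwartz functions passes to the limit.\<close>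
lemma fourier_L2_exists:
  fixes f :: "'a::euclidean_space \<Rightarrow> complex"
  assumes f: "f \<in> L2_space"
  shows "\<exists>g. is_L2_function (\<lambda>\<phi>. \<integral>x. f x * fourier \<phi> x \<partial>lborel) g \<and> L2_norm g \<le> plancherel_const TYPE('a) * L2_norm f"
proof -
  define F where "F = (\<lambda>n::nat. \<lambda>x. indicator (ball 0 (real n)) x * f x)"
  have F: "F n \<in> L2_space" "integrable lborel (F n)" "(\<lambda>n. L2_norm (\<lambda>x. F n x - f x)) \<longlonglongrightarrow> 0" for n
    unfolding F_def by (rule L2_truncation[OF f])+
  have FF: "fourier (F n) \<in> L2_space" for n by (rule fourier_L2_bound_L1(1)[OF F(2,1)])
  have diff: "L2_norm (\<lambda>\<xi>. fourier (F i) \<xi> - fourier (F j) \<xi>) \<le> plancherel_const TYPE('a) * L2_norm (\<lambda>x. F i x - F j x)" for i j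
    using fourier_L2_bound_L1(2)[OF Bochner_Integration.integrable_diff[OF F(2)[of i] F(2)[of j]] L2_diff(1)[OF F(1)[of i] F(1)[of j]]]
    unfolding fourier_diff[OF F(2)[of i] F(2)[of j]] .
  obtain g where g: "g \<in> L2_space" "(\<lambda>n. L2_norm (\<lambda>x. fourier (F n) x - g x)) \<longlonglongrightarrow> 0"
  proof (rule L2_complete[OF FF])
    fix e :: real assume e: "e > 0"
    define e' where "e' = e / (2 * (plancherel_const TYPE('a) + 1))"
    have e': "e' > 0" unfolding e'_def using e by (simp add: add_nonneg_pos)
    obtain N where N: "\<And>n. n \<ge> N \<Longrightarrow> L2_norm (\<lambda>x. F n x - f x) < e'"
      using LIMSEQ_D[OF F(3) e'] by auto
    have "L2_norm (\<lambda>\<xi>. fourier (F i) \<xi> - fourier (F j) \<xi>) < e" if "i \<ge> N" "j \<ge> N" for i j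
    proof -
      have "L2_norm (\<lambda>x. F i x - F j x) \<le> L2_norm (\<lambda>x. F i x - f x) + L2_norm (\<lambda>x. f x - F j x)"
        by (rule L2_norm_diff_triangle[OF F(1) f F(1)])
      then have "L2_norm (\<lambda>x. F i x - F j x) < 2 * e'" using N[OF that(1)] N[OF that(2)] L2_norm_minus_commute[of f "F j"] by simp
      then have "(plancherel_const TYPE('a) + 1) * L2_norm (\<lambda>x. F i x - F j x) < (plancherel_const TYPE('a) + 1) * (2 * e')"
        by (intro mult_strict_left_mono) (auto simp: add_nonneg_pos)
      also have "\<dots> = e" 
      proof -
        have "plancherel_const TYPE('a) + 1 \<noteq> 0" using plancherel_const_nonneg[of "TYPE('a)"] by linarith
        then show ?thesis unfolding e'_def by (simp only: mult.left_commute[of _ 2] mult_divide_mult_cancel_left_if times_divide_eq_right) simp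
      qed
      moreover have "plancherel_const TYPE('a) * L2_norm (\<lambda>x. F i x - F j x) \<le> (plancherel_const TYPE('a) + 1) * L2_norm (\<lambda>x. F i x - F j x)"
        by (intro mult_right_mono) auto
      ultimately show ?thesis using diff[of i j] by linarith
    qed
    then show "\<exists>N. \<forall>i\<ge>N. \<forall>j\<ge>N. L2_norm (\<lambda>\<xi>. fourier (F i) \<xi> - fourier (F j) \<xi>) < e" by blast
  qed (use that in blast)
  have "(\<integral>x. f x * fourier \<phi> x \<partial>lborel) = (\<integral>x. g x * \<phi> x \<partial>lborel)" if \<phi>: "schwartz \<phi>" for \<phi>
  proof (rule LIMSEQ_unique)
    note \<phi>' = schwartz_integrable[OF \<phi>] schwartz_L2[OF \<phi>]
    show "(\<lambda>n. \<integral>x. fourier (F n) x * \<phi> x \<partial>lborel) \<longlonglongrightarrow> (\<integral>x. g x * \<phi> x \<partial>lborel)"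
      by (rule L2_tendsto_pairing[OF FF g(1) \<phi>'(2) g(2)])
    show "(\<lambda>n. \<integral>x. fourier (F n) x * \<phi> x \<partial>lborel) \<longlonglongrightarrow> (\<integral>x. f x * fourier \<phi> x \<partial>lborel)"
      unfolding fourier_multiplication_formula[OF F(2) \<phi>'(1)]
      by (rule L2_tendsto_pairing[OF F(1) f fourier_L2_bound_L1(1)[OF \<phi>'] F(3)])
  qed
  moreover have "L2_norm g \<le> plancherel_const TYPE('a) * L2_norm f"
  proof (rule LIMSEQ_le[OF L2_tendsto_norm[OF FF g] tendsto_mult_left[OF L2_tendsto_norm[OF F(1) f F(3)]]])
    show "\<exists>N. \<forall>n\<ge>N. L2_norm (fourier (F n)) \<le> plancherel_const TYPE('a) * L2_norm (F n)"
      using fourier_L2_bound_L1(2)[OF F(2,1)] by blast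
  qed
  ultimately show ?thesis unfolding is_L2_function_def using g(1) by blast
qed

text \<open>The choice operator in the definition of the transform is harmless because a representing
  function exists.\<close>
lemma fourier_L2_is:
  assumes "f \<in> L2_space" shows "is_L2_function (\<lambda>\<phi>. \<integral>x. f x * fourier \<phi> x \<partial>lborel) (fourier_L2 f)"
proof -
  have "\<exists>g. is_L2_function (\<lambda>\<phi>. \<integral>x. f x * fourier \<phi> x \<partial>lborel) g" using fourier_L2_exists[OF assms] by blast
  from someI_ex[OF this] show ?thesis unfolding fourier_L2_def L2_function_def .
qed

lemma fourier_L2_in_L2 [simp]: "f \<in> L2_space \<Longrightarrow> fourier_L2 f \<in> L2_space"
  using fourier_L2_is unfolding is_L2_function_def by blast

lemma fourier_L2_pairing: "f \<in> L2_space \<Longrightarrow> schwartz \<phi> \<Longrightarrow> (\<integral>x. f x * fourier \<phi> x \<partial>lborel) = (\<integral>x. fourier_L2 f x * \<phi> x \<partial>lborel)"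
  using fourier_L2_is unfolding is_L2_function_def by blast

lemma fourier_L2_unique:
  assumes "f \<in> L2_space" "g \<in> L2_space" "\<And>\<phi>. test_fn \<phi> \<Longrightarrow> (\<integral>x. f x * fourier \<phi> x \<partial>lborel) = (\<integral>x. g x * \<phi> x \<partial>lborel)"
  shows "AE x in lborel. fourier_L2 f x = g x"
  using assms(3) fourier_L2_pairing[OF assms(1) test_fn_schwartz]
  by (intro L2_eq_AE_of_test_functions[OF fourier_L2_in_L2[OF assms(1)] assms(2)]) simp

lemma fourier_L2_bound:
  fixes f :: "'a::euclidean_space \<Rightarrow> complex"
  assumes f: "f \<in> L2_space" shows "L2_norm (fourier_L2 f) \<le> plancherel_const TYPE('a) * L2_norm f"
proof -
  obtain g where g: "is_L2_function (\<lambda>\<phi>. \<integral>x. f x * fourier \<phi> x \<partial>lborel) g" "L2_norm g \<le> plancherel_const TYPE('a) * L2_norm f"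
    using fourier_L2_exists[OF f] by blast
  have g2: "g \<in> L2_space" using g(1) by (simp add: is_L2_function_def)
  have "AE x in lborel. fourier_L2 f x = g x"
    by (rule fourier_L2_unique[OF f g2]) (use g(1) test_fn_schwartz in \<open>auto simp: is_L2_function_def\<close>)
  from L2_cong_AE(2)[OF this L2_measurable[OF g2] fourier_L2_in_L2[OF f]] g(2) show ?thesis by simp
qed

lemma fourier_test_fn_L2: "test_fn \<phi> \<Longrightarrow> fourier \<phi> \<in> L2_space"
  by (rule schwartz_L2[OF fourier_test_fn_schwartz])

lemma fourier_L2_diff:
  assumes f: "f \<in> L2_space" and g: "g \<in> L2_space"
  shows "AE x in lborel. fourier_L2 (\<lambda>x. f x - g x) x = fourier_L2 f x - fourier_L2 g x"
proof (rule fourier_L2_unique[OF L2_diff(1)[OF f g] L2_diff(1)[OF fourier_L2_in_L2[OF f] fourier_L2_in_L2[OF g]]])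
  fix \<phi> :: "'a \<Rightarrow> complex" assume \<phi>: "test_fn \<phi>"
  note s = test_fn_schwartz[OF \<phi>]
  show "(\<integral>x. (f x - g x) * fourier \<phi> x \<partial>lborel) = (\<integral>x. (fourier_L2 f x - fourier_L2 g x) * \<phi> x \<partial>lborel)"
    using fourier_L2_pairing[OF f s] fourier_L2_pairing[OF g s] L2_mult_integrable[OF f fourier_test_fn_L2[OF \<phi>]]
      L2_mult_integrable[OF g fourier_test_fn_L2[OF \<phi>]] L2_mult_integrable[OF fourier_L2_in_L2[OF f] schwartz_L2[OF s]]
      L2_mult_integrable[OF fourier_L2_in_L2[OF g] schwartz_L2[OF s]]
    by (simp add: left_diff_distrib)
qed

lemma fourier_L2_eq_fourier:
  assumes "integrable lborel f" "f \<in> L2_space"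
  shows "AE x in lborel. fourier_L2 f x = fourier f x"
  by (rule fourier_L2_unique[OF assms(2) fourier_L2_bound_L1(1)[OF assms]])
    (rule fourier_multiplication_formula[symmetric, OF assms(1) test_function_integrable])

text \<open>Testing against transforms of test functions shows that applying the transform twice gives the
  reflection times \<open>(2 pi) ^ DIM('a)\<close>; the bound for the second transform then gives
  the claim.\<close>
lemma L2_norm_le_fourier_L2:
  fixes f :: "'a::euclidean_space \<Rightarrow> complex"
  assumes f: "f \<in> L2_space"
  shows "(2 * pi) ^ DIM('a) * L2_norm f \<le> plancherel_const TYPE('a) * L2_norm (fourier_L2 f)"
proof -
  let ?P = "(2 * pi) ^ DIM('a)"
  define h where "h = (\<lambda>x. of_real ?P * f (- x))"
  have [measurable]: "f \<in> borel_measurable borel" using L2_measurable[OF f] .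
  have hm [measurable]: "h \<in> borel_measurable borel" unfolding h_def by measurable
  have refl: "integrable lborel k \<longleftrightarrow> integrable lborel (\<lambda>x. k (- x))" "(\<integral>x. k x \<partial>lborel) = (\<integral>x. k (- x) \<partial>lborel)"
    if "k \<in> borel_measurable borel" for k :: "'a \<Rightarrow> 'b::{banach,second_countable_topology}"
    using lborel_affine_integral[of "-1" k 0] that by simp_all
  have hn: "integrable lborel (\<lambda>x. (norm (h x))\<^sup>2)" "L2_norm h = ?P * L2_norm f"
  proof -
    have sq: "(norm (h x))\<^sup>2 = ?P\<^sup>2 * (norm (f (- x)))\<^sup>2" for x
      unfolding h_def norm_mult norm_of_real by (simp add: power_mult_distrib)
    show "integrable lborel (\<lambda>x. (norm (h x))\<^sup>2)"
      unfolding sq using L2_integrable_sq[OF f] refl(1)[of "\<lambda>x. (norm (f x))\<^sup>2"] by simp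
    have "(L2_norm h)\<^sup>2 = ?P\<^sup>2 * (L2_norm f)\<^sup>2"
      unfolding L2_norm_sq sq using refl(2)[of "\<lambda>x. (norm (f x))\<^sup>2"] by simp
    also have "\<dots> = (?P * L2_norm f)\<^sup>2" by (rule power_mult_distrib[symmetric])
    finally show "L2_norm h = ?P * L2_norm f" by (rule power2_eq_imp_eq) simp_all
  qed
  have h: "h \<in> L2_space" using hn(1) by (simp add: L2_space_def)
  \<comment> \<open>Here \<open>h\<close> is the reflection of \<open>f\<close> with the constant of double transformation.\<close>
  have "AE x in lborel. fourier_L2 (fourier_L2 f) x = h x"
  proof (rule fourier_L2_unique[OF fourier_L2_in_L2[OF f] h])
    fix \<phi> :: "'a \<Rightarrow> complex" assume \<phi>: "test_fn \<phi>"
    have [measurable]: "\<phi> \<in> borel_measurable borel" using test_function_borel[OF \<phi>] .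
    have "(\<integral>x. fourier_L2 f x * fourier \<phi> x \<partial>lborel) = (\<integral>x. f x * fourier (fourier \<phi>) x \<partial>lborel)"
      by (rule fourier_L2_pairing[OF f fourier_test_fn_schwartz[OF \<phi>], symmetric])
    also have "\<dots> = (\<integral>x. f x * (of_real ?P * \<phi> (- x)) \<partial>lborel)"
      using fourier_fourier_test_fn(1)[OF \<phi>, of "- x" for x] by simp
    also have "(\<integral>x. f x * (of_real ?P * \<phi> (- x)) \<partial>lborel) = (\<integral>x. h x * \<phi> x \<partial>lborel)"
      unfolding h_def by (subst refl(2)) (simp_all add: mult_ac)
    finally show "(\<integral>x. fourier_L2 f x * fourier \<phi> x \<partial>lborel) = (\<integral>x. h x * \<phi> x \<partial>lborel)" .
  qed
  from L2_cong_AE(2)[OF this hm] fourier_L2_bound[OF fourier_L2_in_L2[OF f]] hn(2) f show ?thesis by simp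
qed

text \<open>The Fourier transform of the fractional Laplacian of order \<open>s / 2\<close> applied to \<open>f\<close>.\<close>
definition freq_deriv :: "real \<Rightarrow> ('a::euclidean_space \<Rightarrow> complex) \<Rightarrow> 'a \<Rightarrow> complex" where
  "freq_deriv s f \<xi> = of_real (norm \<xi> powr s) * fourier_L2 f \<xi>"

lemma freq_deriv_borel [measurable]: "f \<in> L2_space \<Longrightarrow> freq_deriv s f \<in> borel_measurable borel"
  using L2_measurable[OF fourier_L2_in_L2] unfolding freq_deriv_def by measurable

lemma Hs_L2: "f \<in> Hs_space s \<Longrightarrow> f \<in> L2_space"
  by (simp add: Hs_space_def)

text \<open>Being square integrable is not yet known for the weighted transform, but on bounded sets the
  weight is bounded.\<close>
lemma freq_deriv_local:
  assumes f: "f \<in> L2_space" and s: "s \<ge> 0"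
  shows "integrable lborel (\<lambda>\<xi>. indicator (box a b) \<xi> * freq_deriv s f \<xi>)"
    and "test_fn \<phi> \<Longrightarrow> integrable lborel (\<lambda>\<xi>. freq_deriv s f \<xi> * \<phi> \<xi>)"
proof -
  have pw: "norm \<xi> powr s \<le> R powr s" if "norm \<xi> \<le> R" for \<xi> :: 'a and R using that s by (intro powr_mono2) auto
  obtain R where R: "\<And>\<xi>. \<xi> \<in> box a b \<Longrightarrow> norm \<xi> \<le> R" using bounded_box bounded_iff by metis
  have fm [measurable]: "fourier_L2 f \<in> borel_measurable borel" using L2_measurable[OF fourier_L2_in_L2[OF f]] .
  have "integrable lborel (\<lambda>\<xi>. of_real (R powr s) * (indicator (box a b) \<xi> * fourier_L2 f \<xi>))"
    using L2_box_integrable[OF fourier_L2_in_L2[OF f]] by (rule integrable_mult_right)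
  then show "integrable lborel (\<lambda>\<xi>. indicator (box a b) \<xi> * freq_deriv s f \<xi>)"
  proof (rule Bochner_Integration.integrable_bound)
    show "(\<lambda>\<xi>. indicator (box a b) \<xi> * freq_deriv s f \<xi>) \<in> borel_measurable lborel" using f by measurable
    show "AE \<xi> in lborel. norm (indicator (box a b) \<xi> * freq_deriv s f \<xi>) \<le> norm (of_real (R powr s) * (indicator (box a b) \<xi> * fourier_L2 f \<xi>))"
      using pw[OF R] by (intro AE_I2) (auto simp: freq_deriv_def norm_mult indicator_def intro!: mult_right_mono)
  qed
  assume \<phi>: "test_fn \<phi>"
  obtain C R where CR: "\<And>x. norm (\<phi> x) \<le> C" "\<And>x. norm x > R \<Longrightarrow> \<phi> x = 0"
    using test_function_bounded_support[OF \<phi>] by metis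
  have [measurable]: "\<phi> \<in> borel_measurable borel" using test_function_borel[OF \<phi>] .
  have "integrable lborel (\<lambda>\<xi>. of_real (R powr s) * (fourier_L2 f \<xi> * \<phi> \<xi>))"
    using L2_mult_integrable[OF fourier_L2_in_L2[OF f] test_function_L2[OF \<phi>]] by (rule integrable_mult_right)
  then show "integrable lborel (\<lambda>\<xi>. freq_deriv s f \<xi> * \<phi> \<xi>)"
  proof (rule Bochner_Integration.integrable_bound)
    show "(\<lambda>\<xi>. freq_deriv s f \<xi> * \<phi> \<xi>) \<in> borel_measurable lborel" using f by measurable
    show "AE \<xi> in lborel. norm (freq_deriv s f \<xi> * \<phi> \<xi>) \<le> norm (of_real (R powr s) * (fourier_L2 f \<xi> * \<phi> \<xi>))"
    proof (rule AE_I2)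
      fix \<xi>
      show "norm (freq_deriv s f \<xi> * \<phi> \<xi>) \<le> norm (of_real (R powr s) * (fourier_L2 f \<xi> * \<phi> \<xi>))"
      proof (cases "norm \<xi> \<le> R")
        case True
        then show ?thesis using pw[OF True] by (auto simp: freq_deriv_def norm_mult mult.assoc intro!: mult_right_mono)
      qed (use CR(2) in simp)
    qed
  qed
qed

text \<open>Let \<open>g\<close> be the function that represents the fractional Laplacian of order \<open>s
  / 2\<close>. Pairing with the transform of a test function \<open>\<phi>\<close>, where
  inversion returns \<open>\<phi>\<close>, shows that the transform of \<open>g\<close> is the
  weighted transform of \<open>f\<close>.\<close>
lemma Hs_freq_deriv:
  fixes f :: "'a::euclidean_space \<Rightarrow> complex"
  assumes f: "f \<in> Hs_space s" and s: "s \<ge> 0"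
  shows "freq_deriv s f \<in> L2_space" "L2_norm (freq_deriv s f) \<le> plancherel_const TYPE('a) * Hs_norm s f"
proof -
  define g where "g = L2_function (frac_laplacian (s / 2) f)"
  have ex: "\<exists>g. is_L2_function (frac_laplacian (s / 2) f) g" using f by (simp add: Hs_space_def)
  have g: "is_L2_function (frac_laplacian (s / 2) f) g"
    using someI_ex[OF ex] unfolding g_def L2_function_def .
  have g2: "g \<in> L2_space" using g by (simp add: is_L2_function_def)
  note f2 = Hs_L2[OF f]
  have "AE \<xi> in lborel. fourier_L2 g \<xi> - freq_deriv s f \<xi> = 0"
  proof (rule fundamental_lemma_calculus_of_variations)
    show "integrable lborel (\<lambda>\<xi>. indicator (box a b) \<xi> * (fourier_L2 g \<xi> - freq_deriv s f \<xi>))" for a b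
      unfolding right_diff_distrib
      by (intro Bochner_Integration.integrable_diff L2_box_integrable freq_deriv_local(1) fourier_L2_in_L2 g2 f2 s)
    fix \<phi> :: "'a \<Rightarrow> complex" assume \<phi>: "test_fn \<phi>"
    note s\<phi> = test_fn_schwartz[OF \<phi>]
    have "(\<integral>x. fourier_L2 g x * \<phi> x \<partial>lborel) = (\<integral>x. g x * fourier \<phi> x \<partial>lborel)"
      by (rule fourier_L2_pairing[OF g2 s\<phi>, symmetric])
    also have "\<dots> = frac_laplacian (s / 2) f (fourier \<phi>)"
      using g fourier_test_fn_schwartz[OF \<phi>] by (simp add: is_L2_function_def)
    also have "\<dots> = (\<integral>\<xi>. freq_deriv s f \<xi> * \<phi> \<xi> \<partial>lborel)"
      unfolding frac_laplacian_def freq_deriv_def fourier_fourier_test_fn(2)[OF \<phi>] by simp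
    finally show "(\<integral>\<xi>. (fourier_L2 g \<xi> - freq_deriv s f \<xi>) * \<phi> \<xi> \<partial>lborel) = 0"
      using L2_mult_integrable[OF fourier_L2_in_L2[OF g2] schwartz_L2[OF s\<phi>]] freq_deriv_local(2)[OF f2 s \<phi>]
      by (simp add: left_diff_distrib)
  qed
  then have ae: "AE \<xi> in lborel. fourier_L2 g \<xi> = freq_deriv s f \<xi>" by eventually_elim simp
  show "freq_deriv s f \<in> L2_space"
    by (rule L2_cong_AE(1)[OF ae freq_deriv_borel[OF f2] fourier_L2_in_L2[OF g2]])
  have "L2_norm (freq_deriv s f) = L2_norm (fourier_L2 g)"
    by (rule L2_cong_AE(2)[OF ae freq_deriv_borel[OF f2] fourier_L2_in_L2[OF g2]])
  also have "\<dots> \<le> plancherel_const TYPE('a) * L2_norm g" by (rule fourier_L2_bound[OF g2])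
  also have "\<dots> \<le> plancherel_const TYPE('a) * Hs_norm s f" by (intro mult_left_mono) (simp_all add: Hs_norm_def g_def)
  finally show "L2_norm (freq_deriv s f) \<le> plancherel_const TYPE('a) * Hs_norm s f" .
qed

lemma freq_deriv_diff:
  assumes "f \<in> L2_space" "g \<in> L2_space"
  shows "AE \<xi> in lborel. freq_deriv s (\<lambda>x. f x - g x) \<xi> = freq_deriv s f \<xi> - freq_deriv s g \<xi>"
  using fourier_L2_diff[OF assms] by eventually_elim (simp add: freq_deriv_def right_diff_distrib)

section \<open>Density of test functions in fractional Sobolev spaces\<close>

lemma test_fn_deriv_bound:
  fixes \<phi> :: "'a::euclidean_space \<Rightarrow> complex"
  assumes \<phi>: "test_fn \<phi>"
  obtains C where "C \<ge> 0" "\<And>v x. norm (iter_deriv [v] \<phi> x) \<le> C * norm v"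
proof -
  have "\<forall>i. \<exists>C. C \<ge> 0 \<and> (\<forall>x. norm (iter_deriv [i] \<phi> x) \<le> C)"
  proof
    fix i
    obtain C R where "C > 0" "\<And>x. norm (iter_deriv [i] \<phi> x) \<le> C"
      using test_function_bounded_support[OF test_function_iter_deriv[OF \<phi>, of "[i]"]] by metis
    then show "\<exists>C. C \<ge> 0 \<and> (\<forall>x. norm (iter_deriv [i] \<phi> x) \<le> C)" by (intro exI[of _ C]) auto
  qed
  then obtain C where C: "\<And>i. C i \<ge> 0" "\<And>i x. norm (iter_deriv [i] \<phi> x) \<le> C i" by metis
  have "norm (iter_deriv [v] \<phi> x) \<le> (\<Sum>i\<in>Basis. C i) * norm v" for v x
  proof -
    have lin: "linear (\<lambda>v. iter_deriv [v] \<phi> x)" using has_derivative_linear[OF test_fn_has_derivative[OF \<phi>]] .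
    have "iter_deriv [v] \<phi> x = iter_deriv [\<Sum>i\<in>Basis. (v \<bullet> i) *\<^sub>R i] \<phi> x" by (simp only: euclidean_representation)
    also have "\<dots> = (\<Sum>i\<in>Basis. (v \<bullet> i) *\<^sub>R iter_deriv [i] \<phi> x)"
      using linear_sum[OF lin, of "\<lambda>i. (v \<bullet> i) *\<^sub>R i" Basis] by (simp only: linear_scale[OF lin])
    also have "norm \<dots> \<le> (\<Sum>i\<in>Basis. norm v * C i)"
    proof (rule sum_norm_le)
      fix i :: 'a assume "i \<in> Basis"
      show "norm ((v \<bullet> i) *\<^sub>R iter_deriv [i] \<phi> x) \<le> norm v * C i"
        unfolding norm_scaleR using Basis_le_norm[OF \<open>i \<in> Basis\<close>, of v] by (intro mult_mono C) auto
    qed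
    also have "(\<Sum>i\<in>Basis. norm v * C i) = (\<Sum>i\<in>Basis. C i) * norm v"
      unfolding sum_distrib_left[symmetric] by (rule mult.commute)
    finally show ?thesis .
  qed
  then show thesis using that[of "\<Sum>i\<in>Basis. C i"] sum_nonneg[of Basis C] C(1) by blast
qed

definition conv :: "('a::euclidean_space \<Rightarrow> complex) \<Rightarrow> ('a \<Rightarrow> complex) \<Rightarrow> 'a \<Rightarrow> complex" where
  "conv f \<psi> x = (\<integral>y. f y * \<psi> (x - y) \<partial>lborel)"

lemma conv_integrand_integrable:
  assumes f: "integrable lborel f" and \<psi>: "test_fn \<psi>"
  shows "integrable lborel (\<lambda>y. f y * \<psi> (x - y))"
proof -
  obtain C R where C: "\<And>x. norm (\<psi> x) \<le> C" using test_function_bounded_support[OF \<psi>] by metis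
  have [measurable]: "f \<in> borel_measurable borel" using f by (auto dest: borel_measurable_integrable)
  have [measurable]: "\<psi> \<in> borel_measurable borel" using test_function_borel[OF \<psi>] .
  show ?thesis
  proof (rule Bochner_Integration.integrable_bound)
    show "integrable lborel (\<lambda>y. norm (f y) * C)" using f by (intro integrable_mult_left integrable_norm)
    show "AE y in lborel. norm (f y * \<psi> (x - y)) \<le> norm (norm (f y) * C)"
    proof (rule AE_I2)
      fix y
      have "norm (f y) * norm (\<psi> (x - y)) \<le> norm (f y) * C" by (intro mult_left_mono C) simp
      then show "norm (f y * \<psi> (x - y)) \<le> norm (norm (f y) * C)" unfolding norm_mult real_norm_def by linarith
    qed
  qed measurable
qed

lemma conv_has_derivative:
  fixes f :: "'a::euclidean_space \<Rightarrow> complex"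
  assumes f: "integrable lborel f" and \<psi>: "test_fn \<psi>"
  shows "(conv f \<psi> has_derivative (\<lambda>v. conv f (iter_deriv [v] \<psi>) x)) (at x)"
proof -
  obtain C where C: "C \<ge> 0" "\<And>v x. norm (iter_deriv [v] \<psi> x) \<le> C * norm v" using test_fn_deriv_bound[OF \<psi>] by blast
  have "((\<lambda>x. \<integral>y. f y * \<psi> (x - y) \<partial>lborel) has_derivative (\<lambda>v. \<integral>y. f y * iter_deriv [v] \<psi> (x - y) \<partial>lborel)) (at x)"
  proof (rule has_derivative_integral(2))
    fix x y :: 'a
    have "((\<lambda>x. x - y) has_derivative (\<lambda>v. v)) (at x)" by (auto intro!: derivative_eq_intros)
    from has_derivative_compose[OF this test_fn_has_derivative[OF \<psi>, of "x - y"]]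
    show "((\<lambda>x. f y * \<psi> (x - y)) has_derivative (\<lambda>v. f y * iter_deriv [v] \<psi> (x - y))) (at x)"
      by (rule has_derivative_mult_right)
    fix v
    have "norm (f y) * norm (iter_deriv [v] \<psi> (x - y)) \<le> norm (f y) * (C * norm v)"
      by (intro mult_left_mono C) simp
    then show "norm (f y * iter_deriv [v] \<psi> (x - y)) \<le> (norm (f y) * C) * norm v"
      unfolding norm_mult by (simp only: mult.assoc)
  next
    show "integrable lborel (\<lambda>y. norm (f y) * C)" using f by (intro integrable_mult_left integrable_norm)
  qed (rule conv_integrand_integrable[OF f \<psi>])
  then show ?thesis unfolding conv_def[abs_def] .
qed

text \<open>All derivatives fall on the smooth factor, and the supports add up.\<close>
lemma conv_test_fn:
  assumes f: "integrable lborel f" and R: "\<And>y. norm y > R \<Longrightarrow> f y = 0" and \<psi>: "test_fn \<psi>"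
  shows "test_fn (conv f \<psi>)"
proof -
  have "smooth (conv f \<psi>)"
  proof (rule smooth_coinduct[of _ "{conv f \<phi> | \<phi>. test_fn \<phi>}"])
    fix g assume "g \<in> {conv f \<phi> | \<phi>. test_fn \<phi>}"
    then obtain \<phi> where g: "g = conv f \<phi>" and \<phi>: "test_fn \<phi>" by blast
    show "\<exists>g'. (\<forall>x. (g has_derivative g' x) (at x)) \<and> (\<forall>v. (\<lambda>x. g' x v) \<in> {conv f \<phi> | \<phi>. test_fn \<phi>})"
      unfolding g
    proof (intro exI[of _ "\<lambda>x v. conv f (iter_deriv [v] \<phi>) x"] conjI allI)
      show "(conv f \<phi> has_derivative (\<lambda>v. conv f (iter_deriv [v] \<phi>) x)) (at x)" for x
        by (rule conv_has_derivative[OF f \<phi>])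
      show "(\<lambda>x. conv f (iter_deriv [v] \<phi>) x) \<in> {conv f \<phi> | \<phi>. test_fn \<phi>}" for v
        using test_function_iter_deriv[OF \<phi>] by blast
    qed
  qed (use \<psi> in blast)
  moreover obtain C R' where R': "\<And>x. norm x > R' \<Longrightarrow> \<psi> x = 0"
    using test_function_bounded_support[OF \<psi>] by metis
  have "supported_in (conv f \<psi>) (cball 0 (R + R'))" unfolding supported_in_def
  proof (intro allI impI)
    fix x :: 'a assume x: "x \<notin> cball 0 (R + R')"
    have "f y * \<psi> (x - y) = 0" for y
    proof (cases "norm y > R")
      case False
      then have "norm (x - y) > R'" using x norm_triangle_ineq2[of x y] by simp
      then show ?thesis using R' by simp
    qed (use R in simp)
    then show "conv f \<psi> x = 0" unfolding conv_def by (simp only: Bochner_Integration.integral_zero)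
  qed
  ultimately show ?thesis unfolding test_function_on_def using compact_cball by blast
qed

lemma fourier_conv:
  fixes f :: "'a::euclidean_space \<Rightarrow> complex"
  assumes f: "integrable lborel f" and \<psi>: "test_fn \<psi>"
  shows "fourier (conv f \<psi>) \<xi> = fourier f \<xi> * fourier \<psi> \<xi>"
proof -
  have [measurable]: "f \<in> borel_measurable borel" using f by (auto dest: borel_measurable_integrable)
  have pm [measurable]: "\<psi> \<in> borel_measurable borel" using test_function_borel[OF \<psi>] .
  let ?k = "\<lambda>y x. cis (- (x \<bullet> \<xi>)) * (f y * \<psi> (x - y))"
  have tr: "integrable lborel k \<longleftrightarrow> integrable lborel (\<lambda>x. k (y + x))" "(\<integral>x. k x \<partial>lborel) = (\<integral>x. k (y + x) \<partial>lborel)"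
    if "k \<in> borel_measurable borel" for k :: "'a \<Rightarrow> 'b::{banach,second_countable_topology}" and y
    using lborel_affine_integral[of 1 k y] that by simp_all
  have km: "case_prod ?k \<in> borel_measurable (lborel \<Otimes>\<^sub>M lborel)"
    unfolding cis_conv_exp by measurable
  have km1: "(\<lambda>x. ?k y x) \<in> borel_measurable borel" for y
    unfolding cis_conv_exp by measurable
  have slice: "integrable lborel (\<lambda>x. ?k y x)" for y
    by (subst tr(1)[OF km1, of _ y]) (auto intro!: cis_integrable integrable_mult_right test_function_integrable[OF \<psi>])
  have "integrable (lborel \<Otimes>\<^sub>M lborel) (case_prod ?k)"
  proof (rule lborel_pair.Fubini_integrable[OF km])
    have "(\<integral>x. norm (?k y x) \<partial>lborel) = norm (f y) * (\<integral>x. norm (\<psi> x) \<partial>lborel)" for y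
      by (subst tr(2)[OF measurable_compose[OF km1 borel_measurable_norm], of _ y]) (auto simp: norm_mult)
    then show "integrable lborel (\<lambda>y. \<integral>x. norm (case (y, x) of (y, x) \<Rightarrow> ?k y x) \<partial>lborel)"
      using f by simp
    show "AE y in lborel. integrable lborel (\<lambda>x. case (y, x) of (y, x) \<Rightarrow> ?k y x)" using slice by simp
  qed
  from lborel_pair.Fubini_integral[OF this]
  have "(\<integral>x. \<integral>y. ?k y x \<partial>lborel \<partial>lborel) = (\<integral>y. \<integral>x. ?k y x \<partial>lborel \<partial>lborel)" .
  moreover have "(\<integral>y. ?k y x \<partial>lborel) = cis (- (x \<bullet> \<xi>)) * conv f \<psi> x" for x
    unfolding conv_def by (rule integral_mult_right_zero)
  moreover have "(\<integral>x. ?k y x \<partial>lborel) = (cis (- (y \<bullet> \<xi>)) * f y) * fourier \<psi> \<xi>" for y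
  proof -
    have "(\<integral>x. ?k y x \<partial>lborel) = (\<integral>x. ?k y (y + x) \<partial>lborel)" by (rule tr(2)[OF km1])
    also have "\<dots> = (\<integral>x. (cis (- (y \<bullet> \<xi>)) * f y) * (cis (- (x \<bullet> \<xi>)) * \<psi> x) \<partial>lborel)"
    proof (rule Bochner_Integration.integral_cong[OF refl])
      fix x
      have "cis (- ((y + x) \<bullet> \<xi>)) = cis (- (y \<bullet> \<xi>)) * cis (- (x \<bullet> \<xi>))" unfolding cis_mult by (simp add: inner_add_left)
      then show "?k y (y + x) = (cis (- (y \<bullet> \<xi>)) * f y) * (cis (- (x \<bullet> \<xi>)) * \<psi> x)" by (simp add: mult_ac)
    qed
    also have "\<dots> = (cis (- (y \<bullet> \<xi>)) * f y) * fourier \<psi> \<xi>" unfolding fourier_def by (rule integral_mult_right_zero)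
    finally show ?thesis .
  qed
  ultimately show ?thesis unfolding fourier_def[of "conv f \<psi>"] by (simp add: fourier_def[of f])
qed

text \<open>The usual family of mollifiers; on the Fourier side it is a dilation.\<close>
lemma test_fn_scaled:
  fixes \<rho> :: "'a::euclidean_space \<Rightarrow> complex"
  assumes \<rho>: "test_fn \<rho>" and \<delta>: "\<delta> > 0"
  defines "\<rho>' \<equiv> \<lambda>x. of_real (1 / \<delta> ^ DIM('a)) * \<rho> ((1 / \<delta>) *\<^sub>R x)"
  shows "test_fn \<rho>'" "fourier \<rho>' \<xi> = fourier \<rho> (\<delta> *\<^sub>R \<xi>)"
proof -
  obtain C R where R: "\<And>x. norm x > R \<Longrightarrow> \<rho> x = 0" using test_function_bounded_support[OF \<rho>] by metis
  have "smooth \<rho>'" unfolding \<rho>'_def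
    by (intro smooth_cmult smooth_compose_linear(2)[OF _ test_function_smooth[OF \<rho>]] bounded_linear_scaleR_right)
  moreover have "supported_in \<rho>' (cball 0 (\<delta> * R))" unfolding supported_in_def
  proof (intro allI impI)
    fix x :: 'a assume "x \<notin> cball 0 (\<delta> * R)"
    then have "norm ((1 / \<delta>) *\<^sub>R x) > R" using \<delta> by (simp add: pos_less_divide_eq mult.commute)
    then show "\<rho>' x = 0" unfolding \<rho>'_def by (simp only: R mult_zero_right)
  qed
  ultimately show "test_fn \<rho>'" unfolding test_function_on_def using compact_cball by blast
  have [measurable]: "\<rho> \<in> borel_measurable borel" using test_function_borel[OF \<rho>] .
  have cm: "(\<lambda>x::'a. cis (- (x \<bullet> \<xi>)) * \<rho>' x) \<in> borel_measurable borel" unfolding cis_conv_exp \<rho>'_def by measurable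
  have "fourier \<rho>' \<xi> = \<bar>\<delta>\<bar> ^ DIM('a) *\<^sub>R (\<integral>x. cis (- ((0 + \<delta> *\<^sub>R x) \<bullet> \<xi>)) * \<rho>' (0 + \<delta> *\<^sub>R x) \<partial>lborel)"
    unfolding fourier_def by (rule lborel_affine_integral(1)[OF _ cm]) (use \<delta> in simp)
  also have "\<dots> = (\<integral>x. \<bar>\<delta>\<bar> ^ DIM('a) *\<^sub>R (cis (- ((0 + \<delta> *\<^sub>R x) \<bullet> \<xi>)) * \<rho>' (0 + \<delta> *\<^sub>R x)) \<partial>lborel)"
    by (rule integral_scaleR_right[symmetric])
  also have "\<dots> = fourier \<rho> (\<delta> *\<^sub>R \<xi>)"
    unfolding fourier_def \<rho>'_def using \<delta> by (intro Bochner_Integration.integral_cong refl) (simp add: scaleR_conv_of_real)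
  finally show "fourier \<rho>' \<xi> = fourier \<rho> (\<delta> *\<^sub>R \<xi>)" .
qed

text \<open>If every test function had integral zero, the constant one would vanish almost everywhere.\<close>
lemma mollifier_exists:
  obtains \<rho> :: "'a::euclidean_space \<Rightarrow> complex" where "test_fn \<rho>" "fourier \<rho> 0 = 1"
proof -
  have "\<exists>\<phi> :: 'a \<Rightarrow> complex. test_fn \<phi> \<and> (\<integral>x. \<phi> x \<partial>lborel) \<noteq> 0"
  proof (rule ccontr)
    assume neg: "\<not> ?thesis"
    have "AE x in lborel. (\<lambda>_::'a. 1::complex) x = 0"
    proof (rule fundamental_lemma_calculus_of_variations)
      fix a b :: 'a
      have "integrable lborel (\<lambda>x. complex_of_real (indicat_real (box a b) x))"
        unfolding complex_of_real_integrable_eq by (intro integrable_real_indicator emeasure_lborel_box_finite) auto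
      moreover have "complex_of_real (indicat_real (box a b) x) = indicator (box a b) x * 1" for x by (auto simp: indicator_def)
      ultimately show "integrable lborel (\<lambda>x. indicator (box a b) x * (1::complex))" by simp
    qed (use neg in auto)
    then have "{x \<in> space (lborel :: 'a measure). \<not> False} \<in> null_sets lborel"
      by (subst AE_iff_null[symmetric]) auto
    then show False by (simp add: null_sets_def)
  qed
  then obtain \<phi> :: "'a \<Rightarrow> complex" where \<phi>: "test_fn \<phi>" "(\<integral>x. \<phi> x \<partial>lborel) \<noteq> 0" by blast
  let ?c = "1 / (\<integral>x. \<phi> x \<partial>lborel)"
  have "fourier (\<lambda>x. ?c * \<phi> x) 0 = ?c * (\<integral>x. \<phi> x \<partial>lborel)"
    unfolding fourier_def by simp
  then show thesis using that[OF test_fn_cmult[OF \<phi>(1), of ?c]] \<phi>(2) by simp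
qed

lemma powr_le_one_plus_power:
  fixes r s :: real assumes "r \<ge> 0" "s \<ge> 0"
  shows "r powr s \<le> 1 + r ^ nat \<lceil>s\<rceil>"
proof (cases "r \<le> 1")
  case True
  then have "r powr s \<le> 1" using assms by (intro powr_le1) auto
  then show ?thesis using assms by (simp add: add_increasing2)
next
  case False
  then have "r powr s \<le> r powr real (nat \<lceil>s\<rceil>)" using assms by (intro powr_mono) (auto simp: real_nat_ceiling_ge)
  also have "\<dots> = r ^ nat \<lceil>s\<rceil>" using False by (simp add: powr_realpow)
  finally show ?thesis by simp
qed

lemma norm_one_plus: "r \<ge> 0 \<Longrightarrow> norm (1 + complex_of_real r) = 1 + r"
  using norm_of_real[of "1 + r", where 'a = complex] by simp

text \<open>This is why truncating before mollifying is harmless in \<open>H\<^sup>s\<close>: multiplication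
  by the transform of a test function absorbs the weight.\<close>
lemma fourier_test_fn_weighted_bound:
  fixes \<eta> :: "'a::euclidean_space \<Rightarrow> complex"
  assumes \<eta>: "test_fn \<eta>" and s: "s \<ge> 0"
  obtains B where "B \<ge> 0" "\<And>\<xi>. (1 + norm \<xi> powr s) * norm (fourier \<eta> \<xi>) \<le> B"
proof -
  let ?N = "nat \<lceil>s\<rceil>"
  obtain M0 M1 where M: "\<And>\<xi>. norm \<xi> ^ 0 * norm (fourier \<eta> \<xi>) \<le> M0" "\<And>\<xi>. norm \<xi> ^ ?N * norm (fourier \<eta> \<xi>) \<le> M1"
    using fourier_test_fn_decay[OF \<eta>] by metis
  have b: "(1 + norm \<xi> powr s) * norm (fourier \<eta> \<xi>) \<le> 2 * M0 + M1" for \<xi>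
  proof -
    have "(1 + norm \<xi> powr s) * norm (fourier \<eta> \<xi>) \<le> (1 + (1 + norm \<xi> ^ ?N)) * norm (fourier \<eta> \<xi>)"
      using powr_le_one_plus_power[of "norm \<xi>" s] s by (intro mult_right_mono add_left_mono) auto
    also have "\<dots> \<le> 2 * M0 + M1" using M(1)[of \<xi>] M(2)[of \<xi>] by (simp add: algebra_simps)
    finally show ?thesis .
  qed
  moreover have "0 \<le> (1 + norm (0::'a) powr s) * norm (fourier \<eta> 0)" by simp
  ultimately show thesis using that order_trans by blast
qed

text \<open>Take \<open>\<eta>\<close> to be a mollification of a truncation of \<open>\<omega>\<close>.
  First the mollifier is chosen, so that its transform \<open>m n\<close> changes the weighted
  transform of \<open>\<omega>\<close> by little; then, with the mollifier fixed, the truncation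
  radius, whose effect is controlled in \<open>L\<^sup>2\<close> without weight. Smoothness comes
  from the mollifier, so the truncation can be sharp.\<close>
lemma mollified_truncation_converges:
  fixes \<omega> :: "'a::euclidean_space \<Rightarrow> complex"
  assumes \<omega>: "\<omega> \<in> L2_space" and D\<omega>: "freq_deriv s \<omega> \<in> L2_space" and s: "s \<ge> 0" and e: "e > 0"
  obtains \<eta> where "test_fn \<eta>"
    "(\<lambda>\<xi>. of_real (1 + norm \<xi> powr s) * (fourier_L2 \<eta> \<xi> - fourier_L2 \<omega> \<xi>)) \<in> L2_space"
    "L2_norm (\<lambda>\<xi>. of_real (1 + norm \<xi> powr s) * (fourier_L2 \<eta> \<xi> - fourier_L2 \<omega> \<xi>)) < e"
proof -
  define w where "w = (\<lambda>\<xi>::'a. complex_of_real (1 + norm \<xi> powr s))"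
  define p where "p = fourier_L2 \<omega>"
  have wm [measurable]: "w \<in> borel_measurable borel" unfolding w_def by measurable
  have p2: "p \<in> L2_space" unfolding p_def by (rule fourier_L2_in_L2[OF \<omega>])
  have pm [measurable]: "p \<in> borel_measurable borel" by (rule L2_measurable[OF p2])
  have wp: "(\<lambda>\<xi>. w \<xi> * p \<xi>) \<in> L2_space"
    using L2_add(1)[OF p2 D\<omega>] by (simp add: w_def p_def freq_deriv_def[abs_def] distrib_right)
  obtain \<rho> :: "'a \<Rightarrow> complex" where \<rho>: "test_fn \<rho>" "fourier \<rho> 0 = 1" by (rule mollifier_exists)
  define m where "m = (\<lambda>n::nat. \<lambda>\<xi>. fourier \<rho> ((1 / real (Suc n)) *\<^sub>R \<xi>))"
  have cont: "continuous_on UNIV (fourier \<rho>)"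
    using fourier_derivative[OF \<rho>(1)] has_derivative_continuous continuous_at_imp_continuous_on by blast
  have [measurable]: "fourier \<rho> \<in> borel_measurable borel" by (rule borel_measurable_continuous_onI[OF cont])
  have mm [measurable]: "m n \<in> borel_measurable borel" for n unfolding m_def by measurable
  define C where "C = (\<integral>x. norm (\<rho> x) \<partial>lborel)"
  have C: "norm (m n \<xi>) \<le> C" for n \<xi> unfolding m_def C_def by (rule fourier_bound)
  have "(\<lambda>n. L2_norm (\<lambda>\<xi>. (w \<xi> * p \<xi>) * (m n \<xi> - 1))) \<longlonglongrightarrow> 0"
  proof (rule L2_dominated_convergence[where g = "\<lambda>\<xi>. of_real (C + 1) * (w \<xi> * p \<xi>)"])
    show "(\<lambda>\<xi>. of_real (C + 1) * (w \<xi> * p \<xi>)) \<in> L2_space" by (rule L2_cmult[OF wp])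
    show "AE \<xi> in lborel. norm ((w \<xi> * p \<xi>) * (m n \<xi> - 1)) \<le> norm (of_real (C + 1) * (w \<xi> * p \<xi>))" for n
    proof (rule AE_I2)
      fix \<xi>
      have "norm (m n \<xi> - 1) \<le> \<bar>C + 1\<bar>" using C[of n \<xi>] norm_triangle_ineq4[of "m n \<xi>" 1] by simp
      then have "norm (w \<xi> * p \<xi>) * norm (m n \<xi> - 1) \<le> norm (w \<xi> * p \<xi>) * \<bar>C + 1\<bar>" by (intro mult_left_mono) auto
      then show "norm ((w \<xi> * p \<xi>) * (m n \<xi> - 1)) \<le> norm (of_real (C + 1) * (w \<xi> * p \<xi>))"
        unfolding norm_mult norm_of_real by (simp only: mult.commute)
    qed
    show "AE \<xi> in lborel. (\<lambda>n. (w \<xi> * p \<xi>) * (m n \<xi> - 1)) \<longlonglongrightarrow> 0"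
    proof (rule AE_I2)
      fix \<xi> :: 'a
      have "(\<lambda>n. (1 / real (Suc n)) *\<^sub>R \<xi>) \<longlonglongrightarrow> 0 *\<^sub>R \<xi>" by (intro tendsto_intros LIMSEQ_Suc[OF lim_1_over_n])
      then have "(\<lambda>n. m n \<xi>) \<longlonglongrightarrow> 1"
        unfolding m_def using continuous_on_tendsto_compose[OF cont, of _ 0 sequentially] \<rho>(2) by simp
      then have "(\<lambda>n. (w \<xi> * p \<xi>) * (m n \<xi> - 1)) \<longlonglongrightarrow> (w \<xi> * p \<xi>) * (1 - 1)" by (intro tendsto_intros)
      then show "(\<lambda>n. (w \<xi> * p \<xi>) * (m n \<xi> - 1)) \<longlonglongrightarrow> 0" by simp
    qed
  qed measurable
  then have "\<forall>\<^sub>F n in sequentially. L2_norm (\<lambda>\<xi>. (w \<xi> * p \<xi>) * (m n \<xi> - 1)) < e / 2"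
    by (rule order_tendstoD(2)) (use e in simp)
  then obtain n where n: "L2_norm (\<lambda>\<xi>. (w \<xi> * p \<xi>) * (m n \<xi> - 1)) < e / 2"
    using eventually_happens'[OF sequentially_bot] by blast
  have t1: "(\<lambda>\<xi>. (w \<xi> * p \<xi>) * (m n \<xi> - 1)) \<in> L2_space"
  proof -
    have "AE \<xi> in lborel. norm (m n \<xi> - 1) \<le> C + 1" using C[of n] norm_triangle_ineq4[of "m n _" 1] 
      by (intro AE_I2) (smt (verit) norm_one)
    moreover have "C + 1 \<ge> 0" using C[of n 0] norm_ge_zero[of "m n 0"] by linarith
    ultimately show ?thesis using L2_multiplier(1)[OF wp, of "\<lambda>\<xi>. m n \<xi> - 1" "C + 1"] by (simp add: mult.commute)
  qed
  define \<rho>' where "\<rho>' = (\<lambda>x. of_real (1 / (1 / real (Suc n)) ^ DIM('a)) * \<rho> ((1 / (1 / real (Suc n))) *\<^sub>R x))"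
  have \<rho>': "test_fn \<rho>'" "fourier \<rho>' \<xi> = m n \<xi>" for \<xi>
    unfolding \<rho>'_def m_def by (rule test_fn_scaled[OF \<rho>(1)], simp)+
  obtain B where B: "B \<ge> 0" "\<And>\<xi>. (1 + norm \<xi> powr s) * norm (m n \<xi>) \<le> B"
    using fourier_test_fn_weighted_bound[OF \<rho>'(1) s] unfolding \<rho>'(2) by blast
  have wB: "AE \<xi> in lborel. norm (w \<xi> * m n \<xi>) \<le> B"
    using B(2) by (intro AE_I2) (simp add: norm_mult w_def norm_one_plus)
  define F where "F = (\<lambda>k::nat. \<lambda>x. indicator (ball 0 (real k)) x * \<omega> x)"
  have F: "F k \<in> L2_space" "integrable lborel (F k)" "(\<lambda>k. L2_norm (\<lambda>x. F k x - \<omega> x)) \<longlonglongrightarrow> 0" for k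
    unfolding F_def by (rule L2_truncation[OF \<omega>])+
  have "(\<lambda>k. B * plancherel_const TYPE('a) * L2_norm (\<lambda>x. F k x - \<omega> x)) \<longlonglongrightarrow> 0"
    using tendsto_mult_right_zero[OF F(3)] .
  then have "\<forall>\<^sub>F k in sequentially. B * plancherel_const TYPE('a) * L2_norm (\<lambda>x. F k x - \<omega> x) < e / 2"
    by (rule order_tendstoD(2)) (use e in simp)
  then obtain k where k: "B * plancherel_const TYPE('a) * L2_norm (\<lambda>x. F k x - \<omega> x) < e / 2"
    using eventually_happens'[OF sequentially_bot] by blast
  let ?G = "fourier_L2 (\<lambda>x. F k x - \<omega> x)"
  have G: "?G \<in> L2_space" by (intro fourier_L2_in_L2 L2_diff(1) F \<omega>)
  have t2: "(\<lambda>\<xi>. (w \<xi> * m n \<xi>) * ?G \<xi>) \<in> L2_space"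
    by (rule L2_multiplier(1)[OF G _ wB B(1)]) measurable
  have "L2_norm (\<lambda>\<xi>. (w \<xi> * m n \<xi>) * ?G \<xi>) \<le> B * L2_norm ?G"
    by (rule L2_multiplier(2)[OF G _ wB B(1)]) measurable
  also have "\<dots> \<le> B * (plancherel_const TYPE('a) * L2_norm (\<lambda>x. F k x - \<omega> x))"
    by (intro mult_left_mono fourier_L2_bound L2_diff(1) F \<omega> B(1))
  finally have n2: "L2_norm (\<lambda>\<xi>. (w \<xi> * m n \<xi>) * ?G \<xi>) < e / 2" using k by (simp add: mult.assoc)
  define \<eta> where "\<eta> = conv (F k) \<rho>'"
  have \<eta>: "test_fn \<eta>" unfolding \<eta>_def by (rule conv_test_fn[OF F(2) _ \<rho>'(1), of "real k"]) (simp add: F_def)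
  note \<eta>2 = test_function_L2[OF \<eta>]
  \<comment> \<open>The two errors, from the mollifier and from the truncation, add up to the total error.\<close>
  have ae: "AE \<xi> in lborel. (w \<xi> * p \<xi>) * (m n \<xi> - 1) + (w \<xi> * m n \<xi>) * ?G \<xi> = w \<xi> * (fourier_L2 \<eta> \<xi> - p \<xi>)"
    using fourier_L2_eq_fourier[OF test_function_integrable[OF \<eta>] \<eta>2] fourier_L2_eq_fourier[OF F(2)[of k] F(1)[of k]] fourier_L2_diff[OF F(1)[of k] \<omega>]
  proof eventually_elim
    case (elim \<xi>)
    have "fourier_L2 \<eta> \<xi> = fourier_L2 (F k) \<xi> * m n \<xi>"
      using elim(1,2) by (simp add: \<eta>_def fourier_conv[OF F(2) \<rho>'(1)] \<rho>'(2))
    then show ?case unfolding elim(3) p_def[symmetric] by (simp add: algebra_simps)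
  qed
  have meas: "(\<lambda>\<xi>. w \<xi> * (fourier_L2 \<eta> \<xi> - p \<xi>)) \<in> borel_measurable borel"
    using L2_measurable[OF fourier_L2_in_L2[OF \<eta>2]] by measurable
  show thesis
  proof (rule that[OF \<eta>])
    show "(\<lambda>\<xi>. of_real (1 + norm \<xi> powr s) * (fourier_L2 \<eta> \<xi> - fourier_L2 \<omega> \<xi>)) \<in> L2_space"
      using L2_cong_AE(1)[OF ae meas L2_add(1)[OF t1 t2]] unfolding w_def p_def .
    have "L2_norm (\<lambda>\<xi>. w \<xi> * (fourier_L2 \<eta> \<xi> - p \<xi>)) < e"
      using L2_cong_AE(2)[OF ae meas L2_add(1)[OF t1 t2]] L2_add(2)[OF t1 t2] n n2 by linarith
    then show "L2_norm (\<lambda>\<xi>. of_real (1 + norm \<xi> powr s) * (fourier_L2 \<eta> \<xi> - fourier_L2 \<omega> \<xi>)) < e"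
      unfolding w_def p_def .
  qed
qed

text \<open>The previous lemma in terms of functions of \<open>x\<close>; the lower bound for the transform
  converts smallness of the transform back.\<close>
lemma test_functions_dense_in_Hs:
  fixes \<omega> :: "'a::euclidean_space \<Rightarrow> complex"
  assumes \<omega>: "\<omega> \<in> L2_space" and D\<omega>: "freq_deriv s \<omega> \<in> L2_space" and s: "s \<ge> 0" and e: "e > 0"
  obtains \<eta> where "test_fn \<eta>" "L2_norm (\<lambda>x. \<eta> x - \<omega> x) < e" "freq_deriv s \<eta> \<in> L2_space"
    "L2_norm (\<lambda>\<xi>. freq_deriv s \<eta> \<xi> - freq_deriv s \<omega> \<xi>) < e"
proof -
  let ?P = "(2 * pi) ^ DIM('a)"
  define K where "K = plancherel_const TYPE('a) / ?P"
  have K: "K \<ge> 0" unfolding K_def by simp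
  \<comment> \<open>The same tolerance serves the function, which costs a factor \<open>K\<close>, and its fractional derivative.\<close>
  define e' where "e' = e / (K + 1)"
  have e': "e' > 0" "K * e' < e" "e' \<le> e" unfolding e'_def using e K by (auto simp: field_simps)
  obtain \<eta> where \<eta>: "test_fn \<eta>"
    and W: "(\<lambda>\<xi>. of_real (1 + norm \<xi> powr s) * (fourier_L2 \<eta> \<xi> - fourier_L2 \<omega> \<xi>)) \<in> L2_space" (is "?W \<in> _")
    and We: "L2_norm (\<lambda>\<xi>. of_real (1 + norm \<xi> powr s) * (fourier_L2 \<eta> \<xi> - fourier_L2 \<omega> \<xi>)) < e'"
    using mollified_truncation_converges[OF \<omega> D\<omega> s e'(1)] .
  note \<eta>2 = test_function_L2[OF \<eta>]
  have nW: "norm (?W \<xi>) = (1 + norm \<xi> powr s) * norm (fourier_L2 \<eta> \<xi> - fourier_L2 \<omega> \<xi>)" for \<xi>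
    unfolding norm_mult norm_of_real by simp
  have "L2_norm (\<lambda>\<xi>. fourier_L2 \<eta> \<xi> - fourier_L2 \<omega> \<xi>) \<le> L2_norm ?W"
  proof (rule L2_dominated(2)[OF _ W])
    show "(\<lambda>\<xi>. fourier_L2 \<eta> \<xi> - fourier_L2 \<omega> \<xi>) \<in> borel_measurable borel"
      by (intro L2_measurable L2_diff(1) fourier_L2_in_L2 \<omega> \<eta>2)
    show "AE \<xi> in lborel. norm (fourier_L2 \<eta> \<xi> - fourier_L2 \<omega> \<xi>) \<le> norm (?W \<xi>)"
      unfolding nW by (intro AE_I2) (simp add: distrib_right)
  qed
  moreover have "L2_norm (fourier_L2 (\<lambda>x. \<eta> x - \<omega> x)) = L2_norm (\<lambda>\<xi>. fourier_L2 \<eta> \<xi> - fourier_L2 \<omega> \<xi>)"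
    by (rule L2_cong_AE(2)[symmetric, OF fourier_L2_diff[OF \<eta>2 \<omega>]])
      (intro L2_measurable L2_diff(1) fourier_L2_in_L2 \<omega> \<eta>2)+
  ultimately have "L2_norm (fourier_L2 (\<lambda>x. \<eta> x - \<omega> x)) \<le> e'" using We by linarith
  then have "plancherel_const TYPE('a) * L2_norm (fourier_L2 (\<lambda>x. \<eta> x - \<omega> x)) \<le> plancherel_const TYPE('a) * e'" by (intro mult_left_mono) auto
  with L2_norm_le_fourier_L2[OF L2_diff(1)[OF \<eta>2 \<omega>]] have "?P * L2_norm (\<lambda>x. \<eta> x - \<omega> x) \<le> plancherel_const TYPE('a) * e'" by linarith
  then have "L2_norm (\<lambda>x. \<eta> x - \<omega> x) \<le> K * e'" unfolding K_def by (simp add: pos_le_divide_eq mult.commute)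
  then have 1: "L2_norm (\<lambda>x. \<eta> x - \<omega> x) < e" using e'(2) by linarith
  have dm: "(\<lambda>\<xi>. freq_deriv s \<eta> \<xi> - freq_deriv s \<omega> \<xi>) \<in> borel_measurable borel"
    by (intro borel_measurable_diff freq_deriv_borel \<eta>2 \<omega>)
  have dae: "AE \<xi> in lborel. norm (freq_deriv s \<eta> \<xi> - freq_deriv s \<omega> \<xi>) \<le> norm (?W \<xi>)"
    unfolding nW freq_deriv_def right_diff_distrib[symmetric] norm_mult
    by (intro AE_I2) (simp add: distrib_right norm_one_plus)
  note D = L2_dominated[OF dm W dae]
  have 2: "freq_deriv s \<eta> \<in> L2_space" using L2_add(1)[OF D(1) D\<omega>] by simp
  show thesis by (rule that[OF \<eta> 1 2]) (use D(2) We e'(3) in linarith)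
qed

text \<open>The conjugate turns the bilinear pairing with a test function into an inner product; the
  constant is the one in the inversion formula.\<close>
lemma frac_laplacian_pairing:
  fixes f :: "'a::euclidean_space \<Rightarrow> complex"
  assumes f: "f \<in> L2_space" and \<eta>: "test_fn \<eta>"
  shows "frac_laplacian s f (\<lambda>x. cnj (\<eta> x)) = L2_inner (freq_deriv s f) (freq_deriv s \<eta>) / (2 * pi) ^ DIM('a)"
proof -
  note \<eta>2 = test_function_L2[OF \<eta>]
  have inv: "inv_fourier (\<lambda>x. cnj (\<eta> x)) \<xi> = cnj (fourier \<eta> \<xi>) / (2 * pi) ^ DIM('a)" for \<xi>
  proof -
    have "(\<integral>x. cis (\<xi> \<bullet> x) * cnj (\<eta> x) \<partial>lborel) = (\<integral>x. cnj (cis (- (x \<bullet> \<xi>)) * \<eta> x) \<partial>lborel)"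
      by (simp add: cis_cnj inner_commute)
    also have "\<dots> = cnj (fourier \<eta> \<xi>)" unfolding fourier_def by (rule Bochner_Integration.integral_cnj)
    finally show ?thesis unfolding inv_fourier_def by simp
  qed
  have cnjm: "cnj \<in> borel_measurable borel" by (intro borel_measurable_continuous_onI continuous_on_cnj continuous_on_id)
  have m1: "(\<lambda>\<xi>. of_real (norm \<xi> powr (2 * s)) * fourier_L2 f \<xi> * cnj (fourier \<eta> \<xi>)) \<in> borel_measurable borel"
    using L2_measurable[OF fourier_L2_in_L2[OF f]] measurable_compose[OF L2_measurable[OF fourier_test_fn_L2[OF \<eta>]] cnjm] by measurable
  have m2: "(\<lambda>\<xi>. freq_deriv s f \<xi> * cnj (freq_deriv s \<eta> \<xi>)) \<in> borel_measurable borel"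
    using freq_deriv_borel[OF f] measurable_compose[OF freq_deriv_borel[OF \<eta>2] cnjm] by measurable
  have "frac_laplacian s f (\<lambda>x. cnj (\<eta> x)) = (\<integral>\<xi>. (of_real (norm \<xi> powr (2 * s)) * fourier_L2 f \<xi> * cnj (fourier \<eta> \<xi>)) / (2 * pi) ^ DIM('a) \<partial>lborel)"
    unfolding frac_laplacian_def inv by simp
  also have "\<dots> = (\<integral>\<xi>. of_real (norm \<xi> powr (2 * s)) * fourier_L2 f \<xi> * cnj (fourier \<eta> \<xi>) \<partial>lborel) / (2 * pi) ^ DIM('a)"
    by (rule integral_divide_zero)
  also have "(\<integral>\<xi>. of_real (norm \<xi> powr (2 * s)) * fourier_L2 f \<xi> * cnj (fourier \<eta> \<xi>) \<partial>lborel) = L2_inner (freq_deriv s f) (freq_deriv s \<eta>)"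
    unfolding L2_inner_def
  proof (rule integral_cong_AE)
    show "AE \<xi> in lborel. of_real (norm \<xi> powr (2 * s)) * fourier_L2 f \<xi> * cnj (fourier \<eta> \<xi>) = freq_deriv s f \<xi> * cnj (freq_deriv s \<eta> \<xi>)"
      using fourier_L2_eq_fourier[OF test_function_integrable[OF \<eta>] \<eta>2]
    proof eventually_elim
      case (elim \<xi>)
      have "norm \<xi> powr (2 * s) = norm \<xi> powr s * norm \<xi> powr s" using powr_add[of "norm \<xi>" s s] by simp
      then show ?case unfolding freq_deriv_def elim by (simp add: mult_ac)
    qed
  qed (use m1 m2 in simp_all)
  finally show ?thesis .
qed

section \<open>Weak second derivatives of scalar functions\<close>

lemma has_vector_derivative_of_quotient:
  fixes g :: "real \<Rightarrow> complex"
  assumes "((\<lambda>\<tau>. norm ((g \<tau> - g t) / of_real (\<tau> - t) - d)) \<longlongrightarrow> 0) (at t within S)"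
  shows "(g has_vector_derivative d) (at t within S)"
proof -
  have "((\<lambda>\<tau>. norm ((g \<tau> - g t - (\<tau> - t) *\<^sub>R d) /\<^sub>R norm (\<tau> - t))) \<longlongrightarrow> 0) (at t within S)"
  proof (rule Lim_transform_eventually[OF assms])
    have "\<forall>\<^sub>F \<tau> in at t within S. \<tau> \<noteq> t" by (simp add: eventually_at_filter)
    then show "\<forall>\<^sub>F \<tau> in at t within S. norm ((g \<tau> - g t) / of_real (\<tau> - t) - d) = norm ((g \<tau> - g t - (\<tau> - t) *\<^sub>R d) /\<^sub>R norm (\<tau> - t))"
    proof eventually_elim
      case (elim \<tau>)
      have "(g \<tau> - g t) / of_real (\<tau> - t) - d = (g \<tau> - g t - (\<tau> - t) *\<^sub>R d) / of_real (\<tau> - t)"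
        using elim by (simp add: scaleR_conv_of_real diff_divide_distrib flip: of_real_diff)
      then show ?case by (simp only: norm_divide norm_scaleR norm_of_real norm_inverse real_norm_def abs_inverse abs_abs) (simp only: divide_inverse mult.commute)
    qed
  qed
  then have "((\<lambda>\<tau>. (g \<tau> - g t - (\<tau> - t) *\<^sub>R d) /\<^sub>R norm (\<tau> - t)) \<longlongrightarrow> 0) (at t within S)"
    by (rule tendsto_norm_zero_cancel)
  then show ?thesis
    unfolding has_vector_derivative_def has_derivative_at_within by (simp add: bounded_linear_scaleR_left)
qed

lemma smooth_real_has_vector_derivative:
  fixes \<theta> :: "real \<Rightarrow> complex"
  assumes "smooth \<theta>"
  shows "(\<theta> has_vector_derivative iter_deriv [1] \<theta> t) (at t within S)"
proof -
  have d: "(\<theta> has_derivative (\<lambda>v. iter_deriv [v] \<theta> t)) (at t)" by (rule smooth_has_derivative[OF assms])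
  have eq: "(\<lambda>v. iter_deriv [v] \<theta> t) = (\<lambda>v. v *\<^sub>R iter_deriv [1] \<theta> t)"
  proof
    fix v
    show "iter_deriv [v] \<theta> t = v *\<^sub>R iter_deriv [1] \<theta> t"
      using linear_scale[OF has_derivative_linear[OF d], of v 1] unfolding real_scaleR_def mult_1_right .
  qed
  show ?thesis
    unfolding has_vector_derivative_def using has_derivative_at_withinI[OF d[unfolded eq]] .
qed

text \<open>In one dimension a distributional equation \<open>g'' = - F\<close> with continuous
  \<open>F\<close> holds classically. One integration by parts shows that \<open>h\<close> plus
  the primitive of \<open>F\<close> is orthogonal to derivatives of test functions. A difference
  of two steps at \<open>p\<close> and \<open>q\<close> has as derivative a difference of two
  approximate Dirac masses, so the function has equal values at \<open>p\<close> and
  \<open>q\<close>.\<close>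
lemma weak_second_derivative:
  fixes g h F :: "real \<Rightarrow> complex"
  assumes T: "T > 0"
    and g: "\<And>t. t \<in> {0..T} \<Longrightarrow> (g has_vector_derivative h t) (at t within {0..T})"
    and h: "continuous_on {0..T} h" and F: "continuous_on {0..T} F"
    and weak: "\<And>\<theta>. test_function_on {0<..<T} \<theta> \<Longrightarrow> integral {0..T} (\<lambda>t. iter_deriv [1, 1] \<theta> t * g t + \<theta> t * F t) = 0"
    and t: "t \<in> {0..T}"
  shows "h t = h 0 - integral {0..t} F"
proof -
  define \<Phi> where "\<Phi> = (\<lambda>t. h t + integral {0..t} F)"
  have Gd: "((\<lambda>t. integral {0..t} F) has_vector_derivative F t) (at t within {0..T})" if "t \<in> {0..T}" for t
    by (rule integral_has_vector_derivative[OF F that])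
  have Gc: "continuous_on {0..T} (\<lambda>t. integral {0..t} F)"
    by (rule continuous_on_vector_derivative[OF Gd])
  have gc: "continuous_on {0..T} g" by (rule continuous_on_vector_derivative[OF g])
  have \<Phi>c: "continuous_on {0..T} \<Phi>" unfolding \<Phi>_def by (intro continuous_intros h Gc)
  have zero: "integral {0..T} (\<lambda>t. iter_deriv [1] \<theta> t * \<Phi> t) = 0" if \<theta>: "test_function_on {0<..<T} \<theta>" for \<theta>
  proof -
    note sm = test_function_smooth[OF \<theta>]
    have sm': "smooth (iter_deriv [1] \<theta>)" by (rule smooth_iter_deriv[OF sm])
    have c: "continuous_on {0..T} \<theta>" "continuous_on {0..T} (iter_deriv [1] \<theta>)" "continuous_on {0..T} (iter_deriv [1,1] \<theta>)"
      using smooth_continuous_on smooth_iter_deriv sm by blast+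
    have z: "\<theta> 0 = 0" "\<theta> T = 0" "iter_deriv [1] \<theta> 0 = 0" "iter_deriv [1] \<theta> T = 0"
    proof -
      have "\<phi> 0 = 0 \<and> \<phi> T = 0" if "test_function_on {0<..<T} \<phi>" for \<phi>
        using that by (auto simp: test_function_on_def supported_in_def)
      from this[OF \<theta>] this[OF test_function_iter_deriv[OF \<theta>]]
      show "\<theta> 0 = 0" "\<theta> T = 0" "iter_deriv [1] \<theta> 0 = 0" "iter_deriv [1] \<theta> T = 0" by blast+
    qed
    \<comment> \<open>The primitive \<open>?W\<close> vanishes at both endpoints and collects both integrations by parts.\<close>
    let ?W = "\<lambda>t. iter_deriv [1] \<theta> t * g t + \<theta> t * integral {0..t} F"
    let ?W' = "\<lambda>t. (iter_deriv [1,1] \<theta> t * g t + \<theta> t * F t) + iter_deriv [1] \<theta> t * \<Phi> t"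
    have "(?W' has_integral (?W T - ?W 0)) {0..T}"
    proof (rule fundamental_theorem_of_calculus)
      show "0 \<le> T" using T by simp
      fix t assume t: "t \<in> {0..T}"
      have d2: "(iter_deriv [1] \<theta> has_vector_derivative iter_deriv [1,1] \<theta> t) (at t within {0..T})"
        using smooth_real_has_vector_derivative[OF sm'] by simp
      show "(?W has_vector_derivative ?W' t) (at t within {0..T})"
        by (rule has_vector_derivative_eq_rhs[OF has_vector_derivative_add[OF has_vector_derivative_mult[OF d2 g[OF t]] 
             has_vector_derivative_mult[OF smooth_real_has_vector_derivative[OF sm] Gd[OF t]]]])
          (simp add: \<Phi>_def algebra_simps del: iter_deriv.simps)
    qed
    then have "integral {0..T} ?W' = 0" using z by (simp add: integral_unique del: iter_deriv.simps)
    moreover have "integral {0..T} ?W' = integral {0..T} (\<lambda>t. iter_deriv [1,1] \<theta> t * g t + \<theta> t * F t) + integral {0..T} (\<lambda>t. iter_deriv [1] \<theta> t * \<Phi> t)"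
      by (intro Henstock_Kurzweil_Integration.integral_add integrable_continuous_interval continuous_on_add continuous_on_mult c gc F \<Phi>c)
    ultimately show ?thesis using weak[OF \<theta>] by simp
  qed
  obtain S \<beta> :: "real \<Rightarrow> real" where S: "smooth S" "smooth \<beta>" "\<And>t. (S has_real_derivative \<beta> t) (at t)"
    "\<And>t. \<beta> t \<ge> 0" "\<And>t. t \<notin> {0..1} \<Longrightarrow> \<beta> t = 0" "\<And>t. t \<le> 0 \<Longrightarrow> S t = 0" "\<And>t. t \<ge> 1 \<Longrightarrow> S t = 1"
    using smooth_step_exists by metis
  have const: "\<Phi> p = \<Phi> q" if pq: "0 < p" "p < q" "q < T" for p q
  proof -
    have bound: "norm (\<Phi> p - \<Phi> q) \<le> 2 * e" if e: "e > 0" for e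
    proof -
      have near: "\<exists>d>0. \<forall>t\<in>{0..T}. dist t r < d \<longrightarrow> dist (\<Phi> t) (\<Phi> r) < e" if "r \<in> {0..T}" for r
        using \<Phi>c e that unfolding continuous_on_iff by blast
      have "p \<in> {0..T}" "q \<in> {0..T}" using pq by auto
      then obtain d1 d2 where d: "d1 > 0" "\<And>t. t \<in> {0..T} \<Longrightarrow> dist t p < d1 \<Longrightarrow> dist (\<Phi> t) (\<Phi> p) < e"
        "d2 > 0" "\<And>t. t \<in> {0..T} \<Longrightarrow> dist t q < d2 \<Longrightarrow> dist (\<Phi> t) (\<Phi> q) < e"
        using near[of p] near[of q] by blast
      \<comment> \<open>Small enough for both oscillations and for the second step to fit into the time interval.\<close>
      define \<delta> where "\<delta> = min (min (d1 / 2) (d2 / 2)) ((T - q) / 2)"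
      have \<delta>: "\<delta> > 0" "\<delta> < d1" "\<delta> < d2" "q + \<delta> < T" unfolding \<delta>_def using d pq by (auto simp: min_def field_simps)
      define \<beta>' where "\<beta>' = (\<lambda>r t. \<beta> ((t - r) / \<delta>) / \<delta>)"
      have Sd: "((\<lambda>t. S ((t - r) / \<delta>)) has_real_derivative \<beta>' r t) (at t within X)" for r t X
      proof -
        have "((\<lambda>t. (t - r) / \<delta>) has_real_derivative 1 / \<delta>) (at t)" using \<delta>(1) by (auto intro!: derivative_eq_intros)
        from DERIV_chain2[OF S(3) this] show ?thesis unfolding \<beta>'_def by (auto intro: has_field_derivative_at_within)
      qed
      have S_smooth: "smooth (\<lambda>t. complex_of_real (S ((t - r) / \<delta>)))" for r
      proof -
        have "bounded_linear (\<lambda>t::real. t / \<delta>)" by (rule bounded_linear_divide)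
        from smooth_compose_linear(2)[OF this smooth_translate(2)[OF S(1), of "- r / \<delta>"]]
        have "smooth (\<lambda>t. S ((t - r) / \<delta>))" by (simp add: diff_divide_distrib)
        from smooth_linear_compose[OF bounded_linear_of_real this] show ?thesis .
      qed
      define \<theta> where "\<theta> = (\<lambda>t. complex_of_real (S ((t - p) / \<delta>)) + (- 1) * complex_of_real (S ((t - q) / \<delta>)))"
      have sm: "smooth \<theta>" unfolding \<theta>_def by (intro smooth_add smooth_cmult S_smooth)
      have "supported_in \<theta> {p..q + \<delta>}" unfolding supported_in_def
      proof (intro allI impI)
        fix t assume "t \<notin> {p..q + \<delta>}"
        then consider "t < p" | "t > q + \<delta>" by force
        then show "\<theta> t = 0"
        proof cases
          case 1
          then have "(t - p) / \<delta> \<le> 0" "(t - q) / \<delta> \<le> 0" using pq \<delta> by (auto simp: divide_le_0_iff)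
          then show ?thesis by (simp add: \<theta>_def S)
        next
          case 2
          then have "(t - p) / \<delta> \<ge> 1" "(t - q) / \<delta> \<ge> 1" using pq \<delta> by (auto simp: le_divide_eq)
          then show ?thesis by (simp add: \<theta>_def S)
        qed
      qed
      moreover have "{p..q + \<delta>} \<subseteq> {0<..<T}" using pq \<delta> by auto
      ultimately have \<theta>: "test_function_on {0<..<T} \<theta>"
        unfolding test_function_on_def using sm compact_Icc by blast
      have \<theta>': "iter_deriv [1] \<theta> t = of_real (\<beta>' p t) - of_real (\<beta>' q t)" for t
      proof -
        have "(\<theta> has_vector_derivative (of_real (\<beta>' p t) + (- 1) * of_real (\<beta>' q t))) (at t)"
          unfolding \<theta>_def using Sd[of p t UNIV] Sd[of q t UNIV]
          by (intro has_vector_derivative_add has_vector_derivative_mult_right has_vector_derivative_of_real)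
            (simp_all add: has_real_derivative_iff_has_vector_derivative)
        from vector_derivative_unique_at[OF smooth_real_has_vector_derivative[OF sm] this] show ?thesis by simp
      qed
      have \<beta>c: "continuous_on X (\<beta>' r)" for r X
      proof -
        have "continuous_on UNIV \<beta>" by (rule smooth_continuous_on[OF S(2)])
        then show ?thesis unfolding \<beta>'_def using \<delta>(1) by (auto intro!: continuous_intros intro: continuous_on_compose2)
      qed
      have \<beta>nn: "\<beta>' r t \<ge> 0" for r t unfolding \<beta>'_def using S(4) \<delta>(1) by simp
      have one: "(\<beta>' r has_integral 1) {0..T}" if "r > 0" "r + \<delta> < T" for r
      proof -
        have "(\<beta>' r has_integral (S ((T - r) / \<delta>) - S ((0 - r) / \<delta>))) {0..T}"
          using Sd T by (intro fundamental_theorem_of_calculus) (auto simp: has_real_derivative_iff_has_vector_derivative)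
        moreover have "(T - r) / \<delta> \<ge> 1" "(0 - r) / \<delta> \<le> 0" using that \<delta>(1) by (auto simp: le_divide_eq divide_le_0_iff)
        ultimately show ?thesis by (simp add: S)
      qed
      have int: "(\<lambda>t. complex_of_real (\<beta>' r t) * \<Phi> t) integrable_on {0..T}" for r
        by (intro integrable_continuous_interval continuous_intros \<beta>c \<Phi>c)
      have close: "norm (integral {0..T} (\<lambda>t. complex_of_real (\<beta>' r t) * \<Phi> t) - \<Phi> r) \<le> e"
        if r: "r > 0" "r + \<delta> < T" and near: "\<And>t. t \<in> {0..T} \<Longrightarrow> dist t r \<le> \<delta> \<Longrightarrow> dist (\<Phi> t) (\<Phi> r) < e" for r
      proof -
        have "((\<lambda>t. complex_of_real (\<beta>' r t) * \<Phi> r) has_integral (1 * \<Phi> r)) {0..T}"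
          using has_integral_mult_left[OF has_integral_of_real[OF one[OF r]], of "\<Phi> r"] by simp
        then have I1: "integral {0..T} (\<lambda>t. complex_of_real (\<beta>' r t) * \<Phi> r) = 1 * \<Phi> r" by (rule integral_unique)
        have "integral {0..T} (\<lambda>t. complex_of_real (\<beta>' r t) * \<Phi> t) - \<Phi> r
           = integral {0..T} (\<lambda>t. complex_of_real (\<beta>' r t) * \<Phi> t - complex_of_real (\<beta>' r t) * \<Phi> r)"
          unfolding Henstock_Kurzweil_Integration.integral_diff[OF int integrable_continuous_interval[OF continuous_on_mult[OF continuous_on_of_real[OF \<beta>c] continuous_on_const]]] I1 mult_1 ..
        also have "norm \<dots> \<le> integral {0..T} (\<lambda>t. \<beta>' r t * e)"
        proof (rule integral_norm_bound_integral)
          show "(\<lambda>t. complex_of_real (\<beta>' r t) * \<Phi> t - complex_of_real (\<beta>' r t) * \<Phi> r) integrable_on {0..T}"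
            by (intro integrable_continuous_interval continuous_intros \<beta>c \<Phi>c)
          show "(\<lambda>t. \<beta>' r t * e) integrable_on {0..T}"
            by (intro integrable_continuous_interval continuous_intros \<beta>c)
          fix t assume t: "t \<in> {0..T}"
          show "norm (complex_of_real (\<beta>' r t) * \<Phi> t - complex_of_real (\<beta>' r t) * \<Phi> r) \<le> \<beta>' r t * e"
          proof (cases "(t - r) / \<delta> \<in> {0..1}")
            case True
            then have "dist t r \<le> \<delta>" using \<delta>(1) by (auto simp: dist_real_def field_simps)
            from near[OF t this] have "norm (\<Phi> t - \<Phi> r) \<le> e" by (simp add: dist_norm)
            from mult_left_mono[OF this \<beta>nn[of r t]] show ?thesis
              unfolding right_diff_distrib[symmetric] norm_mult norm_of_real using \<beta>nn[of r t] by simp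
          next
            case False
            then have "\<beta>' r t = 0" using S(5) by (simp add: \<beta>'_def)
            then show ?thesis by simp
          qed
        qed
        also have "\<dots> = 1 * e" by (rule integral_unique[OF has_integral_mult_left[OF one[OF r]]])
        finally show ?thesis by simp
      qed
      have "integral {0..T} (\<lambda>t. complex_of_real (\<beta>' p t) * \<Phi> t) - integral {0..T} (\<lambda>t. complex_of_real (\<beta>' q t) * \<Phi> t) = 0"
        using zero[OF \<theta>] unfolding \<theta>' left_diff_distrib Henstock_Kurzweil_Integration.integral_diff[OF int int] .
      moreover have "norm (integral {0..T} (\<lambda>t. complex_of_real (\<beta>' p t) * \<Phi> t) - \<Phi> p) \<le> e"
        by (rule close) (use pq \<delta> d(2) in auto)
      moreover have "norm (integral {0..T} (\<lambda>t. complex_of_real (\<beta>' q t) * \<Phi> t) - \<Phi> q) \<le> e"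
        by (rule close) (use pq \<delta> d(4) in auto)
      ultimately show ?thesis
        using norm_triangle_ineq4[of "integral {0..T} (\<lambda>t. complex_of_real (\<beta>' q t) * \<Phi> t) - \<Phi> q" "integral {0..T} (\<lambda>t. complex_of_real (\<beta>' p t) * \<Phi> t) - \<Phi> p"]
        by (simp add: algebra_simps)
    qed
    then have "norm (\<Phi> p - \<Phi> q) \<le> 0 + e" if "e > 0" for e using bound[of "e / 2"] that by simp
    then have "norm (\<Phi> p - \<Phi> q) \<le> 0" by (rule field_le_epsilon)
    then show ?thesis by simp
  qed
  define c where "c = \<Phi> (T / 2)"
  have inner: "\<Phi> t = c" if "t \<in> {0<..<T}" for t
  proof (cases t "T / 2" rule: linorder_cases)
    case less
    have "\<Phi> t = \<Phi> (T / 2)" by (rule const[OF _ less]) (use that T in auto)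
    then show ?thesis by (simp only: c_def)
  next
    case greater
    have "\<Phi> (T / 2) = \<Phi> t" by (rule const[OF _ greater]) (use that T in auto)
    then show ?thesis by (simp only: c_def)
  qed (simp only: c_def)
  have "\<Phi> t = c" if "t \<in> {0..T}" for t
  proof (rule continuous_constant_on_closure[of "{0<..<T}"])
    show "continuous_on (closure {0<..<T}) \<Phi>" using \<Phi>c T by (simp add: closure_greaterThanLessThan)
    show "t \<in> closure {0<..<T}" using that T by (simp add: closure_greaterThanLessThan)
  qed (use inner in auto)
  from this[OF t] this[of 0] T show ?thesis by (simp add: \<Phi>_def algebra_simps)
qed

section \<open>Continuous curves of square integrable functions\<close>

abbreviation L2_continuous :: "real \<Rightarrow> (real \<Rightarrow> 'a::euclidean_space \<Rightarrow> complex) \<Rightarrow> bool" where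
  "L2_continuous T f \<equiv> continuous_into T L2_space L2_norm f"

lemma L2_continuous_mem: "L2_continuous T f \<Longrightarrow> t \<in> {0..T} \<Longrightarrow> f t \<in> L2_space"
  by (simp add: continuous_into_def)

lemma L2_continuous_lim:
  "L2_continuous T f \<Longrightarrow> t \<in> {0..T} \<Longrightarrow> ((\<lambda>\<tau>. L2_norm (\<lambda>x. f \<tau> x - f t x)) \<longlongrightarrow> 0) (at t within {0..T})"
  by (simp add: continuous_into_def)

lemma eventually_within_Icc: "\<forall>\<^sub>F \<tau> in at t within {0..T}. \<tau> \<in> {0..(T::real)}"
  by (auto simp: eventually_at_filter)

text \<open>Continuity follows from any modulus that tends to zero.\<close>
lemma L2_continuousI:
  assumes "\<And>t. t \<in> {0..T} \<Longrightarrow> f t \<in> L2_space"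
    and "\<And>t. t \<in> {0..T} \<Longrightarrow> (G t \<longlongrightarrow> 0) (at t within {0..T})"
    and "\<And>t \<tau>. t \<in> {0..T} \<Longrightarrow> \<tau> \<in> {0..T} \<Longrightarrow> L2_norm (\<lambda>x. f \<tau> x - f t x) \<le> G t \<tau>"
  shows "L2_continuous T f"
  unfolding continuous_into_def
proof (intro ballI conjI assms(1))
  fix t assume t: "t \<in> {0..T}"
  show "((\<lambda>\<tau>. L2_norm (\<lambda>x. f \<tau> x - f t x)) \<longlongrightarrow> 0) (at t within {0..T})"
  proof (rule Lim_null_comparison[OF _ assms(2)[OF t]])
    show "\<forall>\<^sub>F \<tau> in at t within {0..T}. norm (L2_norm (\<lambda>x. f \<tau> x - f t x)) \<le> G t \<tau>"
      using eventually_within_Icc by eventually_elim (use assms(3)[OF t] in simp)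
  qed
qed

lemma L2_continuous_const: "f \<in> L2_space \<Longrightarrow> L2_continuous T (\<lambda>_. f)"
  by (simp add: continuous_into_def)

lemma L2_continuous_diff:
  assumes f: "L2_continuous T f" and g: "L2_continuous T g"
  shows "L2_continuous T (\<lambda>t x. f t x - g t x)"
proof (rule L2_continuousI)
  show "t \<in> {0..T} \<Longrightarrow> (\<lambda>x. f t x - g t x) \<in> L2_space" for t
    by (intro L2_diff(1) L2_continuous_mem[OF f] L2_continuous_mem[OF g])
  show "((\<lambda>\<tau>. L2_norm (\<lambda>x. f \<tau> x - f t x) + L2_norm (\<lambda>x. g \<tau> x - g t x)) \<longlongrightarrow> 0) (at t within {0..T})" if "t \<in> {0..T}" for t
    using tendsto_add[OF L2_continuous_lim[OF f that] L2_continuous_lim[OF g that]] by simp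
  fix t \<tau> assume t: "t \<in> {0..T}" "\<tau> \<in> {0..T}"
  have "(\<lambda>x. (f \<tau> x - g \<tau> x) - (f t x - g t x)) = (\<lambda>x. (f \<tau> x - f t x) - (g \<tau> x - g t x))" by (rule ext) simp
  then show "L2_norm (\<lambda>x. (f \<tau> x - g \<tau> x) - (f t x - g t x)) \<le> L2_norm (\<lambda>x. f \<tau> x - f t x) + L2_norm (\<lambda>x. g \<tau> x - g t x)"
    using L2_diff(2)[OF L2_diff(1)[OF L2_continuous_mem[OF f t(2)] L2_continuous_mem[OF f t(1)]] L2_diff(1)[OF L2_continuous_mem[OF g t(2)] L2_continuous_mem[OF g t(1)]]]
    by simp
qed

lemma L2_continuous_multiplier:
  assumes f: "L2_continuous T f" and m: "m \<in> borel_measurable borel" "AE x in lborel. norm (m x) \<le> C" "C \<ge> 0"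
  shows "L2_continuous T (\<lambda>t x. m x * f t x)"
proof (rule L2_continuousI)
  show "t \<in> {0..T} \<Longrightarrow> (\<lambda>x. m x * f t x) \<in> L2_space" for t
    by (intro L2_multiplier(1)[OF _ m] L2_continuous_mem[OF f])
  show "((\<lambda>\<tau>. C * L2_norm (\<lambda>x. f \<tau> x - f t x)) \<longlongrightarrow> 0) (at t within {0..T})" if "t \<in> {0..T}" for t
    using tendsto_mult_right_zero[OF L2_continuous_lim[OF f that]] .
  fix t \<tau> assume t: "t \<in> {0..T}" "\<tau> \<in> {0..T}"
  show "L2_norm (\<lambda>x. m x * f \<tau> x - m x * f t x) \<le> C * L2_norm (\<lambda>x. f \<tau> x - f t x)"
    unfolding right_diff_distrib[symmetric]
    by (rule L2_multiplier(2)[OF L2_diff(1)[OF L2_continuous_mem[OF f t(2)] L2_continuous_mem[OF f t(1)]] m])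
qed

lemma L2_continuous_norm:
  assumes f: "L2_continuous T f"
  shows "continuous_on {0..T} (\<lambda>t. L2_norm (f t))"
  unfolding continuous_on_def
proof
  fix t assume t: "t \<in> {0..T}"
  have "((\<lambda>\<tau>. L2_norm (f \<tau>) - L2_norm (f t)) \<longlongrightarrow> 0) (at t within {0..T})"
  proof (rule Lim_null_comparison[OF _ L2_continuous_lim[OF f t]])
    show "\<forall>\<^sub>F \<tau> in at t within {0..T}. norm (L2_norm (f \<tau>) - L2_norm (f t)) \<le> L2_norm (\<lambda>x. f \<tau> x - f t x)"
      using eventually_within_Icc
    proof eventually_elim
      case (elim \<tau>)
      show ?case
        using L2_norm_triangle_diff[OF L2_continuous_mem[OF f elim] L2_continuous_mem[OF f t]]
          L2_norm_triangle_diff[OF L2_continuous_mem[OF f t] L2_continuous_mem[OF f elim]] L2_norm_minus_commute[of "f t" "f \<tau>"] by simp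
    qed
  qed
  then show "((\<lambda>t. L2_norm (f t)) \<longlongrightarrow> L2_norm (f t)) (at t within {0..T})" by (rule LIM_zero_cancel)
qed

lemma L2_continuous_bounded:
  assumes f: "L2_continuous T f"
  obtains M where "M \<ge> 0" "\<And>t. t \<in> {0..T} \<Longrightarrow> L2_norm (f t) \<le> M"
proof -
  have "bounded ((\<lambda>t. L2_norm (f t)) ` {0..T})"
    by (intro compact_imp_bounded compact_continuous_image L2_continuous_norm[OF f] compact_Icc)
  then obtain M where "M > 0" "\<And>t. t \<in> {0..T} \<Longrightarrow> norm (L2_norm (f t)) \<le> M" unfolding bounded_pos by blast
  then show thesis using that[of M] by simp
qed

text \<open>Joint continuity in two independent times is what the kernel in the energy argument needs.\<close>
lemma L2_inner_continuous_two:
  assumes f: "L2_continuous T f" and g: "L2_continuous T g"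
  shows "continuous_on ({0..T} \<times> {0..T}) (\<lambda>(r, t). L2_inner (f r) (g t))"
  unfolding continuous_on_def
proof (clarify)
  fix r t assume rt: "r \<in> {0..T}" "t \<in> {0..T}"
  obtain M where M: "M \<ge> 0" "\<And>t. t \<in> {0..T} \<Longrightarrow> L2_norm (g t) \<le> M" using L2_continuous_bounded[OF g] by blast
  let ?F = "at (r, t) within {0..T} \<times> {0..T}"
  have c1: "((\<lambda>z. L2_norm (\<lambda>x. f (fst z) x - f r x)) \<longlongrightarrow> 0) ?F"
  proof -
    have "continuous_on {0..T} (\<lambda>\<tau>. L2_norm (\<lambda>x. f \<tau> x - f r x))"
      by (rule L2_continuous_norm[OF L2_continuous_diff[OF f L2_continuous_const[OF L2_continuous_mem[OF f rt(1)]]]])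
    then have "continuous_on ({0..T} \<times> {0..T}) (\<lambda>z. L2_norm (\<lambda>x. f (fst z) x - f r x))"
      by (rule continuous_on_compose2) (auto intro!: continuous_intros)
    then show ?thesis using rt unfolding continuous_on_def by (force dest: bspec[of _ _ "(r, t)"])
  qed
  have c2: "((\<lambda>z. L2_norm (\<lambda>x. g (snd z) x - g t x)) \<longlongrightarrow> 0) ?F"
  proof -
    have "continuous_on {0..T} (\<lambda>\<tau>. L2_norm (\<lambda>x. g \<tau> x - g t x))"
      by (rule L2_continuous_norm[OF L2_continuous_diff[OF g L2_continuous_const[OF L2_continuous_mem[OF g rt(2)]]]])
    then have "continuous_on ({0..T} \<times> {0..T}) (\<lambda>z. L2_norm (\<lambda>x. g (snd z) x - g t x))"
      by (rule continuous_on_compose2) (auto intro!: continuous_intros)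
    then show ?thesis using rt unfolding continuous_on_def by (force dest: bspec[of _ _ "(r, t)"])
  qed
  have "((\<lambda>z. L2_inner (f (fst z)) (g (snd z)) - L2_inner (f r) (g t)) \<longlongrightarrow> 0) ?F"
  proof (rule Lim_null_comparison)
    show "((\<lambda>z. L2_norm (\<lambda>x. f (fst z) x - f r x) * M + L2_norm (f r) * L2_norm (\<lambda>x. g (snd z) x - g t x)) \<longlongrightarrow> 0) ?F"
      using tendsto_add[OF tendsto_mult_left_zero[OF c1, of M] tendsto_mult_right_zero[OF c2, of "L2_norm (f r)"]] by simp
    have "\<forall>\<^sub>F z in ?F. z \<in> {0..T} \<times> {0..T}" unfolding eventually_at_filter by (intro always_eventually) blast
    then show "\<forall>\<^sub>F z in ?F. norm (L2_inner (f (fst z)) (g (snd z)) - L2_inner (f r) (g t)) \<le> L2_norm (\<lambda>x. f (fst z) x - f r x) * M + L2_norm (f r) * L2_norm (\<lambda>x. g (snd z) x - g t x)"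
    proof eventually_elim
      case (elim z)
      then have z: "fst z \<in> {0..T}" "snd z \<in> {0..T}" by auto
      note mem = L2_continuous_mem[OF f z(1)] L2_continuous_mem[OF f rt(1)] L2_continuous_mem[OF g z(2)] L2_continuous_mem[OF g rt(2)]
      have "L2_inner (f (fst z)) (g (snd z)) - L2_inner (f r) (g t) = L2_inner (\<lambda>x. f (fst z) x - f r x) (g (snd z)) + L2_inner (f r) (\<lambda>x. g (snd z) x - g t x)"
        by (simp add: L2_inner_diff_left L2_inner_diff_right mem)
      also have "norm \<dots> \<le> L2_norm (\<lambda>x. f (fst z) x - f r x) * L2_norm (g (snd z)) + L2_norm (f r) * L2_norm (\<lambda>x. g (snd z) x - g t x)"
        by (intro norm_triangle_mono L2_inner_bound L2_diff(1) mem)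
      also have "\<dots> \<le> L2_norm (\<lambda>x. f (fst z) x - f r x) * M + L2_norm (f r) * L2_norm (\<lambda>x. g (snd z) x - g t x)"
        by (intro add_right_mono mult_left_mono M z) simp
      finally show ?case .
    qed
  qed
  then show "((\<lambda>(r, t). L2_inner (f r) (g t)) \<longlongrightarrow> L2_inner (f r) (g t)) ?F"
    unfolding case_prod_beta by (rule LIM_zero_cancel)
qed

lemma L2_inner_continuous:
  assumes f: "L2_continuous T f" and g: "L2_continuous T g"
  shows "continuous_on {0..T} (\<lambda>t. L2_inner (f t) (g t))"
proof -
  have "continuous_on {0..T} (\<lambda>t. (t, t))" by (intro continuous_intros)
  from continuous_on_compose2[OF L2_inner_continuous_two[OF f g] this] show ?thesis by auto
qed

lemma L2_inner_const_continuous: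
  assumes f: "L2_continuous T f" and g: "g \<in> L2_space"
  shows "continuous_on {0..T} (\<lambda>t. L2_inner (f t) g)"
  by (rule L2_inner_continuous[OF f L2_continuous_const[OF g]])

text \<open>Linearity of the fractional Laplacian needs convergence of the defining integrals, which holds
  because the weighted transforms are square integrable.\<close>
lemma Hs_diff:
  assumes f: "f \<in> Hs_space s" and g: "g \<in> Hs_space s" and s: "s \<ge> 0"
  shows "(\<lambda>x. f x - g x) \<in> Hs_space s"
proof -
  obtain F G where F: "is_L2_function (frac_laplacian (s / 2) f) F" and G: "is_L2_function (frac_laplacian (s / 2) g) G"
    using f g by (auto simp: Hs_space_def)
  note f2 = Hs_L2[OF f] and g2 = Hs_L2[OF g]
  have "is_L2_function (frac_laplacian (s / 2) (\<lambda>x. f x - g x)) (\<lambda>x. F x - G x)"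
    unfolding is_L2_function_def
  proof (intro conjI allI impI)
    have F2: "F \<in> L2_space" "G \<in> L2_space" using F G by (auto simp: is_L2_function_def)
    then show "(\<lambda>x. F x - G x) \<in> L2_space" by (rule L2_diff(1))
    fix \<phi> :: "'a \<Rightarrow> complex" assume \<phi>: "schwartz \<phi>"
    note \<phi>2 = schwartz_L2[OF \<phi>]
    have fr: "frac_laplacian (s / 2) h \<phi> = (\<integral>\<xi>. freq_deriv s h \<xi> * inv_fourier \<phi> \<xi> \<partial>lborel)" for h
      by (simp add: frac_laplacian_def freq_deriv_def)
    have inv2: "inv_fourier \<phi> \<in> L2_space"
    proof -
      have F2: "fourier \<phi> \<in> L2_space" by (rule fourier_L2_bound_L1(1)[OF schwartz_integrable[OF \<phi>] \<phi>2])
      have [measurable]: "fourier \<phi> \<in> borel_measurable borel" by (rule L2_measurable[OF F2])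
      have eq: "inv_fourier \<phi> = (\<lambda>\<xi>. (1 / (2 * pi) ^ DIM('a)) * fourier \<phi> (- \<xi>))"
        by (rule ext) (simp add: inv_fourier_def fourier_def inner_commute)
      have "integrable lborel (\<lambda>\<xi>. (norm (fourier \<phi> (- \<xi>)))\<^sup>2)"
        using lborel_affine_integral(2)[of "-1" "\<lambda>\<xi>. (norm (fourier \<phi> \<xi>))\<^sup>2" 0] L2_integrable_sq[OF F2] by simp
      then have "(\<lambda>\<xi>. fourier \<phi> (- \<xi>)) \<in> L2_space" by (simp add: L2_space_def)
      then show ?thesis unfolding eq by (rule L2_cmult)
    qed
    have D: "freq_deriv s f \<in> L2_space" "freq_deriv s g \<in> L2_space" using Hs_freq_deriv(1) f g s by auto
    have "frac_laplacian (s / 2) (\<lambda>x. f x - g x) \<phi> = (\<integral>\<xi>. (freq_deriv s f \<xi> - freq_deriv s g \<xi>) * inv_fourier \<phi> \<xi> \<partial>lborel)"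
      unfolding fr
    proof (rule integral_cong_AE)
      show "AE \<xi> in lborel. freq_deriv s (\<lambda>x. f x - g x) \<xi> * inv_fourier \<phi> \<xi> = (freq_deriv s f \<xi> - freq_deriv s g \<xi>) * inv_fourier \<phi> \<xi>"
        using freq_deriv_diff[OF f2 g2, of s] by eventually_elim simp
    qed (use freq_deriv_borel[OF L2_diff(1)[OF f2 g2], of s] L2_measurable[OF inv2] L2_measurable[OF D(1)] L2_measurable[OF D(2)] in measurable)
    also have "\<dots> = frac_laplacian (s / 2) f \<phi> - frac_laplacian (s / 2) g \<phi>"
      unfolding fr using L2_mult_integrable[OF D(1) inv2] L2_mult_integrable[OF D(2) inv2] by (simp add: left_diff_distrib)
    also have "\<dots> = (\<integral>x. F x * \<phi> x \<partial>lborel) - (\<integral>x. G x * \<phi> x \<partial>lborel)"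
      using F G \<phi> by (simp add: is_L2_function_def)
    also have "\<dots> = (\<integral>x. (F x - G x) * \<phi> x \<partial>lborel)"
      using L2_mult_integrable[OF F2(1) \<phi>2] L2_mult_integrable[OF F2(2) \<phi>2] by (simp add: left_diff_distrib)
    finally show "frac_laplacian (s / 2) (\<lambda>x. f x - g x) \<phi> = (\<integral>x. (F x - G x) * \<phi> x \<partial>lborel)" .
  qed
  then show ?thesis unfolding Hs_space_def using L2_diff(1)[OF f2 g2] by blast
qed

lemma L2_norm_le_Hs_norm: "L2_norm f \<le> Hs_norm s f"
  by (simp add: Hs_norm_def)

text \<open>Continuity into \<open>H\<^sup>s\<close> splits into continuity of the curve and of its
  fractional derivative on the Fourier side.\<close>
lemma Hs_continuous:
  fixes u :: "real \<Rightarrow> 'a::euclidean_space \<Rightarrow> complex"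
  assumes u: "continuous_into T (Hs_space s) (Hs_norm s) u" and s: "s \<ge> 0"
  shows "L2_continuous T u" "L2_continuous T (\<lambda>t. freq_deriv s (u t))"
proof -
  have mem: "u t \<in> Hs_space s" if "t \<in> {0..T}" for t using u that by (simp add: continuous_into_def)
  have lim: "((\<lambda>\<tau>. Hs_norm s (\<lambda>x. u \<tau> x - u t x)) \<longlongrightarrow> 0) (at t within {0..T})" if "t \<in> {0..T}" for t
    using u that by (simp add: continuous_into_def)
  show "L2_continuous T u"
    by (rule L2_continuousI[OF Hs_L2[OF mem] lim L2_norm_le_Hs_norm])
  show "L2_continuous T (\<lambda>t. freq_deriv s (u t))"
  proof (rule L2_continuousI)
    show "((\<lambda>\<tau>. plancherel_const TYPE('a) * Hs_norm s (\<lambda>x. u \<tau> x - u t x)) \<longlongrightarrow> 0) (at t within {0..T})" if "t \<in> {0..T}" for t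
      by (rule tendsto_mult_right_zero[OF lim[OF that]])
    fix t \<tau> assume t: "t \<in> {0..T}" "\<tau> \<in> {0..T}"
    note h = Hs_diff[OF mem[OF t(2)] mem[OF t(1)] s]
    have "L2_norm (\<lambda>\<xi>. freq_deriv s (u \<tau>) \<xi> - freq_deriv s (u t) \<xi>) = L2_norm (freq_deriv s (\<lambda>x. u \<tau> x - u t x))"
      by (rule L2_cong_AE(2)[OF freq_deriv_diff[OF Hs_L2[OF mem[OF t(2)]] Hs_L2[OF mem[OF t(1)]]] _ Hs_freq_deriv(1)[OF h s]])
        (intro borel_measurable_diff freq_deriv_borel Hs_L2[OF mem[OF t(1)]] Hs_L2[OF mem[OF t(2)]])
    also have "\<dots> \<le> plancherel_const TYPE('a) * Hs_norm s (\<lambda>x. u \<tau> x - u t x)" by (rule Hs_freq_deriv(2)[OF h s])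
    finally show "L2_norm (\<lambda>\<xi>. freq_deriv s (u \<tau>) \<xi> - freq_deriv s (u t) \<xi>) \<le> plancherel_const TYPE('a) * Hs_norm s (\<lambda>x. u \<tau> x - u t x)" .
  qed (use Hs_freq_deriv(1)[OF mem s] in blast)
qed

lemma time_derivative_diff:
  assumes uv: "has_L2_time_derivative T u v" "has_L2_time_derivative T u' v'"
    and c: "L2_continuous T u" "L2_continuous T v" "L2_continuous T u'" "L2_continuous T v'"
  shows "has_L2_time_derivative T (\<lambda>t x. u t x - u' t x) (\<lambda>t x. v t x - v' t x)"
  unfolding has_L2_time_derivative_def
proof
  fix t assume t: "t \<in> {0..T}"
  let ?q = "\<lambda>u v \<tau>. \<lambda>x. (u \<tau> x - u t x) / complex_of_real (\<tau> - t) - v t x"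
  have mem: "?q f g \<tau> \<in> L2_space" if "L2_continuous T f" "L2_continuous T g" "\<tau> \<in> {0..T}" for f g \<tau>
    using L2_diff(1)[OF L2_cmult[OF L2_diff(1)[OF L2_continuous_mem[OF that(1,3)] L2_continuous_mem[OF that(1) t]], of "1 / complex_of_real (\<tau> - t)"] L2_continuous_mem[OF that(2) t]]
    by simp
  show "((\<lambda>\<tau>. L2_norm (\<lambda>x. ((u \<tau> x - u' \<tau> x) - (u t x - u' t x)) / complex_of_real (\<tau> - t) - (v t x - v' t x))) \<longlongrightarrow> 0) (at t within {0..T})"
  proof (rule Lim_null_comparison)
    show "((\<lambda>\<tau>. L2_norm (?q u v \<tau>) + L2_norm (?q u' v' \<tau>)) \<longlongrightarrow> 0) (at t within {0..T})"
      using tendsto_add[of _ 0 _ _ 0] uv t unfolding has_L2_time_derivative_def by fastforce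
    show "\<forall>\<^sub>F \<tau> in at t within {0..T}. norm (L2_norm (\<lambda>x. ((u \<tau> x - u' \<tau> x) - (u t x - u' t x)) / complex_of_real (\<tau> - t) - (v t x - v' t x))) \<le> L2_norm (?q u v \<tau>) + L2_norm (?q u' v' \<tau>)"
      using eventually_within_Icc
    proof eventually_elim
      case (elim \<tau>)
      have "(\<lambda>x. ((u \<tau> x - u' \<tau> x) - (u t x - u' t x)) / complex_of_real (\<tau> - t) - (v t x - v' t x)) = (\<lambda>x. ?q u v \<tau> x - ?q u' v' \<tau> x)"
        by (rule ext) (simp add: diff_divide_distrib)
      then show ?case using L2_diff(2)[OF mem[OF c(1,2) elim] mem[OF c(3,4) elim]] by simp
    qed
  qed
qed

lemma time_derivative_multiplier:
  assumes uv: "has_L2_time_derivative T u v" and c: "L2_continuous T u" "L2_continuous T v"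
    and m: "m \<in> borel_measurable borel" "AE x in lborel. norm (m x) \<le> C" "C \<ge> 0"
  shows "has_L2_time_derivative T (\<lambda>t x. m x * u t x) (\<lambda>t x. m x * v t x)"
  unfolding has_L2_time_derivative_def
proof
  fix t assume t: "t \<in> {0..T}"
  let ?q = "\<lambda>\<tau>. \<lambda>x. (u \<tau> x - u t x) / complex_of_real (\<tau> - t) - v t x"
  have mem: "?q \<tau> \<in> L2_space" if "\<tau> \<in> {0..T}" for \<tau>
    using L2_diff(1)[OF L2_cmult[OF L2_diff(1)[OF L2_continuous_mem[OF c(1) that] L2_continuous_mem[OF c(1) t]], of "1 / complex_of_real (\<tau> - t)"] L2_continuous_mem[OF c(2) t]]
    by simp
  show "((\<lambda>\<tau>. L2_norm (\<lambda>x. (m x * u \<tau> x - m x * u t x) / complex_of_real (\<tau> - t) - m x * v t x)) \<longlongrightarrow> 0) (at t within {0..T})"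
  proof (rule Lim_null_comparison)
    have "((\<lambda>\<tau>. L2_norm (?q \<tau>)) \<longlongrightarrow> 0) (at t within {0..T})" using uv t unfolding has_L2_time_derivative_def by blast
    then show "((\<lambda>\<tau>. C * L2_norm (?q \<tau>)) \<longlongrightarrow> 0) (at t within {0..T})" by (rule tendsto_mult_right_zero)
    show "\<forall>\<^sub>F \<tau> in at t within {0..T}. norm (L2_norm (\<lambda>x. (m x * u \<tau> x - m x * u t x) / complex_of_real (\<tau> - t) - m x * v t x)) \<le> C * L2_norm (?q \<tau>)"
      using eventually_within_Icc
    proof eventually_elim
      case (elim \<tau>)
      have "(\<lambda>x. (m x * u \<tau> x - m x * u t x) / complex_of_real (\<tau> - t) - m x * v t x) = (\<lambda>x. m x * ?q \<tau> x)"
        by (rule ext) (simp add: right_diff_distrib)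
      then show ?case using L2_multiplier(2)[OF mem[OF elim] m] by simp
    qed
  qed
qed

text \<open>The product rule, proved on difference quotients.\<close>
lemma L2_inner_has_vector_derivative:
  assumes uv: "has_L2_time_derivative T u v" and u: "L2_continuous T u" and v: "L2_continuous T v"
    and uv': "has_L2_time_derivative T u' v'" and u': "L2_continuous T u'" and v': "L2_continuous T v'" and t: "t \<in> {0..T}"
  shows "((\<lambda>t. L2_inner (u t) (u' t)) has_vector_derivative L2_inner (v t) (u' t) + L2_inner (u t) (v' t)) (at t within {0..T})"
proof (rule has_vector_derivative_of_quotient, rule tendsto_norm_zero)
  let ?q = "\<lambda>u \<tau>. \<lambda>x. (u \<tau> x - u t x) / complex_of_real (\<tau> - t)"
  have mem: "?q f \<tau> \<in> L2_space" if "L2_continuous T f" "\<tau> \<in> {0..T}" for f :: "real \<Rightarrow> 'a \<Rightarrow> complex" and \<tau>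
    using L2_cmult[OF L2_diff(1)[OF L2_continuous_mem[OF that] L2_continuous_mem[OF that(1) t]], of "1 / complex_of_real (\<tau> - t)"] by simp
  note m = L2_continuous_mem[OF u t] L2_continuous_mem[OF v t] L2_continuous_mem[OF u' t] L2_continuous_mem[OF v' t]
  obtain M where M: "M \<ge> 0" "\<And>t. t \<in> {0..T} \<Longrightarrow> L2_norm (u' t) \<le> M" using L2_continuous_bounded[OF u'] by blast
  show "((\<lambda>\<tau>. (L2_inner (u \<tau>) (u' \<tau>) - L2_inner (u t) (u' t)) / complex_of_real (\<tau> - t) - (L2_inner (v t) (u' t) + L2_inner (u t) (v' t))) \<longlongrightarrow> 0) (at t within {0..T})"
  proof (rule Lim_null_comparison)
    let ?B = "\<lambda>\<tau>. L2_norm (\<lambda>x. ?q u \<tau> x - v t x) * M + (L2_norm (v t) * L2_norm (\<lambda>x. u' \<tau> x - u' t x) + L2_norm (u t) * L2_norm (\<lambda>x. ?q u' \<tau> x - v' t x))"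
    have "((\<lambda>\<tau>. L2_norm (\<lambda>x. ?q u \<tau> x - v t x)) \<longlongrightarrow> 0) (at t within {0..T})" "((\<lambda>\<tau>. L2_norm (\<lambda>x. ?q u' \<tau> x - v' t x)) \<longlongrightarrow> 0) (at t within {0..T})"
      using uv uv' t unfolding has_L2_time_derivative_def by blast+
    from tendsto_add[OF tendsto_mult_left_zero[OF this(1), of M] tendsto_add[OF tendsto_mult_right_zero[OF L2_continuous_lim[OF u' t], of "L2_norm (v t)"] tendsto_mult_right_zero[OF this(2), of "L2_norm (u t)"]]]
    show "(?B \<longlongrightarrow> 0) (at t within {0..T})" by simp
    show "\<forall>\<^sub>F \<tau> in at t within {0..T}. norm ((L2_inner (u \<tau>) (u' \<tau>) - L2_inner (u t) (u' t)) / complex_of_real (\<tau> - t) - (L2_inner (v t) (u' t) + L2_inner (u t) (v' t))) \<le> ?B \<tau>"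
      using eventually_within_Icc
    proof eventually_elim
      case (elim \<tau>)
      note m' = L2_continuous_mem[OF u elim] L2_continuous_mem[OF u' elim] mem[OF u elim] mem[OF u' elim]
      have q1: "L2_inner (?q u \<tau>) g = (L2_inner (u \<tau>) g - L2_inner (u t) g) / complex_of_real (\<tau> - t)" if "g \<in> L2_space" for g
        using L2_inner_cmult(1)[of "1 / complex_of_real (\<tau> - t)" "\<lambda>x. u \<tau> x - u t x" g] L2_inner_diff_left[OF m'(1) m(1) that] by simp
      have q2: "L2_inner g (?q u' \<tau>) = (L2_inner g (u' \<tau>) - L2_inner g (u' t)) / complex_of_real (\<tau> - t)" if "g \<in> L2_space" for g
        using L2_inner_cmult(2)[of g "1 / complex_of_real (\<tau> - t)" "\<lambda>x. u' \<tau> x - u' t x"] L2_inner_diff_right[OF m'(2) m(3) that] by simp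
      have eq: "(L2_inner (u \<tau>) (u' \<tau>) - L2_inner (u t) (u' t)) / complex_of_real (\<tau> - t) - (L2_inner (v t) (u' t) + L2_inner (u t) (v' t))
         = L2_inner (\<lambda>x. ?q u \<tau> x - v t x) (u' \<tau>) + (L2_inner (v t) (\<lambda>x. u' \<tau> x - u' t x) + L2_inner (u t) (\<lambda>x. ?q u' \<tau> x - v' t x))"
        unfolding L2_inner_diff_left[OF m'(3) m(2) m'(2)] L2_inner_diff_right[OF m'(2) m(3) m(2)] L2_inner_diff_right[OF m'(4) m(4) m(1)] q1[OF m'(2)] q2[OF m(1)]
        by (simp add: diff_divide_distrib)
      have "norm ((L2_inner (u \<tau>) (u' \<tau>) - L2_inner (u t) (u' t)) / complex_of_real (\<tau> - t) - (L2_inner (v t) (u' t) + L2_inner (u t) (v' t))) \<le> L2_norm (\<lambda>x. ?q u \<tau> x - v t x) * L2_norm (u' \<tau>) + (L2_norm (v t) * L2_norm (\<lambda>x. u' \<tau> x - u' t x) + L2_norm (u t) * L2_norm (\<lambda>x. ?q u' \<tau> x - v' t x))"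
        unfolding eq by (intro norm_triangle_mono L2_inner_bound L2_diff(1) m m')
      also have "\<dots> \<le> ?B \<tau>" by (rule add_right_mono[OF mult_left_mono[OF M(2)[OF elim] L2_norm_nonneg]])
      finally show ?case .
    qed
  qed
qed

lemma L2_inner_const_has_vector_derivative:
  assumes uv: "has_L2_time_derivative T u v" and u: "L2_continuous T u" and v: "L2_continuous T v"
    and g: "g \<in> L2_space" and t: "t \<in> {0..T}"
  shows "((\<lambda>t. L2_inner (u t) g) has_vector_derivative L2_inner (v t) g) (at t within {0..T})"
proof -
  have "has_L2_time_derivative T (\<lambda>_. g) (\<lambda>_ _. 0)" by (simp add: has_L2_time_derivative_def)
  from L2_inner_has_vector_derivative[OF uv u v this L2_continuous_const[OF g] L2_continuous_const[OF L2_zero(1)] t]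
  show ?thesis by (simp add: L2_inner_def)
qed

section \<open>The equation integrated once in time\<close>

lemma Linf_bound:
  fixes a :: "'a::euclidean_space \<Rightarrow> complex"
  assumes a: "a \<in> Linf_space"
  shows "a \<in> borel_measurable borel" "AE x in lborel. norm (a x) \<le> Linf_norm a" "Linf_norm a \<ge> 0"
proof -
  let ?E = "esssup lborel (\<lambda>x. ereal (norm (a x)))"
  show [measurable]: "a \<in> borel_measurable borel" using a by (simp add: Linf_space_def)
  have ae: "AE x in lborel. ereal (norm (a x)) \<le> ?E" by (rule esssup_AE)
  have nn: "0 \<le> ?E"
  proof (rule ccontr)
    assume "\<not> 0 \<le> ?E"
    have "AE x in (lborel :: 'a measure). False" using ae
    proof eventually_elim
      case (elim x)
      have "0 \<le> ereal (norm (a x))" by simp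
      then show ?case using elim \<open>\<not> 0 \<le> ?E\<close> order_trans by blast
    qed
    then have "{x \<in> space (lborel :: 'a measure). \<not> False} \<in> null_sets lborel"
      by (subst AE_iff_null[symmetric]) auto
    then show False by (simp add: null_sets_def)
  qed
  have E: "ereal (Linf_norm a) = ?E"
    unfolding Linf_norm_def using a nn by (intro ereal_real') (auto simp: Linf_space_def)
  show "AE x in lborel. norm (a x) \<le> Linf_norm a" using ae unfolding E[symmetric] by simp
  show "Linf_norm a \<ge> 0" unfolding Linf_norm_def using nn by (rule real_of_ereal_pos)
qed

lemma tensor_time_derivative:
  fixes \<theta> :: "real \<Rightarrow> complex" and \<zeta> :: "'a::euclidean_space \<Rightarrow> complex"
  assumes \<theta>: "smooth \<theta>" and \<zeta>: "smooth \<zeta>"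
  shows "iter_deriv [(1, 0)] (\<lambda>z. \<theta> (fst z) * \<zeta> (snd z)) = (\<lambda>z. iter_deriv [1] \<theta> (fst z) * \<zeta> (snd z))"
proof -
  have lz: "iter_deriv [0] \<zeta> x = 0" for x
    using linear_0[OF has_derivative_linear[OF smooth_has_derivative[OF \<zeta>]]] .
  have d: "((\<lambda>z. \<theta> (fst z) * \<zeta> (snd z)) has_derivative
     (\<lambda>v. \<theta> (fst z) * iter_deriv [snd v] \<zeta> (snd z) + iter_deriv [fst v] \<theta> (fst z) * \<zeta> (snd z))) (at z)" for z
    by (rule has_derivative_mult)
      (rule has_derivative_compose[OF has_derivative_fst[OF has_derivative_ident] smooth_has_derivative[OF \<theta>]]
        has_derivative_compose[OF has_derivative_snd[OF has_derivative_ident] smooth_has_derivative[OF \<zeta>]])+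
  show ?thesis unfolding iter_deriv_eqI[OF d] by (simp add: lz del: iter_deriv.simps)
qed

text \<open>A product of a test function of time and one of space is a test function on the slab, and time
  derivatives act on the first factor only.\<close>
lemma tensor_test_function:
  fixes \<theta> :: "real \<Rightarrow> complex" and \<zeta> :: "'a::euclidean_space \<Rightarrow> complex"
  assumes \<theta>: "test_function_on U \<theta>" and \<zeta>: "test_fn \<zeta>"
  shows "test_function_on (U \<times> UNIV) (\<lambda>z. \<theta> (fst z) * \<zeta> (snd z))"
    and "iter_deriv [(1, 0), (1, 0)] (\<lambda>z. \<theta> (fst z) * \<zeta> (snd z)) = (\<lambda>z. iter_deriv [1, 1] \<theta> (fst z) * \<zeta> (snd z))"
proof -
  note sm = test_function_smooth[OF \<theta>] test_function_smooth[OF \<zeta>]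
  obtain K L where K: "compact K" "K \<subseteq> U" "supported_in \<theta> K" and L: "compact L" "supported_in \<zeta> L"
    using \<theta> \<zeta> by (auto simp: test_function_on_def)
  have "smooth (\<lambda>z. \<theta> (fst z) * \<zeta> (snd z))"
    by (rule smooth_mult[OF smooth_compose_linear(2)[OF bounded_linear_fst sm(1)] smooth_compose_linear(2)[OF bounded_linear_snd sm(2)]])
  moreover have "supported_in (\<lambda>z. \<theta> (fst z) * \<zeta> (snd z)) (K \<times> L)"
    using K(3) L(2) by (auto simp: supported_in_def)
  ultimately show "test_function_on (U \<times> UNIV) (\<lambda>z. \<theta> (fst z) * \<zeta> (snd z))"
    unfolding test_function_on_def using compact_Times[OF K(1) L(1)] K(2) by blast
  have "iter_deriv [(1, 0), (1, 0)] (\<lambda>z. \<theta> (fst z) * \<zeta> (snd z)) = iter_deriv [(1, 0)] (iter_deriv [(1, 0)] (\<lambda>z. \<theta> (fst z) * \<zeta> (snd z)))"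
    by simp
  also have "\<dots> = (\<lambda>z. iter_deriv [1] (iter_deriv [1] \<theta>) (fst z) * \<zeta> (snd z))"
    unfolding tensor_time_derivative[OF sm] tensor_time_derivative[OF smooth_iter_deriv[OF sm(1)] sm(2)] ..
  finally show "iter_deriv [(1, 0), (1, 0)] (\<lambda>z. \<theta> (fst z) * \<zeta> (snd z)) = (\<lambda>z. iter_deriv [1, 1] \<theta> (fst z) * \<zeta> (snd z))"
    by simp
qed

lemma frac_laplacian_cmult: "frac_laplacian s f (\<lambda>x. c * \<phi> x) = c * frac_laplacian s f \<phi>"
proof -
  have "inv_fourier (\<lambda>x. c * \<phi> x) \<xi> = c * inv_fourier \<phi> \<xi>" for \<xi>
    unfolding inv_fourier_def mult.left_commute[of _ c] integral_mult_right_zero by simp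
  then show ?thesis
    unfolding frac_laplacian_def mult.left_commute[of _ c] by (simp only: mult.left_commute[of _ c] integral_mult_right_zero)
qed

lemma set_integral_open_interval:
  fixes K :: "real \<Rightarrow> complex"
  assumes K: "continuous_on {0..T} K"
  shows "(LINT t:{0<..<T}|lborel. K t) = integral {0..T} K"
proof -
  have "set_integrable lborel {0..T} K" by (rule borel_integrable_atLeastAtMost'[OF K])
  then have "set_integrable lborel {0<..<T} K" by (rule set_integrable_subset) auto
  from set_borel_integral_eq_integral(2)[OF this] show ?thesis
    by (simp add: integral_open_interval_real)
qed

lemma damped_wave_equation_tensor:
  fixes u v :: "real \<Rightarrow> 'a::euclidean_space \<Rightarrow> complex"
  assumes eq: "damped_wave_equation s T a b u v" and \<theta>: "test_function_on {0<..<T} \<theta>" and \<eta>: "test_fn \<eta>"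
  shows "(LINT t:{0<..<T}|lborel. iter_deriv [1, 1] \<theta> t * L2_inner (u t) \<eta> + \<theta> t * (frac_laplacian s (u t) (\<lambda>x. cnj (\<eta> x))
     + L2_inner (\<lambda>x. a x * u t x) \<eta> + L2_inner (\<lambda>x. b x * v t x) \<eta>)) = 0"
proof -
  note t = tensor_test_function[OF \<theta> test_function_cnj[OF \<eta>]]
  have 1: "(\<integral>x. f x * (c * cnj (\<eta> x)) \<partial>lborel) = c * L2_inner f \<eta>" for f c
    unfolding L2_inner_def mult.left_commute[of _ c] by (rule integral_mult_right_zero)
  from eq[unfolded damped_wave_equation_def, rule_format, OF t(1)]
  show ?thesis unfolding t(2) fst_conv snd_conv 1 frac_laplacian_cmult by (simp only: distrib_left add.assoc)
qed

text \<open>The scalar function \<open>\<langle>u(t), \<eta>\<rangle>\<close> satisfies a second order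
  equation with continuous right-hand side. Since \<open>b\<close> is independent of time, the
  damping term is the derivative of \<open>\<langle>b u(t), \<eta>\<rangle>\<close> and can be
  integrated.\<close>
lemma integrated_equation_test:
  fixes u v :: "real \<Rightarrow> 'a::euclidean_space \<Rightarrow> complex"
  assumes T: "T > 0" and s: "s > 0" and a: "a \<in> Linf_space" and b: "b \<in> Linf_space"
    and u: "continuous_into T (Hs_space s) (Hs_norm s) u"
    and uv: "has_L2_time_derivative T u v" and v: "L2_continuous T v" and eq: "damped_wave_equation s T a b u v"
    and \<eta>: "test_fn \<eta>" and D\<eta>: "freq_deriv s \<eta> \<in> L2_space" and t: "t \<in> {0..T}"
  shows "L2_inner (v t) \<eta> + L2_inner (\<lambda>x. b x * u t x) \<eta> = L2_inner (v 0) \<eta> + L2_inner (\<lambda>x. b x * u 0 x) \<eta>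
     - integral {0..t} (\<lambda>r. L2_inner (freq_deriv s (u r)) (freq_deriv s \<eta>) / (2 * pi) ^ DIM('a) + L2_inner (\<lambda>x. a x * u r x) \<eta>)"
proof -
  have s0: "s \<ge> 0" using s by simp
  note uc = Hs_continuous[OF u s0]
  note au = L2_continuous_multiplier[OF uc(1) Linf_bound[OF a]] and bu = L2_continuous_multiplier[OF uc(1) Linf_bound[OF b]]
    and bv = L2_continuous_multiplier[OF v Linf_bound[OF b]]
  note \<eta>2 = test_function_L2[OF \<eta>]
  define A where "A = (\<lambda>r. L2_inner (freq_deriv s (u r)) (freq_deriv s \<eta>) / (2 * pi) ^ DIM('a) + L2_inner (\<lambda>x. a x * u r x) \<eta>)"
  define F where "F = (\<lambda>r. A r + L2_inner (\<lambda>x. b x * v r x) \<eta>)"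
  have Ac: "continuous_on {0..T} A" unfolding A_def
    by (intro continuous_on_add continuous_on_divide L2_inner_const_continuous[OF uc(2) D\<eta>] L2_inner_const_continuous[OF au \<eta>2] continuous_on_const) simp
  have Fc: "continuous_on {0..T} F" unfolding F_def by (intro continuous_on_add Ac L2_inner_const_continuous[OF bv \<eta>2])
  have gc: "continuous_on {0..T} (\<lambda>r. L2_inner (u r) \<eta>)" by (rule L2_inner_const_continuous[OF uc(1) \<eta>2])
  have "L2_inner (v t) \<eta> = L2_inner (v 0) \<eta> - integral {0..t} F"
  proof (rule weak_second_derivative[OF T _ L2_inner_const_continuous[OF v \<eta>2] Fc _ t])
    show "((\<lambda>t. L2_inner (u t) \<eta>) has_vector_derivative L2_inner (v r) \<eta>) (at r within {0..T})" if "r \<in> {0..T}" for r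
      by (rule L2_inner_const_has_vector_derivative[OF uv uc(1) v \<eta>2 that])
    fix \<theta> :: "real \<Rightarrow> complex" assume \<theta>: "test_function_on {0<..<T} \<theta>"
    have "integral {0..T} (\<lambda>r. iter_deriv [1, 1] \<theta> r * L2_inner (u r) \<eta> + \<theta> r * F r) = (LINT r:{0<..<T}|lborel. iter_deriv [1, 1] \<theta> r * L2_inner (u r) \<eta> + \<theta> r * F r)"
      by (rule set_integral_open_interval[symmetric])
        (intro continuous_on_add continuous_on_mult smooth_continuous_on[OF smooth_iter_deriv[OF test_function_smooth[OF \<theta>]]] gc test_function_continuous[OF \<theta>] Fc)
    also have "\<dots> = (LINT t:{0<..<T}|lborel. iter_deriv [1, 1] \<theta> t * L2_inner (u t) \<eta> + \<theta> t * (frac_laplacian s (u t) (\<lambda>x. cnj (\<eta> x))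
     + L2_inner (\<lambda>x. a x * u t x) \<eta> + L2_inner (\<lambda>x. b x * v t x) \<eta>))"
    proof (rule set_lebesgue_integral_cong)
      show "\<forall>r. r \<in> {0<..<T} \<longrightarrow> iter_deriv [1, 1] \<theta> r * L2_inner (u r) \<eta> + \<theta> r * F r = iter_deriv [1, 1] \<theta> r * L2_inner (u r) \<eta> + \<theta> r * (frac_laplacian s (u r) (\<lambda>x. cnj (\<eta> x))
     + L2_inner (\<lambda>x. a x * u r x) \<eta> + L2_inner (\<lambda>x. b x * v r x) \<eta>)"
        using frac_laplacian_pairing[OF L2_continuous_mem[OF uc(1)] \<eta>, of _ s] by (simp add: F_def A_def del: iter_deriv.simps)
    qed simp
    also have "\<dots> = 0" by (rule damped_wave_equation_tensor[OF eq \<theta> \<eta>])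
    finally show "integral {0..T} (\<lambda>r. iter_deriv [1, 1] \<theta> r * L2_inner (u r) \<eta> + \<theta> r * F r) = 0" .
  qed
  moreover have "integral {0..t} F = integral {0..t} A + (L2_inner (\<lambda>x. b x * u t x) \<eta> - L2_inner (\<lambda>x. b x * u 0 x) \<eta>)"
  proof -
    have sub: "{0..t} \<subseteq> {0..T}" using t by auto
    have B: "((\<lambda>r. L2_inner (\<lambda>x. b x * v r x) \<eta>) has_integral (L2_inner (\<lambda>x. b x * u t x) \<eta> - L2_inner (\<lambda>x. b x * u 0 x) \<eta>)) {0..t}"
    proof (rule fundamental_theorem_of_calculus)
      show "0 \<le> t" using t by simp
      fix r assume r: "r \<in> {0..t}"
      then have r': "r \<in> {0..T}" using sub by blast
      show "((\<lambda>r. L2_inner (\<lambda>x. b x * u r x) \<eta>) has_vector_derivative L2_inner (\<lambda>x. b x * v r x) \<eta>) (at r within {0..t})"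
        by (rule has_vector_derivative_within_subset[OF L2_inner_const_has_vector_derivative[OF time_derivative_multiplier[OF uv uc(1) v Linf_bound[OF b]] bu bv \<eta>2 r'] sub])
    qed
    have "A integrable_on {0..t}" by (rule integrable_continuous_interval[OF continuous_on_subset[OF Ac sub]])
    from Henstock_Kurzweil_Integration.integral_add[OF this has_integral_integrable[OF B]]
    show ?thesis unfolding F_def integral_unique[OF B] .
  qed
  ultimately show ?thesis unfolding A_def[symmetric] by (simp add: algebra_simps)
qed

text \<open>Both sides are continuous in \<open>\<omega>\<close> with respect to the norm of
  \<open>H\<^sup>s\<close>, with the constant \<open>C\<close> of the proof, so the identity
  extends from test functions by density.\<close>
lemma integrated_equation:
  fixes u v :: "real \<Rightarrow> 'a::euclidean_space \<Rightarrow> complex"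
  assumes T: "T > 0" and s: "s > 0" and a: "a \<in> Linf_space" and b: "b \<in> Linf_space"
    and u: "continuous_into T (Hs_space s) (Hs_norm s) u"
    and uv: "has_L2_time_derivative T u v" and v: "L2_continuous T v" and eq: "damped_wave_equation s T a b u v"
    and \<omega>: "\<omega> \<in> L2_space" and D\<omega>: "freq_deriv s \<omega> \<in> L2_space" and t: "t \<in> {0..T}"
  shows "L2_inner (v t) \<omega> + L2_inner (\<lambda>x. b x * u t x) \<omega> = L2_inner (v 0) \<omega> + L2_inner (\<lambda>x. b x * u 0 x) \<omega>
     - integral {0..t} (\<lambda>r. L2_inner (freq_deriv s (u r)) (freq_deriv s \<omega>) / (2 * pi) ^ DIM('a) + L2_inner (\<lambda>x. a x * u r x) \<omega>)"
proof -
  have s0: "s \<ge> 0" using s by simp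
  note uc = Hs_continuous[OF u s0]
  note au = L2_continuous_multiplier[OF uc(1) Linf_bound[OF a]] and bu = L2_continuous_multiplier[OF uc(1) Linf_bound[OF b]]
  define A where "A = (\<lambda>\<omega> r. L2_inner (freq_deriv s (u r)) (freq_deriv s \<omega>) / (2 * pi) ^ DIM('a) + L2_inner (\<lambda>x. a x * u r x) \<omega>)"
  define E where "E = (\<lambda>\<omega>. (L2_inner (v t) \<omega> + L2_inner (\<lambda>x. b x * u t x) \<omega>) - (L2_inner (v 0) \<omega> + L2_inner (\<lambda>x. b x * u 0 x) \<omega>) + integral {0..t} (A \<omega>))"
  have tT: "0 \<in> {0..T}" "{0..t} \<subseteq> {0..T}" using t by auto
  have Ac: "A \<omega> integrable_on {0..t}" if "\<omega> \<in> L2_space" "freq_deriv s \<omega> \<in> L2_space" for \<omega>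
  proof (rule integrable_continuous_interval[OF continuous_on_subset[OF _ tT(2)]])
    show "continuous_on {0..T} (A \<omega>)" unfolding A_def
      by (intro continuous_on_add continuous_on_divide L2_inner_const_continuous[OF uc(2) that(2)] L2_inner_const_continuous[OF au that(1)] continuous_on_const) simp
  qed
  obtain M1 where M1: "M1 \<ge> 0" "\<And>r. r \<in> {0..T} \<Longrightarrow> L2_norm (freq_deriv s (u r)) \<le> M1" using L2_continuous_bounded[OF uc(2)] by blast
  obtain M2 where M2: "M2 \<ge> 0" "\<And>r. r \<in> {0..T} \<Longrightarrow> L2_norm (\<lambda>x. a x * u r x) \<le> M2" using L2_continuous_bounded[OF au] by blast
  define C where "C = L2_norm (v t) + L2_norm (\<lambda>x. b x * u t x) + (L2_norm (v 0) + L2_norm (\<lambda>x. b x * u 0 x)) + (M1 / (2 * pi) ^ DIM('a) + M2) * t"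
  have C: "C \<ge> 0" unfolding C_def using M1(1) M2(1) t by (intro add_nonneg_nonneg mult_nonneg_nonneg divide_nonneg_nonneg) auto
  have "norm (E \<omega>) \<le> 0 + e" if e: "e > 0" for e
  proof -
    define d where "d = e / (C + 1)"
    have d: "d > 0" "C * d \<le> e" unfolding d_def using e C by (auto simp: field_simps)
    obtain \<eta> where \<eta>: "test_fn \<eta>" "L2_norm (\<lambda>x. \<eta> x - \<omega> x) < d" "freq_deriv s \<eta> \<in> L2_space"
      "L2_norm (\<lambda>\<xi>. freq_deriv s \<eta> \<xi> - freq_deriv s \<omega> \<xi>) < d"
      using test_functions_dense_in_Hs[OF \<omega> D\<omega> s0 d(1)] by blast
    note \<eta>2 = test_function_L2[OF \<eta>(1)]
    have E\<eta>: "E \<eta> = 0"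
      unfolding E_def A_def integrated_equation_test[OF T s a b u uv v eq \<eta>(1,3) t] by simp
    have ipd: "norm (L2_inner f \<eta> - L2_inner f \<omega>) \<le> L2_norm f * d" if "f \<in> L2_space" for f
    proof -
      have "norm (L2_inner f \<eta> - L2_inner f \<omega>) \<le> L2_norm f * L2_norm (\<lambda>x. \<eta> x - \<omega> x)"
        using L2_inner_bound[OF that L2_diff(1)[OF \<eta>2 \<omega>]] L2_inner_diff_right[OF \<eta>2 \<omega> that] by simp
      also have "\<dots> \<le> L2_norm f * d" using \<eta>(2) by (intro mult_left_mono) auto
      finally show ?thesis .
    qed
    have Ad: "norm (A \<eta> r - A \<omega> r) \<le> (M1 / (2 * pi) ^ DIM('a) + M2) * d" if r: "r \<in> {0..t}" for r
    proof -
      have r': "r \<in> {0..T}" using r tT(2) by blast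
      note Du = L2_continuous_mem[OF uc(2) r'] and aur = L2_continuous_mem[OF au r']
      have "norm (L2_inner (freq_deriv s (u r)) (freq_deriv s \<eta>) - L2_inner (freq_deriv s (u r)) (freq_deriv s \<omega>)) \<le> M1 * d"
      proof -
        have "norm (L2_inner (freq_deriv s (u r)) (freq_deriv s \<eta>) - L2_inner (freq_deriv s (u r)) (freq_deriv s \<omega>)) \<le> L2_norm (freq_deriv s (u r)) * L2_norm (\<lambda>\<xi>. freq_deriv s \<eta> \<xi> - freq_deriv s \<omega> \<xi>)"
          using L2_inner_bound[OF Du L2_diff(1)[OF \<eta>(3) D\<omega>]] L2_inner_diff_right[OF \<eta>(3) D\<omega> Du] by simp
        also have "\<dots> \<le> M1 * d" using \<eta>(4) M1 r' by (intro mult_mono) auto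
        finally show ?thesis .
      qed
      then have "norm ((L2_inner (freq_deriv s (u r)) (freq_deriv s \<eta>) - L2_inner (freq_deriv s (u r)) (freq_deriv s \<omega>)) / (2 * pi) ^ DIM('a)) \<le> M1 * d / (2 * pi) ^ DIM('a)"
        unfolding norm_divide by (simp add: norm_power norm_mult divide_right_mono)
      moreover have "norm (L2_inner (\<lambda>x. a x * u r x) \<eta> - L2_inner (\<lambda>x. a x * u r x) \<omega>) \<le> M2 * d"
        by (rule order_trans[OF ipd[OF aur] mult_right_mono[OF M2(2)[OF r']]]) (use d in simp)
      ultimately have "norm ((L2_inner (freq_deriv s (u r)) (freq_deriv s \<eta>) - L2_inner (freq_deriv s (u r)) (freq_deriv s \<omega>)) / (2 * pi) ^ DIM('a) + (L2_inner (\<lambda>x. a x * u r x) \<eta> - L2_inner (\<lambda>x. a x * u r x) \<omega>)) \<le> M1 * d / (2 * pi) ^ DIM('a) + M2 * d"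
        by (rule norm_triangle_mono)
      moreover have "A \<eta> r - A \<omega> r = (L2_inner (freq_deriv s (u r)) (freq_deriv s \<eta>) - L2_inner (freq_deriv s (u r)) (freq_deriv s \<omega>)) / (2 * pi) ^ DIM('a) + (L2_inner (\<lambda>x. a x * u r x) \<eta> - L2_inner (\<lambda>x. a x * u r x) \<omega>)"
        unfolding A_def by (simp add: diff_divide_distrib)
      ultimately show ?thesis by (simp add: distrib_right)
    qed
    have int: "norm (integral {0..t} (A \<eta>) - integral {0..t} (A \<omega>)) \<le> (M1 / (2 * pi) ^ DIM('a) + M2) * d * t"
    proof -
      have "integral {0..t} (A \<eta>) - integral {0..t} (A \<omega>) = integral {0..t} (\<lambda>r. A \<eta> r - A \<omega> r)"
        by (rule Henstock_Kurzweil_Integration.integral_diff[symmetric, OF Ac[OF \<eta>2 \<eta>(3)] Ac[OF \<omega> D\<omega>]])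
      moreover have "norm (integral {0..t} (\<lambda>r. A \<eta> r - A \<omega> r)) \<le> integral {0..t} (\<lambda>r. (M1 / (2 * pi) ^ DIM('a) + M2) * d)"
        by (rule integral_norm_bound_integral[OF integrable_diff[OF Ac[OF \<eta>2 \<eta>(3)] Ac[OF \<omega> D\<omega>]] _ Ad]) auto
      ultimately show ?thesis using t by (simp add: mult_ac)
    qed
    have mem: "v t \<in> L2_space" "(\<lambda>x. b x * u t x) \<in> L2_space" "v 0 \<in> L2_space" "(\<lambda>x. b x * u 0 x) \<in> L2_space"
      using L2_continuous_mem[OF v] L2_continuous_mem[OF bu] t tT(1) by auto
    have "E \<eta> - E \<omega> = ((L2_inner (v t) \<eta> - L2_inner (v t) \<omega>) + (L2_inner (\<lambda>x. b x * u t x) \<eta> - L2_inner (\<lambda>x. b x * u t x) \<omega>))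
      - ((L2_inner (v 0) \<eta> - L2_inner (v 0) \<omega>) + (L2_inner (\<lambda>x. b x * u 0 x) \<eta> - L2_inner (\<lambda>x. b x * u 0 x) \<omega>)) + (integral {0..t} (A \<eta>) - integral {0..t} (A \<omega>))"
      unfolding E_def by (simp add: algebra_simps)
    moreover have "norm (((L2_inner (v t) \<eta> - L2_inner (v t) \<omega>) + (L2_inner (\<lambda>x. b x * u t x) \<eta> - L2_inner (\<lambda>x. b x * u t x) \<omega>))
      - ((L2_inner (v 0) \<eta> - L2_inner (v 0) \<omega>) + (L2_inner (\<lambda>x. b x * u 0 x) \<eta> - L2_inner (\<lambda>x. b x * u 0 x) \<omega>)) + (integral {0..t} (A \<eta>) - integral {0..t} (A \<omega>))) 
      \<le> (L2_norm (v t) * d + L2_norm (\<lambda>x. b x * u t x) * d) + (L2_norm (v 0) * d + L2_norm (\<lambda>x. b x * u 0 x) * d) + (M1 / (2 * pi) ^ DIM('a) + M2) * d * t"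
      by (intro norm_triangle_mono order_trans[OF norm_triangle_ineq4 add_mono] ipd mem int)
    moreover have "(L2_norm (v t) * d + L2_norm (\<lambda>x. b x * u t x) * d) + (L2_norm (v 0) * d + L2_norm (\<lambda>x. b x * u 0 x) * d) + (M1 / (2 * pi) ^ DIM('a) + M2) * d * t = C * d"
      unfolding C_def by (simp add: algebra_simps)
    ultimately have "norm (E \<eta> - E \<omega>) \<le> C * d" by simp
    then show ?thesis using E\<eta> d(2) by simp
  qed
  then have "norm (E \<omega>) \<le> 0" by (rule field_le_epsilon)
  then have "E \<omega> = 0" by simp
  then show ?thesis unfolding E_def A_def by (simp add: algebra_simps)
qed

section \<open>Positive kernels and the scalar energy argument\<close>

lemma continuous_slices:
  fixes k :: "real \<Rightarrow> real \<Rightarrow> real"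
  assumes k: "continuous_on ({0..\<tau>} \<times> {0..\<tau>}) (\<lambda>(r, t). k r t)"
  shows "t \<in> {0..\<tau>} \<Longrightarrow> continuous_on {0..\<tau>} (\<lambda>r. k r t)" "r \<in> {0..\<tau>} \<Longrightarrow> continuous_on {0..\<tau>} (\<lambda>t. k r t)"
proof -
  assume t: "t \<in> {0..\<tau>}"
  have "continuous_on {0..\<tau>} (\<lambda>r. (r, t))" by (intro continuous_intros)
  from continuous_on_compose2[OF k this] image_subsetI[of "{0..\<tau>}" "\<lambda>r. (r, t)" "{0..\<tau>} \<times> {0..\<tau>}"] t
  show "continuous_on {0..\<tau>} (\<lambda>r. k r t)" by simp
next
  assume r: "r \<in> {0..\<tau>}"
  have "continuous_on {0..\<tau>} (\<lambda>t. (r, t))" by (intro continuous_intros)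
  from continuous_on_compose2[OF k this] image_subsetI[of "{0..\<tau>}" "\<lambda>t. (r, t)" "{0..\<tau>} \<times> {0..\<tau>}"] r
  show "continuous_on {0..\<tau>} (\<lambda>t. k r t)" by simp
qed

lemma lborel_integral_indicator_Icc:
  fixes f :: "real \<Rightarrow> real"
  assumes "continuous_on {a..b} f"
  shows "(\<integral>x. indicat_real {a..b} x *\<^sub>R f x \<partial>lborel) = integral {a..b} f"
  using set_borel_integral_eq_integral(2)[OF borel_integrable_atLeastAtMost'[OF assms]] by (simp add: set_lebesgue_integral_def)

text \<open>Fubini on the triangle \<open>0 \<le> r \<le> t \<le> \<tau>\<close>, carried out with Lebesgue
  integrals over the plane.\<close>
lemma triangle_integral_swap:
  fixes k :: "real \<Rightarrow> real \<Rightarrow> real"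
  assumes k: "continuous_on ({0..\<tau>} \<times> {0..\<tau>}) (\<lambda>(r, t). k r t)"
  shows "(\<lambda>t. integral {0..t} (\<lambda>r. k r t)) integrable_on {0..\<tau>}"
    and "(\<lambda>r. integral {r..\<tau>} (\<lambda>t. k r t)) integrable_on {0..\<tau>}"
    and "integral {0..\<tau>} (\<lambda>t. integral {0..t} (\<lambda>r. k r t)) = integral {0..\<tau>} (\<lambda>r. integral {r..\<tau>} (\<lambda>t. k r t))"
proof -
  define S where "S = ({0..\<tau>} \<times> {0..\<tau>}) \<inter> {z. fst z \<le> (snd z :: real)}"
  have S: "compact S" unfolding S_def
    by (intro compact_Int_closed compact_Times compact_Icc closed_Collect_le continuous_intros)
  define f where "f = (\<lambda>r t. indicat_real S (r, t) *\<^sub>R k r t)"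
  have "integrable lborel (\<lambda>z. indicat_real S z *\<^sub>R (case z of (r, t) \<Rightarrow> k r t))"
    by (rule borel_integrable_compact[OF S continuous_on_subset[OF k]]) (auto simp: S_def)
  then have int: "integrable (lborel \<Otimes>\<^sub>M lborel) (case_prod f)"
    unfolding lborel_prod f_def by (simp add: case_prod_beta')
  note sl = continuous_slices[OF k]
  have X: "(\<integral>r. f r t \<partial>lborel) = (if t \<in> {0..\<tau>} then integral {0..t} (\<lambda>r. k r t) else 0)" for t
  proof (cases "t \<in> {0..\<tau>}")
    case True
    then have "f r t = indicat_real {0..t} r *\<^sub>R k r t" for r by (auto simp: f_def S_def indicator_def)
    moreover have "continuous_on {0..t} (\<lambda>r. k r t)" using True by (intro continuous_on_subset[OF sl(1)[OF True]]) auto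
    ultimately show ?thesis using True by (simp only: lborel_integral_indicator_Icc if_True)
  qed (auto simp: f_def S_def indicator_def)
  have Y: "(\<integral>t. f r t \<partial>lborel) = (if r \<in> {0..\<tau>} then integral {r..\<tau>} (\<lambda>t. k r t) else 0)" for r
  proof (cases "r \<in> {0..\<tau>}")
    case True
    then have "f r t = indicat_real {r..\<tau>} t *\<^sub>R k r t" for t by (auto simp: f_def S_def indicator_def)
    moreover have "continuous_on {r..\<tau>} (\<lambda>t. k r t)" using True by (intro continuous_on_subset[OF sl(2)[OF True]]) auto
    ultimately show ?thesis using True by (simp only: lborel_integral_indicator_Icc if_True)
  qed (auto simp: f_def S_def indicator_def)
  have Xi: "integrable lborel (\<lambda>t. if t \<in> {0..\<tau>} then integral {0..t} (\<lambda>r. k r t) else 0)"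
    using lborel_pair.integrable_snd[OF int] unfolding X .
  have Yi: "integrable lborel (\<lambda>r. if r \<in> {0..\<tau>} then integral {r..\<tau>} (\<lambda>t. k r t) else 0)"
    using lborel_pair.integrable_fst[OF int] unfolding Y .
  show "(\<lambda>t. integral {0..t} (\<lambda>r. k r t)) integrable_on {0..\<tau>}"
    using integrable_on_lborel[OF Xi] unfolding integrable_restrict_UNIV .
  show "(\<lambda>r. integral {r..\<tau>} (\<lambda>t. k r t)) integrable_on {0..\<tau>}"
    using integrable_on_lborel[OF Yi] unfolding integrable_restrict_UNIV .
  show "integral {0..\<tau>} (\<lambda>t. integral {0..t} (\<lambda>r. k r t)) = integral {0..\<tau>} (\<lambda>r. integral {r..\<tau>} (\<lambda>t. k r t))"
    using lborel_pair.Fubini_integral[OF int] unfolding X Y integral_lborel[OF Xi, symmetric] integral_lborel[OF Yi, symmetric] integral_restrict_UNIV .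
qed

text \<open>By symmetry the two triangles that make up the square contribute equally.\<close>
lemma triangle_integral_half_square:
  fixes k :: "real \<Rightarrow> real \<Rightarrow> real"
  assumes k: "continuous_on ({0..\<tau>} \<times> {0..\<tau>}) (\<lambda>(r, t). k r t)"
    and sym: "\<And>r t. r \<in> {0..\<tau>} \<Longrightarrow> t \<in> {0..\<tau>} \<Longrightarrow> k r t = k t r"
  shows "2 * integral {0..\<tau>} (\<lambda>t. integral {0..t} (\<lambda>r. k r t)) = integral {0..\<tau>} (\<lambda>t. integral {0..\<tau>} (\<lambda>r. k r t))"
proof -
  note sw = triangle_integral_swap[OF k]
  have "integral {0..\<tau>} (\<lambda>t. integral {0..t} (\<lambda>r. k r t)) + integral {0..\<tau>} (\<lambda>t. integral {t..\<tau>} (\<lambda>r. k t r))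
    = integral {0..\<tau>} (\<lambda>t. integral {0..t} (\<lambda>r. k r t) + integral {t..\<tau>} (\<lambda>r. k t r))"
    by (rule Henstock_Kurzweil_Integration.integral_add[symmetric, OF sw(1,2)])
  also have "\<dots> = integral {0..\<tau>} (\<lambda>t. integral {0..\<tau>} (\<lambda>r. k r t))"
  proof (rule Henstock_Kurzweil_Integration.integral_cong)
    fix t assume t: "t \<in> {0..\<tau>}"
    have "integral {t..\<tau>} (\<lambda>r. k t r) = integral {t..\<tau>} (\<lambda>r. k r t)"
      by (rule Henstock_Kurzweil_Integration.integral_cong) (use t sym in auto)
    then show "integral {0..t} (\<lambda>r. k r t) + integral {t..\<tau>} (\<lambda>r. k t r) = integral {0..\<tau>} (\<lambda>r. k r t)"
      using Henstock_Kurzweil_Integration.integral_combine[of 0 t \<tau> "\<lambda>r. k r t"] t integrable_continuous_interval[OF continuous_slices(1)[OF k t]] by auto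
  qed
  finally show ?thesis using sw(3) by simp
qed

text \<open>Folding an interval of length \<open>n h\<close> onto its first piece of length
  \<open>h\<close>.\<close>
lemma integral_split_equal:
  fixes f :: "real \<Rightarrow> real"
  assumes h: "h \<ge> 0" and f: "continuous_on {0..real n * h} f"
  shows "integral {0..real n * h} f = integral {0..h} (\<lambda>r. \<Sum>i<n. f (real i * h + r))"
  using f
proof (induction n)
  case (Suc n)
  have le: "real n * h \<le> real (Suc n) * h" "0 \<le> real n * h" using h by (auto simp: mult_right_mono)
  have c1: "continuous_on {0..real n * h} f" "continuous_on {real n * h..real (Suc n) * h} f"
    by (rule continuous_on_subset[OF Suc.prems]; use le in auto)+
  have c: "continuous_on {0..h} (\<lambda>r. f (real i * h + r))" if "i < Suc n" for i
  proof (rule continuous_on_compose2[OF Suc.prems])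
    show "continuous_on {0..h} (\<lambda>r. real i * h + r)" by (intro continuous_intros)
    have "real i * h + h \<le> real (Suc n) * h" using mult_right_mono[of "real (Suc i)" "real (Suc n)" h] that h by (simp add: algebra_simps)
    then show "(\<lambda>r. real i * h + r) ` {0..h} \<subseteq> {0..real (Suc n) * h}" using h by force
  qed
  have "integral {0..real (Suc n) * h} f = integral {0..real n * h} f + integral {real n * h..real (Suc n) * h} f"
    using Henstock_Kurzweil_Integration.integral_combine[OF le(2,1) integrable_continuous_interval[OF Suc.prems]] by simp
  also have "integral {real n * h..real (Suc n) * h} f = integral {0..h} (\<lambda>r. f (real n * h + r))"
    using integral_shift[of 0 "real n * h" h f] c1(2) by (simp add: o_def algebra_simps)
  also have "integral {0..real n * h} f = integral {0..h} (\<lambda>r. \<Sum>i<n. f (real i * h + r))" by (rule Suc.IH[OF c1(1)])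
  also have "integral {0..h} (\<lambda>r. \<Sum>i<n. f (real i * h + r)) + integral {0..h} (\<lambda>r. f (real n * h + r)) = integral {0..h} (\<lambda>r. (\<Sum>i<n. f (real i * h + r)) + f (real n * h + r))"
    by (intro Henstock_Kurzweil_Integration.integral_add[symmetric] integrable_continuous_interval continuous_on_sum c) auto
  finally show ?case by simp
qed simp

text \<open>Fold both variables onto \<open>[0, h]\<close>. For equal arguments the folded integrand is a
  sum \<open>\<Sum>\<Sum> k (p i) (p j)\<close>, hence non-negative; for different arguments it
  changes by little because the arguments differ by at most \<open>h\<close> and \<open>k\<close>
  is uniformly continuous.\<close>
lemma positive_kernel_square_integral_nonneg:
  fixes k :: "real \<Rightarrow> real \<Rightarrow> real"
  assumes \<tau>: "\<tau> \<ge> 0" and k: "continuous_on ({0..\<tau>} \<times> {0..\<tau>}) (\<lambda>(r, t). k r t)"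
    and psd: "\<And>(n::nat) p. (\<And>i. i < n \<Longrightarrow> p i \<in> {0..\<tau>}) \<Longrightarrow> (\<Sum>i<n. \<Sum>j<n. k (p i) (p j)) \<ge> 0"
  shows "integral {0..\<tau>} (\<lambda>t. integral {0..\<tau>} (\<lambda>r. k r t)) \<ge> 0"
proof -
  define q where "q = (\<lambda>t. integral {0..\<tau>} (\<lambda>r. k r t))"
  have qc: "continuous_on {0..\<tau>} q"
  proof -
    have "continuous_on ({0..\<tau>} \<times> cbox 0 \<tau>) (\<lambda>(t, r). k r t)"
    proof -
      have "continuous_on ({0..\<tau>} \<times> {0..\<tau>}) (\<lambda>z. (snd z, fst z))" by (intro continuous_intros)
      note c = this
      have "(\<lambda>z. (snd z, fst z)) ` ({0..\<tau>} \<times> {0..\<tau>}) \<subseteq> {0..\<tau>} \<times> {0..\<tau>}" by auto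
      from continuous_on_compose2[OF k c this] show ?thesis by (simp add: case_prod_beta')
    qed
    from integral_continuous_on_param[OF this] show ?thesis by (simp add: q_def)
  qed
  have "- integral {0..\<tau>} q \<le> 0 + e" if e: "e > 0" for e
  proof -
    \<comment> \<open>The total error is the area of the square times \<open>e'\<close>; adding one covers the degenerate square.\<close>
    define e' where "e' = e / (\<tau>\<^sup>2 + 1)"
    have e': "e' > 0" "\<tau>\<^sup>2 * e' \<le> e" unfolding e'_def using e by (auto simp: field_simps add_pos_nonneg)
    have "uniformly_continuous_on ({0..\<tau>} \<times> {0..\<tau>}) (\<lambda>(r, t). k r t)"
      by (intro compact_uniformly_continuous k compact_Times compact_Icc)
    then obtain d where d: "d > 0" "\<And>z z'. z \<in> {0..\<tau>} \<times> {0..\<tau>} \<Longrightarrow> z' \<in> {0..\<tau>} \<times> {0..\<tau>} \<Longrightarrow> dist z' z < d \<Longrightarrow> dist (case_prod k z') (case_prod k z) < e'"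
      unfolding uniformly_continuous_on_def using e'(1) by blast
    obtain n :: nat where n: "real n > \<tau> / d" using reals_Archimedean2 by blast
    have "\<tau> / d \<ge> 0" using \<tau> d(1) by simp
    then have n0: "n > 0" using n by (cases n) auto
    define h where "h = \<tau> / real n"
    have h: "h \<ge> 0" "real n * h = \<tau>" "h < d" unfolding h_def using n n0 \<tau> d(1) by (auto simp: field_simps)
    have inT: "real i * h + r \<in> {0..\<tau>}" if "i < n" "r \<in> {0..h}" for i r
    proof -
      have "real i * h + h \<le> real n * h" using mult_right_mono[of "real (Suc i)" "real n" h] that(1) h(1) by (simp add: algebra_simps)
      then show ?thesis using that(2) h by auto
    qed
    have cI: "continuous_on {0..h} (\<lambda>r. g (real i * h + r))" if "continuous_on {0..\<tau>} g" "i < n" for g :: "real \<Rightarrow> real" and i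
    proof (rule continuous_on_compose2[OF that(1)])
      show "continuous_on {0..h} (\<lambda>r. real i * h + r)" by (intro continuous_intros)
      show "(\<lambda>r. real i * h + r) ` {0..h} \<subseteq> {0..\<tau>}" by (rule image_subsetI, rule inT[OF that(2)])
    qed
    have low: "(\<Sum>j<n. \<Sum>i<n. k (real i * h + r) (real j * h + t)) \<ge> - (real n * (real n * e'))" if rt: "r \<in> {0..h}" "t \<in> {0..h}" for r t
    proof -
      have "(\<Sum>j<n. \<Sum>i<n. k (real i * h + r) (real j * h + r) - e') \<le> (\<Sum>j<n. \<Sum>i<n. k (real i * h + r) (real j * h + t))"
      proof (intro sum_mono)
        fix i j assume "i \<in> {..<n}" "j \<in> {..<n}"
        then have z: "(real i * h + r, real j * h + r) \<in> {0..\<tau>} \<times> {0..\<tau>}" "(real i * h + r, real j * h + t) \<in> {0..\<tau>} \<times> {0..\<tau>}"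
          using inT rt by auto
        have "dist (real i * h + r, real j * h + t) (real i * h + r, real j * h + r) < d"
          using rt h(3) by (auto simp: dist_Pair_Pair dist_real_def)
        from d(2)[OF z this] show "k (real i * h + r) (real j * h + r) - e' \<le> k (real i * h + r) (real j * h + t)"
          by (simp add: dist_real_def)
      qed
      moreover have "(\<Sum>j<n. \<Sum>i<n. k (real i * h + r) (real j * h + r)) \<ge> 0"
        using psd[of n "\<lambda>i. real i * h + r"] inT rt(1) sum.swap[of "\<lambda>i j. k (real i * h + r) (real j * h + r)" "{..<n}" "{..<n}"] by simp
      ultimately show ?thesis by (simp add: sum_subtractf)
    qed
    have inner: "(\<Sum>j<n. q (real j * h + t)) \<ge> - (real n * (real n * e')) * h" if t: "t \<in> {0..h}" for t
    proof -
      have kc: "continuous_on {0..\<tau>} (\<lambda>r. k r (real j * h + t))" if "j < n" for j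
        by (rule continuous_slices(1)[OF k inT[OF that t]])
      have "q (real j * h + t) = integral {0..h} (\<lambda>r. \<Sum>i<n. k (real i * h + r) (real j * h + t))" if "j < n" for j
        unfolding q_def using integral_split_equal[OF h(1), of n "\<lambda>r. k r (real j * h + t)"] kc[OF that] by (simp add: h(2))
      then have "(\<Sum>j<n. q (real j * h + t)) = (\<Sum>j<n. integral {0..h} (\<lambda>r. \<Sum>i<n. k (real i * h + r) (real j * h + t)))" by simp
      also have "\<dots> = integral {0..h} (\<lambda>r. \<Sum>j<n. \<Sum>i<n. k (real i * h + r) (real j * h + t))"
        by (rule Henstock_Kurzweil_Integration.integral_sum[symmetric])
          (auto intro!: integrable_continuous_interval continuous_on_sum cI[OF kc])
      also have "\<dots> \<ge> integral {0..h} (\<lambda>r. - (real n * (real n * e')))"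
        by (rule integral_le) (use low t in \<open>auto intro!: integrable_continuous_interval continuous_on_sum cI[OF kc]\<close>)
      finally show ?thesis using h(1) by (simp add: mult_ac)
    qed
    have "integral {0..\<tau>} q = integral {0..h} (\<lambda>t. \<Sum>j<n. q (real j * h + t))"
      using integral_split_equal[OF h(1), of n q] qc by (simp add: h(2))
    also have "\<dots> \<ge> integral {0..h} (\<lambda>t. - (real n * (real n * e')) * h)"
      by (rule integral_le) (use inner in \<open>auto intro!: integrable_continuous_interval continuous_on_sum cI[OF qc]\<close>)
    finally have "integral {0..\<tau>} q \<ge> - ((real n * h) * (real n * h) * e')" using h(1) by (simp add: mult_ac)
    then show ?thesis using e'(2) unfolding h(2) by (simp add: power2_eq_square)
  qed
  then have "- integral {0..\<tau>} q \<le> 0" by (rule field_le_epsilon)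
  then show ?thesis unfolding q_def by simp
qed

text \<open>Integrate the inequality up to a time \<open>m\<close> at which \<open>N\<close> is maximal. The
  kernel contributes with a favourable sign, leaving \<open>(N m)\<^sup>2 \<le> (N 0)\<^sup>2 + 2
  K T N m\<close>. As \<open>N 0 \<le> N m\<close>, one factor \<open>N m\<close> cancels.\<close>
lemma scalar_energy_bound:
  fixes N p :: "real \<Rightarrow> real" and k :: "real \<Rightarrow> real \<Rightarrow> real"
  assumes T: "T > 0" and K: "K \<ge> 0" and Nc: "continuous_on {0..T} N" and Nn: "\<And>t. N t \<ge> 0"
    and d: "\<And>t. t \<in> {0..T} \<Longrightarrow> ((\<lambda>t. (N t)\<^sup>2) has_vector_derivative 2 * p t) (at t within {0..T})"
    and pc: "continuous_on {0..T} p"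
    and k: "continuous_on ({0..T} \<times> {0..T}) (\<lambda>(r, t). k r t)"
    and sym: "\<And>r t. r \<in> {0..T} \<Longrightarrow> t \<in> {0..T} \<Longrightarrow> k r t = k t r"
    and psd: "\<And>(n::nat) q. (\<And>i. i < n \<Longrightarrow> q i \<in> {0..T}) \<Longrightarrow> (\<Sum>i<n. \<Sum>j<n. k (q i) (q j)) \<ge> 0"
    and le: "\<And>t. t \<in> {0..T} \<Longrightarrow> p t \<le> K * N t - integral {0..t} (\<lambda>r. k r t)"
    and t: "t \<in> {0..T}"
  shows "N t \<le> N 0 + 2 * T * K"
proof -
  obtain m where m: "m \<in> {0..T}" "\<And>t. t \<in> {0..T} \<Longrightarrow> N t \<le> N m"
    using continuous_attains_sup[OF compact_Icc _ Nc] T by fastforce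
  have sub: "{0..m} \<subseteq> {0..T}" using m(1) by auto
  have km: "continuous_on ({0..m} \<times> {0..m}) (\<lambda>(r, t). k r t)" by (rule continuous_on_subset[OF k]) (use sub in auto)
  have J: "integral {0..m} (\<lambda>t. integral {0..t} (\<lambda>r. k r t)) \<ge> 0"
  proof -
    have psd': "(\<Sum>i<n. \<Sum>j<n. k (q i) (q j)) \<ge> 0" if "\<And>i. i < n \<Longrightarrow> q i \<in> {0..m}" for n :: nat and q
      by (rule psd) (use that sub in blast)
    have "integral {0..m} (\<lambda>t. integral {0..m} (\<lambda>r. k r t)) \<ge> 0"
      by (rule positive_kernel_square_integral_nonneg[OF _ km psd']) (use m(1) in simp)
    then show ?thesis using triangle_integral_half_square[OF km sym] sub by fastforce
  qed
  have "((\<lambda>t. 2 * p t) has_integral ((N m)\<^sup>2 - (N 0)\<^sup>2)) {0..m}"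
    by (rule fundamental_theorem_of_calculus) (use m(1) sub in \<open>auto intro!: has_vector_derivative_within_subset[OF d sub]\<close>)
  note ftc = this
  have I2: "(\<lambda>t. 2 * integral {0..t} (\<lambda>r. k r t)) integrable_on {0..m}"
    using integrable_on_cmult_left[OF triangle_integral_swap(1)[OF km], of 2] by simp
  from ftc have "(N m)\<^sup>2 - (N 0)\<^sup>2 = integral {0..m} (\<lambda>t. 2 * p t)" by (simp only: integral_unique)
  also have "\<dots> \<le> integral {0..m} (\<lambda>t. 2 * K * N m - 2 * integral {0..t} (\<lambda>r. k r t))"
  proof (rule integral_le)
    show "(\<lambda>t. 2 * p t) integrable_on {0..m}" by (intro integrable_continuous_interval continuous_intros continuous_on_subset[OF pc sub])
    show "(\<lambda>t. 2 * K * N m - 2 * integral {0..t} (\<lambda>r. k r t)) integrable_on {0..m}"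
      by (intro integrable_diff integrable_const_ivl I2)
    fix t assume "t \<in> {0..m}"
    then have t: "t \<in> {0..T}" using sub by blast
    have "K * N t \<le> K * N m" by (intro mult_left_mono m(2)[OF t] K)
    then show "2 * p t \<le> 2 * K * N m - 2 * integral {0..t} (\<lambda>r. k r t)" using le[OF t] by simp
  qed
  also have "\<dots> = 2 * K * N m * m - 2 * integral {0..m} (\<lambda>t. integral {0..t} (\<lambda>r. k r t))"
    using Henstock_Kurzweil_Integration.integral_diff[OF integrable_const_ivl I2, of "2 * K * N m"] m(1)
    by (simp add: mult.commute)
  also have "\<dots> \<le> 2 * K * N m * T"
  proof -
    have "2 * K * N m * m \<le> 2 * K * N m * T" using m(1) K Nn[of m] by (intro mult_left_mono) auto
    then show ?thesis using J by linarith
  qed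
  finally have main: "(N m)\<^sup>2 \<le> (N 0)\<^sup>2 + 2 * K * N m * T" by simp
  have "N m \<le> N 0 + 2 * T * K"
  proof (rule ccontr)
    assume neg: "\<not> ?thesis"
    have "N 0 \<le> N m" by (rule m(2)) (use T in simp)
    have "N m * N m > N m * (N 0 + 2 * T * K)"
      using neg Nn[of 0] T K by (intro mult_strict_left_mono) (auto intro: le_less_trans[of 0 "N 0 + 2 * T * K"])
    moreover have "N m * N 0 \<ge> N 0 * N 0" by (intro mult_right_mono \<open>N 0 \<le> N m\<close> Nn)
    ultimately show False using main by (simp add: power2_eq_square algebra_simps)
  qed
  then show ?thesis using m(2)[OF t] by linarith
qed

section \<open>Estimates for solutions and the uniqueness theorem\<close>

lemma L2_inner_sum_left: "finite I \<Longrightarrow> (\<And>i. i \<in> I \<Longrightarrow> f i \<in> L2_space) \<Longrightarrow> g \<in> L2_space \<Longrightarrow> L2_inner (\<lambda>x. \<Sum>i\<in>I. f i x) g = (\<Sum>i\<in>I. L2_inner (f i) g)"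
proof (induction I rule: finite_induct)
  case (insert i I)
  then show ?case using L2_inner_add_left[of "f i" "\<lambda>x. \<Sum>i\<in>I. f i x" g] L2_sum[of I f] by simp
qed (simp add: L2_inner_def)

lemma L2_inner_sum_right: "finite I \<Longrightarrow> (\<And>i. i \<in> I \<Longrightarrow> f i \<in> L2_space) \<Longrightarrow> g \<in> L2_space \<Longrightarrow> L2_inner g (\<lambda>x. \<Sum>i\<in>I. f i x) = (\<Sum>i\<in>I. L2_inner g (f i))"
  using L2_inner_sum_left[of I f g] by (simp add: L2_inner_cnj[symmetric, of g] del: L2_inner_cnj)

text \<open>This is the sign of the damping term, and positivity of the contribution of \<open>a\<close> to
  the kernel.\<close>
lemma L2_inner_nonneg_multiplier:
  assumes a: "\<And>x. a x \<in> \<real>\<^sub>\<ge>\<^sub>0" and am: "a \<in> borel_measurable borel" "AE x in lborel. norm (a x) \<le> C" "C \<ge> 0" and f: "f \<in> L2_space"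
  shows "Re (L2_inner (\<lambda>x. a x * f x) f) \<ge> 0"
proof -
  have eq: "a x * f x * cnj (f x) = complex_of_real (Re (a x) * (norm (f x))\<^sup>2)" for x
  proof -
    have "a x = complex_of_real (Re (a x))" using a[of x] by (auto simp: nonneg_Reals_def)
    then have "a x * (f x * cnj (f x)) = complex_of_real (Re (a x)) * (f x * cnj (f x))" by simp
    then show ?thesis unfolding complex_norm_square[symmetric] of_real_mult by (simp only: mult.assoc complex_norm_square)
  qed
  have "L2_inner (\<lambda>x. a x * f x) f = complex_of_real (\<integral>x. Re (a x) * (norm (f x))\<^sup>2 \<partial>lborel)"
    unfolding L2_inner_def eq by (rule integral_complex_of_real)
  moreover have "(\<integral>x. Re (a x) * (norm (f x))\<^sup>2 \<partial>lborel) \<ge> 0"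
  proof (rule Bochner_Integration.integral_nonneg)
    show "Re (a x) * (norm (f x))\<^sup>2 \<ge> 0" for x using a[of x] by (simp add: complex_nonneg_Reals_iff)
  qed
  ultimately show ?thesis by simp
qed

lemma L2_inner_real_multiplier_cnj:
  assumes a: "\<And>x. a x \<in> \<real>\<^sub>\<ge>\<^sub>0"
  shows "L2_inner (\<lambda>x. a x * f x) g = cnj (L2_inner (\<lambda>x. a x * g x) f)"
proof -
  have "cnj (a x) = a x" for x using a[of x] by (auto simp: nonneg_Reals_def)
  then show ?thesis unfolding L2_inner_def Bochner_Integration.integral_cnj[symmetric] by (simp add: mult_ac)
qed

text \<open>The kernel is the real part of \<open>\<langle>D(r), D(t)\<rangle> / P + \<langle>a w(r),
  w(t)\<rangle>\<close>. A double sum over times is the same form evaluated at the sums of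
  \<open>D\<close> and \<open>w\<close>, so it is non-negative. The function \<open>D\<close>
  stands for the fractional derivative of \<open>w\<close> on the Fourier side.\<close>
lemma L2_energy_estimate:
  fixes w z D :: "real \<Rightarrow> 'a::euclidean_space \<Rightarrow> complex"
  assumes T: "T > 0" and K: "K \<ge> 0" and P: "P > 0"
    and a: "a \<in> Linf_space" "\<And>x. a x \<in> \<real>\<^sub>\<ge>\<^sub>0" and b: "b \<in> Linf_space" "\<And>x. b x \<in> \<real>\<^sub>\<ge>\<^sub>0"
    and w: "L2_continuous T w" and z: "L2_continuous T z" and D: "L2_continuous T D"
    and wz: "has_L2_time_derivative T w z"
    and rel: "\<And>t. t \<in> {0..T} \<Longrightarrow> norm (L2_inner (z t) (w t) + L2_inner (\<lambda>x. b x * w t x) (w t)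
       + integral {0..t} (\<lambda>r. L2_inner (D r) (D t) / of_real P + L2_inner (\<lambda>x. a x * w r x) (w t))) \<le> K * L2_norm (w t)"
    and t: "t \<in> {0..T}"
  shows "L2_norm (w t) \<le> L2_norm (w 0) + 2 * T * K"
proof -
  note aw = L2_continuous_multiplier[OF w Linf_bound[OF a(1)]]
  define kc where "kc = (\<lambda>r t. L2_inner (D r) (D t) / complex_of_real P + L2_inner (\<lambda>x. a x * w r x) (w t))"
  have kcc: "continuous_on ({0..T} \<times> {0..T}) (\<lambda>(r, t). kc r t)"
    unfolding kc_def case_prod_beta
    using L2_inner_continuous_two[OF D D] L2_inner_continuous_two[OF aw w] P
    by (intro continuous_on_add continuous_on_divide continuous_on_const) (simp_all add: case_prod_beta)
  have kc1: "continuous_on {0..T} (\<lambda>r. kc r t)" if "t \<in> {0..T}" for t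
    unfolding kc_def using P
    by (intro continuous_on_add continuous_on_divide continuous_on_const L2_inner_const_continuous[OF D L2_continuous_mem[OF D that]] L2_inner_const_continuous[OF aw L2_continuous_mem[OF w that]]) simp
  show ?thesis
  proof (rule scalar_energy_bound[OF T K L2_continuous_norm[OF w] L2_norm_nonneg, where p = "\<lambda>t. Re (L2_inner (z t) (w t))" and k = "\<lambda>r t. Re (kc r t)"])
    show "t \<in> {0..T}" by fact
    show "continuous_on {0..T} (\<lambda>t. Re (L2_inner (z t) (w t)))" by (intro continuous_on_Re L2_inner_continuous[OF z w])
    show "continuous_on ({0..T} \<times> {0..T}) (\<lambda>(r, t). Re (kc r t))"
      using continuous_on_Re[OF kcc] by (simp add: case_prod_beta)
    show "Re (kc r t) = Re (kc t r)" for r t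
    proof -
      have "L2_inner (D r) (D t) = cnj (L2_inner (D t) (D r))" by (simp add: L2_inner_cnj)
      moreover have "L2_inner (\<lambda>x. a x * w r x) (w t) = cnj (L2_inner (\<lambda>x. a x * w t x) (w r))" by (rule L2_inner_real_multiplier_cnj[OF a(2)])
      ultimately show ?thesis unfolding kc_def by simp
    qed
    show "((\<lambda>t. (L2_norm (w t))\<^sup>2) has_vector_derivative 2 * Re (L2_inner (z t) (w t))) (at t within {0..T})" if t: "t \<in> {0..T}" for t
    proof -
      have "((\<lambda>t. Re (L2_inner (w t) (w t))) has_vector_derivative Re (L2_inner (z t) (w t) + L2_inner (w t) (z t))) (at t within {0..T})"
        by (rule bounded_linear.has_vector_derivative[OF bounded_linear_Re L2_inner_has_vector_derivative[OF wz w z wz w z t]])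
      moreover have "Re (L2_inner (z t) (w t) + L2_inner (w t) (z t)) = 2 * Re (L2_inner (z t) (w t))"
        using L2_inner_cnj[of "z t" "w t"] by (simp flip: L2_inner_cnj[of "z t" "w t"])
      ultimately show ?thesis by (simp add: L2_inner_self)
    qed
    show "(\<Sum>i<n. \<Sum>j<n. Re (kc (q i) (q j))) \<ge> 0" if q: "\<And>i. i < n \<Longrightarrow> q i \<in> {0..T}" for n :: nat and q
    proof -
      let ?D = "\<lambda>x. \<Sum>i<n. D (q i) x" and ?W = "\<lambda>x. \<Sum>i<n. w (q i) x"
      have mem: "D (q i) \<in> L2_space" "w (q i) \<in> L2_space" "(\<lambda>x. a x * w (q i) x) \<in> L2_space" if "i \<in> {..<n}" for i
        using q that L2_continuous_mem[OF D] L2_continuous_mem[OF w] L2_continuous_mem[OF aw] by auto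
      have D2: "?D \<in> L2_space" and W2: "?W \<in> L2_space" by (intro L2_sum mem; simp)+
      have "(\<Sum>i<n. \<Sum>j<n. L2_inner (D (q i)) (D (q j))) = (\<Sum>i<n. L2_inner (D (q i)) ?D)"
        by (intro sum.cong refl L2_inner_sum_right[symmetric] mem) auto
      also have "\<dots> = L2_inner ?D ?D" by (intro L2_inner_sum_left[symmetric] mem D2) auto
      finally have e1: "(\<Sum>i<n. \<Sum>j<n. L2_inner (D (q i)) (D (q j))) = L2_inner ?D ?D" .
      have "(\<Sum>i<n. \<Sum>j<n. L2_inner (\<lambda>x. a x * w (q i) x) (w (q j))) = (\<Sum>i<n. L2_inner (\<lambda>x. a x * w (q i) x) ?W)"
        by (intro sum.cong refl L2_inner_sum_right[symmetric] mem) auto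
      also have "\<dots> = L2_inner (\<lambda>x. \<Sum>i<n. a x * w (q i) x) ?W" by (intro L2_inner_sum_left[symmetric] mem W2) auto
      finally have e2: "(\<Sum>i<n. \<Sum>j<n. L2_inner (\<lambda>x. a x * w (q i) x) (w (q j))) = L2_inner (\<lambda>x. a x * ?W x) ?W"
        by (simp add: sum_distrib_left)
      have "(\<Sum>i<n. \<Sum>j<n. Re (kc (q i) (q j))) = Re (\<Sum>i<n. \<Sum>j<n. kc (q i) (q j))" by simp
      also have "(\<Sum>i<n. \<Sum>j<n. kc (q i) (q j)) = L2_inner ?D ?D / of_real P + L2_inner (\<lambda>x. a x * ?W x) ?W"
        unfolding kc_def sum.distrib sum_divide_distrib[symmetric] e1 e2 ..
      also have "Re \<dots> \<ge> 0"
        using L2_inner_nonneg_multiplier[OF a(2) Linf_bound[OF a(1)] W2] P by (simp add: L2_inner_self)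
      finally show ?thesis .
    qed
    show "Re (L2_inner (z t) (w t)) \<le> K * L2_norm (w t) - integral {0..t} (\<lambda>r. Re (kc r t))" if t: "t \<in> {0..T}" for t
    proof -
      have "(\<lambda>r. kc r t) integrable_on {0..t}"
        by (rule integrable_continuous_interval[OF continuous_on_subset[OF kc1[OF t]]]) (use t in auto)
      from integral_linear[OF this bounded_linear_Re]
      have I: "integral {0..t} (\<lambda>r. Re (kc r t)) = Re (integral {0..t} (\<lambda>r. kc r t))" by (simp add: o_def)
      have "Re (L2_inner (z t) (w t) + L2_inner (\<lambda>x. b x * w t x) (w t) + integral {0..t} (\<lambda>r. kc r t)) \<le> K * L2_norm (w t)"
        using rel[OF t] complex_Re_le_cmod order_trans unfolding kc_def by blast
      moreover have "Re (L2_inner (\<lambda>x. b x * w t x) (w t)) \<ge> 0"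
        by (rule L2_inner_nonneg_multiplier[OF b(2) Linf_bound[OF b(1)] L2_continuous_mem[OF w t]])
      ultimately show ?thesis unfolding I by simp
    qed
  qed
qed

text \<open>The energy estimate without a source: the right-hand side of the integrated equation consists of
  the initial data.\<close>
lemma solution_L2_bound:
  fixes u :: "real \<Rightarrow> 'a::euclidean_space \<Rightarrow> complex"
  assumes T: "T > 0" and s: "s > 0"
    and a: "a \<in> Linf_space" "\<And>x. a x \<in> \<real>\<^sub>\<ge>\<^sub>0" and b: "b \<in> Linf_space" "\<And>x. b x \<in> \<real>\<^sub>\<ge>\<^sub>0"
    and sol: "solves_cauchy_problem s T a b u0 u1 u" and m: "u0 \<in> L2_space" "u1 \<in> L2_space"
    and t: "t \<in> {0..T}"
  shows "L2_norm (u t) \<le> L2_norm u0 + 2 * T * (L2_norm u1 + Linf_norm b * L2_norm u0)"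
proof -
  obtain v where u: "continuous_into T (Hs_space s) (Hs_norm s) u" and uv: "has_L2_time_derivative T u v"
    and v: "L2_continuous T v" and eq: "damped_wave_equation s T a b u v"
    and i: "AE x in lborel. u 0 x = u0 x" "AE x in lborel. v 0 x = u1 x"
    using sol unfolding solves_cauchy_problem_def by blast
  have s0: "s \<ge> 0" and t0: "0 \<in> {0..T}" using s T by auto
  note uc = Hs_continuous[OF u s0]
  note bu = L2_continuous_multiplier[OF uc(1) Linf_bound[OF b(1)]]
  have n0: "L2_norm u0 = L2_norm (u 0)" "L2_norm u1 = L2_norm (v 0)"
    using L2_cong_AE(2)[OF i(1) L2_measurable[OF m(1)] L2_continuous_mem[OF uc(1) t0]] L2_cong_AE(2)[OF i(2) L2_measurable[OF m(2)] L2_continuous_mem[OF v t0]] by auto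
  define P :: real where "P = (2 * pi) ^ DIM('a)"
  have "L2_norm (u t) \<le> L2_norm (u 0) + 2 * T * (L2_norm (v 0) + Linf_norm b * L2_norm (u 0))"
  proof (rule L2_energy_estimate[OF T _ _ a b uc(1) v uc(2) uv _ t])
    show "P > 0" by (simp add: P_def)
    show "0 \<le> L2_norm (v 0) + Linf_norm b * L2_norm (u 0)"
      by (intro add_nonneg_nonneg mult_nonneg_nonneg Linf_bound(3)[OF b(1)]) simp_all
    fix t assume t: "t \<in> {0..T}"
    note ut = L2_continuous_mem[OF uc(1) t]
    have "L2_inner (v t) (u t) + L2_inner (\<lambda>x. b x * u t x) (u t) + integral {0..t} (\<lambda>r. L2_inner (freq_deriv s (u r)) (freq_deriv s (u t)) / of_real P + L2_inner (\<lambda>x. a x * u r x) (u t))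
       = L2_inner (v 0) (u t) + L2_inner (\<lambda>x. b x * u 0 x) (u t)"
      using integrated_equation[OF T s a(1) b(1) u uv v eq ut L2_continuous_mem[OF uc(2) t] t] by (simp add: P_def)
    moreover have "norm (L2_inner (v 0) (u t) + L2_inner (\<lambda>x. b x * u 0 x) (u t)) \<le> L2_norm (v 0) * L2_norm (u t) + (Linf_norm b * L2_norm (u 0)) * L2_norm (u t)"
      by (intro norm_triangle_mono L2_inner_bound L2_continuous_mem[OF v t0] ut
         order_trans[OF L2_inner_bound[OF L2_continuous_mem[OF bu t0] ut] mult_right_mono[OF L2_multiplier(2)[OF L2_continuous_mem[OF uc(1) t0] Linf_bound[OF b(1)]] L2_norm_nonneg]])
    ultimately show "norm (L2_inner (v t) (u t) + L2_inner (\<lambda>x. b x * u t x) (u t) + integral {0..t} (\<lambda>r. L2_inner (freq_deriv s (u r)) (freq_deriv s (u t)) / of_real P + L2_inner (\<lambda>x. a x * u r x) (u t)))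
       \<le> (L2_norm (v 0) + Linf_norm b * L2_norm (u 0)) * L2_norm (u t)" by (simp add: distrib_right)
  qed
  then show ?thesis unfolding n0 .
qed

lemma L2_inner_cong_AE_right:
  assumes "AE x in lborel. g x = g' x" "f \<in> L2_space" "g \<in> L2_space" "g' \<in> L2_space"
  shows "L2_inner f g = L2_inner f g'"
proof -
  have "AE x in lborel. f x * cnj (g x) = f x * cnj (g' x)" using assms(1) by eventually_elim simp
  then show ?thesis unfolding L2_inner_def
    by (intro integral_cong_AE borel_measurable_integrable L2_inner_integrable assms) auto
qed

text \<open>The cancellation behind the next lemma, with the pairings as unknowns.\<close>
lemma subtracted_equations:
  fixes v v' z :: complex
  assumes "v + p = v0 + p0 - A" "v' + p' = v0' + p0' - A'" "p - p' = q + r" "p0 - p0' = q0 + r0"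
    "v - v' = z" "v0 - v0' = z0" "A - A' = B + R"
  shows "z + q + B = (z0 + q0) + (r0 - r) - R"
  using assms by algebra

text \<open>Subtract the integrated equations for \<open>u\<close> and \<open>u'\<close>, both tested with
  \<open>w t\<close>, and write \<open>b u - b' u' = b w + (b - b') u'\<close> and likewise for
  \<open>a\<close>. The terms with coefficient differences involve \<open>u'\<close> and not its
  time derivative, which is why a bound on \<open>u'\<close> in \<open>L\<^sup>2\<close> is
  enough.\<close>
lemma solution_difference_L2_bound:
  fixes u u' :: "real \<Rightarrow> 'a::euclidean_space \<Rightarrow> complex"
  assumes T: "T > 0" and s: "s > 0"
    and a: "a \<in> Linf_space" "\<And>x. a x \<in> \<real>\<^sub>\<ge>\<^sub>0" and b: "b \<in> Linf_space" "\<And>x. b x \<in> \<real>\<^sub>\<ge>\<^sub>0"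
    and a': "a' \<in> Linf_space" and b': "b' \<in> Linf_space"
    and da: "(\<lambda>x. a x - a' x) \<in> Linf_space" and db: "(\<lambda>x. b x - b' x) \<in> Linf_space"
    and sol: "solves_cauchy_problem s T a b u0 u1 u" and m: "u0 \<in> L2_space" "u1 \<in> L2_space"
    and sol': "solves_cauchy_problem s T a' b' u0' u1' u'" and m': "u0' \<in> L2_space" "u1' \<in> L2_space"
    and M: "\<And>t. t \<in> {0..T} \<Longrightarrow> L2_norm (u' t) \<le> M"
    and t: "t \<in> {0..T}"
  shows "(\<lambda>x. u t x - u' t x) \<in> L2_space"
    and "L2_norm (\<lambda>x. u t x - u' t x) \<le> L2_norm (\<lambda>x. u0 x - u0' x)
      + 2 * T * (L2_norm (\<lambda>x. u1 x - u1' x) + Linf_norm b * L2_norm (\<lambda>x. u0 x - u0' x)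
        + (2 * Linf_norm (\<lambda>x. b x - b' x) + T * Linf_norm (\<lambda>x. a x - a' x)) * M)"
proof -
  obtain v where u: "continuous_into T (Hs_space s) (Hs_norm s) u" and uv: "has_L2_time_derivative T u v"
    and v: "L2_continuous T v" and eq: "damped_wave_equation s T a b u v"
    and i: "AE x in lborel. u 0 x = u0 x" "AE x in lborel. v 0 x = u1 x"
    using sol unfolding solves_cauchy_problem_def by blast
  obtain v' where u': "continuous_into T (Hs_space s) (Hs_norm s) u'" and uv': "has_L2_time_derivative T u' v'"
    and v': "L2_continuous T v'" and eq': "damped_wave_equation s T a' b' u' v'"
    and i': "AE x in lborel. u' 0 x = u0' x" "AE x in lborel. v' 0 x = u1' x"
    using sol' unfolding solves_cauchy_problem_def by blast
  have s0: "s \<ge> 0" and t0: "0 \<in> {0..T}" using s T by auto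
  note uc = Hs_continuous[OF u s0] and uc' = Hs_continuous[OF u' s0]
  define w where "w = (\<lambda>t x. u t x - u' t x)"
  define z where "z = (\<lambda>t x. v t x - v' t x)"
  define D where "D = (\<lambda>t \<xi>. freq_deriv s (u t) \<xi> - freq_deriv s (u' t) \<xi>)"
  define \<alpha> where "\<alpha> = (\<lambda>x. a x - a' x)"
  define \<beta> where "\<beta> = (\<lambda>x. b x - b' x)"
  have wc: "L2_continuous T w" unfolding w_def by (rule L2_continuous_diff[OF uc(1) uc'(1)])
  have zc: "L2_continuous T z" unfolding z_def by (rule L2_continuous_diff[OF v v'])
  have Dc: "L2_continuous T D" unfolding D_def by (rule L2_continuous_diff[OF uc(2) uc'(2)])
  have wz: "has_L2_time_derivative T w z" unfolding w_def z_def by (rule time_derivative_diff[OF uv uv' uc(1) v uc'(1) v'])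
  show "(\<lambda>x. u t x - u' t x) \<in> L2_space" using L2_continuous_mem[OF wc t] unfolding w_def .
  have \<alpha>: "\<alpha> \<in> Linf_space" and \<beta>: "\<beta> \<in> Linf_space" using da db unfolding \<alpha>_def \<beta>_def .
  note bw = L2_continuous_multiplier[OF wc Linf_bound[OF b(1)]] and aw = L2_continuous_multiplier[OF wc Linf_bound[OF a(1)]]
    and bu = L2_continuous_multiplier[OF uc(1) Linf_bound[OF b(1)]] and bu' = L2_continuous_multiplier[OF uc'(1) Linf_bound[OF b']]
    and au = L2_continuous_multiplier[OF uc(1) Linf_bound[OF a(1)]] and au' = L2_continuous_multiplier[OF uc'(1) Linf_bound[OF a']]
    and \<beta>u = L2_continuous_multiplier[OF uc'(1) Linf_bound[OF \<beta>]] and \<alpha>u = L2_continuous_multiplier[OF uc'(1) Linf_bound[OF \<alpha>]]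
  have n0: "L2_norm (\<lambda>x. u0 x - u0' x) = L2_norm (w 0)" "L2_norm (\<lambda>x. u1 x - u1' x) = L2_norm (z 0)"
  proof -
    have "AE x in lborel. w 0 x = u0 x - u0' x" using i(1) i'(1) by eventually_elim (simp add: w_def)
    from L2_cong_AE(2)[OF this L2_measurable[OF L2_diff(1)[OF m(1) m'(1)]] L2_continuous_mem[OF wc t0]]
    show "L2_norm (\<lambda>x. u0 x - u0' x) = L2_norm (w 0)" .
    have "AE x in lborel. z 0 x = u1 x - u1' x" using i(2) i'(2) by eventually_elim (simp add: z_def)
    from L2_cong_AE(2)[OF this L2_measurable[OF L2_diff(1)[OF m(2) m'(2)]] L2_continuous_mem[OF zc t0]]
    show "L2_norm (\<lambda>x. u1 x - u1' x) = L2_norm (z 0)" .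
  qed
  have M0: "M \<ge> 0" using M[OF t0] L2_norm_nonneg order_trans by blast
  define P :: real where "P = (2 * pi) ^ DIM('a)"
  define K where "K = L2_norm (z 0) + Linf_norm b * L2_norm (w 0) + (2 * Linf_norm \<beta> + T * Linf_norm \<alpha>) * M"
  have "L2_norm (w t) \<le> L2_norm (w 0) + 2 * T * K"
  proof (rule L2_energy_estimate[OF T _ _ a b wc zc Dc wz _ t])
    show "P > 0" by (simp add: P_def)
    show "K \<ge> 0" unfolding K_def using M0 T
      by (intro add_nonneg_nonneg mult_nonneg_nonneg Linf_bound(3)[OF b(1)] Linf_bound(3)[OF \<beta>] Linf_bound(3)[OF \<alpha>]) simp_all
    fix t assume t: "t \<in> {0..T}"
    note wt = L2_continuous_mem[OF wc t] and Dt = L2_continuous_mem[OF Dc t]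
    have ae: "AE \<xi> in lborel. freq_deriv s (w t) \<xi> = D t \<xi>"
      unfolding w_def D_def by (rule freq_deriv_diff[OF L2_continuous_mem[OF uc(1) t] L2_continuous_mem[OF uc'(1) t]])
    have Dw: "freq_deriv s (w t) \<in> L2_space"
    proof (rule L2_cong_AE(1)[OF _ freq_deriv_borel[OF wt] Dt])
      show "AE \<xi> in lborel. D t \<xi> = freq_deriv s (w t) \<xi>" using ae by eventually_elim simp
    qed
    have tT: "{0..t} \<subseteq> {0..T}" using t by auto
    define A where "A = (\<lambda>r. L2_inner (freq_deriv s (u r)) (freq_deriv s (w t)) / of_real P + L2_inner (\<lambda>x. a x * u r x) (w t))"
    define A' where "A' = (\<lambda>r. L2_inner (freq_deriv s (u' r)) (freq_deriv s (w t)) / of_real P + L2_inner (\<lambda>x. a' x * u' r x) (w t))"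
    define B where "B = (\<lambda>r. L2_inner (D r) (D t) / of_real P + L2_inner (\<lambda>x. a x * w r x) (w t))"
    define R where "R = (\<lambda>r. L2_inner (\<lambda>x. \<alpha> x * u' r x) (w t))"
    have P0: "complex_of_real P \<noteq> 0" unfolding P_def by simp
    have ints: "A integrable_on {0..t}" "A' integrable_on {0..t}" "B integrable_on {0..t}" "R integrable_on {0..t}"
      unfolding A_def A'_def B_def R_def
      by (intro integrable_continuous_interval continuous_on_subset[OF _ tT] continuous_on_add continuous_on_divide continuous_on_const
          L2_inner_const_continuous[OF uc(2) Dw] L2_inner_const_continuous[OF uc'(2) Dw] L2_inner_const_continuous[OF Dc Dt]
          L2_inner_const_continuous[OF au wt] L2_inner_const_continuous[OF au' wt] L2_inner_const_continuous[OF aw wt] L2_inner_const_continuous[OF \<alpha>u wt] ballI P0)+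
    have e1: "L2_inner (v t) (w t) + L2_inner (\<lambda>x. b x * u t x) (w t) = L2_inner (v 0) (w t) + L2_inner (\<lambda>x. b x * u 0 x) (w t) - integral {0..t} A"
      using integrated_equation[OF T s a(1) b(1) u uv v eq wt Dw t] by (simp add: P_def A_def)
    have e2: "L2_inner (v' t) (w t) + L2_inner (\<lambda>x. b' x * u' t x) (w t) = L2_inner (v' 0) (w t) + L2_inner (\<lambda>x. b' x * u' 0 x) (w t) - integral {0..t} A'"
      using integrated_equation[OF T s a' b' u' uv' v' eq' wt Dw t] by (simp add: P_def A'_def)
    have split: "L2_inner (\<lambda>x. c x * u r x) (w t) - L2_inner (\<lambda>x. c' x * u' r x) (w t) = L2_inner (\<lambda>x. c x * w r x) (w t) + L2_inner (\<lambda>x. (c x - c' x) * u' r x) (w t)"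
      if "c \<in> Linf_space" "c' \<in> Linf_space" "(\<lambda>x. c x - c' x) \<in> Linf_space" "r \<in> {0..T}" for c c' r
    proof -
      note mem = L2_continuous_mem[OF L2_continuous_multiplier[OF uc(1) Linf_bound[OF that(1)]] that(4)]
        L2_continuous_mem[OF L2_continuous_multiplier[OF uc'(1) Linf_bound[OF that(2)]] that(4)]
        L2_continuous_mem[OF L2_continuous_multiplier[OF wc Linf_bound[OF that(1)]] that(4)]
        L2_continuous_mem[OF L2_continuous_multiplier[OF uc'(1) Linf_bound[OF that(3)]] that(4)]
      have "(\<lambda>x. c x * u r x - c' x * u' r x) = (\<lambda>x. c x * w r x + (c x - c' x) * u' r x)"
        by (rule ext) (simp add: w_def algebra_simps)
      then show ?thesis using L2_inner_diff_left[OF mem(1,2) wt] L2_inner_add_left[OF mem(3,4) wt] by simp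
    qed
    have zsplit: "L2_inner (v r) (w t) - L2_inner (v' r) (w t) = L2_inner (z r) (w t)" if "r \<in> {0..T}" for r
      unfolding z_def by (rule L2_inner_diff_left[symmetric, OF L2_continuous_mem[OF v that] L2_continuous_mem[OF v' that] wt])
    have AB: "A r - A' r = B r + R r" if r: "r \<in> {0..t}" for r
    proof -
      have r': "r \<in> {0..T}" using r tT by blast
      have "L2_inner (freq_deriv s (u r)) (freq_deriv s (w t)) - L2_inner (freq_deriv s (u' r)) (freq_deriv s (w t)) = L2_inner (D r) (freq_deriv s (w t))"
        unfolding D_def by (rule L2_inner_diff_left[symmetric, OF L2_continuous_mem[OF uc(2) r'] L2_continuous_mem[OF uc'(2) r'] Dw])
      also have "\<dots> = L2_inner (D r) (D t)" by (rule L2_inner_cong_AE_right[OF ae L2_continuous_mem[OF Dc r'] Dw Dt])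
      finally have d: "L2_inner (freq_deriv s (u r)) (freq_deriv s (w t)) / of_real P - L2_inner (freq_deriv s (u' r)) (freq_deriv s (w t)) / of_real P = L2_inner (D r) (D t) / of_real P"
        unfolding diff_divide_distrib[symmetric] by simp
      show ?thesis using d split[OF a(1) a' da r'] unfolding A_def A'_def B_def R_def \<alpha>_def by (simp add: algebra_simps)
    qed
    have I: "integral {0..t} A - integral {0..t} A' = integral {0..t} B + integral {0..t} R"
    proof -
      have "integral {0..t} A - integral {0..t} A' = integral {0..t} (\<lambda>r. A r - A' r)"
        by (rule Henstock_Kurzweil_Integration.integral_diff[symmetric, OF ints(1,2)])
      also have "\<dots> = integral {0..t} (\<lambda>r. B r + R r)" by (rule Henstock_Kurzweil_Integration.integral_cong[OF AB])
      also have "\<dots> = integral {0..t} B + integral {0..t} R" by (rule Henstock_Kurzweil_Integration.integral_add[OF ints(3,4)])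
      finally show ?thesis .
    qed
    have split\<beta>: "L2_inner (\<lambda>x. b x * u r x) (w t) - L2_inner (\<lambda>x. b' x * u' r x) (w t) = L2_inner (\<lambda>x. b x * w r x) (w t) + L2_inner (\<lambda>x. \<beta> x * u' r x) (w t)"
      if "r \<in> {0..T}" for r unfolding \<beta>_def by (rule split[OF b(1) b' db that])
    have main: "L2_inner (z t) (w t) + L2_inner (\<lambda>x. b x * w t x) (w t) + integral {0..t} B
      = (L2_inner (z 0) (w t) + L2_inner (\<lambda>x. b x * w 0 x) (w t)) + (L2_inner (\<lambda>x. \<beta> x * u' 0 x) (w t) - L2_inner (\<lambda>x. \<beta> x * u' t x) (w t)) - integral {0..t} R"
      by (rule subtracted_equations[OF e1 e2 split\<beta>[OF t] split\<beta>[OF t0] zsplit[OF t] zsplit[OF t0] I])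
    have bnd: "norm (L2_inner (\<lambda>x. c x * f r x) (w t)) \<le> Linf_norm c * L * L2_norm (w t)"
      if "c \<in> Linf_space" "L2_continuous T f" "r \<in> {0..T}" "L2_norm (f r) \<le> L" for c f r L
    proof -
      have "norm (L2_inner (\<lambda>x. c x * f r x) (w t)) \<le> L2_norm (\<lambda>x. c x * f r x) * L2_norm (w t)"
        by (rule L2_inner_bound[OF L2_continuous_mem[OF L2_continuous_multiplier[OF that(2) Linf_bound[OF that(1)]] that(3)] wt])
      also have "\<dots> \<le> (Linf_norm c * L2_norm (f r)) * L2_norm (w t)"
        by (rule mult_right_mono[OF L2_multiplier(2)[OF L2_continuous_mem[OF that(2,3)] Linf_bound[OF that(1)]] L2_norm_nonneg])
      also have "\<dots> \<le> (Linf_norm c * L) * L2_norm (w t)"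
        by (rule mult_right_mono[OF mult_left_mono[OF that(4) Linf_bound(3)[OF that(1)]] L2_norm_nonneg])
      finally show ?thesis .
    qed
    have Rb: "norm (integral {0..t} R) \<le> T * Linf_norm \<alpha> * M * L2_norm (w t)"
    proof -
      let ?c = "Linf_norm \<alpha> * M * L2_norm (w t)"
      have "norm (R r) \<le> ?c" if r: "r \<in> {0..t}" for r
      proof -
        have r': "r \<in> {0..T}" using r tT by blast
        show ?thesis unfolding R_def by (rule bnd[OF \<alpha> uc'(1) r' M[OF r']])
      qed
      then have "norm (integral {0..t} R) \<le> integral {0..t} (\<lambda>r. ?c)"
        by (intro integral_norm_bound_integral ints(4)) auto
      also have "\<dots> = t * ?c" using t by simp
      also have "\<dots> \<le> T * ?c" using t M0 by (intro mult_right_mono mult_nonneg_nonneg Linf_bound(3)[OF \<alpha>]) auto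
      finally show ?thesis by (simp add: mult.assoc)
    qed
    have "norm ((L2_inner (z 0) (w t) + L2_inner (\<lambda>x. b x * w 0 x) (w t)) + (L2_inner (\<lambda>x. \<beta> x * u' 0 x) (w t) - L2_inner (\<lambda>x. \<beta> x * u' t x) (w t)) - integral {0..t} R)
      \<le> (L2_norm (z 0) * L2_norm (w t) + Linf_norm b * L2_norm (w 0) * L2_norm (w t)) + (Linf_norm \<beta> * M * L2_norm (w t) + Linf_norm \<beta> * M * L2_norm (w t)) + T * Linf_norm \<alpha> * M * L2_norm (w t)"
      by (intro order_trans[OF norm_triangle_ineq4 add_mono] norm_triangle_mono L2_inner_bound[OF L2_continuous_mem[OF zc t0] wt]
          bnd[OF b(1) wc t0 order_refl] bnd[OF \<beta> uc'(1) t0 M[OF t0]] bnd[OF \<beta> uc'(1) t M[OF t]] Rb)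
    also have "\<dots> = K * L2_norm (w t)" unfolding K_def by (simp add: algebra_simps)
    finally show "norm (L2_inner (z t) (w t) + L2_inner (\<lambda>x. b x * w t x) (w t) + integral {0..t} (\<lambda>r. L2_inner (D r) (D t) / of_real P + L2_inner (\<lambda>x. a x * w r x) (w t))) \<le> K * L2_norm (w t)"
      unfolding main[unfolded B_def] .
  qed
  then show "L2_norm (\<lambda>x. u t x - u' t x) \<le> L2_norm (\<lambda>x. u0 x - u0' x)
      + 2 * T * (L2_norm (\<lambda>x. u1 x - u1' x) + Linf_norm b * L2_norm (\<lambda>x. u0 x - u0' x)
        + (2 * Linf_norm (\<lambda>x. b x - b' x) + T * Linf_norm (\<lambda>x. a x - a' x)) * M)"
    unfolding n0 K_def w_def[of] \<alpha>_def \<beta>_def by simp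
qed

text \<open>Moderateness and negligibility of the real functions of \<open>\<epsilon>\<close> that bound the nets.\<close>
definition moderate_scale :: "(real \<Rightarrow> real) \<Rightarrow> bool" where
  "moderate_scale r \<longleftrightarrow> (\<exists>(N::nat) C. C > 0 \<and> (\<forall>\<epsilon>\<in>{0<..1}. r \<epsilon> \<le> C * \<epsilon> powr (- real N)))"

definition negligible_scale :: "(real \<Rightarrow> real) \<Rightarrow> bool" where
  "negligible_scale r \<longleftrightarrow> (\<forall>k::real. k > 0 \<longrightarrow> (\<exists>C. C > 0 \<and> (\<forall>\<epsilon>\<in>{0<..1}. r \<epsilon> \<le> C * \<epsilon> powr k)))"

lemma moderate_const: "moderate_scale (\<lambda>_. c)"
  unfolding moderate_scale_def by (intro exI[of _ 0] exI[of _ "\<bar>c\<bar> + 1"]) auto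

lemma moderate_add:
  assumes "moderate_scale r" "moderate_scale q" shows "moderate_scale (\<lambda>\<epsilon>. r \<epsilon> + q \<epsilon>)"
proof -
  obtain N C where 1: "C > 0" "\<And>\<epsilon>. \<epsilon> \<in> {0<..1} \<Longrightarrow> r \<epsilon> \<le> C * \<epsilon> powr (- real N)" using assms(1) unfolding moderate_scale_def by blast
  obtain N' C' where 2: "C' > 0" "\<And>\<epsilon>. \<epsilon> \<in> {0<..1} \<Longrightarrow> q \<epsilon> \<le> C' * \<epsilon> powr (- real N')" using assms(2) unfolding moderate_scale_def by blast
  have "r \<epsilon> + q \<epsilon> \<le> (C + C') * \<epsilon> powr (- real (N + N'))" if e: "\<epsilon> \<in> {0<..1}" for \<epsilon>
  proof -
    have "\<epsilon> powr (- real N) \<le> \<epsilon> powr (- real (N + N'))" "\<epsilon> powr (- real N') \<le> \<epsilon> powr (- real (N + N'))"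
      using e by (auto intro!: powr_mono')
    then have "C * \<epsilon> powr (- real N) + C' * \<epsilon> powr (- real N') \<le> C * \<epsilon> powr (- real (N + N')) + C' * \<epsilon> powr (- real (N + N'))"
      using 1(1) 2(1) by (intro add_mono mult_left_mono) auto
    then show ?thesis using 1(2)[OF e] 2(2)[OF e] by (simp add: distrib_right)
  qed
  then show ?thesis unfolding moderate_scale_def using 1(1) 2(1) by (intro exI[of _ "N + N'"] exI[of _ "C + C'"]) auto
qed

lemma moderate_mult:
  assumes "moderate_scale r" "moderate_scale q" and nn: "\<And>\<epsilon>. \<epsilon> \<in> {0<..1} \<Longrightarrow> r \<epsilon> \<ge> 0" "\<And>\<epsilon>. \<epsilon> \<in> {0<..1} \<Longrightarrow> q \<epsilon> \<ge> 0"
  shows "moderate_scale (\<lambda>\<epsilon>. r \<epsilon> * q \<epsilon>)"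
proof -
  obtain N C where 1: "C > 0" "\<And>\<epsilon>. \<epsilon> \<in> {0<..1} \<Longrightarrow> r \<epsilon> \<le> C * \<epsilon> powr (- real N)" using assms(1) unfolding moderate_scale_def by blast
  obtain N' C' where 2: "C' > 0" "\<And>\<epsilon>. \<epsilon> \<in> {0<..1} \<Longrightarrow> q \<epsilon> \<le> C' * \<epsilon> powr (- real N')" using assms(2) unfolding moderate_scale_def by blast
  have "r \<epsilon> * q \<epsilon> \<le> (C * C') * \<epsilon> powr (- real (N + N'))" if e: "\<epsilon> \<in> {0<..1}" for \<epsilon>
  proof -
    have "r \<epsilon> * q \<epsilon> \<le> (C * \<epsilon> powr (- real N)) * (C' * \<epsilon> powr (- real N'))"
      using 1 2 e nn by (intro mult_mono) (auto intro: mult_nonneg_nonneg)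
    also have "\<dots> = (C * C') * (\<epsilon> powr (- real N) * \<epsilon> powr (- real N'))" by (simp only: mult_ac)
    also have "\<epsilon> powr (- real N) * \<epsilon> powr (- real N') = \<epsilon> powr (- real (N + N'))" unfolding powr_add[symmetric] by simp
    finally show ?thesis .
  qed
  then show ?thesis unfolding moderate_scale_def using 1(1) 2(1) by (intro exI[of _ "N + N'"] exI[of _ "C * C'"]) auto
qed

lemma negligible_add:
  assumes "negligible_scale r" "negligible_scale q" shows "negligible_scale (\<lambda>\<epsilon>. r \<epsilon> + q \<epsilon>)"
  unfolding negligible_scale_def
proof (intro allI impI)
  fix k :: real assume k: "k > 0"
  obtain C where 1: "C > 0" "\<And>\<epsilon>. \<epsilon> \<in> {0<..1} \<Longrightarrow> r \<epsilon> \<le> C * \<epsilon> powr k" using assms(1) k unfolding negligible_scale_def by blast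
  obtain C' where 2: "C' > 0" "\<And>\<epsilon>. \<epsilon> \<in> {0<..1} \<Longrightarrow> q \<epsilon> \<le> C' * \<epsilon> powr k" using assms(2) k unfolding negligible_scale_def by blast
  have "r \<epsilon> + q \<epsilon> \<le> (C + C') * \<epsilon> powr k" if "\<epsilon> \<in> {0<..1}" for \<epsilon>
    using 1(2)[OF that] 2(2)[OF that] by (simp add: distrib_right)
  then show "\<exists>C. C > 0 \<and> (\<forall>\<epsilon>\<in>{0<..1}. r \<epsilon> + q \<epsilon> \<le> C * \<epsilon> powr k)" using 1(1) 2(1) by (intro exI[of _ "C + C'"]) auto
qed

text \<open>Negligible scales are faster than every power, so the power lost to the moderate factor can be
  requested in advance.\<close>
lemma negligible_mult_moderate:
  assumes "negligible_scale r" "moderate_scale q" and nn: "\<And>\<epsilon>. \<epsilon> \<in> {0<..1} \<Longrightarrow> r \<epsilon> \<ge> 0" "\<And>\<epsilon>. \<epsilon> \<in> {0<..1} \<Longrightarrow> q \<epsilon> \<ge> 0"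
  shows "negligible_scale (\<lambda>\<epsilon>. r \<epsilon> * q \<epsilon>)"
  unfolding negligible_scale_def
proof (intro allI impI)
  fix k :: real assume k: "k > 0"
  obtain N C' where 2: "C' > 0" "\<And>\<epsilon>. \<epsilon> \<in> {0<..1} \<Longrightarrow> q \<epsilon> \<le> C' * \<epsilon> powr (- real N)" using assms(2) unfolding moderate_scale_def by blast
  have "k + real N > 0" using k by simp
  then obtain C where 1: "C > 0" "\<And>\<epsilon>. \<epsilon> \<in> {0<..1} \<Longrightarrow> r \<epsilon> \<le> C * \<epsilon> powr (k + real N)" using assms(1) unfolding negligible_scale_def by blast
  have "r \<epsilon> * q \<epsilon> \<le> (C * C') * \<epsilon> powr k" if e: "\<epsilon> \<in> {0<..1}" for \<epsilon>
  proof -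
    have "r \<epsilon> * q \<epsilon> \<le> (C * \<epsilon> powr (k + real N)) * (C' * \<epsilon> powr (- real N))"
      using 1 2 e nn by (intro mult_mono) (auto intro: mult_nonneg_nonneg)
    also have "\<dots> = (C * C') * (\<epsilon> powr (k + real N) * \<epsilon> powr (- real N))" by (simp only: mult_ac)
    also have "\<epsilon> powr (k + real N) * \<epsilon> powr (- real N) = \<epsilon> powr k" unfolding powr_add[symmetric] by simp
    finally show ?thesis .
  qed
  then show "\<exists>C. C > 0 \<and> (\<forall>\<epsilon>\<in>{0<..1}. r \<epsilon> * q \<epsilon> \<le> C * \<epsilon> powr k)" using 1(1) 2(1) by (intro exI[of _ "C * C'"]) auto
qed

lemma negligible_mono:
  "negligible_scale q \<Longrightarrow> (\<And>\<epsilon>. \<epsilon> \<in> {0<..1} \<Longrightarrow> r \<epsilon> \<le> q \<epsilon>) \<Longrightarrow> negligible_scale r"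
  unfolding negligible_scale_def by (meson order_trans)

lemma moderate_mono:
  "moderate_scale q \<Longrightarrow> (\<And>\<epsilon>. \<epsilon> \<in> {0<..1} \<Longrightarrow> r \<epsilon> \<le> q \<epsilon>) \<Longrightarrow> moderate_scale r"
  unfolding moderate_scale_def by (meson order_trans)

lemma moderate_net_scale: "moderate_net X nrm f \<Longrightarrow> moderate_scale (\<lambda>\<epsilon>. nrm (f \<epsilon>))"
  by (simp add: moderate_net_def moderate_scale_def)

lemma negligible_net_scale: "negligible_net X nrm f \<Longrightarrow> negligible_scale (\<lambda>\<epsilon>. nrm (f \<epsilon>))"
  by (simp add: negligible_net_def negligible_scale_def)

theorem theorem3p4:
  fixes s T :: real
    and a b u0 u1 :: "(real ^ 'n) function_or_distribution"
    and approximates ::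
      "(real \<Rightarrow> real ^ 'n \<Rightarrow> complex) \<Rightarrow> (real ^ 'n) function_or_distribution \<Rightarrow> bool"
  assumes "s > 0" and "T > 0"
    and "is_function_or_distribution a" and "is_function_or_distribution b"
    and "is_function_or_distribution u0" and "is_function_or_distribution u1"
    and "\<exists>ae. moderate_approximation approximates Linf_space Linf_norm a ae \<and> nonneg_net ae"
    and "\<exists>be. moderate_approximation approximates Linf_space Linf_norm b be \<and> nonneg_net be"
    and "\<exists>u0e. moderate_approximation approximates (Hs_space s) (Hs_norm s) u0 u0e"
    and "\<exists>u1e. moderate_approximation approximates L2_space L2_norm u1 u1e"
  shows "\<forall>ae ae' be be' u0e u0e' u1e u1e'
           (u :: real \<Rightarrow> real \<Rightarrow> real ^ 'n \<Rightarrow> complex) (u' :: real \<Rightarrow> real \<Rightarrow> real ^ 'n \<Rightarrow> complex).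
      moderate_approximation approximates Linf_space Linf_norm a ae \<and> nonneg_net ae \<and>
      moderate_approximation approximates Linf_space Linf_norm a ae' \<and> nonneg_net ae' \<and>
      moderate_approximation approximates Linf_space Linf_norm b be \<and> nonneg_net be \<and>
      moderate_approximation approximates Linf_space Linf_norm b be' \<and> nonneg_net be' \<and>
      moderate_approximation approximates (Hs_space s) (Hs_norm s) u0 u0e \<and>
      moderate_approximation approximates (Hs_space s) (Hs_norm s) u0 u0e' \<and>
      moderate_approximation approximates L2_space L2_norm u1 u1e \<and>
      moderate_approximation approximates L2_space L2_norm u1 u1e' \<and>
      negligible_net Linf_space Linf_norm (\<lambda>\<epsilon> x. ae \<epsilon> x - ae' \<epsilon> x) \<and>
      negligible_net Linf_space Linf_norm (\<lambda>\<epsilon> x. be \<epsilon> x - be' \<epsilon> x) \<and>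
      negligible_net (Hs_space s) (Hs_norm s) (\<lambda>\<epsilon> x. u0e \<epsilon> x - u0e' \<epsilon> x) \<and>
      negligible_net L2_space L2_norm (\<lambda>\<epsilon> x. u1e \<epsilon> x - u1e' \<epsilon> x) \<and>
      (\<forall>\<epsilon>\<in>{0<..1}. solves_cauchy_problem s T (ae \<epsilon>) (be \<epsilon>) (u0e \<epsilon>) (u1e \<epsilon>) (u \<epsilon>)) \<and>
      (\<forall>\<epsilon>\<in>{0<..1}. solves_cauchy_problem s T (ae' \<epsilon>) (be' \<epsilon>) (u0e' \<epsilon>) (u1e' \<epsilon>) (u' \<epsilon>))
      \<longrightarrow> (\<forall>t\<in>{0..T}. negligible_net L2_space L2_norm (\<lambda>\<epsilon> x. u \<epsilon> t x - u' \<epsilon> t x))"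
proof (intro allI impI ballI, elim conjE)
  fix ae ae' be be' u0e u0e' u1e u1e' and u u' :: "real \<Rightarrow> real \<Rightarrow> real ^ 'n \<Rightarrow> complex" and t
  assume t: "t \<in> {0..T}"
    and ae: "moderate_approximation approximates Linf_space Linf_norm a ae" "nonneg_net ae"
    and ae': "moderate_approximation approximates Linf_space Linf_norm a ae'" "nonneg_net ae'"
    and be: "moderate_approximation approximates Linf_space Linf_norm b be" "nonneg_net be"
    and be': "moderate_approximation approximates Linf_space Linf_norm b be'" "nonneg_net be'"
    and u0e: "moderate_approximation approximates (Hs_space s) (Hs_norm s) u0 u0e"
    and u0e': "moderate_approximation approximates (Hs_space s) (Hs_norm s) u0 u0e'"
    and u1e: "moderate_approximation approximates L2_space L2_norm u1 u1e"
    and u1e': "moderate_approximation approximates L2_space L2_norm u1 u1e'"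
    and na: "negligible_net Linf_space Linf_norm (\<lambda>\<epsilon> x. ae \<epsilon> x - ae' \<epsilon> x)"
    and nb: "negligible_net Linf_space Linf_norm (\<lambda>\<epsilon> x. be \<epsilon> x - be' \<epsilon> x)"
    and n0: "negligible_net (Hs_space s) (Hs_norm s) (\<lambda>\<epsilon> x. u0e \<epsilon> x - u0e' \<epsilon> x)"
    and n1: "negligible_net L2_space L2_norm (\<lambda>\<epsilon> x. u1e \<epsilon> x - u1e' \<epsilon> x)"
    and sol: "\<forall>\<epsilon>\<in>{0<..1}. solves_cauchy_problem s T (ae \<epsilon>) (be \<epsilon>) (u0e \<epsilon>) (u1e \<epsilon>) (u \<epsilon>)"
    and sol': "\<forall>\<epsilon>\<in>{0<..1}. solves_cauchy_problem s T (ae' \<epsilon>) (be' \<epsilon>) (u0e' \<epsilon>) (u1e' \<epsilon>) (u' \<epsilon>)"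
  let ?I = "{0<..1::real}"
  have mn: "moderate_net X nrm f" if "moderate_approximation approximates X nrm F f" for X nrm F f
    using that by (simp add: moderate_approximation_def)
  have mem: "f \<epsilon> \<in> X" if "moderate_net X nrm f" "\<epsilon> \<in> ?I" for X nrm f \<epsilon>
    using that by (simp add: moderate_net_def)
  have nmem: "f \<epsilon> \<in> X" if "negligible_net X nrm f" "\<epsilon> \<in> ?I" for X nrm f \<epsilon>
    using that by (simp add: negligible_net_def)
  have nonneg: "f \<epsilon> x \<in> \<real>\<^sub>\<ge>\<^sub>0" if "nonneg_net f" "\<epsilon> \<in> ?I" for f :: "real \<Rightarrow> real ^ 'n \<Rightarrow> complex" and \<epsilon> x
    using that by (simp add: nonneg_net_def)
  define M where "M = (\<lambda>\<epsilon>. L2_norm (u0e' \<epsilon>) + 2 * T * (L2_norm (u1e' \<epsilon>) + Linf_norm (be' \<epsilon>) * L2_norm (u0e' \<epsilon>)))"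
  define W where "W = (\<lambda>\<epsilon>. L2_norm (\<lambda>x. u0e \<epsilon> x - u0e' \<epsilon> x)
      + 2 * T * (L2_norm (\<lambda>x. u1e \<epsilon> x - u1e' \<epsilon> x) + Linf_norm (be \<epsilon>) * L2_norm (\<lambda>x. u0e \<epsilon> x - u0e' \<epsilon> x)
        + (2 * Linf_norm (\<lambda>x. be \<epsilon> x - be' \<epsilon> x) + T * Linf_norm (\<lambda>x. ae \<epsilon> x - ae' \<epsilon> x)) * M \<epsilon>))"
  have bound: "(\<lambda>x. u \<epsilon> t x - u' \<epsilon> t x) \<in> L2_space \<and> L2_norm (\<lambda>x. u \<epsilon> t x - u' \<epsilon> t x) \<le> W \<epsilon>" if e: "\<epsilon> \<in> ?I" for \<epsilon>
  proof -
    note i0 = Hs_L2[OF mem[OF mn[OF u0e] e]] and i0' = Hs_L2[OF mem[OF mn[OF u0e'] e]]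
      and i1 = mem[OF mn[OF u1e] e] and i1' = mem[OF mn[OF u1e'] e]
      and ia = mem[OF mn[OF ae(1)] e] and ia' = mem[OF mn[OF ae'(1)] e] and ib = mem[OF mn[OF be(1)] e] and ib' = mem[OF mn[OF be'(1)] e]
    have M: "L2_norm (u' \<epsilon> r) \<le> M \<epsilon>" if "r \<in> {0..T}" for r
      unfolding M_def
      by (rule solution_L2_bound[OF \<open>T > 0\<close> \<open>s > 0\<close> ia' nonneg[OF ae'(2) e] ib' nonneg[OF be'(2) e] bspec[OF sol' e] i0' i1' that])
    show ?thesis unfolding W_def
      using solution_difference_L2_bound[OF \<open>T > 0\<close> \<open>s > 0\<close> ia nonneg[OF ae(2) e] ib nonneg[OF be(2) e] ia' ib'
        nmem[OF na e] nmem[OF nb e] bspec[OF sol e] i0 i1 bspec[OF sol' e] i0' i1' M t] by blast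
  qed
  have b0: "Linf_norm (be \<epsilon>) \<ge> 0" "Linf_norm (be' \<epsilon>) \<ge> 0" "Linf_norm (\<lambda>x. be \<epsilon> x - be' \<epsilon> x) \<ge> 0" "Linf_norm (\<lambda>x. ae \<epsilon> x - ae' \<epsilon> x) \<ge> 0"
    if e: "\<epsilon> \<in> ?I" for \<epsilon>
    using Linf_bound(3) mem[OF mn[OF be(1)] e] mem[OF mn[OF be'(1)] e] nmem[OF na e] nmem[OF nb e] by blast+
  have m0: "moderate_scale (\<lambda>\<epsilon>. L2_norm (u0e' \<epsilon>))"
    by (rule moderate_mono[OF moderate_net_scale[OF mn[OF u0e']] L2_norm_le_Hs_norm])
  have mM: "moderate_scale M" unfolding M_def
    by (rule moderate_add[OF m0 moderate_mult[OF moderate_const moderate_add[OF moderate_net_scale[OF mn[OF u1e']]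
          moderate_mult[OF moderate_net_scale[OF mn[OF be'(1)]] m0]]]])
      (use b0 \<open>T > 0\<close> in \<open>auto intro!: add_nonneg_nonneg mult_nonneg_nonneg\<close>)
  have M0: "M \<epsilon> \<ge> 0" if "\<epsilon> \<in> ?I" for \<epsilon>
    unfolding M_def using b0[OF that] \<open>T > 0\<close> by (intro add_nonneg_nonneg mult_nonneg_nonneg) auto
  have z0: "negligible_scale (\<lambda>\<epsilon>. L2_norm (\<lambda>x. u0e \<epsilon> x - u0e' \<epsilon> x))"
    by (rule negligible_mono[OF negligible_net_scale[OF n0] L2_norm_le_Hs_norm])
  have cm: "negligible_scale (\<lambda>\<epsilon>. c * r \<epsilon>)" if "negligible_scale r" "\<And>\<epsilon>. \<epsilon> \<in> ?I \<Longrightarrow> r \<epsilon> \<ge> 0" "c \<ge> 0" for c r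
    using negligible_mult_moderate[OF that(1) moderate_const[of c]] that by (simp add: mult.commute)
  have zb: "negligible_scale (\<lambda>\<epsilon>. Linf_norm (be \<epsilon>) * L2_norm (\<lambda>x. u0e \<epsilon> x - u0e' \<epsilon> x))"
    using negligible_mult_moderate[OF z0 moderate_net_scale[OF mn[OF be(1)]]] b0 by (simp add: mult.commute)
  have zc: "negligible_scale (\<lambda>\<epsilon>. 2 * Linf_norm (\<lambda>x. be \<epsilon> x - be' \<epsilon> x) + T * Linf_norm (\<lambda>x. ae \<epsilon> x - ae' \<epsilon> x))"
    by (intro negligible_add cm negligible_net_scale[OF nb] negligible_net_scale[OF na] b0) (use \<open>T > 0\<close> in simp_all)
  have zM: "negligible_scale (\<lambda>\<epsilon>. (2 * Linf_norm (\<lambda>x. be \<epsilon> x - be' \<epsilon> x) + T * Linf_norm (\<lambda>x. ae \<epsilon> x - ae' \<epsilon> x)) * M \<epsilon>)"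
    by (rule negligible_mult_moderate[OF zc mM _ M0]) (use b0 \<open>T > 0\<close> in \<open>auto intro!: add_nonneg_nonneg mult_nonneg_nonneg\<close>)
  have zW: "negligible_scale W" unfolding W_def
  proof (rule negligible_add[OF z0 cm[OF negligible_add[OF negligible_add[OF negligible_net_scale[OF n1] zb] zM]]])
    show "0 \<le> 2 * T" using \<open>T > 0\<close> by simp
    fix \<epsilon> assume e: "\<epsilon> \<in> ?I"
    show "0 \<le> L2_norm (\<lambda>x. u1e \<epsilon> x - u1e' \<epsilon> x) + Linf_norm (be \<epsilon>) * L2_norm (\<lambda>x. u0e \<epsilon> x - u0e' \<epsilon> x)
        + (2 * Linf_norm (\<lambda>x. be \<epsilon> x - be' \<epsilon> x) + T * Linf_norm (\<lambda>x. ae \<epsilon> x - ae' \<epsilon> x)) * M \<epsilon>"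
      using b0[OF e] M0[OF e] \<open>T > 0\<close> by (intro add_nonneg_nonneg mult_nonneg_nonneg) auto
  qed
  have "negligible_scale (\<lambda>\<epsilon>. L2_norm (\<lambda>x. u \<epsilon> t x - u' \<epsilon> t x))"
    by (rule negligible_mono[OF zW]) (use bound in blast)
  then show "negligible_net L2_space L2_norm (\<lambda>\<epsilon> x. u \<epsilon> t x - u' \<epsilon> t x)"
    unfolding negligible_net_def negligible_scale_def using bound by blast
qed

end
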